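(* Let $T>0$, $\nu>0$, $\tilde F\in L^2(0,T;V')$ and $u_0\in H$. The function $u$ satisfying $u\in L^2(0,T;V)$, $u'\in L^1(0,T;V')$, $u'+\nu Au+Bu=\tilde F$ on $]0,T[$ (in $V'$) and $u(0)=u_0$ is unique. Moreover it is a.e. equal to a continuous function from $[0,T]$ into $H$, and $u(t)\to u(t_1)$ in $H$ as $t\to t_1$ for every $t_1\in[0,T]$; in particular $u(t)\to u_0$ in $H$ as $t\to0$ and $u(t)\to u(T)$ in $H$ as $t\to T$.
   Context: Let $a,b>0$ and $R=]0,a[\times]0,b[$, with unit normal $\mathbf n$ on $\partial R$. Write $\nabla^\bot=(-\partial_{x_2},\partial_{x_1})$, so $\nabla^\bot\cdot u=-\partial_{x_2}u_1+\partial_{x_1}u_2$; $\mathbf L^2(R)=L^2(R)^2$, $\mathbf H^k(R)=H^k(R)^2$. Let $\mathcal D_1(R)=\{u\in C^\infty(\overline R)^2: \nabla\cdot u=0 \text{ in } R,\ u\cdot\mathbf n=0 \text{ and } \nabla^\bot\cdot u=0\text{ on }\partial R\}$. Define $H=\{u\in\mathbf L^2(R):\nabla\cdot u=0,\ u\cdot\mathbf n=0\text{ on }\partial R\}$ with the $\mathbf L^2$ scalar product $(\cdot,\cdot)$ and norm $|\cdot|$; $V$ = closure of $\mathcal D_1(R)$ in $\mathbf H^1(R)$, with scalar product $((u,v))=\sum_{i=1}^2\int_R\nabla u_i\cdot\nabla v_i\,dx$ and norm $\|\cdot\|$ (equivalent to the $\mathbf H^1$ norm on $V$). $H$ is identified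 with its dual, so $V\subset H\subset V'$, and $\langle f,v\rangle=(f,v)$ for $f\in H$, $v\in V$. $A:V\to V'$ is defined by $\langle Au,v\rangle=((u,v))$. For $u,v,w\in\mathbf H^1(R)$, $b(u,v,w)=\sum_{i,j=1}^2\int_R u_i(\partial_i v_j)w_j\,dx$, and for $u\in V$, $Bu\in V'$ is defined by $\langle Bu,w\rangle=b(u,u,w)$, $w\in V$. $u'$ is the $V'$-valued distributional time derivative; a function $u$ with $u\in L^2(0,T;V)$, $u'\in L^1(0,T;V')$ is a.e. equal to a continuous function $[0,T]\to V'$, which gives meaning to $u(0)$. At least one such solution $u$ is known to exist. *)

theory Defs
  imports "HOL-Analysis.Analysis"
begin

text \<open>
  Elements of Lebesgue and Sobolev spaces are represented by functions, and two representatives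
  denote the same element iff they agree almost everywhere on the domain. Accordingly the norms
  below are seminorms on representatives. A normed space is given by a set X of functions (closed
  under pointwise linear combinations) together with such a seminorm N.
\<close>

type_synonym scalar_field = "real^2 \<Rightarrow> real"
type_synonym vector_field = "real^2 \<Rightarrow> real^2"
type_synonym functional = "vector_field \<Rightarrow> real"

definition pderiv_at :: "'a \<Rightarrow> ('a::euclidean_space \<Rightarrow> 'b::real_normed_vector) \<Rightarrow> 'a \<Rightarrow> 'b" where
  "pderiv_at i f x = frechet_derivative f (at x) i"

fun C_k :: "nat \<Rightarrow> ('a::euclidean_space \<Rightarrow> 'b::real_normed_vector) \<Rightarrow> bool" where
  "C_k 0 f \<longleftrightarrow> continuous_on UNIV f"
| "C_k (Suc k) f \<longleftrightarrow> (\<forall>x. f differentiable (at x)) \<and> (\<forall>i\<in>Basis. C_k k (pderiv_at i f))"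

definition smooth :: "('a::euclidean_space \<Rightarrow> 'b::real_normed_vector) \<Rightarrow> bool" where
  "smooth f \<longleftrightarrow> (\<forall>k. C_k k f)"

definition test_functions :: "'a::euclidean_space set \<Rightarrow> ('a \<Rightarrow> real) set" where
  "test_functions S =
     {\<phi>. smooth \<phi> \<and> compact (closure {x. \<phi> x \<noteq> 0}) \<and> closure {x. \<phi> x \<noteq> 0} \<subseteq> S}"

definition has_step_integral ::
  "('x \<Rightarrow> 'y::real_vector) set \<Rightarrow> real set \<Rightarrow> (real \<Rightarrow> 'x \<Rightarrow> 'y) \<Rightarrow> ('x \<Rightarrow> 'y) \<Rightarrow> bool" where
  "has_step_integral X S s J \<longleftrightarrow>
     (\<exists>(n::nat) E z.
        (\<forall>k<n. E k \<in> sets (lebesgue_on S) \<and> emeasure (lebesgue_on S) (E k) < \<infinity> \<and> z k \<in> X) \<and>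
        (\<forall>t\<in>S. s t = (\<lambda>x. \<Sum>k<n. indicat_real (E k) t *\<^sub>R z k x)) \<and>
        J = (\<lambda>x. \<Sum>k<n. measure (lebesgue_on S) (E k) *\<^sub>R z k x))"

definition strongly_measurable ::
  "('x \<Rightarrow> 'y::real_vector) set \<Rightarrow> (('x \<Rightarrow> 'y) \<Rightarrow> real) \<Rightarrow> real set \<Rightarrow> (real \<Rightarrow> 'x \<Rightarrow> 'y) \<Rightarrow> bool" where
  "strongly_measurable X N S f \<longleftrightarrow>
     (AE t in lebesgue_on S. f t \<in> X) \<and>
     (\<exists>s J. (\<forall>m. has_step_integral X S (s m) (J m)) \<and>
        (AE t in lebesgue_on S. (\<lambda>m. N (\<lambda>x. f t x - s m t x)) \<longlonglongrightarrow> 0))"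

definition bochner_Lp ::
  "nat \<Rightarrow> ('x \<Rightarrow> 'y::real_vector) set \<Rightarrow> (('x \<Rightarrow> 'y) \<Rightarrow> real) \<Rightarrow> real set \<Rightarrow> (real \<Rightarrow> 'x \<Rightarrow> 'y) set" where
  "bochner_Lp p X N S =
     {f. strongly_measurable X N S f \<and> integrable (lebesgue_on S) (\<lambda>t. N (f t) ^ p)}"

definition has_bochner_integral_in ::
  "('x \<Rightarrow> 'y::real_vector) set \<Rightarrow> (('x \<Rightarrow> 'y) \<Rightarrow> real) \<Rightarrow> real set
     \<Rightarrow> (real \<Rightarrow> 'x \<Rightarrow> 'y) \<Rightarrow> ('x \<Rightarrow> 'y) \<Rightarrow> bool" where
  "has_bochner_integral_in X N S f I \<longleftrightarrow>
     (AE t in lebesgue_on S. f t \<in> X) \<and> I \<in> X \<and>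
     (\<exists>s J. (\<forall>m. has_step_integral X S (s m) (J m)) \<and>
        (AE t in lebesgue_on S. (\<lambda>m. N (\<lambda>x. f t x - s m t x)) \<longlonglongrightarrow> 0) \<and>
        (\<lambda>m. \<integral>\<^sup>+ t. ennreal (N (\<lambda>x. f t x - s m t x)) \<partial>lebesgue_on S) \<longlonglongrightarrow> 0 \<and>
        (\<lambda>m. N (\<lambda>x. J m x - I x)) \<longlonglongrightarrow> 0)"

definition has_distributional_derivative ::
  "('x \<Rightarrow> 'y::real_vector) set \<Rightarrow> (('x \<Rightarrow> 'y) \<Rightarrow> real) \<Rightarrow> real set
     \<Rightarrow> (real \<Rightarrow> 'x \<Rightarrow> 'y) \<Rightarrow> (real \<Rightarrow> 'x \<Rightarrow> 'y) \<Rightarrow> bool" where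
  "has_distributional_derivative X N S f g \<longleftrightarrow>
     (\<forall>\<phi>\<in>test_functions S. \<exists>I.
        has_bochner_integral_in X N S (\<lambda>t x. deriv \<phi> t *\<^sub>R f t x) I \<and>
        has_bochner_integral_in X N S (\<lambda>t x. \<phi> t *\<^sub>R g t x) (\<lambda>x. - I x))"

definition continuous_into ::
  "('x \<Rightarrow> 'y::real_vector) set \<Rightarrow> (('x \<Rightarrow> 'y) \<Rightarrow> real) \<Rightarrow> real set \<Rightarrow> (real \<Rightarrow> 'x \<Rightarrow> 'y) \<Rightarrow> bool" where
  "continuous_into X N S w \<longleftrightarrow>
     (\<forall>t\<in>S. w t \<in> X) \<and>
     (\<forall>t1\<in>S. ((\<lambda>t. N (\<lambda>x. w t x - w t1 x)) \<longlongrightarrow> 0) (at t1 within S))"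

definition ae_equal :: "(real^2) set \<Rightarrow> (real^2 \<Rightarrow> 'b) \<Rightarrow> (real^2 \<Rightarrow> 'b) \<Rightarrow> bool" where
  "ae_equal S f g \<longleftrightarrow> (AE x in lebesgue_on S. f x = g x)"

definition L2 :: "(real^2) set \<Rightarrow> (real^2 \<Rightarrow> 'b::euclidean_space) set" where
  "L2 S = {f. f \<in> borel_measurable (lebesgue_on S) \<and> integrable (lebesgue_on S) (\<lambda>x. (norm (f x))\<^sup>2)}"

definition L2_inner ::
  "(real^2) set \<Rightarrow> (real^2 \<Rightarrow> 'b::euclidean_space) \<Rightarrow> (real^2 \<Rightarrow> 'b) \<Rightarrow> real" where
  "L2_inner S f g = (\<integral>x. f x \<bullet> g x \<partial>lebesgue_on S)"

definition L2_norm :: "(real^2) set \<Rightarrow> (real^2 \<Rightarrow> 'b::euclidean_space) \<Rightarrow> real" where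
  "L2_norm S f = sqrt (L2_inner S f f)"

definition has_weak_pderiv :: "(real^2) set \<Rightarrow> 2 \<Rightarrow> scalar_field \<Rightarrow> scalar_field \<Rightarrow> bool" where
  "has_weak_pderiv S i f g \<longleftrightarrow>
     (\<forall>\<phi>\<in>test_functions S. L2_inner S f (pderiv_at (axis i 1) \<phi>) = - L2_inner S g \<phi>)"

definition H1 :: "(real^2) set \<Rightarrow> scalar_field set" where
  "H1 S = {f \<in> L2 S. \<forall>i. \<exists>g\<in>L2 S. has_weak_pderiv S i f g}"

text \<open>A representative of the weak derivative, which is unique up to null sets.\<close>

definition weak_pderiv :: "(real^2) set \<Rightarrow> 2 \<Rightarrow> scalar_field \<Rightarrow> scalar_field" where
  "weak_pderiv S i f = (SOME g. g \<in> L2 S \<and> has_weak_pderiv S i f g)"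

definition weak_grad :: "(real^2) set \<Rightarrow> scalar_field \<Rightarrow> vector_field" where
  "weak_grad S f x = (\<chi> i. weak_pderiv S i f x)"

definition H1_vec :: "(real^2) set \<Rightarrow> vector_field set" where
  "H1_vec S = {u. \<forall>j. (\<lambda>x. u x $ j) \<in> H1 S}"

definition dirichlet_form :: "(real^2) set \<Rightarrow> vector_field \<Rightarrow> vector_field \<Rightarrow> real" where
  "dirichlet_form S u v =
     (\<Sum>i\<in>UNIV. L2_inner S (weak_grad S (\<lambda>x. u x $ i)) (weak_grad S (\<lambda>x. v x $ i)))"

definition H1_norm :: "(real^2) set \<Rightarrow> vector_field \<Rightarrow> real" where
  "H1_norm S u = sqrt (L2_inner S u u + dirichlet_form S u u)"

definition has_weak_div :: "(real^2) set \<Rightarrow> vector_field \<Rightarrow> scalar_field \<Rightarrow> bool" where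
  "has_weak_div S u d \<longleftrightarrow>
     (\<forall>\<phi>\<in>test_functions S. L2_inner S u (\<lambda>x. \<chi> i. pderiv_at (axis i 1) \<phi> x) = - L2_inner S d \<phi>)"

text \<open>
  The normal component on the boundary of a square-integrable field u with square-integrable
  divergence d is the functional on boundary traces of H1 functions defined by the
  generalised Green formula: it maps the trace of \<phi> to (u, grad \<phi>) + (d, \<phi>).
\<close>

definition normal_trace_zero :: "(real^2) set \<Rightarrow> vector_field \<Rightarrow> bool" where
  "normal_trace_zero S u \<longleftrightarrow>
     (\<exists>d\<in>L2 S. has_weak_div S u d \<and>
        (\<forall>\<phi>\<in>H1 S. L2_inner S u (weak_grad S \<phi>) + L2_inner S d \<phi> = 0))"

definition Rect :: "real \<Rightarrow> real \<Rightarrow> (real^2) set" where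
  "Rect a b = {x. 0 < x $ 1 \<and> x $ 1 < a \<and> 0 < x $ 2 \<and> x $ 2 < b}"

text \<open>The outward unit normal is defined on the boundary except at the four corners.\<close>

definition unit_normal :: "real \<Rightarrow> real \<Rightarrow> real^2 \<Rightarrow> real^2 \<Rightarrow> bool" where
  "unit_normal a b x n \<longleftrightarrow>
     0 < x $ 2 \<and> x $ 2 < b \<and> (x $ 1 = 0 \<and> n = - axis 1 1 \<or> x $ 1 = a \<and> n = axis 1 1) \<or>
     0 < x $ 1 \<and> x $ 1 < a \<and> (x $ 2 = 0 \<and> n = - axis 2 1 \<or> x $ 2 = b \<and> n = axis 2 1)"

definition divergence :: "vector_field \<Rightarrow> scalar_field" where
  "divergence u x = (\<Sum>i\<in>UNIV. pderiv_at (axis i 1) u x $ i)"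

definition curl :: "vector_field \<Rightarrow> scalar_field" where
  "curl u x = - (pderiv_at (axis 2 1) u x $ 1) + pderiv_at (axis 1 1) u x $ 2"

text \<open>
  Smooth fields on the closed rectangle are the restrictions of smooth fields on the plane;
  such an extension serves as the representative.
\<close>

definition D1 :: "real \<Rightarrow> real \<Rightarrow> vector_field set" where
  "D1 a b = {u. smooth u \<and> (\<forall>x\<in>Rect a b. divergence u x = 0) \<and>
     (\<forall>x n. unit_normal a b x n \<longrightarrow> u x \<bullet> n = 0) \<and>
     (\<forall>x\<in>frontier (Rect a b). curl u x = 0)}"

definition H_space :: "real \<Rightarrow> real \<Rightarrow> vector_field set" where
  "H_space a b =
     {u \<in> L2 (Rect a b). has_weak_div (Rect a b) u (\<lambda>x. 0) \<and> normal_trace_zero (Rect a b) u}"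

definition V_space :: "real \<Rightarrow> real \<Rightarrow> vector_field set" where
  "V_space a b = {u \<in> H1_vec (Rect a b).
     \<forall>\<epsilon>>0. \<exists>v\<in>D1 a b. H1_norm (Rect a b) (\<lambda>x. u x - v x) < \<epsilon>}"

definition V_norm :: "real \<Rightarrow> real \<Rightarrow> vector_field \<Rightarrow> real" where
  "V_norm a b u = sqrt (dirichlet_form (Rect a b) u u)"

text \<open>
  Elements of the dual of V are functionals on representatives; only their values on V matter,
  and boundedness makes them respect equality almost everywhere.
\<close>

definition V_dual :: "real \<Rightarrow> real \<Rightarrow> functional set" where
  "V_dual a b = {l.
     (\<forall>u\<in>V_space a b. \<forall>v\<in>V_space a b. \<forall>c d.
        l (\<lambda>x. c *\<^sub>R u x + d *\<^sub>R v x) = c * l u + d * l v) \<and>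
     (\<exists>C. \<forall>v\<in>V_space a b. \<bar>l v\<bar> \<le> C * V_norm a b v)}"

definition V_dual_norm :: "real \<Rightarrow> real \<Rightarrow> functional \<Rightarrow> real" where
  "V_dual_norm a b l = (SUP v\<in>{v \<in> V_space a b. V_norm a b v \<le> 1}. \<bar>l v\<bar>)"

definition V_dual_equal :: "real \<Rightarrow> real \<Rightarrow> functional \<Rightarrow> functional \<Rightarrow> bool" where
  "V_dual_equal a b l m \<longleftrightarrow> (\<forall>v\<in>V_space a b. l v = m v)"

definition embed_H :: "real \<Rightarrow> real \<Rightarrow> vector_field \<Rightarrow> functional" where
  "embed_H a b f v = L2_inner (Rect a b) f v"

definition stokes_op :: "real \<Rightarrow> real \<Rightarrow> vector_field \<Rightarrow> functional" where
  "stokes_op a b u v = dirichlet_form (Rect a b) u v"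

definition b_form ::
  "real \<Rightarrow> real \<Rightarrow> vector_field \<Rightarrow> vector_field \<Rightarrow> vector_field \<Rightarrow> real" where
  "b_form a b u v w =
     (\<Sum>i\<in>UNIV. \<Sum>j\<in>UNIV.
        \<integral>x. u x $ i * weak_pderiv (Rect a b) i (\<lambda>y. v y $ j) x * w x $ j \<partial>lebesgue_on (Rect a b))"

definition B_op :: "real \<Rightarrow> real \<Rightarrow> vector_field \<Rightarrow> functional" where
  "B_op a b u w = b_form a b u u w"

definition is_solution ::
  "real \<Rightarrow> real \<Rightarrow> real \<Rightarrow> real \<Rightarrow> (real \<Rightarrow> functional) \<Rightarrow> vector_field
     \<Rightarrow> (real \<Rightarrow> vector_field) \<Rightarrow> bool" where
  "is_solution a b T \<nu> F u0 u \<longleftrightarrow>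
     u \<in> bochner_Lp 2 (V_space a b) (V_norm a b) {0<..<T} \<and>
     (\<exists>u' \<in> bochner_Lp 1 (V_dual a b) (V_dual_norm a b) {0<..<T}.
        has_distributional_derivative (V_dual a b) (V_dual_norm a b) {0<..<T}
          (\<lambda>t. embed_H a b (u t)) u' \<and>
        (AE t in lebesgue_on {0<..<T}.
           V_dual_equal a b (\<lambda>v. u' t v + \<nu> * stokes_op a b (u t) v + B_op a b (u t) v) (F t))) \<and>
     (\<exists>w. continuous_into (V_dual a b) (V_dual_norm a b) {0..T} w \<and>
        (AE t in lebesgue_on {0<..<T}. V_dual_equal a b (embed_H a b (u t)) (w t)) \<and>
        V_dual_equal a b (w 0) (embed_H a b u0))"

end

theory Submission
  imports Defs
begin

text \<open>The Stokes eigenfields on the rectangle, explicit products of sines and cosines, are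
  divergence-free, orthogonal in \<open>L2\<close> and in \<open>V\<close>, and complete in \<open>H\<close> and \<open>V\<close>. Let \<open>P\<^sub>n\<close> be the
  projection to the fields with both frequencies below \<open>n\<close>. Since \<open>b(u, w, w) = 0\<close>, the bounds
  \<open>\<bar>P\<^sub>n u\<bar>\<^sub>\<infinity> \<le> C n \<bar>P\<^sub>n u\<bar>\<close> and \<open>\<bar>u - P\<^sub>n u\<bar> \<le> (C/n) \<parallel>u - P\<^sub>n u\<parallel>\<close> give
  \<open>\<bar>b(u, z, P\<^sub>n z)\<bar> \<le> C \<parallel>z - P\<^sub>n z\<parallel> (\<parallel>u\<parallel> \<bar>P\<^sub>n z\<bar> + \<bar>P\<^sub>n u\<bar> \<parallel>P\<^sub>n z\<parallel>)\<close>
  with \<open>C\<close> independent of \<open>n\<close>. So the nonlinear term can be tested with \<open>P\<^sub>n u\<close>, although only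
  \<open>u' \<in> L\<^sup>1(0, T; V')\<close> is known: \<open>\<bar>P\<^sub>n u(t)\<bar>\<^sup>2\<close> is bounded, and equicontinuous in \<open>t\<close>, uniformly in \<open>n\<close>,
  which puts \<open>u\<close> into \<open>L\<^sup>\<infinity>(0, T; H)\<close> and makes it continuous into \<open>H\<close>. For the difference \<open>z\<close> of
  two solutions, Ladyzhenskaya's inequality bounds \<open>b(P\<^sub>n z, u, P\<^sub>n z)\<close>, the remainders tend to \<open>0\<close>
  in \<open>L\<^sup>1(0, T)\<close> by dominated convergence, and Gronwall's lemma gives \<open>z = 0\<close>.\<close>

section \<open>Smooth functions and cutoffs\<close>

text \<open>The obstacle: \<open>u'\<close> in \<open>L\<^sup>1(0,T;V')\<close> cannot be paired
  with \<open>u\<close> in \<open>L\<^sup>2(0,T;V)\<close>, so the energy identity for |u|^2 is not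
  at hand, and the bound of u in H that would improve u' is itself to be proved. The coefficients of
  u in the eigenbasis are scalar and absolutely continuous, and for finite sums of their squares the
  product rule is elementary; the difficulty moves into bounds uniform in n. That the two powers of
  n cancel is tied to dimension two: \<open>KK n\<close> holds n^2 modes with a common sup bound, so
  Cauchy-Schwarz costs a factor n, while every eigenvalue outside \<open>KK n\<close> is at least of
  order n^2, so the L2 norm of a tail gains 1/n against its V norm. The conditions u.n = 0 and curl
  u = 0 on the boundary make the eigenfields explicit and orthogonal in both spaces, hence the
  projections are contractions in V as well. Continuity into H is weak continuity, coefficient by
  coefficient, joined with continuity of the norm.\<close>

lemma pderiv_at_eq: "(f has_derivative f') (at x) \<Longrightarrow> pderiv_at i f x = f' i"
  unfolding pderiv_at_def by (metis frechet_derivative_at)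

lemma pderiv_at_real_eq: "(f has_real_derivative D) (at x) \<Longrightarrow> pderiv_at 1 f x = D"
  by (subst pderiv_at_eq[where f' = "\<lambda>h. D * h"]) (auto simp: has_field_derivative_def)

lemma C_k_continuous: "C_k k f \<Longrightarrow> continuous_on UNIV f"
  by (cases k) (auto intro!: continuous_at_imp_continuous_on differentiable_imp_continuous_within)

lemma C_k_SucD: "C_k (Suc k) f \<Longrightarrow> C_k k f"
proof (induction k arbitrary: f)
  case 0
  then show ?case using C_k_continuous[of "Suc 0" f] by simp
next
  case (Suc k)
  then show ?case by (metis C_k.simps(2))
qed

section \<open>Closure properties of the classes of k times continuously differentiable
  functions\<close>

lemma C_k_bounded_linear:
  assumes L: "bounded_linear L" and f: "C_k k f"
  shows "C_k k (\<lambda>x. L (f x))"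
  using f
proof (induction k arbitrary: f)
  case 0
  then show ?case
    by (auto intro!: bounded_linear.continuous_on[OF L])
next
  case (Suc k)
  have d: "f differentiable at x" for x using Suc.prems by auto
  have D: "((\<lambda>x. L (f x)) has_derivative (\<lambda>h. L (frechet_derivative f (at x) h))) (at x)" for x
    using bounded_linear.has_derivative[OF L] d frechet_derivative_works by blast
  have "pderiv_at i (\<lambda>x. L (f x)) = (\<lambda>x. L (pderiv_at i f x))" for i
    using pderiv_at_eq[OF D] by (auto simp: pderiv_at_def)
  with Suc D show ?case by (auto simp: differentiable_def)
qed

lemma C_k_add:
  assumes "C_k k f" "C_k k g"
  shows "C_k k (\<lambda>x. f x + g x)"
  using assms
proof (induction k arbitrary: f g)
  case 0
  then show ?case by (auto intro!: continuous_intros)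
next
  case (Suc k)
  have D: "((\<lambda>x. f x + g x) has_derivative
      (\<lambda>h. frechet_derivative f (at x) h + frechet_derivative g (at x) h)) (at x)" for x
    using Suc.prems frechet_derivative_works by (intro has_derivative_add) auto
  have "pderiv_at i (\<lambda>x. f x + g x) = (\<lambda>x. pderiv_at i f x + pderiv_at i g x)" for i
    using pderiv_at_eq[OF D] by (auto simp: pderiv_at_def)
  with Suc D show ?case by (auto simp: differentiable_def)
qed

lemma C_k_mult:
  fixes f g :: "'a::euclidean_space \<Rightarrow> real"
  assumes "C_k k f" "C_k k g"
  shows "C_k k (\<lambda>x. f x * g x)"
  using assms
proof (induction k arbitrary: f g)
  case 0
  then show ?case by (auto intro!: continuous_intros)
next
  case (Suc k)
  have D: "((\<lambda>x. f x * g x) has_derivative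
      (\<lambda>h. f x * frechet_derivative g (at x) h + frechet_derivative f (at x) h * g x)) (at x)" for x
    using Suc.prems frechet_derivative_works by (intro has_derivative_mult) auto
  have "pderiv_at i (\<lambda>x. f x * g x) = (\<lambda>x. f x * pderiv_at i g x + pderiv_at i f x * g x)" for i
    using pderiv_at_eq[OF D] by (auto simp: pderiv_at_def)
  moreover have "C_k k (\<lambda>x. f x * pderiv_at i g x + pderiv_at i f x * g x)" if "i \<in> Basis" for i
    using Suc.prems that C_k_SucD[OF Suc.prems(1)] C_k_SucD[OF Suc.prems(2)]
    by (intro C_k_add Suc.IH) auto
  ultimately show ?case using D by (auto simp: differentiable_def)
qed

lemma C_k_const [simp]: "C_k k (\<lambda>x. c)"
proof (induction k arbitrary: c)
  case (Suc k)
  have "pderiv_at i (\<lambda>x::'a. c) = (\<lambda>x. 0)" for i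
    using pderiv_at_eq[OF has_derivative_const] by auto
  with Suc show ?case by auto
qed auto

lemma C_k_inverse:
  fixes f :: "'a::euclidean_space \<Rightarrow> real"
  assumes "C_k k f" "\<And>x. f x \<noteq> 0"
  shows "C_k k (\<lambda>x. inverse (f x))"
  using assms
proof (induction k arbitrary: f)
  case 0
  then show ?case by (auto intro!: continuous_intros)
next
  case (Suc k)
  have D: "((\<lambda>x. inverse (f x)) has_derivative
      (\<lambda>h. - (inverse (f x) * frechet_derivative f (at x) h * inverse (f x)))) (at x)" for x
    using Suc.prems frechet_derivative_works by (intro Deriv.has_derivative_inverse) auto
  have "pderiv_at i (\<lambda>x. inverse (f x)) = (\<lambda>x. (- 1 * inverse (f x)) * (pderiv_at i f x * inverse (f x)))" for i
    using pderiv_at_eq[OF D] by (auto simp: pderiv_at_def)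
  moreover have "C_k k (\<lambda>x. (- 1 * inverse (f x)) * (pderiv_at i f x * inverse (f x)))" if "i \<in> Basis" for i
    using Suc.prems that C_k_SucD[OF Suc.prems(1)]
    by (intro C_k_mult Suc.IH C_k_const) auto
  ultimately show ?case using D by (auto simp: differentiable_def)
qed

lemma pderiv_at_affine:
  fixes f :: "real \<Rightarrow> real" and c :: "'a::euclidean_space"
  assumes "f differentiable at (x \<bullet> c + d)"
  shows "(\<lambda>x. f (x \<bullet> c + d)) differentiable at x"
    and "pderiv_at i (\<lambda>x. f (x \<bullet> c + d)) x = (i \<bullet> c) * deriv f (x \<bullet> c + d)"
proof -
  have "DERIV f (x \<bullet> c + d) :> deriv f (x \<bullet> c + d)"
    using assms by (simp add: DERIV_deriv_iff_real_differentiable)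
  then have f: "(f has_derivative (\<lambda>h. deriv f (x \<bullet> c + d) * h)) (at (x \<bullet> c + d))"
    by (simp add: has_field_derivative_def)
  have "((\<lambda>x. x \<bullet> c + d) has_derivative (\<lambda>h. h \<bullet> c)) (at x)"
    by (auto intro!: derivative_eq_intros)
  from has_derivative_compose[OF this f]
  have D: "((\<lambda>x. f (x \<bullet> c + d)) has_derivative (\<lambda>h. deriv f (x \<bullet> c + d) * (h \<bullet> c))) (at x)"
    by simp
  then show "(\<lambda>x. f (x \<bullet> c + d)) differentiable at x"
    by (auto simp: differentiable_def)
  show "pderiv_at i (\<lambda>x. f (x \<bullet> c + d)) x = (i \<bullet> c) * deriv f (x \<bullet> c + d)"
    using pderiv_at_eq[OF D] by simp
qed

lemma pderiv_at_real: "f differentiable at x \<Longrightarrow> pderiv_at 1 f x = deriv (f :: real \<Rightarrow> real) x"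
  by (metis DERIV_deriv_iff_real_differentiable pderiv_at_real_eq)

lemma C_k_real_Suc:
  fixes f :: "real \<Rightarrow> real"
  shows "C_k (Suc k) f \<longleftrightarrow> (\<forall>x. f differentiable at x) \<and> C_k k (deriv f)"
proof -
  have "pderiv_at 1 f = deriv f" if "\<forall>x. f differentiable at x"
    using that by (auto simp: pderiv_at_real)
  then show ?thesis by auto
qed

lemma C_k_affine:
  fixes f :: "real \<Rightarrow> real" and c :: "'a::euclidean_space"
  assumes "C_k k f"
  shows "C_k k (\<lambda>x. f (x \<bullet> c + d))"
  using assms
proof (induction k arbitrary: f)
  case 0
  then show ?case
    by (auto intro!: continuous_on_compose2[of UNIV f] continuous_intros)
next
  case (Suc k)
  have C: "C_k k (deriv f)" and d: "f differentiable at x" for x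
    using Suc.prems unfolding C_k_real_Suc by auto
  have "pderiv_at i (\<lambda>x. f (x \<bullet> c + d)) = (\<lambda>x. (i \<bullet> c) * deriv f (x \<bullet> c + d))" for i
    by (rule ext, rule pderiv_at_affine(2)[OF d])
  then show ?case using Suc.IH[OF C] pderiv_at_affine(1)[OF d]
    by (auto intro!: C_k_mult)
qed

text \<open>With the whole chain of derivatives given in advance, the induction on k only moves
  along the chain and no higher derivative has to be computed. For the sine the chain consists of
  phase shifts, for \<open>flat_exp\<close> of a recursion on polynomials.\<close>

lemma C_k_real_sequence:
  fixes D :: "nat \<Rightarrow> real \<Rightarrow> real"
  assumes "\<And>n x. (D n has_real_derivative D (Suc n) x) (at x)"
  shows "C_k k (D n)"
proof (induction k arbitrary: n)
  case 0
  then show ?case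
    using assms DERIV_continuous_on[of UNIV "D n" "D (Suc n)"] by auto
next
  case (Suc k)
  have "deriv (D n) = D (Suc n)" using assms DERIV_imp_deriv by blast
  with Suc show ?case unfolding C_k_real_Suc
    using assms real_differentiable_def by metis
qed

lemma smooth_add: "smooth f \<Longrightarrow> smooth g \<Longrightarrow> smooth (\<lambda>x. f x + g x)"
  by (simp add: smooth_def C_k_add)

lemma smooth_const [simp]: "smooth (\<lambda>x. c)"
  by (simp add: smooth_def)

lemma smooth_mult: "smooth f \<Longrightarrow> smooth g \<Longrightarrow> smooth (\<lambda>x. f x * g x :: real)"
  by (simp add: smooth_def C_k_mult)

lemma smooth_inverse: "smooth f \<Longrightarrow> (\<And>x. f x \<noteq> 0) \<Longrightarrow> smooth (\<lambda>x. inverse (f x :: real))"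
  by (simp add: smooth_def C_k_inverse)

lemma smooth_affine: "smooth f \<Longrightarrow> smooth (\<lambda>x. f (x \<bullet> c + d) :: real)"
  by (simp add: smooth_def C_k_affine)

lemma smooth_bounded_linear: "bounded_linear L \<Longrightarrow> smooth f \<Longrightarrow> smooth (\<lambda>x. L (f x))"
  by (simp add: smooth_def C_k_bounded_linear)

lemma smooth_differentiable: "smooth f \<Longrightarrow> f differentiable at x"
  unfolding smooth_def using C_k.simps(2) by blast

lemma smooth_pderiv: "smooth f \<Longrightarrow> i \<in> Basis \<Longrightarrow> smooth (pderiv_at i f)"
  unfolding smooth_def using C_k.simps(2) by blast

lemma smooth_continuous: "smooth f \<Longrightarrow> continuous_on S f"
  unfolding smooth_def using C_k_continuous continuous_on_subset by blast

lemma smooth_deriv: "smooth f \<Longrightarrow> smooth (deriv f :: real \<Rightarrow> real)"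
  unfolding smooth_def using C_k_real_Suc by blast

lemma smooth_DERIV: "smooth f \<Longrightarrow> (f has_real_derivative deriv f x) (at x)"
  using smooth_differentiable DERIV_deriv_iff_real_differentiable by blast

lemma smooth_sum: "(\<And>i. i \<in> I \<Longrightarrow> smooth (f i)) \<Longrightarrow> smooth (\<lambda>x. \<Sum>i\<in>I. f i x)"
  by (induction I rule: infinite_finite_induct) (auto intro: smooth_add)

lemma smooth_sin: "smooth (\<lambda>x::real. sin (c * x + d))"
proof -
  have "smooth (\<lambda>x. sin x :: real)"
    unfolding smooth_def
  proof
    fix k
    \<comment> \<open>Differentiating the sine shifts the phase by a quarter period, which supplies
      the chain.\<close>
    have *: "((\<lambda>x. sin (x + n * (pi/2))) has_real_derivative sin (x + Suc n * (pi/2))) (at x)" for n :: nat and x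
    proof -
      have "((\<lambda>x. sin (x + n * (pi/2))) has_real_derivative cos (x + n * (pi/2))) (at x)"
        by (auto intro!: derivative_eq_intros)
      moreover have "cos (x + n * (pi/2)) = sin (x + Suc n * (pi/2))"
        using sin_add[of "x + n * (pi/2)" "pi/2"] by (simp add: algebra_simps add_divide_distrib)
      ultimately show ?thesis by simp
    qed
    show "C_k k (\<lambda>x. sin x :: real)"
      using C_k_real_sequence[of "\<lambda>n x. sin (x + n * (pi/2))", OF *, of k 0] by simp
  qed
  from smooth_affine[OF this, of c d] show ?thesis by (simp add: mult.commute)
qed

lemma smooth_cos: "smooth (\<lambda>x::real. cos (c * x + d))"
  using smooth_sin[of c "d + pi/2"] by (simp add: sin_add flip: add.assoc)

section \<open>The flat function exp(-1/x) and smooth steps\<close>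

lemma poly_times_exp_tendsto_0:
  fixes p :: "real poly"
  shows "((\<lambda>y. y ^ n * poly p y * exp (- y)) \<longlongrightarrow> 0) at_top"
proof (induction p arbitrary: n)
  case 0
  then show ?case by simp
next
  \<comment> \<open>The extra factor y of the longer polynomial is absorbed into the power y^n,
    which is why the statement carries an arbitrary n.\<close>
  case (pCons c p)
  have "((\<lambda>y. y ^ n / exp y) \<longlongrightarrow> (0::real)) at_top" by (rule tendsto_power_div_exp_0)
  from tendsto_add[OF tendsto_mult[OF tendsto_const[of c] this] pCons.IH[of "Suc n"]]
  show ?case by (simp add: algebra_simps exp_minus divide_inverse)
qed

text \<open>The functions p(1/x) exp(-1/x) form a class closed under differentiation: with s = 1/x
  the derivative replaces p by s^2 (p - p'). One derivative computation thus gives smoothness for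
  the whole class.\<close>

definition flat_exp :: "real poly \<Rightarrow> real \<Rightarrow> real" where
  "flat_exp p x = (if x > 0 then poly p (1 / x) * exp (- (1 / x)) else 0)"

lemma DERIV_flat_exp:
  "(flat_exp p has_real_derivative flat_exp ([:0,0,1:] * (p - pderiv p)) x) (at x)"
proof -
  consider "x > 0" | "x < 0" | "x = 0" by linarith
  then show ?thesis
  proof cases
    case 1
    have D: "((\<lambda>x. poly p (1 / x) * exp (- (1 / x))) has_real_derivative
        flat_exp ([:0,0,1:] * (p - pderiv p)) x) (at x)"
      using 1 unfolding flat_exp_def
      by (auto intro!: derivative_eq_intros DERIV_chain2[OF poly_DERIV] simp: field_simps power2_eq_square)
    show ?thesis
      by (rule has_field_derivative_transform_within_open[OF D, of "{0<..}"]) (use 1 in \<open>auto simp: flat_exp_def\<close>)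
  next
    case 2
    have D: "((\<lambda>x. 0) has_real_derivative flat_exp ([:0,0,1:] * (p - pderiv p)) x) (at x)"
      using 2 unfolding flat_exp_def by simp
    show ?thesis
      by (rule has_field_derivative_transform_within_open[OF D, of "{..<0}"]) (use 2 in \<open>auto simp: flat_exp_def\<close>)
  next
    case 3
    \<comment> \<open>At the junction the difference quotient is y p(y) exp(-y) with y = 1/h, which
      tends to 0.\<close>
    have "((\<lambda>y. y * poly p y * exp (- y)) \<longlongrightarrow> 0) at_top"
      using poly_times_exp_tendsto_0[of 1 p] by simp
    from filterlim_compose[OF this filterlim_inverse_at_top_right]
    have "((\<lambda>h. flat_exp p h / h) \<longlongrightarrow> 0) (at_right 0)"
      by (rule Lim_transform_eventually)
         (auto simp: flat_exp_def eventually_at_right_less field_simps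
               intro!: eventually_mono[OF eventually_at_right_less])
    moreover have "((\<lambda>h. flat_exp p h / h) \<longlongrightarrow> 0) (at_left 0)"
      by (rule Lim_transform_eventually[OF tendsto_const])
         (auto simp: flat_exp_def eventually_at_filter)
    ultimately have "((\<lambda>h. flat_exp p h / h) \<longlongrightarrow> 0) (at 0)"
      by (simp add: filterlim_at_split)
    with 3 show ?thesis by (simp add: DERIV_def flat_exp_def)
  qed
qed

lemma smooth_flat_exp: "smooth (flat_exp p)"
  unfolding smooth_def
proof
  fix k
  define P where "P n = ((\<lambda>p. [:0,0,1:] * (p - pderiv p)) ^^ n) p" for n
  have "(flat_exp (P n) has_real_derivative flat_exp (P (Suc n)) x) (at x)" for n x
    using DERIV_flat_exp[of "P n"] by (simp add: P_def)
  from C_k_real_sequence[of "\<lambda>n. flat_exp (P n)", OF this, of k 0]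
  show "C_k k (flat_exp p)" by (simp add: P_def)
qed

definition flat :: "real \<Rightarrow> real" where "flat = flat_exp 1"

lemma flat_pos: "x > 0 \<Longrightarrow> flat x > 0" and flat_zero: "x \<le> 0 \<Longrightarrow> flat x = 0"
  by (auto simp: flat_def flat_exp_def)

lemma flat_nonneg: "flat x \<ge> 0"
  using flat_pos[of x] flat_zero[of x] by (cases "x > 0") auto

lemma smooth_flat: "smooth flat"
  by (simp add: flat_def smooth_flat_exp)

definition smooth_step :: "real \<Rightarrow> real" where
  "smooth_step x = flat x * inverse (flat x + flat (1 - x))"

text \<open>\<open>x\<close> and \<open>1 - x\<close> are never both nonpositive; the denominator of
  \<open>smooth_step\<close> is therefore positive.\<close>

lemma flat_sum_pos: "flat x + flat (1 - x) > 0"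
  using flat_pos[of x] flat_pos[of "1 - x"] flat_nonneg[of x] flat_nonneg[of "1 - x"]
  by (cases "x > 0") auto

lemma smooth_smooth_step: "smooth smooth_step"
proof -
  have "smooth (\<lambda>x. flat (1 - x))" using smooth_affine[OF smooth_flat, of "-1::real" 1] by simp
  moreover have "flat x + flat (1 - x) \<noteq> 0" for x using flat_sum_pos[of x] by simp
  ultimately have "smooth (\<lambda>x. flat x * inverse (flat x + flat (1 - x)))"
    by (intro smooth_mult smooth_inverse smooth_add smooth_flat)
  then show ?thesis unfolding smooth_step_def[abs_def] .
qed

lemma smooth_step_0: "x \<le> 0 \<Longrightarrow> smooth_step x = 0"
  by (simp add: smooth_step_def flat_zero)

lemma smooth_step_1: "x \<ge> 1 \<Longrightarrow> smooth_step x = 1"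
  using flat_sum_pos[of x] by (simp add: smooth_step_def flat_zero)

lemma smooth_step_bounds: "0 \<le> smooth_step x" "smooth_step x \<le> 1"
  using flat_sum_pos[of x] flat_nonneg[of x] flat_nonneg[of "1 - x"]
  by (auto simp: smooth_step_def field_simps)

lemma deriv_const_open:
  fixes f :: "real \<Rightarrow> real"
  assumes "open U" "x \<in> U" "\<And>y. y \<in> U \<Longrightarrow> f y = c"
  shows "deriv f x = 0"
  by (rule DERIV_imp_deriv, rule has_field_derivative_transform_within_open[OF DERIV_const assms(1,2)])
     (use assms in auto)

lemma deriv_smooth_step_0: "x \<notin> {0..1} \<Longrightarrow> deriv smooth_step x = 0"
  using deriv_const_open[of "{..<0}" x smooth_step 0] deriv_const_open[of "{1<..}" x smooth_step 1]
  by (cases "x < 0") (auto simp: smooth_step_0 smooth_step_1)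

lemma deriv_zero_outside_closed:
  fixes f :: "real \<Rightarrow> real"
  assumes "closed K" "\<And>x. x \<notin> K \<Longrightarrow> f x = 0" "x \<notin> K"
  shows "deriv f x = 0"
  by (rule deriv_const_open[of "- K" _ _ 0]) (use assms in auto)

lemma deriv_smooth_step_bounded: "\<exists>C\<ge>0. \<forall>x. \<bar>deriv smooth_step x\<bar> \<le> C"
proof -
  have "continuous_on {0..1} (deriv smooth_step)"
    by (intro smooth_continuous smooth_deriv smooth_smooth_step)
  then have "bounded (deriv smooth_step ` {0..1})"
    by (intro compact_imp_bounded compact_continuous_image) auto
  then obtain C where C: "\<forall>x\<in>{0..1}. \<bar>deriv smooth_step x\<bar> \<le> C"
    unfolding bounded_iff by auto
  have "\<bar>deriv smooth_step x\<bar> \<le> max C 0" for x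
    using C deriv_smooth_step_0[of x] by (cases "x \<in> {0..1}") force+
  then show ?thesis by (intro exI[of _ "max C 0"]) auto
qed

text \<open>Each ramp starts at an end point and goes inwards over a length
  \<open>\<epsilon>\<close>, so the support stays in \<open>{s..t}\<close> for every positive
  \<open>\<epsilon>\<close>, even one larger than the interval.\<close>

definition cutoff :: "real \<Rightarrow> real \<Rightarrow> real \<Rightarrow> real \<Rightarrow> real" where
  "cutoff \<epsilon> s t x = smooth_step ((x - s) / \<epsilon>) * smooth_step ((t - x) / \<epsilon>)"

lemma smooth_cutoff: "smooth (cutoff \<epsilon> s t)"
proof -
  have "smooth (\<lambda>x. smooth_step ((x - s) / \<epsilon>))"
    using smooth_affine[OF smooth_smooth_step, of "1/\<epsilon>" "- s/\<epsilon>"]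
    by (simp add: diff_divide_distrib)
  moreover have "smooth (\<lambda>x. smooth_step ((t - x) / \<epsilon>))"
    using smooth_affine[OF smooth_smooth_step, of "-1/\<epsilon>" "t/\<epsilon>"]
    by (simp add: diff_divide_distrib)
  ultimately show ?thesis unfolding cutoff_def[abs_def] by (rule smooth_mult)
qed

lemma cutoff_0: "\<epsilon> > 0 \<Longrightarrow> x \<notin> {s..t} \<Longrightarrow> cutoff \<epsilon> s t x = 0"
  by (auto simp: cutoff_def not_le smooth_step_0 divide_le_0_iff)

lemma cutoff_bounds: "0 \<le> cutoff \<epsilon> s t x" "cutoff \<epsilon> s t x \<le> 1"
  using smooth_step_bounds[of "(x - s) / \<epsilon>"] smooth_step_bounds[of "(t - x) / \<epsilon>"]
  by (auto simp: cutoff_def mult_le_one)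

lemma deriv_cutoff:
  "deriv (cutoff \<epsilon> s t) x = deriv smooth_step ((x - s) / \<epsilon>) / \<epsilon> * smooth_step ((t - x) / \<epsilon>)
     - smooth_step ((x - s) / \<epsilon>) * (deriv smooth_step ((t - x) / \<epsilon>) / \<epsilon>)"
proof (rule DERIV_imp_deriv)
  have 1: "((\<lambda>x. smooth_step ((x - s) / \<epsilon>)) has_real_derivative deriv smooth_step ((x - s) / \<epsilon>) * (1/\<epsilon>)) (at x)"
    by (rule DERIV_chain2[OF smooth_DERIV[OF smooth_smooth_step]]) (rule DERIV_cdivide, auto intro!: derivative_eq_intros)
  have 2: "((\<lambda>x. smooth_step ((t - x) / \<epsilon>)) has_real_derivative deriv smooth_step ((t - x) / \<epsilon>) * (-1/\<epsilon>)) (at x)"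
    by (rule DERIV_chain2[OF smooth_DERIV[OF smooth_smooth_step]]) (rule DERIV_cdivide, auto intro!: derivative_eq_intros)
  show "(cutoff \<epsilon> s t has_real_derivative deriv smooth_step ((x - s) / \<epsilon>) / \<epsilon> * smooth_step ((t - x) / \<epsilon>)
     - smooth_step ((x - s) / \<epsilon>) * (deriv smooth_step ((t - x) / \<epsilon>) / \<epsilon>)) (at x)"
    using DERIV_mult[OF 1 2] unfolding cutoff_def[abs_def] by (simp add: algebra_simps)
qed

section \<open>Test functions and their tensor products\<close>

lemma test_functionsI:
  assumes "smooth \<phi>" "compact K" "K \<subseteq> S" "\<And>x. x \<notin> K \<Longrightarrow> \<phi> x = 0"
  shows "\<phi> \<in> test_functions S"
proof -
  have "closure {x. \<phi> x \<noteq> 0} \<subseteq> K"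
    using assms by (intro closure_minimal compact_imp_closed) auto
  moreover from this have "compact (closure {x. \<phi> x \<noteq> 0})"
    using \<open>compact K\<close> bounded_subset by (auto simp: compact_eq_bounded_closed)
  ultimately show ?thesis using assms by (auto simp: test_functions_def)
qed

lemma test_functionsE:
  assumes "\<phi> \<in> test_functions S"
  obtains K where "smooth \<phi>" "compact K" "K \<subseteq> S" "\<And>x. x \<notin> K \<Longrightarrow> \<phi> x = 0"
  using assms closure_subset[of "{x. \<phi> x \<noteq> 0}"] unfolding test_functions_def by blast

lemma test_functions_smooth: "\<phi> \<in> test_functions S \<Longrightarrow> smooth \<phi>"
  by (auto simp: test_functions_def)

lemma test_functions_zero: "\<phi> \<in> test_functions S \<Longrightarrow> x \<notin> S \<Longrightarrow> \<phi> x = 0"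
  by (metis subsetD test_functionsE)

lemma cutoff_test: "\<epsilon> > 0 \<Longrightarrow> {s..t} \<subseteq> S \<Longrightarrow> cutoff \<epsilon> s t \<in> test_functions S"
  by (rule test_functionsI[of _ "{s..t}"]) (auto simp: smooth_cutoff cutoff_0)

lemma test_functions_mult:
  assumes "\<phi> \<in> test_functions S" "smooth \<psi>"
  shows "(\<lambda>x. \<phi> x * \<psi> x) \<in> test_functions S"
proof -
  obtain K where K: "smooth \<phi>" "compact K" "K \<subseteq> S" "\<And>x. x \<notin> K \<Longrightarrow> \<phi> x = 0"
    using assms by (elim test_functionsE) blast
  show ?thesis
    by (rule test_functionsI[of _ K]) (use K assms in \<open>auto intro: smooth_mult\<close>)
qed

lemma test_functions_deriv:
  assumes "\<phi> \<in> test_functions (S :: real set)"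
  shows "deriv \<phi> \<in> test_functions S"
proof -
  obtain K where K: "smooth \<phi>" "compact K" "K \<subseteq> S" "\<And>x. x \<notin> K \<Longrightarrow> \<phi> x = 0"
    using assms by (elim test_functionsE) blast
  show ?thesis
    by (rule test_functionsI[of _ K])
       (use K in \<open>auto intro: smooth_deriv deriv_zero_outside_closed[of K] compact_imp_closed\<close>)
qed

lemma nth_eq_inner_axis: "x $ i = (x :: real^'n) \<bullet> axis i 1"
  by (simp add: inner_axis)

lemma smooth_tensor:
  fixes \<alpha> \<beta> :: "real \<Rightarrow> real"
  assumes "smooth \<alpha>" "smooth \<beta>"
  shows "smooth (\<lambda>x::real^2. \<alpha> (x $ 1) * \<beta> (x $ 2))"
  using smooth_mult[OF smooth_affine[OF assms(1), of "axis 1 1 :: real^2" 0]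
      smooth_affine[OF assms(2), of "axis 2 1 :: real^2" 0]]
  by (simp add: nth_eq_inner_axis)

lemma pderiv_tensor:
  fixes \<alpha> \<beta> :: "real \<Rightarrow> real"
  assumes "smooth \<alpha>" "smooth \<beta>"
  shows "pderiv_at (axis 1 1) (\<lambda>x::real^2. \<alpha> (x $ 1) * \<beta> (x $ 2)) = (\<lambda>x. deriv \<alpha> (x $ 1) * \<beta> (x $ 2))"
    and "pderiv_at (axis 2 1) (\<lambda>x::real^2. \<alpha> (x $ 1) * \<beta> (x $ 2)) = (\<lambda>x. \<alpha> (x $ 1) * deriv \<beta> (x $ 2))"
proof -
  have D: "((\<lambda>x::real^2. \<alpha> (x $ 1) * \<beta> (x $ 2)) has_derivative
     (\<lambda>h. \<alpha> (x $ 1) * (deriv \<beta> (x $ 2) * h $ 2) + (deriv \<alpha> (x $ 1) * h $ 1) * \<beta> (x $ 2))) (at x)" for x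
  proof (rule has_derivative_mult)
    have nth: "((\<lambda>x::real^2. x $ i) has_derivative (\<lambda>h. h $ i)) (at x)" for i
      by (intro bounded_linear_imp_has_derivative bounded_linear_vec_nth)
    show "((\<lambda>x::real^2. \<alpha> (x $ 1)) has_derivative (\<lambda>h. deriv \<alpha> (x $ 1) * h $ 1)) (at x)"
      using has_derivative_compose[OF nth] smooth_DERIV[OF assms(1)]
      unfolding has_field_derivative_def by blast
    show "((\<lambda>x::real^2. \<beta> (x $ 2)) has_derivative (\<lambda>h. deriv \<beta> (x $ 2) * h $ 2)) (at x)"
      using has_derivative_compose[OF nth] smooth_DERIV[OF assms(2)]
      unfolding has_field_derivative_def by blast
  qed
  show "pderiv_at (axis 1 1) (\<lambda>x::real^2. \<alpha> (x $ 1) * \<beta> (x $ 2)) = (\<lambda>x. deriv \<alpha> (x $ 1) * \<beta> (x $ 2))"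
    and "pderiv_at (axis 2 1) (\<lambda>x::real^2. \<alpha> (x $ 1) * \<beta> (x $ 2)) = (\<lambda>x. \<alpha> (x $ 1) * deriv \<beta> (x $ 2))"
    by (auto simp: fun_eq_iff pderiv_at_eq[OF D] axis_def)
qed

lemma test_functions_tensor:
  assumes "\<alpha> \<in> test_functions {0<..<a}" "\<beta> \<in> test_functions {0<..<b}"
  shows "(\<lambda>x::real^2. \<alpha> (x $ 1) * \<beta> (x $ 2)) \<in> test_functions (Rect a b)"
proof -
  obtain K where K: "smooth \<alpha>" "compact K" "K \<subseteq> {0<..<a}" "\<And>x. x \<notin> K \<Longrightarrow> \<alpha> x = 0"
    using assms(1) by (elim test_functionsE) blast
  obtain L where L: "smooth \<beta>" "compact L" "L \<subseteq> {0<..<b}" "\<And>x. x \<notin> L \<Longrightarrow> \<beta> x = 0"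
    using assms(2) by (elim test_functionsE) blast
  let ?f = "\<lambda>p. \<chi> i. if i = (1::2) then fst p else snd (p::real\<times>real)"
  have "continuous_on (K \<times> L) (\<lambda>p. if i = (1::2) then fst p else snd (p::real\<times>real))" for i
    by (cases "i = 1") (auto intro!: continuous_intros)
  then have "compact (?f ` (K \<times> L))"
    using K L by (intro compact_continuous_image compact_Times continuous_intros continuous_on_vec_lambda)
  moreover have "?f ` (K \<times> L) \<subseteq> Rect a b"
    using K L by (auto simp: Rect_def)
  moreover have "\<alpha> (x $ 1) * \<beta> (x $ 2) = 0" if "x \<notin> ?f ` (K \<times> L)" for x :: "real^2"
  proof (rule ccontr)
    assume "\<alpha> (x $ 1) * \<beta> (x $ 2) \<noteq> 0"
    then have "(x $ 1, x $ 2) \<in> K \<times> L" using K(4) L(4) by fastforce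
    moreover have "x = ?f (x $ 1, x $ 2)"
      by (auto simp: vec_eq_iff forall_2)
    ultimately show False using that by blast
  qed
  ultimately show ?thesis
    using K(1) L(1) by (intro test_functionsI smooth_tensor)
qed

section \<open>Integration over the rectangle\<close>

definition vec2 :: "real \<Rightarrow> real \<Rightarrow> real^2" where
  "vec2 x y = (\<chi> i. if i = 1 then x else y)"

lemma vec2_nth [simp]: "vec2 x y $ 1 = x" "vec2 x y $ 2 = y"
  by (simp_all add: vec2_def)

lemma vec2_axis: "vec2 x y = x *\<^sub>R axis 1 1 + y *\<^sub>R axis 2 1"
  by (simp add: vec_eq_iff forall_2 axis_def)

lemma Basis_real2: "(Basis :: (real^2) set) = {axis 1 1, axis 2 1}"
  by (auto simp: Basis_vec_def UNIV_2)

lemma axis_in_Basis: "axis i 1 \<in> (Basis :: (real^2) set)"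
  by (simp add: axis_in_Basis_iff)

lemma continuous_on_vec2 [continuous_intros]:
  "continuous_on S f \<Longrightarrow> continuous_on S g \<Longrightarrow> continuous_on S (\<lambda>x. vec2 (f x) (g x))"
  unfolding vec2_axis by (intro continuous_intros)

lemma measurable_vec2 [measurable]:
  "(\<lambda>p. vec2 (fst p) (snd p)) \<in> borel_measurable borel"
  by (intro borel_measurable_continuous_onI continuous_intros)

text \<open>Boxes pull back to boxes of the same volume, and Lebesgue measure is determined by its
  values on boxes. This identification transports Fubini from pairs of reals to
  \<open>real^2\<close>.\<close>

lemma lborel_vec2:
  "distr (lborel :: (real \<times> real) measure) borel (\<lambda>p. vec2 (fst p) (snd p)) = lborel"
proof (rule lborel_eqI[symmetric])
  fix l u :: "real^2"
  assume le: "\<And>b. b \<in> Basis \<Longrightarrow> l \<bullet> b \<le> u \<bullet> b"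
  have le': "l $ 1 \<le> u $ 1" "l $ 2 \<le> u $ 2"
    using le[of "axis 1 1"] le[of "axis 2 1"] by (auto simp: axis_in_Basis inner_axis)
  have pre: "(\<lambda>p. vec2 (fst p) (snd p)) -` box l u = box (l $ 1, l $ 2) (u $ 1, u $ 2)"
    by (auto simp: box_def Basis_real2 Basis_prod_def inner_axis)
  have "emeasure (distr (lborel :: (real \<times> real) measure) borel (\<lambda>p. vec2 (fst p) (snd p))) (box l u)
      = emeasure lborel (box (l $ 1, l $ 2) (u $ 1, u $ 2))"
    by (subst emeasure_distr) (auto simp: pre measurable_vec2)
  also have "\<dots> = (u $ 1 - l $ 1) * (u $ 2 - l $ 2)"
    using le' by (subst emeasure_lborel_box) (auto simp: Basis_prod_def prod.union_disjoint)
  also have "(u $ 1 - l $ 1) * (u $ 2 - l $ 2) = (\<Prod>b\<in>Basis. (u - l) \<bullet> b)"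
    by (simp add: Basis_real2 axis_eq_axis inner_axis)
  finally show "emeasure (distr (lborel :: (real \<times> real) measure) borel (\<lambda>p. vec2 (fst p) (snd p))) (box l u)
      = (\<Prod>b\<in>Basis. (u - l) \<bullet> b)" .
qed auto

lemma open_Rect: "open (Rect a b)"
proof -
  have "Rect a b = {x. 0 < x $ 1} \<inter> {x. x $ 1 < a} \<inter> {x. 0 < x $ 2} \<inter> {x. x $ 2 < b}"
    by (auto simp: Rect_def)
  then show ?thesis by (auto intro!: open_Int open_Collect_less continuous_intros)
qed

lemma Rect_borel [measurable]: "Rect a b \<in> sets borel"
  by (simp add: borel_open open_Rect)

lemma Rect_lebesgue [measurable]: "Rect a b \<in> sets lebesgue"
  using Rect_borel by auto

definition closed_Rect :: "real \<Rightarrow> real \<Rightarrow> (real^2) set" where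
  "closed_Rect a b = {x. 0 \<le> x $ 1 \<and> x $ 1 \<le> a \<and> 0 \<le> x $ 2 \<and> x $ 2 \<le> b}"

lemma closed_Rect_cbox: "closed_Rect a b = cbox 0 (vec2 a b)"
  by (auto simp: closed_Rect_def mem_box_cart forall_2)

lemma compact_closed_Rect: "compact (closed_Rect a b)"
  by (simp add: closed_Rect_cbox)

lemma Rect_subset_closed: "Rect a b \<subseteq> closed_Rect a b"
  by (auto simp: Rect_def closed_Rect_def)

lemma emeasure_Rect_finite: "emeasure lebesgue (Rect a b) < \<infinity>"
proof -
  have "emeasure lebesgue (Rect a b) \<le> emeasure lebesgue (cbox 0 (vec2 a b))"
    using Rect_subset_closed[of a b] unfolding closed_Rect_cbox by (intro emeasure_mono) auto
  also have "\<dots> < \<infinity>"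
    using emeasure_bounded_finite[OF bounded_cbox, of 0 "vec2 a b"] by simp
  finally show ?thesis .
qed

lemma space_Rect [simp]: "space (lebesgue_on (Rect a b)) = Rect a b"
  by (simp add: space_restrict_space)

lemma finite_measure_Rect: "finite_measure (lebesgue_on (Rect a b))"
  using emeasure_Rect_finite[of a b]
  by (intro finite_measureI) (simp add: emeasure_restrict_space)

lemma borel_measurable_continuous_Rect:
  "continuous_on UNIV f \<Longrightarrow> f \<in> borel_measurable (lebesgue_on (Rect a b))"
  using continuous_imp_measurable_on_sets_lebesgue[of "Rect a b" f] continuous_on_subset[of UNIV f]
  by auto

lemma continuous_bounded_Rect:
  fixes f :: "real^2 \<Rightarrow> 'b::real_normed_vector"
  assumes "continuous_on UNIV f"
  obtains B where "B > 0" "\<And>x. x \<in> closed_Rect a b \<Longrightarrow> norm (f x) \<le> B"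
proof -
  have "bounded (f ` closed_Rect a b)"
    by (intro compact_imp_bounded compact_continuous_image compact_closed_Rect)
       (rule continuous_on_subset[OF assms], auto)
  then obtain B where "B > 0" "\<forall>x\<in>closed_Rect a b. norm (f x) \<le> B"
    unfolding bounded_pos by auto
  then show ?thesis using that by auto
qed

lemma integrable_continuous_Rect:
  fixes f :: "real^2 \<Rightarrow> 'b::{banach,second_countable_topology}"
  assumes "continuous_on UNIV f"
  shows "integrable (lebesgue_on (Rect a b)) f"
proof -
  obtain B where B: "B > 0" "\<And>x. x \<in> closed_Rect a b \<Longrightarrow> norm (f x) \<le> B"
    using continuous_bounded_Rect[OF assms] by blast
  interpret finite_measure "lebesgue_on (Rect a b)" by (rule finite_measure_Rect)
  show ?thesis
    by (rule integrable_const_bound[of _ B])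
       (use B Rect_subset_closed[of a b] assms in \<open>auto intro!: AE_I2 B borel_measurable_continuous_Rect\<close>)
qed

lemma indicator_Rect_vec2:
  "indicator (Rect a b) (vec2 x y) = indicator {0<..<a} x * (indicator {0<..<b} y :: 'a::semiring_1)"
  by (auto simp: indicator_def Rect_def)

lemma indicator_Rect_vec2':
  "indicator (Rect a b) (vec2 x y) = indicator {0<..<b} y * (indicator {0<..<a} x :: 'a::semiring_1)"
  by (auto simp: indicator_def Rect_def)

text \<open>Both orders of integration are kept because the Ladyzhenskaya estimate freezes a
  different variable in each factor. Borel measurability of f makes its sections measurable.\<close>

lemma nn_integral_Rect:
  fixes f :: "real^2 \<Rightarrow> ennreal"
  assumes [measurable]: "f \<in> borel_measurable borel"
  shows "(\<integral>\<^sup>+x. f x \<partial>lebesgue_on (Rect a b)) =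
    (\<integral>\<^sup>+x. (\<integral>\<^sup>+y. f (vec2 x y) * indicator {0<..<b} y \<partial>lborel) * indicator {0<..<a} x \<partial>lborel)"
    (is "_ = ?R")
    and "(\<integral>\<^sup>+x. f x \<partial>lebesgue_on (Rect a b)) =
    (\<integral>\<^sup>+y. (\<integral>\<^sup>+x. f (vec2 x y) * indicator {0<..<a} x \<partial>lborel) * indicator {0<..<b} y \<partial>lborel)"
    (is "_ = ?R2")
proof -
  let ?g = "\<lambda>p::real\<times>real. f (vec2 (fst p) (snd p)) * indicator (Rect a b) (vec2 (fst p) (snd p))"
  have "(\<integral>\<^sup>+x. f x \<partial>lebesgue_on (Rect a b)) = (\<integral>\<^sup>+x. f x * indicator (Rect a b) x \<partial>lebesgue)"
    by (subst nn_integral_restrict_space) auto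
  also have "\<dots> = (\<integral>\<^sup>+x. f x * indicator (Rect a b) x \<partial>lborel)"
    by (simp add: nn_integral_completion)
  also have "\<dots> = (\<integral>\<^sup>+p. ?g p \<partial>(lborel :: (real \<times> real) measure))"
    by (subst lborel_vec2[symmetric], subst nn_integral_distr) auto
  also have "\<dots> = (\<integral>\<^sup>+p. ?g p \<partial>(lborel \<Otimes>\<^sub>M lborel))"
    by (simp add: lborel_prod)
  finally have *: "(\<integral>\<^sup>+x. f x \<partial>lebesgue_on (Rect a b)) = (\<integral>\<^sup>+p. ?g p \<partial>(lborel \<Otimes>\<^sub>M lborel))" .
  have [measurable]: "?g \<in> borel_measurable (lborel \<Otimes>\<^sub>M lborel)"
    unfolding lborel_prod by measurable
  have vm: "(\<lambda>y. vec2 x y) \<in> borel_measurable borel" "(\<lambda>x. vec2 x y) \<in> borel_measurable borel" for x y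
    by (intro borel_measurable_continuous_onI continuous_intros)+
  have m1: "(\<lambda>y. f (vec2 x y)) \<in> borel_measurable borel" "(\<lambda>x. f (vec2 x y)) \<in> borel_measurable borel" for x y
    using vm by (auto intro!: measurable_compose[OF _ assms])
  have "(\<integral>\<^sup>+p. ?g p \<partial>(lborel \<Otimes>\<^sub>M lborel)) = (\<integral>\<^sup>+x. \<integral>\<^sup>+y. ?g (x, y) \<partial>lborel \<partial>lborel)"
    by (subst lborel.nn_integral_fst) auto
  also have "\<dots> = ?R"
    by (intro nn_integral_cong, subst nn_integral_multc[symmetric])
       (use m1 in \<open>auto simp: indicator_Rect_vec2 mult_ac intro!: nn_integral_cong\<close>)
  finally show "(\<integral>\<^sup>+x. f x \<partial>lebesgue_on (Rect a b)) = ?R" using * by simp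
  have "(\<integral>\<^sup>+p. ?g p \<partial>(lborel \<Otimes>\<^sub>M lborel)) = (\<integral>\<^sup>+y. \<integral>\<^sup>+x. ?g (x, y) \<partial>lborel \<partial>lborel)"
    by (subst lborel_pair.nn_integral_snd) auto
  also have "\<dots> = ?R2"
    by (intro nn_integral_cong, subst nn_integral_multc[symmetric])
       (use m1 in \<open>auto simp: indicator_Rect_vec2 mult_ac intro!: nn_integral_cong\<close>)
  finally show "(\<integral>\<^sup>+x. f x \<partial>lebesgue_on (Rect a b)) = ?R2" using * by simp
qed

lemma integral_Rect:
  fixes f :: "real^2 \<Rightarrow> real"
  assumes f: "continuous_on UNIV f" and ab: "a > 0" "b > 0"
  shows "integral\<^sup>L (lebesgue_on (Rect a b)) f = (LBINT x=0..a. (LBINT y=0..b. f (vec2 x y)))"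
    and "integral\<^sup>L (lebesgue_on (Rect a b)) f = (LBINT y=0..b. (LBINT x=0..a. f (vec2 x y)))"
proof -
  have [measurable]: "f \<in> borel_measurable borel"
    by (rule borel_measurable_continuous_onI[OF f])
  let ?h = "\<lambda>x. indicator (Rect a b) x *\<^sub>R f x"
  let ?g = "\<lambda>p::real\<times>real. ?h (vec2 (fst p) (snd p))"
  have "integral\<^sup>L (lebesgue_on (Rect a b)) f = integral\<^sup>L lebesgue ?h"
    by (subst integral_restrict_space) auto
  also have "\<dots> = integral\<^sup>L lborel ?h"
    by (subst integral_completion) auto
  also have "\<dots> = integral\<^sup>L (lborel \<Otimes>\<^sub>M lborel) ?g"
    by (subst lborel_vec2[symmetric], subst integral_distr) (auto simp: lborel_prod)
  finally have *: "integral\<^sup>L (lebesgue_on (Rect a b)) f = integral\<^sup>L (lborel \<Otimes>\<^sub>M lborel) ?g" .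
  have "integrable lebesgue ?h"
    using integrable_continuous_Rect[OF f, of a b] by (subst (asm) integrable_restrict_space) auto
  then have "integrable lborel ?h"
    by (subst (asm) integrable_completion) auto
  then have "integrable (lborel :: (real\<times>real) measure) ?g"
    by (subst (asm) lborel_vec2[symmetric], subst (asm) integrable_distr_eq) auto
  then have int: "integrable (lborel \<Otimes>\<^sub>M lborel) (\<lambda>(x,y). ?g (x,y))"
    by (simp add: lborel_prod split_beta')
  have "integral\<^sup>L (lborel \<Otimes>\<^sub>M lborel) ?g = (\<integral>x. \<integral>y. ?g (x,y) \<partial>lborel \<partial>lborel)"
    using lborel_pair.integral_fst[OF int] by (simp add: split_beta')
  also have "\<dots> = (LBINT x=0..a. (LBINT y=0..b. f (vec2 x y)))"
    using ab unfolding interval_lebesgue_integral_def set_lebesgue_integral_def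
    by (auto simp: indicator_Rect_vec2 zero_ereal_def mult.assoc intro!: Bochner_Integration.integral_cong)
  finally show "integral\<^sup>L (lebesgue_on (Rect a b)) f = (LBINT x=0..a. (LBINT y=0..b. f (vec2 x y)))"
    using * by simp
  have "integral\<^sup>L (lborel \<Otimes>\<^sub>M lborel) ?g = (\<integral>y. \<integral>x. ?g (x,y) \<partial>lborel \<partial>lborel)"
    using lborel_pair.integral_snd[OF int] by (simp add: split_beta')
  also have "\<dots> = (LBINT y=0..b. (LBINT x=0..a. f (vec2 x y)))"
    using ab unfolding interval_lebesgue_integral_def set_lebesgue_integral_def
    by (auto simp: indicator_Rect_vec2' zero_ereal_def mult.assoc intro!: Bochner_Integration.integral_cong)
  finally show "integral\<^sup>L (lebesgue_on (Rect a b)) f = (LBINT y=0..b. (LBINT x=0..a. f (vec2 x y)))"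
    using * by simp
qed

section \<open>Integration by parts on the rectangle\<close>

definition face :: "real \<Rightarrow> real \<Rightarrow> 2 \<Rightarrow> (real^2) set" where
  "face a b i = (if i = 1 then {x. (x $ 1 = 0 \<or> x $ 1 = a) \<and> 0 < x $ 2 \<and> x $ 2 < b}
     else {x. (x $ 2 = 0 \<or> x $ 2 = b) \<and> 0 < x $ 1 \<and> x $ 1 < a})"

lemma pderiv_line:
  fixes f :: "'a::euclidean_space \<Rightarrow> real"
  assumes "f differentiable at (x + t *\<^sub>R i)"
  shows "((\<lambda>t. f (x + t *\<^sub>R i)) has_real_derivative pderiv_at i f (x + t *\<^sub>R i)) (at t)"
proof -
  have f: "(f has_derivative frechet_derivative f (at (x + t *\<^sub>R i))) (at (x + t *\<^sub>R i))"
    using assms frechet_derivative_works by blast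
  have "((\<lambda>t. x + t *\<^sub>R i) has_derivative (\<lambda>h. h *\<^sub>R i)) (at t)"
    by (auto intro!: derivative_eq_intros)
  from has_derivative_compose[OF this f]
  show ?thesis
    using linear_scale[OF has_derivative_linear[OF f]]
    by (simp add: has_field_derivative_def pderiv_at_def mult_commute_abs)
qed

text \<open>Integrating first in direction i, the fundamental theorem leaves the difference of the
  values at two points of \<open>face a b i\<close>. The outer variable runs over the open side, so
  the corners, where no normal exists, are never met.\<close>

lemma integral_pderiv_zero:
  fixes f :: "real^2 \<Rightarrow> real"
  assumes d: "\<And>x. f differentiable at x" and c: "continuous_on UNIV (pderiv_at (axis i 1) f)"
    and z: "\<And>x. x \<in> face a b i \<Longrightarrow> f x = 0" and ab: "a > 0" "b > 0"
  shows "integral\<^sup>L (lebesgue_on (Rect a b)) (pderiv_at (axis i 1) f) = 0"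
proof -
  let ?g = "pderiv_at (axis i 1) f"
  consider "i = 1" | "i = 2" using exhaust_2 by blast
  then show ?thesis
  proof cases
    case 1
    have "(LBINT x=0..a. ?g (vec2 x y)) = 0" if y: "0 < y" "y < b" for y
    proof -
      have v: "vec2 x y = vec2 0 y + x *\<^sub>R axis i 1" for x by (simp add: vec2_axis 1)
      have "(LBINT x=ereal 0..ereal a. ?g (vec2 x y)) = f (vec2 a y) - f (vec2 0 y)"
      proof (rule interval_integral_FTC_finite)
        show "continuous_on {min 0 a..max 0 a} (\<lambda>x. ?g (vec2 x y))"
          by (rule continuous_on_compose2[OF c]) (auto intro!: continuous_intros)
        show "((\<lambda>x. f (vec2 x y)) has_vector_derivative ?g (vec2 x y)) (at x within {min 0 a..max 0 a})" for x
          using pderiv_line[of f "vec2 0 y" x "axis i 1", OF d]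
          unfolding v[symmetric] has_real_derivative_iff_has_vector_derivative
          by (rule has_vector_derivative_at_within)
      qed
      also have "\<dots> = 0" using z[of "vec2 a y"] z[of "vec2 0 y"] y 1 by (simp add: face_def)
      finally show ?thesis by (simp add: zero_ereal_def)
    qed
    then have "(LBINT y=0..b. (LBINT x=0..a. ?g (vec2 x y))) = (LBINT y=0..b. 0)"
      using ab by (intro interval_integral_cong) (auto simp: zero_ereal_def einterval_def)
    then show ?thesis using integral_Rect(2)[OF c ab] by simp
  next
    case 2
    have "(LBINT y=0..b. ?g (vec2 x y)) = 0" if x: "0 < x" "x < a" for x
    proof -
      have v: "vec2 x y = vec2 x 0 + y *\<^sub>R axis i 1" for y by (simp add: vec2_axis 2)
      have "(LBINT y=ereal 0..ereal b. ?g (vec2 x y)) = f (vec2 x b) - f (vec2 x 0)"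
      proof (rule interval_integral_FTC_finite)
        show "continuous_on {min 0 b..max 0 b} (\<lambda>y. ?g (vec2 x y))"
          by (rule continuous_on_compose2[OF c]) (auto intro!: continuous_intros)
        show "((\<lambda>y. f (vec2 x y)) has_vector_derivative ?g (vec2 x y)) (at y within {min 0 b..max 0 b})" for y
          using pderiv_line[of f "vec2 x 0" y "axis i 1", OF d]
          unfolding v[symmetric] has_real_derivative_iff_has_vector_derivative
          by (rule has_vector_derivative_at_within)
      qed
      also have "\<dots> = 0" using z[of "vec2 x b"] z[of "vec2 x 0"] x 2 by (simp add: face_def)
      finally show ?thesis by (simp add: zero_ereal_def)
    qed
    then have "(LBINT x=0..a. (LBINT y=0..b. ?g (vec2 x y))) = (LBINT x=0..a. 0)"
      using ab by (intro interval_integral_cong) (auto simp: zero_ereal_def einterval_def)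
    then show ?thesis using integral_Rect(1)[OF c ab] by simp
  qed
qed

lemma pderiv_at_mult:
  fixes f g :: "'a::euclidean_space \<Rightarrow> real"
  assumes "f differentiable at x" "g differentiable at x"
  shows "pderiv_at i (\<lambda>x. f x * g x) x = f x * pderiv_at i g x + pderiv_at i f x * g x"
proof -
  have D: "((\<lambda>x. f x * g x) has_derivative
      (\<lambda>h. f x * frechet_derivative g (at x) h + frechet_derivative f (at x) h * g x)) (at x)"
    using assms frechet_derivative_works by (intro has_derivative_mult) auto
  show ?thesis using pderiv_at_eq[OF D] by (simp add: pderiv_at_def)
qed

text \<open>The product rule reduces this to \<open>integral_pderiv_zero\<close> for f g. At each
  point of the two faces orthogonal to direction i it is enough that one factor vanishes, and u.n =
  0 provides this for the component i of u.\<close>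

lemma integral_by_parts_Rect:
  fixes f g :: "real^2 \<Rightarrow> real"
  assumes f: "smooth f" and g: "smooth g"
    and z: "\<And>x. x \<in> face a b i \<Longrightarrow> f x = 0 \<or> g x = 0" and ab: "a > 0" "b > 0"
  shows "(\<integral>x. pderiv_at (axis i 1) f x * g x \<partial>lebesgue_on (Rect a b)) =
     - (\<integral>x. f x * pderiv_at (axis i 1) g x \<partial>lebesgue_on (Rect a b))"
proof -
  note s = f g smooth_pderiv[OF f axis_in_Basis] smooth_pderiv[OF g axis_in_Basis]
  have pm: "pderiv_at (axis i 1) (\<lambda>x. f x * g x) = (\<lambda>x. f x * pderiv_at (axis i 1) g x + pderiv_at (axis i 1) f x * g x)"
    by (rule ext, rule pderiv_at_mult) (use s smooth_differentiable in auto)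
  have i: "integrable (lebesgue_on (Rect a b)) (\<lambda>x. f x * pderiv_at (axis i 1) g x)"
      "integrable (lebesgue_on (Rect a b)) (\<lambda>x. pderiv_at (axis i 1) f x * g x)"
    by (intro integrable_continuous_Rect continuous_intros smooth_continuous s)+
  have "integral\<^sup>L (lebesgue_on (Rect a b)) (pderiv_at (axis i 1) (\<lambda>x. f x * g x)) = 0"
    by (rule integral_pderiv_zero)
       (use s z ab in \<open>auto intro!: smooth_differentiable smooth_mult smooth_continuous smooth_pderiv axis_in_Basis\<close>)
  then show ?thesis using i by (simp add: pm)
qed

section \<open>Square-integrable functions\<close>

text \<open>An inner product on representatives is only semidefinite, and its algebra holds only on
  a carrier set. The instances are the L2 product and, in the locale \<open>rectangle\<close>, the
  Dirichlet form on \<open>H1_vec\<close>.\<close>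

locale sip =
  fixes X :: "('x \<Rightarrow> 'y::real_vector) set" and ip :: "('x \<Rightarrow> 'y) \<Rightarrow> ('x \<Rightarrow> 'y) \<Rightarrow> real"
  assumes zero: "(\<lambda>x. 0) \<in> X"
    and add: "f \<in> X \<Longrightarrow> g \<in> X \<Longrightarrow> (\<lambda>x. f x + g x) \<in> X"
    and scale: "f \<in> X \<Longrightarrow> (\<lambda>x. c *\<^sub>R f x) \<in> X"
    and sym: "f \<in> X \<Longrightarrow> g \<in> X \<Longrightarrow> ip f g = ip g f"
    and add_left: "f \<in> X \<Longrightarrow> g \<in> X \<Longrightarrow> h \<in> X \<Longrightarrow> ip (\<lambda>x. f x + g x) h = ip f h + ip g h"
    and scale_left: "f \<in> X \<Longrightarrow> g \<in> X \<Longrightarrow> ip (\<lambda>x. c *\<^sub>R f x) g = c * ip f g"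
    and nonneg: "f \<in> X \<Longrightarrow> ip f f \<ge> 0"
begin

abbreviation "nrm f \<equiv> sqrt (ip f f)"

lemma uminus: "f \<in> X \<Longrightarrow> (\<lambda>x. - f x) \<in> X"
  using scale[of f "-1"] by simp

lemma diff: "f \<in> X \<Longrightarrow> g \<in> X \<Longrightarrow> (\<lambda>x. f x - g x) \<in> X"
  using add[OF _ uminus, of f g] by simp

lemma sum: "(\<And>i. i \<in> I \<Longrightarrow> f i \<in> X) \<Longrightarrow> (\<lambda>x. \<Sum>i\<in>I. f i x) \<in> X"
  by (induction I rule: infinite_finite_induct) (auto intro: zero add)

lemma lincomb: "(\<And>i. i \<in> I \<Longrightarrow> f i \<in> X) \<Longrightarrow> (\<lambda>x. \<Sum>i\<in>I. c i *\<^sub>R f i x) \<in> X"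
  by (intro sum scale)

lemma uminus_left: "f \<in> X \<Longrightarrow> g \<in> X \<Longrightarrow> ip (\<lambda>x. - f x) g = - ip f g"
  using scale_left[of f g "-1"] by simp

lemma diff_left: "f \<in> X \<Longrightarrow> g \<in> X \<Longrightarrow> h \<in> X \<Longrightarrow> ip (\<lambda>x. f x - g x) h = ip f h - ip g h"
  using add_left[OF _ uminus, of f g h] by (simp add: uminus_left)

lemma zero_left: "f \<in> X \<Longrightarrow> ip (\<lambda>x. 0) f = 0"
  using scale_left[of f f 0] by simp

lemma zero_right: "f \<in> X \<Longrightarrow> ip f (\<lambda>x. 0) = 0"
  using zero_left sym zero by metis

lemma add_right: "f \<in> X \<Longrightarrow> g \<in> X \<Longrightarrow> h \<in> X \<Longrightarrow> ip h (\<lambda>x. f x + g x) = ip h f + ip h g"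
  using add_left[of f g h] add sym[of h] by simp

lemma scale_right: "f \<in> X \<Longrightarrow> g \<in> X \<Longrightarrow> ip g (\<lambda>x. c *\<^sub>R f x) = c * ip g f"
  using scale_left[of f g c] scale sym[of g] by simp

lemma diff_right: "f \<in> X \<Longrightarrow> g \<in> X \<Longrightarrow> h \<in> X \<Longrightarrow> ip h (\<lambda>x. f x - g x) = ip h f - ip h g"
  using diff_left[of f g h] diff sym[of h] by simp

lemma lincomb_left:
  "(\<And>i. i \<in> I \<Longrightarrow> f i \<in> X) \<Longrightarrow> g \<in> X \<Longrightarrow> ip (\<lambda>x. \<Sum>i\<in>I. c i *\<^sub>R f i x) g = (\<Sum>i\<in>I. c i * ip (f i) g)"
  by (induction I rule: infinite_finite_induct) (auto simp: zero_left add_left scale_left scale lincomb)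

lemma lincomb_right:
  "(\<And>i. i \<in> I \<Longrightarrow> f i \<in> X) \<Longrightarrow> g \<in> X \<Longrightarrow> ip g (\<lambda>x. \<Sum>i\<in>I. c i *\<^sub>R f i x) = (\<Sum>i\<in>I. c i * ip g (f i))"
  by (induction I rule: infinite_finite_induct) (auto simp: zero_right add_right scale_right scale lincomb)

lemma nrm_sq: "f \<in> X \<Longrightarrow> (nrm f)\<^sup>2 = ip f f"
  by (simp add: nonneg)

lemma quadratic:
  assumes "f \<in> X" "g \<in> X"
  shows "ip (\<lambda>x. f x + g x) (\<lambda>x. f x + g x) = ip f f + 2 * ip f g + ip g g"
    and "ip (\<lambda>x. f x - g x) (\<lambda>x. f x - g x) = ip f f - 2 * ip f g + ip g g"
  using assms sym[of f g] by (simp_all add: add diff add_left add_right diff_left diff_right)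

lemma CS: assumes "f \<in> X" "g \<in> X" shows "\<bar>ip f g\<bar> \<le> nrm f * nrm g"
proof -
  have q: "ip f f - 2 * t * ip f g + t\<^sup>2 * ip g g \<ge> 0" for t
    using quadratic(2)[of f "\<lambda>x. t *\<^sub>R g x"] nonneg[OF diff, of f "\<lambda>x. t *\<^sub>R g x"] assms
    by (simp add: scale scale_left scale_right power2_eq_square mult.assoc)
  have "(ip f g)\<^sup>2 \<le> ip f f * ip g g"
  \<comment> \<open>Without definiteness the degenerate case is separate: the quadratic in t is then
    affine, and a nonnegative affine function is constant; the witness below would give it the value
    -1. In the other case t is the minimiser.\<close>
  proof (cases "ip g g = 0")
    case True
    have "ip f g = 0"
    proof (rule ccontr)
      assume "ip f g \<noteq> 0"
      then show False using q[of "(ip f f + 1) / (2 * ip f g)"] True by (simp add: field_simps)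
    qed
    then show ?thesis using True by simp
  next
    case False
    then have "ip g g > 0" using nonneg[OF assms(2)] by simp
    then show ?thesis using q[of "ip f g / ip g g"]
      by (simp add: field_simps power2_eq_square)
  qed
  then have "sqrt ((ip f g)\<^sup>2) \<le> sqrt (ip f f * ip g g)" by (rule real_sqrt_le_mono)
  then show ?thesis by (simp add: real_sqrt_mult)
qed

lemma tri: assumes "f \<in> X" "g \<in> X" shows "nrm (\<lambda>x. f x + g x) \<le> nrm f + nrm g"
proof (rule power2_le_imp_le)
  have "(nrm (\<lambda>x. f x + g x))\<^sup>2 = ip f f + 2 * ip f g + ip g g"
    using nrm_sq[OF add[OF assms]] quadratic(1)[OF assms] by simp
  also have "\<dots> \<le> (nrm f + nrm g)\<^sup>2"
    using CS[OF assms] assms by (simp add: power2_sum nonneg)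
  finally show "(nrm (\<lambda>x. f x + g x))\<^sup>2 \<le> (nrm f + nrm g)\<^sup>2" .
qed (simp add: assms nonneg)

lemma nrm_scale: "f \<in> X \<Longrightarrow> nrm (\<lambda>x. c *\<^sub>R f x) = \<bar>c\<bar> * nrm f"
  by (simp add: scale scale_left scale_right real_sqrt_mult flip: mult.assoc)

lemma nrm_minus_commute: "f \<in> X \<Longrightarrow> g \<in> X \<Longrightarrow> nrm (\<lambda>x. f x - g x) = nrm (\<lambda>x. g x - f x)"
  by (simp add: quadratic sym[of g f])

lemma tri_diff:
  assumes "f \<in> X" "g \<in> X" "h \<in> X"
  shows "nrm (\<lambda>x. f x - h x) \<le> nrm (\<lambda>x. f x - g x) + nrm (\<lambda>x. g x - h x)"
  using tri[of "\<lambda>x. f x - g x" "\<lambda>x. g x - h x"] assms by (simp add: diff)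

lemma tri_sub:
  assumes "f \<in> X" "g \<in> X"
  shows "nrm (\<lambda>x. f x - g x) \<le> nrm f + nrm g"
  using tri_diff[of f "\<lambda>x. 0" g] assms nrm_scale[of g "-1"] by (simp add: zero)

lemma tri_rev:
  assumes "f \<in> X" "g \<in> X"
  shows "\<bar>nrm f - nrm g\<bar> \<le> nrm (\<lambda>x. f x - g x)"
  using tri[of "\<lambda>x. f x - g x" g] tri[of "\<lambda>x. g x - f x" f] assms nrm_minus_commute[of f g]
  by (simp add: diff)

lemma lincomb_orth:
  assumes "\<And>i. i \<in> I \<Longrightarrow> f i \<in> X" "finite I"
    and o: "\<And>i j. i \<in> I \<Longrightarrow> j \<in> I \<Longrightarrow> ip (f i) (f j) = (if i = j then m i else 0)"
  shows "ip (\<lambda>x. \<Sum>i\<in>I. c i *\<^sub>R f i x) (\<lambda>x. \<Sum>i\<in>I. d i *\<^sub>R f i x) = (\<Sum>i\<in>I. m i * c i * d i)"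
proof -
  have "ip (\<lambda>x. \<Sum>i\<in>I. c i *\<^sub>R f i x) (\<lambda>x. \<Sum>i\<in>I. d i *\<^sub>R f i x)
      = (\<Sum>i\<in>I. c i * (\<Sum>j\<in>I. d j * ip (f i) (f j)))"
    using assms(1) by (simp add: lincomb_left lincomb_right lincomb)
  also have "\<dots> = (\<Sum>i\<in>I. m i * c i * d i)"
  proof (rule sum.cong)
    fix i assume i: "i \<in> I"
    have "(\<Sum>j\<in>I. d j * ip (f i) (f j)) = (\<Sum>j\<in>I. if i = j then d j * m i else 0)"
      by (rule sum.cong) (use o i in auto)
    then show "c i * (\<Sum>j\<in>I. d j * ip (f i) (f j)) = m i * c i * d i"
      using i assms(2) by simp
  qed simp
  finally show ?thesis .
qed

end

section \<open>Square-integrable functions on a subset of the plane\<close>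

lemma L2D: "f \<in> L2 S \<Longrightarrow> f \<in> borel_measurable (lebesgue_on S)"
  "f \<in> L2 S \<Longrightarrow> integrable (lebesgue_on S) (\<lambda>x. (norm (f x))\<^sup>2)"
  by (auto simp: L2_def)

lemma L2I_bound:
  assumes "f \<in> borel_measurable (lebesgue_on S)" "integrable (lebesgue_on S) g"
    "\<And>x. x \<in> S \<Longrightarrow> (norm (f x))\<^sup>2 \<le> g x"
  shows "f \<in> L2 S"
proof -
  have "integrable (lebesgue_on S) (\<lambda>x. (norm (f x))\<^sup>2)"
    by (rule Bochner_Integration.integrable_bound[OF assms(2)])
       (use assms in \<open>auto intro!: AE_I2 simp: space_restrict_space order_trans[OF assms(3) abs_ge_self]\<close>)
  then show ?thesis using assms(1) by (simp add: L2_def)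
qed

lemma norm_add_sq_le: "(norm (x + y))\<^sup>2 \<le> 2 * (norm x)\<^sup>2 + 2 * (norm (y::'a::real_normed_vector))\<^sup>2"
proof -
  have "(norm (x + y))\<^sup>2 \<le> (norm x + norm y)\<^sup>2" by (intro power_mono norm_triangle_ineq) auto
  also have "\<dots> \<le> 2 * (norm x)\<^sup>2 + 2 * (norm y)\<^sup>2"
    using sum_squares_bound[of "norm x" "norm y"] by (simp add: power2_sum)
  finally show ?thesis .
qed

lemma L2_add:
  fixes f g :: "real^2 \<Rightarrow> 'b::euclidean_space"
  assumes f: "f \<in> L2 S" and g: "g \<in> L2 S" shows "(\<lambda>x. f x + g x) \<in> L2 S"
  by (rule L2I_bound[OF _ Bochner_Integration.integrable_add[OF
        integrable_mult_right[OF L2D(2)[OF f], of 2] integrable_mult_right[OF L2D(2)[OF g], of 2]]])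
     (use L2D(1)[OF f] L2D(1)[OF g] in \<open>auto simp: norm_add_sq_le\<close>)

lemma L2_scale:
  fixes f :: "real^2 \<Rightarrow> 'b::euclidean_space"
  assumes f: "f \<in> L2 S" shows "(\<lambda>x. c *\<^sub>R f x) \<in> L2 S"
  by (rule L2I_bound[OF _ integrable_mult_right[OF L2D(2)[OF f], of "c\<^sup>2"]])
     (use L2D(1)[OF f] in \<open>auto simp: power_mult_distrib\<close>)

lemma L2_inner_integrable:
  fixes f g :: "real^2 \<Rightarrow> 'b::euclidean_space"
  assumes f: "f \<in> L2 S" and g: "g \<in> L2 S" shows "integrable (lebesgue_on S) (\<lambda>x. f x \<bullet> g x)"
proof (rule Bochner_Integration.integrable_bound[OF Bochner_Integration.integrable_add[OF L2D(2)[OF f] L2D(2)[OF g]]])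
  have "\<bar>x \<bullet> y\<bar> \<le> (norm x)\<^sup>2 + (norm y)\<^sup>2" for x y :: 'b
  proof -
    have "0 \<le> (norm x - norm y)\<^sup>2" by simp
    then have "2 * (norm x * norm y) \<le> (norm x)\<^sup>2 + (norm y)\<^sup>2" by (simp add: power2_diff)
    moreover have "0 \<le> norm x * norm y" by simp
    ultimately show ?thesis using Cauchy_Schwarz_ineq2[of x y] by linarith
  qed
  then show "AE x in lebesgue_on S. norm (f x \<bullet> g x) \<le> norm ((norm (f x))\<^sup>2 + (norm (g x))\<^sup>2)"
    by auto
qed (use L2D(1)[OF f] L2D(1)[OF g] in measurable)

interpretation L2: sip "L2 S :: (real^2 \<Rightarrow> 'b::euclidean_space) set" "L2_inner S" for S
proof
  fix f g h :: "real^2 \<Rightarrow> 'b" and c :: real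
  show "(\<lambda>x. 0) \<in> (L2 S :: (real^2 \<Rightarrow> 'b) set)" by (simp add: L2_def)
  show "f \<in> L2 S \<Longrightarrow> g \<in> L2 S \<Longrightarrow> (\<lambda>x. f x + g x) \<in> L2 S" by (rule L2_add)
  show "f \<in> L2 S \<Longrightarrow> (\<lambda>x. c *\<^sub>R f x) \<in> L2 S" by (rule L2_scale)
  show "L2_inner S f g = L2_inner S g f" by (simp add: L2_inner_def inner_commute)
  show "f \<in> L2 S \<Longrightarrow> g \<in> L2 S \<Longrightarrow> h \<in> L2 S \<Longrightarrow> L2_inner S (\<lambda>x. f x + g x) h = L2_inner S f h + L2_inner S g h"
    by (simp add: L2_inner_def inner_add_left L2_inner_integrable)
  show "L2_inner S (\<lambda>x. c *\<^sub>R f x) g = c * L2_inner S f g"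
    by (simp add: L2_inner_def)
  show "L2_inner S f f \<ge> 0" by (simp add: L2_inner_def)
qed

lemmas L2_CS = L2.CS[folded L2_norm_def]
lemmas L2_tri = L2.tri[folded L2_norm_def]
lemmas L2_tri_sub = L2.tri_sub[folded L2_norm_def]
lemmas L2_tri_diff = L2.tri_diff[folded L2_norm_def]
lemmas L2_tri_rev = L2.tri_rev[folded L2_norm_def]
lemmas L2_norm_scale = L2.nrm_scale[folded L2_norm_def]
lemmas L2_norm_minus_commute = L2.nrm_minus_commute[folded L2_norm_def]

lemma L2_inner_commute: "L2_inner S f g = L2_inner S g f"
  by (simp add: L2_inner_def inner_commute)

lemma L2_inner_nonneg: "L2_inner S f f \<ge> 0"
  by (simp add: L2_inner_def)

lemma L2_norm_nonneg [simp]: "L2_norm S f \<ge> 0"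
  by (simp add: L2_norm_def L2_inner_nonneg)

lemma L2_norm_sq: "(L2_norm S f)\<^sup>2 = L2_inner S f f"
  by (simp add: L2_norm_def L2_inner_nonneg)

lemma L2_inner_self: "L2_inner S f f = (\<integral>x. (norm (f x))\<^sup>2 \<partial>lebesgue_on S)"
  by (simp add: L2_inner_def power2_norm_eq_inner)

lemma L2_norm_norm: "f \<in> L2 S \<Longrightarrow> (\<lambda>x. norm (f x)) \<in> L2 S"
  "L2_norm S (\<lambda>x. norm (f x)) = L2_norm S f"
proof -
  show "f \<in> L2 S \<Longrightarrow> (\<lambda>x. norm (f x)) \<in> L2 S" by (auto simp: L2_def)
  show "L2_norm S (\<lambda>x. norm (f x)) = L2_norm S f" unfolding L2_norm_def L2_inner_self by simp
qed

lemma L2_CS_norm: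
  assumes "f \<in> L2 S" "g \<in> L2 S"
  shows "integrable (lebesgue_on S) (\<lambda>x. norm (f x) * norm (g x))"
    and "(\<integral>x. norm (f x) * norm (g x) \<partial>lebesgue_on S) \<le> L2_norm S f * L2_norm S g"
proof -
  note L2 = L2_norm_norm(1)[OF assms(1)] L2_norm_norm(1)[OF assms(2)]
  show "integrable (lebesgue_on S) (\<lambda>x. norm (f x) * norm (g x))"
    using L2_inner_integrable[OF L2] by simp
  show "(\<integral>x. norm (f x) * norm (g x) \<partial>lebesgue_on S) \<le> L2_norm S f * L2_norm S g"
    using L2_CS[OF L2] by (simp add: L2_norm_norm L2_inner_def)
qed

lemma L2_AE_zero:
  assumes "f \<in> L2 S" shows "L2_inner S f f = 0 \<longleftrightarrow> (AE x in lebesgue_on S. f x = 0)"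
  unfolding L2_inner_self
  by (subst integral_nonneg_eq_0_iff_AE[OF L2D(2)[OF assms]]) auto

lemma L2_norm_AE_zero:
  assumes "f \<in> L2 S" shows "L2_norm S f = 0 \<longleftrightarrow> (AE x in lebesgue_on S. f x = 0)"
  by (simp add: L2_norm_def L2_AE_zero[OF assms])

lemma L2_inner_cong_AE:
  assumes "f \<in> L2 S" "f' \<in> L2 S" "g \<in> L2 S" "g' \<in> L2 S"
    "AE x in lebesgue_on S. f x = f' x" "AE x in lebesgue_on S. g x = g' x"
  shows "L2_inner S f g = L2_inner S f' g'"
  unfolding L2_inner_def
  by (rule integral_cong_AE)
     (use assms in \<open>auto dest: L2_inner_integrable borel_measurable_integrable intro: borel_measurable_inner L2D(1)\<close>)

lemma L2_mult_bounded:
  fixes f :: "real^2 \<Rightarrow> 'b::euclidean_space"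
  assumes f: "f \<in> L2 S" and h: "h \<in> borel_measurable (lebesgue_on S)" "\<And>x. x \<in> S \<Longrightarrow> \<bar>h x\<bar> \<le> B" and B: "B \<ge> 0"
  shows "(\<lambda>x. h x *\<^sub>R f x) \<in> L2 S" and "L2_norm S (\<lambda>x. h x *\<^sub>R f x) \<le> B * L2_norm S f"
proof -
  have le: "(norm (h x *\<^sub>R f x))\<^sup>2 \<le> B\<^sup>2 * (norm (f x))\<^sup>2" if "x \<in> S" for x
    using h(2)[OF that] B
    by (simp add: power_mult_distrib mult_right_mono power2_le_iff_abs_le)
  show 1: "(\<lambda>x. h x *\<^sub>R f x) \<in> L2 S"
    by (rule L2I_bound[OF _ integrable_mult_right[OF L2D(2)[OF f], of "B\<^sup>2"]])
       (use L2D(1)[OF f] h(1) le in auto)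
  have "L2_inner S (\<lambda>x. h x *\<^sub>R f x) (\<lambda>x. h x *\<^sub>R f x) \<le> (\<integral>x. B\<^sup>2 * (norm (f x))\<^sup>2 \<partial>lebesgue_on S)"
    unfolding L2_inner_self
    by (rule integral_mono_AE[OF L2D(2)[OF 1] integrable_mult_right[OF L2D(2)[OF f], of "B\<^sup>2"]])
       (use le in \<open>auto intro!: AE_I2 simp: space_restrict_space\<close>)
  also have "\<dots> = B\<^sup>2 * L2_inner S f f" by (simp add: L2_inner_self)
  finally have "sqrt (L2_inner S (\<lambda>x. h x *\<^sub>R f x) (\<lambda>x. h x *\<^sub>R f x)) \<le> sqrt (B\<^sup>2 * L2_inner S f f)"
    by (rule real_sqrt_le_mono)
  then show "L2_norm S (\<lambda>x. h x *\<^sub>R f x) \<le> B * L2_norm S f"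
    using B by (simp add: L2_norm_def real_sqrt_mult)
qed

lemma L2_continuous:
  fixes f :: "real^2 \<Rightarrow> 'b::euclidean_space"
  assumes "continuous_on UNIV f" shows "f \<in> L2 (Rect a b)"
proof -
  have "integrable (lebesgue_on (Rect a b)) (\<lambda>x. (norm (f x))\<^sup>2)"
    by (rule integrable_continuous_Rect) (intro continuous_intros assms)
  then show ?thesis using borel_measurable_continuous_Rect[OF assms] by (simp add: L2_def)
qed

lemma measurable_nth: "(\<lambda>v::real^'n. v $ i) \<in> borel_measurable borel"
  by (intro borel_measurable_continuous_onI continuous_intros)

lemma L2_vec:
  fixes u :: "real^2 \<Rightarrow> real^2"
  shows "u \<in> L2 S \<longleftrightarrow> (\<forall>i. (\<lambda>x. u x $ i) \<in> L2 S)"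
proof
  assume u: "u \<in> L2 S"
  show "\<forall>i. (\<lambda>x. u x $ i) \<in> L2 S"
  proof
    fix i
    have "(\<lambda>x. u x $ i) \<in> borel_measurable (lebesgue_on S)"
      by (rule measurable_compose[OF L2D(1)[OF u] measurable_nth])
    moreover have "(norm (u x $ i))\<^sup>2 \<le> (norm (u x))\<^sup>2" for x
      using power_mono[OF component_le_norm_cart[of "u x" i], of 2] by simp
    ultimately show "(\<lambda>x. u x $ i) \<in> L2 S"
      by (intro L2I_bound[OF _ L2D(2)[OF u]])
  qed
next
  assume *: "\<forall>i. (\<lambda>x. u x $ i) \<in> L2 S"
  have "u \<in> borel_measurable (lebesgue_on S)"
    by (subst borel_measurable_euclidean_space) (use * L2D(1) in \<open>auto simp: Basis_real2 inner_axis\<close>)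
  moreover have "integrable (lebesgue_on S) (\<lambda>x. \<Sum>i\<in>UNIV. (norm (u x $ i))\<^sup>2)"
    using * by (intro Bochner_Integration.integrable_sum L2D(2)) auto
  moreover have "(\<Sum>i\<in>UNIV. (norm (u x $ i))\<^sup>2) = (norm (u x))\<^sup>2" for x
    by (simp add: norm_vec_def L2_set_def sum_nonneg)
  ultimately show "u \<in> L2 S" by (simp add: L2_def)
qed

lemma L2_inner_vec:
  fixes u v :: "real^2 \<Rightarrow> real^2"
  assumes "u \<in> L2 S" "v \<in> L2 S"
  shows "L2_inner S u v = (\<Sum>i\<in>UNIV. L2_inner S (\<lambda>x. u x $ i) (\<lambda>x. v x $ i))"
proof -
  have "(\<Sum>i\<in>UNIV. L2_inner S (\<lambda>x. u x $ i) (\<lambda>x. v x $ i)) = (\<integral>x. (\<Sum>i\<in>UNIV. u x $ i * v x $ i) \<partial>lebesgue_on S)"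
    using assms L2_inner_integrable[of "\<lambda>x. u x $ _" S "\<lambda>x. v x $ _"] unfolding L2_inner_def L2_vec
    by (subst Bochner_Integration.integral_sum) auto
  then show ?thesis by (simp add: L2_inner_def inner_vec_def)
qed

lemma L2_norm_component:
  fixes u :: "real^2 \<Rightarrow> real^2"
  assumes u: "u \<in> L2 S" shows "L2_norm S (\<lambda>x. u x $ i) \<le> L2_norm S u"
proof -
  have "L2_inner S (\<lambda>x. u x $ i) (\<lambda>x. u x $ i) \<le> (\<Sum>i\<in>UNIV. L2_inner S (\<lambda>x. u x $ i) (\<lambda>x. u x $ i))"
    by (rule member_le_sum) (auto simp: L2_inner_nonneg)
  then show ?thesis unfolding L2_norm_def by (simp add: L2_inner_vec[OF u u])
qed

lemma L2_imp_integrable: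
  assumes "finite_measure (lebesgue_on S)" "f \<in> L2 S"
  shows "integrable (lebesgue_on S) f" "(\<integral>x. norm (f x) \<partial>lebesgue_on S) \<le> sqrt (measure (lebesgue_on S) S) * L2_norm S f"
proof -
  interpret finite_measure "lebesgue_on S" by fact
  have 1: "(\<lambda>x. 1::real) \<in> L2 S" by (simp add: L2_def)
  have n1: "L2_norm S (\<lambda>x. 1::real) = sqrt (measure (lebesgue_on S) S)"
    by (simp add: L2_norm_def L2_inner_def space_restrict_space) 
  have "integrable (lebesgue_on S) (\<lambda>x. norm (f x))"
    using L2_CS_norm(1)[OF 1 assms(2)] by simp
  then show "integrable (lebesgue_on S) f" using L2D(1)[OF assms(2)] integrable_norm_cancel by blast
  show "(\<integral>x. norm (f x) \<partial>lebesgue_on S) \<le> sqrt (measure (lebesgue_on S) S) * L2_norm S f"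
    using L2_CS_norm(2)[OF 1 assms(2)] n1 by simp
qed

text \<open>On a finite measure space an L2 Cauchy sequence is L1 Cauchy, so a subsequence converges
  almost everywhere. Fatou's lemma along it bounds f m - g in L2 by the Cauchy estimate.\<close>

lemma L2_complete:
  fixes f :: "nat \<Rightarrow> real^2 \<Rightarrow> 'b::euclidean_space"
  assumes fin: "finite_measure (lebesgue_on S)" and f: "\<And>n. f n \<in> L2 S"
    and cauchy: "\<And>e. e > 0 \<Longrightarrow> \<exists>N. \<forall>m\<ge>N. \<forall>n\<ge>N. L2_norm S (\<lambda>x. f m x - f n x) < e"
  obtains g where "g \<in> L2 S" "(\<lambda>n. L2_norm S (\<lambda>x. f n x - g x)) \<longlonglongrightarrow> 0"
proof -
  let ?M = "lebesgue_on S"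
  \<comment> \<open>The summand 1 keeps the divisor positive when the set is null.\<close>
  define c where "c = sqrt (measure ?M S) + 1"
  have c: "c > 0" by (simp add: c_def add_nonneg_pos)
  have L1: "\<exists>N. \<forall>i\<ge>N. \<forall>j\<ge>N. (LINT x|?M. norm (f i x - f j x)) < e" if e: "e > 0" for e
  proof -
    obtain N where N: "\<And>m n. m \<ge> N \<Longrightarrow> n \<ge> N \<Longrightarrow> L2_norm S (\<lambda>x. f m x - f n x) < e / c"
      using cauchy[of "e / c"] e c by auto
    have "(LINT x|?M. norm (f i x - f j x)) < e" if "i \<ge> N" "j \<ge> N" for i j
    proof -
      have "(LINT x|?M. norm (f i x - f j x)) \<le> sqrt (measure ?M S) * L2_norm S (\<lambda>x. f i x - f j x)"
        by (rule L2_imp_integrable(2)[OF fin L2.diff[OF f f]])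
      also have "\<dots> \<le> c * L2_norm S (\<lambda>x. f i x - f j x)"
        by (intro mult_right_mono) (auto simp: c_def)
      also have "\<dots> < e" using N[OF that] c by (simp add: field_simps)
      finally show ?thesis .
    qed
    then show ?thesis by blast
  qed
  obtain r where r: "strict_mono r" and AE: "AE x in ?M. Cauchy (\<lambda>i. f (r i) x)"
    using cauchy_L1_AE_cauchy_subseq[of ?M f, OF L2_imp_integrable(1)[OF fin f] L1] by blast
  define g where "g x = lim (\<lambda>i. f (r i) x)" for x
  have fm [measurable]: "f n \<in> borel_measurable ?M" for n using f L2D by blast
  have gm [measurable]: "g \<in> borel_measurable ?M"
    unfolding g_def[abs_def] by (intro borel_measurable_lim_metric) measurable
  have lim: "AE x in ?M. (\<lambda>i. f (r i) x) \<longlonglongrightarrow> g x"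
    using AE by eventually_elim (auto simp: g_def Cauchy_convergent_iff convergent_LIMSEQ_iff)
  have nn: "(\<integral>\<^sup>+x. ennreal ((norm (h x))\<^sup>2) \<partial>?M) = ennreal ((L2_norm S h)\<^sup>2)" if "h \<in> L2 S" for h :: "real^2 \<Rightarrow> 'b"
    using L2D(2)[OF that] by (subst nn_integral_eq_integral) (auto simp: L2_norm_sq L2_inner_self)
  have fatou: "(\<integral>\<^sup>+x. ennreal ((norm (f m x - g x))\<^sup>2) \<partial>?M) \<le> ennreal (e\<^sup>2)"
    if N: "\<And>n. n \<ge> N \<Longrightarrow> L2_norm S (\<lambda>x. f m x - f n x) < e" for m N e
  proof -
    have "(\<integral>\<^sup>+x. ennreal ((norm (f m x - g x))\<^sup>2) \<partial>?M)
        = (\<integral>\<^sup>+x. liminf (\<lambda>i. ennreal ((norm (f m x - f (r i) x))\<^sup>2)) \<partial>?M)"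
    proof (rule nn_integral_cong_AE)
      show "AE x in ?M. ennreal ((norm (f m x - g x))\<^sup>2) = liminf (\<lambda>i. ennreal ((norm (f m x - f (r i) x))\<^sup>2))"
        using lim
      proof eventually_elim
        case (elim x)
        then have "(\<lambda>i. ennreal ((norm (f m x - f (r i) x))\<^sup>2)) \<longlonglongrightarrow> ennreal ((norm (f m x - g x))\<^sup>2)"
          by (intro tendsto_intros)
        from lim_imp_Liminf[OF trivial_limit_sequentially this] show ?case by (rule sym)
      qed
    qed
    also have "\<dots> \<le> liminf (\<lambda>i. \<integral>\<^sup>+x. ennreal ((norm (f m x - f (r i) x))\<^sup>2) \<partial>?M)"
      by (rule nn_integral_liminf) measurable
    also have "\<dots> \<le> ennreal (e\<^sup>2)"
    proof (rule Liminf_le)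
      have "(\<integral>\<^sup>+x. ennreal ((norm (f m x - f (r i) x))\<^sup>2) \<partial>?M) \<le> ennreal (e\<^sup>2)" if "i \<ge> N" for i
      proof -
        have "L2_norm S (\<lambda>x. f m x - f (r i) x) < e"
          using N[of "r i"] seq_suble[OF r, of i] that by simp
        then show ?thesis
          unfolding nn[OF L2.diff[OF f f]] by (intro ennreal_leI power_mono) auto
      qed
      then show "\<forall>\<^sub>F i in sequentially. (\<integral>\<^sup>+x. ennreal ((norm (f m x - f (r i) x))\<^sup>2) \<partial>?M) \<le> ennreal (e\<^sup>2)"
        by (auto simp: eventually_sequentially)
    qed simp
    finally show ?thesis .
  qed
  have dL2: "(\<lambda>x. f m x - g x) \<in> L2 S" if "\<And>n. n \<ge> N \<Longrightarrow> L2_norm S (\<lambda>x. f m x - f n x) < e" for m N e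
  proof -
    have "(\<integral>\<^sup>+x. ennreal (norm ((norm (f m x - g x))\<^sup>2)) \<partial>?M) < \<infinity>"
      using le_less_trans[OF fatou[OF that]] by simp
    then show ?thesis by (auto simp: L2_def integrable_iff_bounded)
  qed
  obtain N1 where N1: "\<And>m n. m \<ge> N1 \<Longrightarrow> n \<ge> N1 \<Longrightarrow> L2_norm S (\<lambda>x. f m x - f n x) < 1"
    using cauchy[of 1] by auto
  have "(\<lambda>x. f N1 x - (f N1 x - g x)) \<in> L2 S"
    by (intro L2.diff f dL2[of N1 _ 1]) (use N1 in auto)
  then have g: "g \<in> L2 S" by simp
  have "(\<lambda>n. L2_norm S (\<lambda>x. f n x - g x)) \<longlonglongrightarrow> 0"
  proof (rule LIMSEQ_I)
    fix e :: real assume e: "e > 0"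
    obtain N where N: "\<And>m n. m \<ge> N \<Longrightarrow> n \<ge> N \<Longrightarrow> L2_norm S (\<lambda>x. f m x - f n x) < e / 2"
      using cauchy[of "e / 2"] e by auto
    have "norm (L2_norm S (\<lambda>x. f m x - g x) - 0) < e" if m: "m \<ge> N" for m
    proof -
      have "ennreal ((L2_norm S (\<lambda>x. f m x - g x))\<^sup>2) \<le> ennreal ((e / 2)\<^sup>2)"
        using fatou[of N m "e / 2"] N m nn[OF L2.diff[OF f g], of m] by simp
      then have "(L2_norm S (\<lambda>x. f m x - g x))\<^sup>2 \<le> (e / 2)\<^sup>2"
        by (subst (asm) ennreal_le_iff) auto
      then have "L2_norm S (\<lambda>x. f m x - g x) \<le> e / 2"
        by (rule power2_le_imp_le) (use e in auto)
      then show ?thesis using e by simp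
    qed
    then show "\<exists>N. \<forall>n\<ge>N. norm (L2_norm S (\<lambda>x. f n x - g x) - 0) < e" by blast
  qed
  with g show ?thesis using that by blast
qed

lemma L2_inner_tendsto:
  assumes f: "\<And>n. f n \<in> L2 S" "g \<in> L2 S" "h \<in> L2 S"
    and lim: "(\<lambda>n. L2_norm S (\<lambda>x. f n x - g x)) \<longlonglongrightarrow> 0"
  shows "(\<lambda>n. L2_inner S (f n) h) \<longlonglongrightarrow> L2_inner S g h"
proof -
  have "(\<lambda>n. L2_norm S (\<lambda>x. f n x - g x) * L2_norm S h) \<longlonglongrightarrow> 0"
    using tendsto_mult_right[OF lim] by simp
  then have "(\<lambda>n. L2_inner S (f n) h - L2_inner S g h) \<longlonglongrightarrow> 0"
    by (rule Lim_null_comparison[rotated])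
       (use L2_CS[OF L2.diff[OF f(1,2)] f(3)] f in \<open>simp add: L2.diff_left\<close>)
  then show ?thesis using LIM_zero_iff by blast
qed

lemma L2_norm_tendsto:
  assumes f: "\<And>n. f n \<in> L2 S" "g \<in> L2 S"
    and lim: "(\<lambda>n. L2_norm S (\<lambda>x. f n x - g x)) \<longlonglongrightarrow> 0"
  shows "(\<lambda>n. L2_norm S (f n)) \<longlonglongrightarrow> L2_norm S g"
proof -
  have "(\<lambda>n. L2_norm S (f n) - L2_norm S g) \<longlonglongrightarrow> 0"
    by (rule Lim_null_comparison[OF _ lim]) (use L2_tri_rev[OF f] in auto)
  then show ?thesis using LIM_zero_iff by blast
qed

section \<open>Cosine series and weak derivatives\<close>

text \<open>Integer frequencies, negative ones included, let the product formulas hold without a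
  case distinction on which frequency is larger.\<close>

definition cosk :: "real \<Rightarrow> int \<Rightarrow> real \<Rightarrow> real" where
  "cosk a k t = cos (of_int k * pi / a * t)"

definition sink :: "real \<Rightarrow> int \<Rightarrow> real \<Rightarrow> real" where
  "sink a k t = sin (of_int k * pi / a * t)"

lemma cosk_0 [simp]: "cosk a 0 t = 1" and sink_0 [simp]: "sink a 0 t = 0"
  by (simp_all add: cosk_def sink_def)

lemma cosk_uminus: "cosk a (- k) t = cosk a k t"
  by (simp add: cosk_def)

lemma cosk_mult: "cosk a j t * cosk a k t = cosk a (j - k) t / 2 + cosk a (j + k) t / 2"
  unfolding cosk_def by (simp add: cos_times_cos add_divide_distrib left_diff_distrib ring_distribs diff_divide_distrib)

lemma sink_mult_cosk: "sink a j t * cosk a k t = sink a (j + k) t / 2 + sink a (j - k) t / 2"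
  unfolding cosk_def sink_def by (simp add: sin_times_cos add_divide_distrib left_diff_distrib ring_distribs diff_divide_distrib)

lemma sink_mult_sink: "sink a j t * sink a k t = cosk a (j - k) t / 2 - cosk a (j + k) t / 2"
  unfolding cosk_def sink_def by (simp add: sin_times_sin add_divide_distrib left_diff_distrib ring_distribs diff_divide_distrib)

lemma smooth_cosk: "smooth (cosk a k)"
  using smooth_cos[of "of_int k * pi / a" 0] by (simp add: cosk_def[abs_def])

lemma smooth_sink: "smooth (sink a k)"
  using smooth_sin[of "of_int k * pi / a" 0] by (simp add: sink_def[abs_def])

lemma deriv_cosk: "deriv (cosk a k) = (\<lambda>t. - (of_int k * pi / a) * sink a k t)"
proof (rule ext, rule DERIV_imp_deriv)
  have "((\<lambda>t. cos (c * t)) has_real_derivative - c * sin (c * t)) (at t)" for c t :: real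
    by (auto intro!: derivative_eq_intros)
  then show "(cosk a k has_real_derivative - (of_int k * pi / a) * sink a k t) (at t)" for t
    unfolding cosk_def[abs_def] sink_def .
qed

lemma deriv_sink: "deriv (sink a k) = (\<lambda>t. (of_int k * pi / a) * cosk a k t)"
proof (rule ext, rule DERIV_imp_deriv)
  have "((\<lambda>t. sin (c * t)) has_real_derivative c * cos (c * t)) (at t)" for c t :: real
    by (auto intro!: derivative_eq_intros)
  then show "(sink a k has_real_derivative (of_int k * pi / a) * cosk a k t) (at t)" for t
    unfolding sink_def[abs_def] cosk_def .
qed

lemma continuous_cosk [continuous_intros]: "continuous_on S f \<Longrightarrow> continuous_on S (\<lambda>x. cosk a k (f x))"
  by (rule continuous_on_compose2[OF smooth_continuous[OF smooth_cosk, of UNIV]]) auto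

lemma continuous_sink [continuous_intros]: "continuous_on S f \<Longrightarrow> continuous_on S (\<lambda>x. sink a k (f x))"
  by (rule continuous_on_compose2[OF smooth_continuous[OF smooth_sink, of UNIV]]) auto

text \<open>The span of the products of cosines, generated inductively so that closure under
  multiplication is an induction; this is the function algebra for Stone-Weierstrass.\<close>

inductive_set cosine_polys :: "real \<Rightarrow> real \<Rightarrow> (real^2 \<Rightarrow> real) set" for a b where
  mono: "(\<lambda>x. c * (cosk a j (x $ 1) * cosk b k (x $ 2))) \<in> cosine_polys a b"
| add: "f \<in> cosine_polys a b \<Longrightarrow> g \<in> cosine_polys a b \<Longrightarrow> (\<lambda>x. f x + g x) \<in> cosine_polys a b"

lemma cosine_polys_continuous: "f \<in> cosine_polys a b \<Longrightarrow> continuous_on S f"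
proof (induction rule: cosine_polys.induct)
  case (mono c j k)
  show ?case by (intro continuous_intros)
next
  case (add f g)
  then show ?case by (intro continuous_intros)
qed

lemma cosine_polys_mult:
  assumes "f \<in> cosine_polys a b" "g \<in> cosine_polys a b"
  shows "(\<lambda>x. f x * g x) \<in> cosine_polys a b"
  using assms(1)
proof (induction rule: cosine_polys.induct)
  case (mono c j k)
  show ?case
    using assms(2)
  proof (induction rule: cosine_polys.induct)
    case (mono d m n)
    have "(\<lambda>x::real^2. c * (cosk a j (x $ 1) * cosk b k (x $ 2)) * (d * (cosk a m (x $ 1) * cosk b n (x $ 2)))) =
      (\<lambda>x. (c * d / 4 * (cosk a (j - m) (x $ 1) * cosk b (k - n) (x $ 2)) +
            c * d / 4 * (cosk a (j + m) (x $ 1) * cosk b (k - n) (x $ 2))) +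
           (c * d / 4 * (cosk a (j - m) (x $ 1) * cosk b (k + n) (x $ 2)) +
            c * d / 4 * (cosk a (j + m) (x $ 1) * cosk b (k + n) (x $ 2))))" (is "_ = ?R")
    proof
      fix x :: "real^2"
      have "c * (cosk a j (x $ 1) * cosk b k (x $ 2)) * (d * (cosk a m (x $ 1) * cosk b n (x $ 2)))
        = c * d * (cosk a j (x $ 1) * cosk a m (x $ 1)) * (cosk b k (x $ 2) * cosk b n (x $ 2))"
        by simp
      also have "\<dots> = ?R x" unfolding cosk_mult by (simp add: field_simps)
      finally show "c * (cosk a j (x $ 1) * cosk b k (x $ 2)) * (d * (cosk a m (x $ 1) * cosk b n (x $ 2))) = ?R x" .
    qed
    moreover have "?R \<in> cosine_polys a b" by (intro cosine_polys.intros)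
    ultimately show ?case by simp
  next
    case (add f g)
    then show ?case by (simp add: ring_distribs cosine_polys.add)
  qed
next
  case (add f g)
  then show ?case by (simp add: ring_distribs cosine_polys.add)
qed

lemma cosk_inj:
  assumes "a > 0" "0 \<le> s" "s \<le> a" "0 \<le> t" "t \<le> a" "cosk a 1 s = cosk a 1 t"
  shows "s = t"
proof -
  have c: "cos (pi / a * s) = cos (pi / a * t)" using assms by (simp add: cosk_def)
  have le: "pi / a * r \<le> pi" if "r \<le> a" for r
    using mult_left_mono[OF that, of "pi / a"] assms(1) by simp
  have ge: "0 \<le> pi / a * r" if "0 \<le> r" for r using that assms(1) by simp
  have "pi / a * s = pi / a * t"
    by (rule cos_inj_pi) (use assms c le ge in blast)+
  then show ?thesis using assms(1) by simp
qed

text \<open>Cosines are chosen instead of sines: constants belong to the span, and cos(pi t / a) is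
  injective on [0, a], so points of the closed rectangle are separated up to the boundary.\<close>

lemma cosine_polys_dense:
  assumes ab: "a > 0" "b > 0" and g: "continuous_on UNIV (g :: real^2 \<Rightarrow> real)" and e: "e > 0"
  obtains r where "r \<in> cosine_polys a b" "\<And>x. x \<in> closed_Rect a b \<Longrightarrow> \<bar>g x - r x\<bar> < e"
proof -
  interpret function_ring_on "cosine_polys a b" "closed_Rect a b"
  proof
    show "(\<lambda>_. c) \<in> cosine_polys a b" for c
      using cosine_polys.mono[of c a 0 b 0] by simp
    show "\<exists>f\<in>cosine_polys a b. f x \<noteq> f y" if "x \<in> closed_Rect a b" "y \<in> closed_Rect a b" "x \<noteq> y" for x y
    proof (cases "x $ 1 = y $ 1")
      case True
      then have "x $ 2 \<noteq> y $ 2" using that by (auto simp: vec_eq_iff forall_2)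
      then have "cosk b 1 (x $ 2) \<noteq> cosk b 1 (y $ 2)"
        using cosk_inj[of b "x $ 2" "y $ 2"] that ab by (auto simp: closed_Rect_def)
      then show ?thesis by (intro bexI[OF _ cosine_polys.mono[of 1 a 0 b 1]]) simp
    next
      case False
      then have "cosk a 1 (x $ 1) \<noteq> cosk a 1 (y $ 1)"
        using cosk_inj[of a "x $ 1" "y $ 1"] that ab by (auto simp: closed_Rect_def)
      then show ?thesis by (intro bexI[OF _ cosine_polys.mono[of 1 a 1 b 0]]) simp
    qed
  qed (fact compact_closed_Rect cosine_polys_continuous cosine_polys.add cosine_polys_mult)+
  show ?thesis
    using Stone_Weierstrass_basic[OF continuous_on_subset[OF g subset_UNIV] e] that by blast
qed

lemma AE_lebesgue_on_negligible:
  assumes "negligible N" "S \<in> sets lebesgue"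
  shows "AE x in lebesgue_on S. x \<notin> N"
proof -
  have "AE x in lebesgue. x \<notin> N"
    using assms(1) AE_not_in negligible_iff_null_sets by blast
  then show ?thesis using assms(2) by (subst AE_restrict_space_iff) auto
qed

lemma integrable_mult_bounded:
  fixes h g :: "'a \<Rightarrow> real"
  assumes "integrable M h" "g \<in> borel_measurable M" "AE x in M. \<bar>g x\<bar> \<le> B"
  shows "integrable M (\<lambda>x. h x * g x)"
proof -
  have "integrable M (\<lambda>x. B * h x)" using assms by simp
  then show ?thesis
    by (rule Bochner_Integration.integrable_bound)
       (use assms in \<open>auto simp: abs_mult mult.commute[of _ "\<bar>h _\<bar>"] intro: order_trans[OF _ abs_ge_self] mult_left_mono elim!: eventually_mono\<close>)
qed

text \<open>By density h is orthogonal to every continuous function; as h is only integrable, the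
  approximation has to be uniform. Continuous functions with values in [-1, 1] converge almost
  everywhere to sgn h, and dominated convergence turns orthogonality into a vanishing integral of
  |h|.\<close>

lemma cosine_orthogonal_imp_zero:
  fixes h :: "real^2 \<Rightarrow> real"
  assumes ab: "a > 0" "b > 0" and h: "integrable (lebesgue_on (Rect a b)) h"
    and orth: "\<And>(j::nat) (k::nat). (\<integral>x. h x * (cosk a j (x $ 1) * cosk b k (x $ 2)) \<partial>lebesgue_on (Rect a b)) = 0"
  shows "AE x in lebesgue_on (Rect a b). h x = 0"
proof -
  let ?M = "lebesgue_on (Rect a b)"
  have ic: "integrable ?M (\<lambda>x. h x * g x)" if g: "continuous_on UNIV g" for g :: "real^2 \<Rightarrow> real"
  proof -
    obtain B where "B > 0" "\<And>x. x \<in> closed_Rect a b \<Longrightarrow> norm (g x) \<le> B"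
      using continuous_bounded_Rect[OF g] by blast
    then show ?thesis
      using Rect_subset_closed[of a b] g
      by (intro integrable_mult_bounded[OF h, of _ B] borel_measurable_continuous_Rect AE_I2) auto
  qed
  have p: "(\<integral>x. h x * r x \<partial>?M) = 0" if "r \<in> cosine_polys a b" for r
    using that
  proof (induction rule: cosine_polys.induct)
    case (mono c j k)
    have abs: "cosk a j t = cosk a (int (nat \<bar>j\<bar>)) t" "cosk b k t = cosk b (int (nat \<bar>k\<bar>)) t" for t
      using cosk_uminus[of a j t] cosk_uminus[of b k t] by (auto simp: abs_if)
    have "(\<integral>x. h x * (c * (cosk a j (x $ 1) * cosk b k (x $ 2))) \<partial>?M)
      = (\<integral>x. c * (h x * (cosk a (int (nat \<bar>j\<bar>)) (x $ 1) * cosk b (int (nat \<bar>k\<bar>)) (x $ 2))) \<partial>?M)"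
      by (subst abs(1), subst abs(2)) (simp add: mult_ac)
    also have "\<dots> = 0" using orth[of "nat \<bar>j\<bar>" "nat \<bar>k\<bar>"] by simp
    finally show ?case .
  next
    case (add f g)
    then show ?case
      using ic[OF cosine_polys_continuous] by (simp add: ring_distribs)
  qed
  have aux: "y < 2 * (y + 1)" if "y \<ge> 0" for y :: real using that by simp
  have c: "(\<integral>x. h x * g x \<partial>?M) = 0" if g: "continuous_on UNIV g" for g
  proof (rule ccontr)
    assume ne: "(\<integral>x. h x * g x \<partial>?M) \<noteq> 0"
    \<comment> \<open>An error e in g changes the integral by less than its absolute value; the
      summand 1 keeps the divisor positive.\<close>
    define e where "e = \<bar>\<integral>x. h x * g x \<partial>?M\<bar> / (2 * ((\<integral>x. \<bar>h x\<bar> \<partial>?M) + 1))"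
    have pos: "(\<integral>x. \<bar>h x\<bar> \<partial>?M) \<ge> 0" by simp
    then have e: "e > 0" using ne unfolding e_def by (simp add: add_nonneg_pos)
    obtain r where r: "r \<in> cosine_polys a b" "\<And>x. x \<in> closed_Rect a b \<Longrightarrow> \<bar>g x - r x\<bar> < e"
      using cosine_polys_dense[OF ab g e] by blast
    have rc: "continuous_on UNIV r" using r cosine_polys_continuous by blast
    have "(\<integral>x. h x * g x \<partial>?M) = (\<integral>x. h x * (g x - r x) \<partial>?M)"
      using ic[OF g] ic[OF rc] p[OF r(1)] by (simp add: right_diff_distrib)
    also have "\<bar>\<dots>\<bar> \<le> (\<integral>x. \<bar>h x * (g x - r x)\<bar> \<partial>?M)" by (rule integral_abs_bound)
    also have "\<dots> \<le> (\<integral>x. e * \<bar>h x\<bar> \<partial>?M)"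
    proof (rule integral_mono)
      show "integrable ?M (\<lambda>x. \<bar>h x * (g x - r x)\<bar>)"
        using ic[of "\<lambda>x. g x - r x"] g rc by (intro integrable_abs) (auto intro: continuous_intros)
      show "integrable ?M (\<lambda>x. e * \<bar>h x\<bar>)" using h by simp
      show "\<bar>h x * (g x - r x)\<bar> \<le> e * \<bar>h x\<bar>" if "x \<in> space ?M" for x
      proof -
        have "\<bar>g x - r x\<bar> \<le> e" using that Rect_subset_closed[of a b] r(2)[of x] by auto
        then show ?thesis by (simp add: abs_mult mult.commute[of e] mult_left_mono)
      qed
    qed
    also have "\<dots> = e * (\<integral>x. \<bar>h x\<bar> \<partial>?M)" by simp
    also have "\<dots> < e * (2 * ((\<integral>x. \<bar>h x\<bar> \<partial>?M) + 1))" by (rule mult_strict_left_mono[OF aux[OF pos] e])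
    also have "\<dots> = \<bar>\<integral>x. h x * g x \<partial>?M\<bar>" using pos by (simp add: e_def field_simps add_nonneg_eq_0_iff)
    finally show False by simp
  qed
  \<comment> \<open>A Lebesgue measurable function is almost everywhere a limit of continuous ones;
    extending sgn h by 0 makes this applicable on the whole plane.\<close>
  define s where "s x = (if x \<in> Rect a b then sgn (h x) else 0)" for x
  have hm: "h \<in> borel_measurable ?M" using h by blast
  have "(\<lambda>x. sgn (h x)) \<in> borel_measurable ?M" using hm by measurable
  then have "s \<in> borel_measurable lebesgue"
    unfolding s_def[abs_def] by (simp add: borel_measurable_if)
  then have "s measurable_on UNIV" by (intro lebesgue_measurable_imp_measurable_on) auto
  then obtain N G where N: "negligible N" and G: "\<And>n. continuous_on UNIV (G n)"
      and lim: "\<And>x. x \<notin> N \<Longrightarrow> (\<lambda>n. G n x) \<longlonglongrightarrow> s x"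
    unfolding measurable_on_def by auto
  \<comment> \<open>Truncation to [-1, 1] leaves the limit unchanged and makes |h| a dominating
    function.\<close>
  define G' where "G' n x = max (-1) (min 1 (G n x))" for n x
  have G': "continuous_on UNIV (G' n)" for n
    unfolding G'_def[abs_def] by (intro continuous_intros G)
  have "(\<lambda>n. \<integral>x. h x * G' n x \<partial>?M) \<longlonglongrightarrow> (\<integral>x. \<bar>h x\<bar> \<partial>?M)"
  proof (rule integral_dominated_convergence[where w = "\<lambda>x. \<bar>h x\<bar>"])
    show "AE x in ?M. (\<lambda>n. h x * G' n x) \<longlonglongrightarrow> \<bar>h x\<bar>"
      using AE_lebesgue_on_negligible[OF N Rect_lebesgue] AE_space
    proof eventually_elim
      case (elim x)
      have "(\<lambda>n. h x * G' n x) \<longlonglongrightarrow> h x * max (-1) (min 1 (s x))"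
        unfolding G'_def using elim lim by (intro tendsto_intros) auto
      also have "h x * max (-1) (min 1 (s x)) = \<bar>h x\<bar>"
        using elim by (auto simp: s_def sgn_if abs_if)
      finally show ?case .
    qed
    have "\<bar>h x * G' n x\<bar> \<le> \<bar>h x\<bar> * 1" for n x
      unfolding abs_mult by (intro mult_left_mono) (auto simp: G'_def)
    then show "AE x in ?M. norm (h x * G' n x) \<le> \<bar>h x\<bar>" for n by simp
    show "(\<lambda>x. h x * G' n x) \<in> borel_measurable ?M" for n
      using ic[OF G'] by blast
  qed (use h hm in auto)
  then have "(\<integral>x. \<bar>h x\<bar> \<partial>?M) = 0" using c[OF G'] by (simp add: LIMSEQ_const_iff)
  then show ?thesis using h by (subst (asm) integral_nonneg_eq_0_iff_AE) auto
qed

lemma smooth_step_pos: "x > 0 \<Longrightarrow> smooth_step x > 0"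
  using flat_pos[of x] flat_sum_pos[of x] by (simp add: smooth_step_def)

lemma cutoff_pos: "\<epsilon> > 0 \<Longrightarrow> s < x \<Longrightarrow> x < t \<Longrightarrow> cutoff \<epsilon> s t x > 0"
  by (simp add: cutoff_def smooth_step_pos)

lemma L2_smooth: "smooth f \<Longrightarrow> f \<in> L2 (Rect a b)"
  by (intro L2_continuous smooth_continuous)

text \<open>Multiplied by cutoffs in both variables, a product of cosines becomes a test function.
  Hence h times the cutoffs is orthogonal to all products of cosines and vanishes almost everywhere;
  at every point of the open rectangle the cutoffs are positive for some n.\<close>

lemma test_orthogonal_imp_zero:
  fixes h :: "real^2 \<Rightarrow> real"
  assumes ab: "a > 0" "b > 0" and h: "h \<in> L2 (Rect a b)"
    and orth: "\<And>\<phi>. \<phi> \<in> test_functions (Rect a b) \<Longrightarrow> L2_inner (Rect a b) h \<phi> = 0"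
  shows "AE x in lebesgue_on (Rect a b). h x = 0"
proof -
  \<comment> \<open>The margin 1/(n+1) to the end points shrinks with n, while the ramps keep the
    fixed width 1: the argument asks of the cutoff only that it be positive inside its
    interval.\<close>
  define \<alpha> where "\<alpha> a n = cutoff 1 (1 / real (Suc n)) (a - 1 / real (Suc n))" for a n
  have test: "\<alpha> a n \<in> test_functions {0<..<a}" for a n
  proof -
    have "{d..a - d} \<subseteq> {0<..<a}" if "d > 0" for d using that by auto
    then show ?thesis unfolding \<alpha>_def by (intro cutoff_test) auto
  qed
  have smooth: "smooth (\<lambda>x::real^2. \<alpha> a n (x $ 1) * \<alpha> b n (x $ 2))" for n
    unfolding \<alpha>_def by (intro smooth_tensor smooth_cutoff)
  have "AE x in lebesgue_on (Rect a b). h x * (\<alpha> a n (x $ 1) * \<alpha> b n (x $ 2)) = 0" for n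
  proof -
    have i: "integrable (lebesgue_on (Rect a b)) (\<lambda>x. h x * (\<alpha> a n (x $ 1) * \<alpha> b n (x $ 2)))"
      using L2_inner_integrable[OF h L2_smooth[OF smooth]] by simp
    have "(\<integral>x. (h x * (\<alpha> a n (x $ 1) * \<alpha> b n (x $ 2))) * (cosk a j (x $ 1) * cosk b k (x $ 2)) \<partial>lebesgue_on (Rect a b)) = 0" for j :: nat and k :: nat
    proof -
      have "(\<lambda>x::real^2. (\<alpha> a n (x $ 1) * cosk a j (x $ 1)) * (\<alpha> b n (x $ 2) * cosk b k (x $ 2))) \<in> test_functions (Rect a b)"
        by (intro test_functions_tensor test_functions_mult test smooth_cosk)
      from orth[OF this] show ?thesis
        by (simp add: L2_inner_def mult_ac)
    qed
    from cosine_orthogonal_imp_zero[OF ab i this] show ?thesis .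
  qed
  then have "AE x in lebesgue_on (Rect a b). \<forall>n. h x * (\<alpha> a n (x $ 1) * \<alpha> b n (x $ 2)) = 0"
    by (subst AE_all_countable) blast
  then show ?thesis
    using AE_space
  proof eventually_elim
    case (elim x)
    define d where "d = min (min (x $ 1) (a - x $ 1)) (min (x $ 2) (b - x $ 2))"
    have "d > 0" using elim by (auto simp: d_def Rect_def)
    then obtain n where n: "1 / real (Suc n) < d" using nat_approx_posE by blast
    have "\<alpha> a n (x $ 1) > 0" "\<alpha> b n (x $ 2) > 0"
      unfolding \<alpha>_def using n by (auto simp: d_def intro!: cutoff_pos)
    then show ?case using elim(1)[rule_format, of n] by auto
  qed
qed

section \<open>Weak derivatives on the rectangle\<close>

lemma test_L2:
  assumes "\<phi> \<in> test_functions S"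
  shows "\<phi> \<in> L2 (Rect a b)" "pderiv_at (axis i 1) \<phi> \<in> L2 (Rect a b)"
  using test_functions_smooth[OF assms]
  by (auto intro!: L2_smooth smooth_pderiv axis_in_Basis)

lemma weak_pderiv_unique:
  assumes ab: "a > 0" "b > 0" and L2: "g \<in> L2 (Rect a b)" "g' \<in> L2 (Rect a b)"
    and w: "has_weak_pderiv (Rect a b) i f g" "has_weak_pderiv (Rect a b) i f g'"
  shows "AE x in lebesgue_on (Rect a b). g x = g' x"
proof -
  have "AE x in lebesgue_on (Rect a b). g x - g' x = 0"
    by (rule test_orthogonal_imp_zero[OF ab L2.diff[OF L2]])
       (use w L2 test_L2(1) in \<open>simp add: has_weak_pderiv_def L2.diff_left\<close>)
  then show ?thesis by eventually_elim simp
qed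

lemma weak_pderiv_L2: "f \<in> H1 S \<Longrightarrow> weak_pderiv S i f \<in> L2 S"
  and weak_pderiv_has: "f \<in> H1 S \<Longrightarrow> has_weak_pderiv S i f (weak_pderiv S i f)"
proof -
  assume "f \<in> H1 S"
  then have "\<exists>g. g \<in> L2 S \<and> has_weak_pderiv S i f g" by (auto simp: H1_def)
  from someI_ex[OF this] show "weak_pderiv S i f \<in> L2 S" "has_weak_pderiv S i f (weak_pderiv S i f)"
    unfolding weak_pderiv_def by auto
qed

lemma H1_L2: "f \<in> H1 S \<Longrightarrow> f \<in> L2 S"
  by (simp add: H1_def)

lemma has_weak_pderiv_add:
  assumes "f \<in> L2 (Rect a b)" "f' \<in> L2 (Rect a b)" "g \<in> L2 (Rect a b)" "g' \<in> L2 (Rect a b)"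
    "has_weak_pderiv (Rect a b) i f g" "has_weak_pderiv (Rect a b) i f' g'"
  shows "has_weak_pderiv (Rect a b) i (\<lambda>x. f x + f' x) (\<lambda>x. g x + g' x)"
  unfolding has_weak_pderiv_def
proof
  fix \<phi> assume \<phi>: "\<phi> \<in> test_functions (Rect a b)"
  show "L2_inner (Rect a b) (\<lambda>x. f x + f' x) (pderiv_at (axis i 1) \<phi>) = - L2_inner (Rect a b) (\<lambda>x. g x + g' x) \<phi>"
    using assms \<phi> test_L2(1)[OF \<phi>, of a b] test_L2(2)[OF \<phi>, of i a b] by (simp add: has_weak_pderiv_def L2.add_left)
qed

lemma has_weak_pderiv_scale:
  assumes "f \<in> L2 (Rect a b)" "g \<in> L2 (Rect a b)" "has_weak_pderiv (Rect a b) i f g"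
  shows "has_weak_pderiv (Rect a b) i (\<lambda>x. c * f x) (\<lambda>x. c * g x)"
  unfolding has_weak_pderiv_def
proof
  fix \<phi> assume \<phi>: "\<phi> \<in> test_functions (Rect a b)"
  show "L2_inner (Rect a b) (\<lambda>x. c * f x) (pderiv_at (axis i 1) \<phi>) = - L2_inner (Rect a b) (\<lambda>x. c * g x) \<phi>"
    using assms \<phi> test_L2(1)[OF \<phi>, of a b] test_L2(2)[OF \<phi>, of i a b]
      L2.scale_left[OF assms(1) test_L2(2)[OF \<phi>, of i a b], of c]
      L2.scale_left[OF assms(2) test_L2(1)[OF \<phi>, of a b], of c]
    by (simp add: has_weak_pderiv_def)
qed

lemma has_weak_pderiv_smooth:
  assumes ab: "a > 0" "b > 0" and f: "smooth f"
  shows "has_weak_pderiv (Rect a b) i f (pderiv_at (axis i 1) f)"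
  unfolding has_weak_pderiv_def
proof
  fix \<phi> assume \<phi>: "\<phi> \<in> test_functions (Rect a b)"
  have "(\<integral>x. pderiv_at (axis i 1) f x * \<phi> x \<partial>lebesgue_on (Rect a b)) =
     - (\<integral>x. f x * pderiv_at (axis i 1) \<phi> x \<partial>lebesgue_on (Rect a b))"
  proof (rule integral_by_parts_Rect[OF f test_functions_smooth[OF \<phi>] _ ab])
    fix x assume "x \<in> face a b i"
    then have "x \<notin> Rect a b" by (auto simp: face_def Rect_def split: if_splits)
    then show "f x = 0 \<or> \<phi> x = 0" using test_functions_zero[OF \<phi>] by blast
  qed
  then show "L2_inner (Rect a b) f (pderiv_at (axis i 1) \<phi>) = - L2_inner (Rect a b) (pderiv_at (axis i 1) f) \<phi>"
    by (simp add: L2_inner_def)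
qed

lemma H1_smooth: "a > 0 \<Longrightarrow> b > 0 \<Longrightarrow> smooth f \<Longrightarrow> f \<in> H1 (Rect a b)"
  unfolding H1_def
  by (blast intro: L2_smooth has_weak_pderiv_smooth smooth_pderiv axis_in_Basis)

text \<open>The chosen representative of a weak derivative is known only almost everywhere, so the
  rules for \<open>weak_pderiv\<close> are obtained from a candidate through uniqueness.\<close>

lemma weak_pderiv_eqI:
  assumes "a > 0" "b > 0" "f \<in> L2 (Rect a b)" "g \<in> L2 (Rect a b)" "has_weak_pderiv (Rect a b) i f g"
    "f \<in> H1 (Rect a b)"
  shows "AE x in lebesgue_on (Rect a b). weak_pderiv (Rect a b) i f x = g x"
  by (rule weak_pderiv_unique[OF assms(1,2) weak_pderiv_L2 assms(4) weak_pderiv_has assms(5)]) fact+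

lemma weak_pderiv_smooth:
  assumes "a > 0" "b > 0" "smooth f"
  shows "AE x in lebesgue_on (Rect a b). weak_pderiv (Rect a b) i f x = pderiv_at (axis i 1) f x"
  using assms by (intro weak_pderiv_eqI L2_smooth H1_smooth has_weak_pderiv_smooth smooth_pderiv axis_in_Basis)

lemma H1I: "f \<in> L2 S \<Longrightarrow> (\<And>i. g i \<in> L2 S) \<Longrightarrow> (\<And>i. has_weak_pderiv S i f (g i)) \<Longrightarrow> f \<in> H1 S"
  unfolding H1_def by blast

lemma H1_add:
  assumes f: "f \<in> H1 (Rect a b)" and g: "g \<in> H1 (Rect a b)"
  shows "(\<lambda>x. f x + g x) \<in> H1 (Rect a b)"
proof (rule H1I)
  note L2 = H1_L2[OF f] H1_L2[OF g] weak_pderiv_L2[OF f] weak_pderiv_L2[OF g]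
  show "(\<lambda>x. f x + g x) \<in> L2 (Rect a b)" by (rule L2.add[OF L2(1,2)])
  show "(\<lambda>x. weak_pderiv (Rect a b) i f x + weak_pderiv (Rect a b) i g x) \<in> L2 (Rect a b)" for i
    by (rule L2.add[OF L2(3,4)])
  show "has_weak_pderiv (Rect a b) i (\<lambda>x. f x + g x) (\<lambda>x. weak_pderiv (Rect a b) i f x + weak_pderiv (Rect a b) i g x)" for i
    by (rule has_weak_pderiv_add[OF L2 weak_pderiv_has[OF f] weak_pderiv_has[OF g]])
qed

lemma H1_scale:
  assumes f: "f \<in> H1 (Rect a b)"
  shows "(\<lambda>x. c * f x) \<in> H1 (Rect a b)"
proof (rule H1I)
  note L2 = H1_L2[OF f] weak_pderiv_L2[OF f]
  show "(\<lambda>x. c * f x) \<in> L2 (Rect a b)"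
    using L2.scale[OF L2(1), of c] by simp
  show "(\<lambda>x. c * weak_pderiv (Rect a b) i f x) \<in> L2 (Rect a b)" for i
    using L2.scale[OF L2(2), of c] by simp
  show "has_weak_pderiv (Rect a b) i (\<lambda>x. c * f x) (\<lambda>x. c * weak_pderiv (Rect a b) i f x)" for i
    by (rule has_weak_pderiv_scale[OF L2 weak_pderiv_has[OF f]])
qed

lemma weak_pderiv_add:
  assumes ab: "a > 0" "b > 0" and f: "f \<in> H1 (Rect a b)" and g: "g \<in> H1 (Rect a b)"
  shows "AE x in lebesgue_on (Rect a b). weak_pderiv (Rect a b) i (\<lambda>x. f x + g x) x =
    weak_pderiv (Rect a b) i f x + weak_pderiv (Rect a b) i g x"
  by (rule weak_pderiv_eqI[OF ab L2.add[OF H1_L2[OF f] H1_L2[OF g]] L2.add[OF weak_pderiv_L2[OF f] weak_pderiv_L2[OF g]]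
      has_weak_pderiv_add[OF H1_L2[OF f] H1_L2[OF g] weak_pderiv_L2[OF f] weak_pderiv_L2[OF g] weak_pderiv_has[OF f] weak_pderiv_has[OF g]]
      H1_add[OF f g]])

lemma weak_pderiv_scale:
  assumes ab: "a > 0" "b > 0" and f: "f \<in> H1 (Rect a b)"
  shows "AE x in lebesgue_on (Rect a b). weak_pderiv (Rect a b) i (\<lambda>x. c * f x) x = c * weak_pderiv (Rect a b) i f x"
  by (rule weak_pderiv_eqI[OF ab L2.scale[OF H1_L2[OF f], unfolded real_scaleR_def]
      L2.scale[OF weak_pderiv_L2[OF f], unfolded real_scaleR_def]
      has_weak_pderiv_scale[OF H1_L2[OF f] weak_pderiv_L2[OF f] weak_pderiv_has[OF f]] H1_scale[OF f]])

section \<open>Divergence-free fields and the space V\<close>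

lemma pderiv_at_component:
  fixes u :: "'a::euclidean_space \<Rightarrow> real^'n"
  assumes "u differentiable at x"
  shows "pderiv_at i (\<lambda>x. u x $ j) x = pderiv_at i u x $ j"
proof -
  have "((\<lambda>x. u x $ j) has_derivative (\<lambda>h. frechet_derivative u (at x) h $ j)) (at x)"
    using bounded_linear.has_derivative[OF bounded_linear_vec_nth] assms frechet_derivative_works by blast
  then show ?thesis using pderiv_at_eq by (simp add: pderiv_at_def)
qed

lemma smooth_component: "smooth u \<Longrightarrow> smooth (\<lambda>x. u x $ j)"
  by (rule smooth_bounded_linear[OF bounded_linear_vec_nth])

lemma pderiv_component_smooth:
  fixes u :: "'a::euclidean_space \<Rightarrow> real^'n"
  shows "smooth u \<Longrightarrow> pderiv_at i (\<lambda>x. u x $ j) = (\<lambda>x. pderiv_at i u x $ j)"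
  by (rule ext) (simp add: pderiv_at_component smooth_differentiable)

lemma pderiv_at_add:
  assumes "f differentiable at x" "g differentiable at x"
  shows "pderiv_at i (\<lambda>x. f x + g x) x = pderiv_at i f x + pderiv_at i g x"
proof -
  have D: "((\<lambda>x. f x + g x) has_derivative
      (\<lambda>h. frechet_derivative f (at x) h + frechet_derivative g (at x) h)) (at x)"
    using assms frechet_derivative_works by (intro has_derivative_add) auto
  show ?thesis using pderiv_at_eq[OF D] by (simp add: pderiv_at_def)
qed

lemma pderiv_at_scaleR:
  assumes "f differentiable at x"
  shows "pderiv_at i (\<lambda>x. c *\<^sub>R f x) x = c *\<^sub>R pderiv_at i f x"
proof -
  have D: "((\<lambda>x. c *\<^sub>R f x) has_derivative (\<lambda>h. c *\<^sub>R frechet_derivative f (at x) h)) (at x)"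
    using assms frechet_derivative_works by (intro has_derivative_scaleR_right) auto
  show ?thesis using pderiv_at_eq[OF D] by (simp add: pderiv_at_def)
qed

lemma Rect_box: "Rect a b = box 0 (vec2 a b)"
  by (auto simp: Rect_def mem_box_cart forall_2)

lemma closure_Rect: "a > 0 \<Longrightarrow> b > 0 \<Longrightarrow> closure (Rect a b) = closed_Rect a b"
  unfolding Rect_box closed_Rect_cbox by (rule closure_box) (auto simp: box_ne_empty Basis_real2 inner_axis)

lemma face_subset_frontier: "a > 0 \<Longrightarrow> b > 0 \<Longrightarrow> face a b i \<subseteq> frontier (Rect a b)"
  unfolding frontier_def interior_open[OF open_Rect]
  by (subst closure_Rect) (auto simp: face_def closed_Rect_def Rect_def split: if_splits)

section \<open>Smooth divergence-free fields on the rectangle\<close>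

lemma D1I:
  assumes "smooth u" "\<And>x. x \<in> Rect a b \<Longrightarrow> divergence u x = 0"
    "\<And>x i. x \<in> face a b i \<Longrightarrow> u x $ i = 0"
    "\<And>x. x \<in> frontier (Rect a b) \<Longrightarrow> curl u x = 0"
  shows "u \<in> D1 a b"
proof -
  have "u x \<bullet> n = 0" if n: "unit_normal a b x n" for x n
  proof -
    from n consider "x \<in> face a b 1" "n = axis 1 1 \<or> n = - axis 1 1" | "x \<in> face a b 2" "n = axis 2 1 \<or> n = - axis 2 1"
      unfolding unit_normal_def face_def by auto
    then show ?thesis using assms(3)[of x] by cases (auto simp: inner_axis)
  qed
  then show ?thesis using assms by (auto simp: D1_def)
qed

lemma D1_smooth: "u \<in> D1 a b \<Longrightarrow> smooth u"
  by (simp add: D1_def)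

lemma D1_div: "u \<in> D1 a b \<Longrightarrow> x \<in> Rect a b \<Longrightarrow> divergence u x = 0"
  by (simp add: D1_def)

lemma D1_face: "u \<in> D1 a b \<Longrightarrow> x \<in> face a b i \<Longrightarrow> u x $ i = 0"
proof -
  assume u: "u \<in> D1 a b" and x: "x \<in> face a b i"
  have "\<exists>n. unit_normal a b x n \<and> (n = axis i 1 \<or> n = - axis i 1)"
    using x exhaust_2[of i] by (auto simp: face_def unit_normal_def)
  then obtain n where "unit_normal a b x n" "n = axis i 1 \<or> n = - axis i 1" by blast
  moreover from this(1) have "u x \<bullet> n = 0" using u by (simp add: D1_def)
  ultimately show ?thesis by (auto simp: inner_axis)
qed

lemma D1_curl: "u \<in> D1 a b \<Longrightarrow> x \<in> frontier (Rect a b) \<Longrightarrow> curl u x = 0"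
  by (simp add: D1_def)

lemma D1_zero: "(\<lambda>x. 0) \<in> D1 a b"
proof -
  have "pderiv_at i (\<lambda>x::real^2. 0 :: real^2) x = 0" for i x
    by (subst pderiv_at_eq[OF has_derivative_const]) simp
  then show ?thesis by (auto intro!: D1I simp: divergence_def curl_def)
qed

lemma D1_add:
  assumes u: "u \<in> D1 a b" and v: "v \<in> D1 a b"
  shows "(\<lambda>x. u x + v x) \<in> D1 a b"
proof (rule D1I)
  note d = smooth_differentiable[OF D1_smooth[OF u]] smooth_differentiable[OF D1_smooth[OF v]]
  show "smooth (\<lambda>x. u x + v x)" by (intro smooth_add D1_smooth[OF u] D1_smooth[OF v])
  show "divergence (\<lambda>x. u x + v x) x = 0" if "x \<in> Rect a b" for x
    using D1_div[OF u that] D1_div[OF v that] by (simp add: divergence_def pderiv_at_add d sum.distrib)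
  show "(u x + v x) $ i = 0" if "x \<in> face a b i" for x i
    using D1_face[OF u that] D1_face[OF v that] by simp
  show "curl (\<lambda>x. u x + v x) x = 0" if "x \<in> frontier (Rect a b)" for x
    using D1_curl[OF u that] D1_curl[OF v that] by (simp add: curl_def pderiv_at_add d)
qed

lemma D1_scale:
  assumes u: "u \<in> D1 a b" shows "(\<lambda>x. c *\<^sub>R u x) \<in> D1 a b"
proof (rule D1I)
  note d = smooth_differentiable[OF D1_smooth[OF u]]
  show "smooth (\<lambda>x. c *\<^sub>R u x)"
    by (rule smooth_bounded_linear[OF bounded_linear_scaleR_right D1_smooth[OF u]])
  show "divergence (\<lambda>x. c *\<^sub>R u x) x = 0" if "x \<in> Rect a b" for x
    using D1_div[OF u that] by (simp add: divergence_def pderiv_at_scaleR d flip: sum_distrib_left)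
  show "(c *\<^sub>R u x) $ i = 0" if "x \<in> face a b i" for x i
    using D1_face[OF u that] by simp
  show "curl (\<lambda>x. c *\<^sub>R u x) x = 0" if "x \<in> frontier (Rect a b)" for x
  proof -
    have "curl (\<lambda>x. c *\<^sub>R u x) x = c * curl u x"
      by (simp add: curl_def pderiv_at_scaleR d ring_distribs)
    then show ?thesis using D1_curl[OF u that] by simp
  qed
qed

lemma D1_sum: "(\<And>i. i \<in> I \<Longrightarrow> f i \<in> D1 a b) \<Longrightarrow> (\<lambda>x. \<Sum>i\<in>I. c i *\<^sub>R f i x) \<in> D1 a b"
  by (induction I rule: infinite_finite_induct) (auto intro!: D1_zero D1_add D1_scale)

lemma D1_diff: "u \<in> D1 a b \<Longrightarrow> v \<in> D1 a b \<Longrightarrow> (\<lambda>x. u x - v x) \<in> D1 a b"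
  using D1_add[OF _ D1_scale[of v a b "-1"], of u] by simp

locale rectangle =
  fixes a b :: real
  assumes a: "a > 0" and b: "b > 0"
begin

abbreviation "R \<equiv> Rect a b"

abbreviation wd :: "2 \<Rightarrow> 2 \<Rightarrow> vector_field \<Rightarrow> scalar_field" where
  "wd i j u \<equiv> weak_pderiv R i (\<lambda>x. u x $ j)"

lemma H1_vec_component: "u \<in> H1_vec R \<Longrightarrow> (\<lambda>x. u x $ j) \<in> H1 R"
  by (simp add: H1_vec_def)

lemma H1_vec_L2: "u \<in> H1_vec R \<Longrightarrow> u \<in> L2 R"
  by (simp add: H1_vec_def L2_vec H1_L2)

lemma wd_L2: "u \<in> H1_vec R \<Longrightarrow> wd i j u \<in> L2 R"
  by (intro weak_pderiv_L2 H1_vec_component)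

lemma H1_vec_add: "u \<in> H1_vec R \<Longrightarrow> v \<in> H1_vec R \<Longrightarrow> (\<lambda>x. u x + v x) \<in> H1_vec R"
  by (simp add: H1_vec_def H1_add)

lemma H1_vec_scale: "u \<in> H1_vec R \<Longrightarrow> (\<lambda>x. c *\<^sub>R u x) \<in> H1_vec R"
  by (simp add: H1_vec_def H1_scale)

lemma wd_add:
  "u \<in> H1_vec R \<Longrightarrow> v \<in> H1_vec R \<Longrightarrow> AE x in lebesgue_on R. wd i j (\<lambda>x. u x + v x) x = wd i j u x + wd i j v x"
  using weak_pderiv_add[OF a b H1_vec_component H1_vec_component] by simp

lemma wd_scale:
  "u \<in> H1_vec R \<Longrightarrow> AE x in lebesgue_on R. wd i j (\<lambda>x. c *\<^sub>R u x) x = c * wd i j u x"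
  using weak_pderiv_scale[OF a b H1_vec_component] by simp

lemma wd_diff:
  assumes "u \<in> H1_vec R" "v \<in> H1_vec R"
  shows "AE x in lebesgue_on R. wd i j (\<lambda>x. u x - v x) x = wd i j u x - wd i j v x"
  using wd_add[OF assms(1) H1_vec_scale[OF assms(2), of "-1"], of i j] wd_scale[OF assms(2), of i "-1" j]
  by eventually_elim simp

lemma weak_grad_L2:
  assumes "f \<in> H1 R" shows "weak_grad R f \<in> L2 R"
  by (simp add: L2_vec weak_grad_def weak_pderiv_L2[OF assms])

lemma dirichlet_eq:
  assumes "u \<in> H1_vec R" "v \<in> H1_vec R"
  shows "dirichlet_form R u v = (\<Sum>j\<in>UNIV. \<Sum>i\<in>UNIV. L2_inner R (wd i j u) (wd i j v))"
  unfolding dirichlet_form_def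
  by (intro sum.cong refl)
     (simp add: L2_inner_vec weak_grad_L2 H1_vec_component assms, simp add: weak_grad_def)

lemma H1_vec_zero: "(\<lambda>x. 0) \<in> H1_vec R"
  by (simp add: H1_vec_def H1_smooth[OF a b])

text \<open>On \<open>H1_vec\<close> the form is only semidefinite, constant fields having norm
  zero; on V it controls the L2 norm through \<open>poincare\<close>. Linearity passes through
  \<open>L2_inner_cong_AE\<close>, as weak derivatives are linear only almost everywhere.\<close>

sublocale D: sip "H1_vec R" "dirichlet_form R"
proof
  fix f g h :: vector_field and c :: real
  show "(\<lambda>x. 0) \<in> H1_vec R" by (rule H1_vec_zero)
  show "f \<in> H1_vec R \<Longrightarrow> g \<in> H1_vec R \<Longrightarrow> (\<lambda>x. f x + g x) \<in> H1_vec R" by (rule H1_vec_add)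
  show "f \<in> H1_vec R \<Longrightarrow> (\<lambda>x. c *\<^sub>R f x) \<in> H1_vec R" by (rule H1_vec_scale)
  show "dirichlet_form R f g = dirichlet_form R g f"
    by (simp add: dirichlet_form_def L2_inner_commute)
  show "dirichlet_form R f f \<ge> 0"
    by (simp add: dirichlet_form_def sum_nonneg L2_inner_nonneg)
  show "dirichlet_form R (\<lambda>x. f x + g x) h = dirichlet_form R f h + dirichlet_form R g h"
    if f: "f \<in> H1_vec R" and g: "g \<in> H1_vec R" and h: "h \<in> H1_vec R"
  proof -
    have "L2_inner R (wd i j (\<lambda>x. f x + g x)) (wd i j h) = L2_inner R (wd i j f) (wd i j h) + L2_inner R (wd i j g) (wd i j h)" for i j
    proof -
      have "L2_inner R (wd i j (\<lambda>x. f x + g x)) (wd i j h) = L2_inner R (\<lambda>x. wd i j f x + wd i j g x) (wd i j h)"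
        by (rule L2_inner_cong_AE)
           (use wd_add[OF f g, of i j] wd_L2[OF f] wd_L2[OF g] wd_L2[OF h] wd_L2[OF H1_vec_add[OF f g], of i j] L2.add[OF wd_L2[OF f, of i j] wd_L2[OF g, of i j]] in auto)
      then show ?thesis using wd_L2[OF f] wd_L2[OF g] wd_L2[OF h] by (simp add: L2.add_left)
    qed
    then show ?thesis
      by (simp add: dirichlet_eq f g h H1_vec_add[simplified] sum.distrib)
  qed
  show "dirichlet_form R (\<lambda>x. c *\<^sub>R f x) g = c * dirichlet_form R f g"
    if f: "f \<in> H1_vec R" and g: "g \<in> H1_vec R"
  proof -
    have "L2_inner R (wd i j (\<lambda>x. c *\<^sub>R f x)) (wd i j g) = c * L2_inner R (wd i j f) (wd i j g)" for i j
    proof -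
      have "L2_inner R (wd i j (\<lambda>x. c *\<^sub>R f x)) (wd i j g) = L2_inner R (\<lambda>x. c *\<^sub>R wd i j f x) (wd i j g)"
        by (rule L2_inner_cong_AE)
           (use wd_scale[OF f, of i c j] wd_L2[OF f] wd_L2[OF g] wd_L2[OF H1_vec_scale[OF f, of c], of i j] L2.scale[OF wd_L2[OF f, of i j], of c] in auto)
      then show ?thesis using L2.scale_left[OF wd_L2[OF f, of i j] wd_L2[OF g, of i j], of c] by simp
    qed
    then show ?thesis
      using H1_vec_scale[OF f, of c] by (simp add: dirichlet_eq f g sum_distrib_left)
  qed
qed

lemma V_norm_sq: "u \<in> H1_vec R \<Longrightarrow> (V_norm a b u)\<^sup>2 = dirichlet_form R u u"
  unfolding V_norm_def by (rule D.nrm_sq)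

lemma V_norm_nonneg [simp]: "V_norm a b u \<ge> 0"
  by (simp add: V_norm_def dirichlet_form_def sum_nonneg L2_inner_nonneg)

lemmas V_CS = D.CS[folded V_norm_def]
lemmas V_tri = D.tri[folded V_norm_def]
lemmas V_tri_sub = D.tri_sub[folded V_norm_def]
lemmas V_norm_scale = D.nrm_scale[folded V_norm_def]

lemma wd_norm_le:
  assumes u: "u \<in> H1_vec R" shows "L2_norm R (wd i j u) \<le> V_norm a b u"
proof -
  have "L2_inner R (wd i j u) (wd i j u) \<le> (\<Sum>i\<in>UNIV. L2_inner R (wd i j u) (wd i j u))"
    by (rule member_le_sum) (auto simp: L2_inner_nonneg)
  also have "\<dots> \<le> dirichlet_form R u u"
    unfolding dirichlet_eq[OF u u] by (rule member_le_sum) (auto simp: L2_inner_nonneg sum_nonneg)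
  finally show ?thesis unfolding V_norm_def L2_norm_def by simp
qed

lemma smooth_H1_vec: "smooth u \<Longrightarrow> u \<in> H1_vec R"
  by (simp add: H1_vec_def H1_smooth[OF a b] smooth_component)

lemma wd_smooth:
  assumes "smooth u"
  shows "AE x in lebesgue_on R. wd i j u x = pderiv_at (axis i 1) u x $ j"
  using weak_pderiv_smooth[OF a b smooth_component[OF assms], of i j] by (simp add: pderiv_component_smooth[OF assms])

lemma smooth_pderiv_component: "smooth u \<Longrightarrow> smooth (\<lambda>x. pderiv_at (axis i 1) u x $ j)"
  for u :: vector_field
  by (intro smooth_component smooth_pderiv axis_in_Basis)

lemma dirichlet_smooth:
  assumes u: "smooth u" and v: "smooth v"
  shows "dirichlet_form R u v = (\<Sum>j\<in>UNIV. \<Sum>i\<in>UNIV.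
    \<integral>x. pderiv_at (axis i 1) u x $ j * pderiv_at (axis i 1) v x $ j \<partial>lebesgue_on R)"
proof -
  have "L2_inner R (wd i j u) (wd i j v) = L2_inner R (\<lambda>x. pderiv_at (axis i 1) u x $ j) (\<lambda>x. pderiv_at (axis i 1) v x $ j)" for i j
    by (intro L2_inner_cong_AE wd_smooth wd_L2 smooth_H1_vec L2_smooth smooth_pderiv_component u v)
  then show ?thesis using u v by (simp add: dirichlet_eq smooth_H1_vec L2_inner_def)
qed

definition lap :: "vector_field \<Rightarrow> vector_field" where
  "lap u x = (\<Sum>i\<in>UNIV. pderiv_at (axis i 1) (pderiv_at (axis i 1) u) x)"

lemma smooth_lap: "smooth u \<Longrightarrow> smooth (lap u)"
  unfolding lap_def[abs_def] by (intro smooth_sum smooth_pderiv axis_in_Basis)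

text \<open>On a face with \<open>u \<bullet> n = 0\<close> the tangential derivative of the normal component vanishes,
  so vanishing curl makes the normal derivative of the tangential component vanish too.\<close>

lemma D1_face_pderiv:
  assumes u: "u \<in> D1 a b" and x: "x \<in> face a b i" and ij: "i \<noteq> j"
  shows "pderiv_at (axis i 1) u x $ j = 0"
proof -
  have t: "pderiv_at (axis j 1) u x $ i = 0"
  proof -
    have d: "((\<lambda>t. u (x + t *\<^sub>R axis j 1) $ i) has_real_derivative
        pderiv_at (axis j 1) (\<lambda>x. u x $ i) (x + 0 *\<^sub>R axis j 1)) (at 0)"
      by (rule pderiv_line[OF smooth_differentiable[OF smooth_component[OF D1_smooth[OF u]]]])
    obtain e where e: "e > 0" and f: "\<And>t. \<bar>t\<bar> < e \<Longrightarrow> x + t *\<^sub>R axis j 1 \<in> face a b i"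
    proof
      \<comment> \<open>The distance from x to the ends of its open side, so that a smaller
        tangential motion stays on the side.\<close>
      let ?e = "if i = 1 then min (x $ 2) (b - x $ 2) else min (x $ 1) (a - x $ 1)"
      show "?e > 0" using x by (auto simp: face_def split: if_splits)
      show "x + t *\<^sub>R axis j 1 \<in> face a b i" if "\<bar>t\<bar> < ?e" for t
        using that x ij exhaust_2[of i] exhaust_2[of j] by (auto simp: face_def axis_def split: if_splits)
    qed
    have "((\<lambda>t. u (x + t *\<^sub>R axis j 1) $ i) has_real_derivative 0) (at 0)"
      by (rule has_field_derivative_transform_within_open[OF DERIV_const, of "{-e<..<e}"])
         (use e D1_face[OF u f] in auto)
    then show ?thesis using d DERIV_unique D1_smooth[OF u] by (fastforce simp: pderiv_component_smooth)
  qed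
  have "curl u x = 0" using D1_curl[OF u] face_subset_frontier[OF a b] x by blast
  then show ?thesis using t ij exhaust_2[of i] exhaust_2[of j] by (auto simp: curl_def)
qed

text \<open>Green's formula without boundary term: on the faces orthogonal to direction i the
  component v_i vanishes, and for j \<noteq> i the derivative of u_j in direction i vanishes by
  \<open>D1_face_pderiv\<close>.\<close>

lemma dirichlet_D1:
  assumes u: "u \<in> D1 a b" and v: "v \<in> D1 a b"
  shows "dirichlet_form R u v = - L2_inner R (lap u) v"
proof -
  note su = D1_smooth[OF u] and sv = D1_smooth[OF v]
  have 2: "pderiv_at (axis i 1) (\<lambda>x. pderiv_at (axis i 1) u x $ j) = (\<lambda>x. pderiv_at (axis i 1) (pderiv_at (axis i 1) u) x $ j)" for i j :: 2
    by (rule pderiv_component_smooth[OF smooth_pderiv[OF su axis_in_Basis]])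
  have 1: "(\<integral>x. pderiv_at (axis i 1) (pderiv_at (axis i 1) u) x $ j * v x $ j \<partial>lebesgue_on R)
      = - (\<integral>x. pderiv_at (axis i 1) u x $ j * pderiv_at (axis i 1) v x $ j \<partial>lebesgue_on R)" for i j
  proof -
    have "\<And>x. x \<in> face a b i \<Longrightarrow> pderiv_at (axis i 1) u x $ j = 0 \<or> v x $ j = 0"
      using D1_face[OF v] D1_face_pderiv[OF u, of _ i j] by (cases "i = j") auto
    from integral_by_parts_Rect[where i = i, OF smooth_pderiv_component[OF su] smooth_component[OF sv] this a b]
    show ?thesis by (simp only: 2 pderiv_component_smooth[OF sv])
  qed
  have i: "integrable (lebesgue_on R) (\<lambda>x. pderiv_at (axis i 1) (pderiv_at (axis i 1) u) x $ j * v x $ j)" for i j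
    using L2_inner_integrable[OF L2_smooth[OF smooth_component[OF smooth_pderiv[OF smooth_pderiv[OF su axis_in_Basis] axis_in_Basis], of i i j]] L2_smooth[OF smooth_component[OF sv, of j]]]
    by simp
  have "L2_inner R (lap u) v = (\<integral>x. (\<Sum>j\<in>UNIV. \<Sum>i\<in>UNIV. pderiv_at (axis i 1) (pderiv_at (axis i 1) u) x $ j * v x $ j) \<partial>lebesgue_on R)"
    unfolding L2_inner_def lap_def inner_vec_def by (simp add: sum_distrib_right)
  also have "\<dots> = (\<Sum>j\<in>UNIV. \<Sum>i\<in>UNIV. \<integral>x. pderiv_at (axis i 1) (pderiv_at (axis i 1) u) x $ j * v x $ j \<partial>lebesgue_on R)"
    using i by (simp add: Bochner_Integration.integral_sum)
  also have "\<dots> = - dirichlet_form R u v"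
    unfolding 1 dirichlet_smooth[OF su sv] by (simp add: sum_negf)
  finally show ?thesis by simp
qed

section \<open>The space V as a closure in H1\<close>

lemma V_H1: "u \<in> V_space a b \<Longrightarrow> u \<in> H1_vec R"
  by (simp add: V_space_def)

lemma V_L2: "u \<in> V_space a b \<Longrightarrow> u \<in> L2 R"
  by (intro H1_vec_L2 V_H1)

lemma H1_norm_bounds:
  "L2_norm R u \<le> H1_norm R u" "V_norm a b u \<le> H1_norm R u"
  "H1_norm R u \<le> L2_norm R u + V_norm a b u"
proof -
  have n: "dirichlet_form R u u \<ge> 0" by (simp add: dirichlet_form_def sum_nonneg L2_inner_nonneg)
  show "L2_norm R u \<le> H1_norm R u" "V_norm a b u \<le> H1_norm R u"
    using n L2_inner_nonneg[of R u] by (simp_all add: L2_norm_def V_norm_def H1_norm_def)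
  show "H1_norm R u \<le> L2_norm R u + V_norm a b u"
    using n L2_inner_nonneg[of R u] by (simp add: L2_norm_def V_norm_def H1_norm_def sqrt_add_le_add_sqrt)
qed

lemma H1_norm_nonneg: "0 \<le> H1_norm R u"
  by (simp add: H1_norm_def L2_inner_nonneg dirichlet_form_def sum_nonneg)

text \<open>The H1 norm is equivalent to the sum of the L2 norm and the Dirichlet seminorm, so
  closure in H1 becomes convergence of one sequence in both.\<close>

lemma V_iff:
  "u \<in> V_space a b \<longleftrightarrow> u \<in> H1_vec R \<and>
    (\<exists>v. (\<forall>n. v n \<in> D1 a b) \<and> (\<lambda>n. L2_norm R (\<lambda>x. u x - v n x)) \<longlonglongrightarrow> 0 \<and>
       (\<lambda>n. V_norm a b (\<lambda>x. u x - v n x)) \<longlonglongrightarrow> 0)"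
proof safe
  assume u: "u \<in> V_space a b"
  then show "u \<in> H1_vec R" by (rule V_H1)
  have "\<exists>v\<in>D1 a b. H1_norm R (\<lambda>x. u x - v x) < inverse (real (Suc n))" for n
    using u by (simp add: V_space_def)
  then obtain v where v: "\<And>n. v n \<in> D1 a b" "\<And>n. H1_norm R (\<lambda>x. u x - v n x) < inverse (real (Suc n))"
    by metis
  have "(\<lambda>n. L2_norm R (\<lambda>x. u x - v n x)) \<longlonglongrightarrow> 0"
    by (rule Lim_null_comparison[OF _ LIMSEQ_inverse_real_of_nat])
       (intro always_eventually allI, use v(2) H1_norm_bounds(1) in \<open>fastforce intro: order_trans less_imp_le\<close>)
  moreover have "(\<lambda>n. V_norm a b (\<lambda>x. u x - v n x)) \<longlonglongrightarrow> 0"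
    by (rule Lim_null_comparison[OF _ LIMSEQ_inverse_real_of_nat])
       (intro always_eventually allI, use v(2) H1_norm_bounds(2) in \<open>fastforce intro: order_trans less_imp_le\<close>)
  ultimately show "\<exists>v. (\<forall>n. v n \<in> D1 a b) \<and> (\<lambda>n. L2_norm R (\<lambda>x. u x - v n x)) \<longlonglongrightarrow> 0 \<and>
       (\<lambda>n. V_norm a b (\<lambda>x. u x - v n x)) \<longlonglongrightarrow> 0"
    using v(1) by blast
next
  fix v assume u: "u \<in> H1_vec R" and v: "\<forall>n. v n \<in> D1 a b"
    and 1: "(\<lambda>n. L2_norm R (\<lambda>x. u x - v n x)) \<longlonglongrightarrow> 0" and 2: "(\<lambda>n. V_norm a b (\<lambda>x. u x - v n x)) \<longlonglongrightarrow> 0"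
  have "(\<lambda>n. H1_norm R (\<lambda>x. u x - v n x)) \<longlonglongrightarrow> 0"
    by (rule Lim_null_comparison[OF _ tendsto_add[OF 1 2, simplified]])
       (simp add: H1_norm_nonneg H1_norm_bounds(3))
  then have "\<exists>n. H1_norm R (\<lambda>x. u x - v n x) < \<epsilon>" if "\<epsilon> > 0" for \<epsilon>
    using order_tendstoD(2)[OF _ that] eventually_sequentially by fastforce
  then show "u \<in> V_space a b" using u v unfolding V_space_def by blast
qed

lemma V_approx:
  assumes "u \<in> V_space a b"
  obtains v where "\<And>n. v n \<in> D1 a b" "(\<lambda>n. L2_norm R (\<lambda>x. u x - v n x)) \<longlonglongrightarrow> 0"
    "(\<lambda>n. V_norm a b (\<lambda>x. u x - v n x)) \<longlonglongrightarrow> 0"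
  using assms V_iff by blast

lemma D1_H1: "u \<in> D1 a b \<Longrightarrow> u \<in> H1_vec R"
  by (intro smooth_H1_vec D1_smooth)

lemma D1_V: assumes "u \<in> D1 a b" shows "u \<in> V_space a b"
proof -
  have "(\<lambda>x. 0 :: real^2) \<in> L2 R" by (rule L2.zero)
  then have "L2_norm R (\<lambda>x. 0 :: real^2) = 0" by (subst L2_norm_AE_zero) auto
  moreover have "V_norm a b (\<lambda>x. 0) = 0"
    unfolding V_norm_def using D.zero_left[OF H1_vec_zero] by simp
  ultimately show ?thesis
    using assms D1_H1[OF assms] unfolding V_iff by (intro conjI exI[of _ "\<lambda>_. u"]) auto
qed

lemma V_zero: "(\<lambda>x. 0) \<in> V_space a b"
  by (intro D1_V D1_zero)

lemma V_add:
  assumes u: "u \<in> V_space a b" and v: "v \<in> V_space a b"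
  shows "(\<lambda>x. u x + v x) \<in> V_space a b"
proof -
  obtain f where f: "\<And>n. f n \<in> D1 a b" "(\<lambda>n. L2_norm R (\<lambda>x. u x - f n x)) \<longlonglongrightarrow> 0"
    "(\<lambda>n. V_norm a b (\<lambda>x. u x - f n x)) \<longlonglongrightarrow> 0" using V_approx[OF u] by blast
  obtain g where g: "\<And>n. g n \<in> D1 a b" "(\<lambda>n. L2_norm R (\<lambda>x. v x - g n x)) \<longlonglongrightarrow> 0"
    "(\<lambda>n. V_norm a b (\<lambda>x. v x - g n x)) \<longlonglongrightarrow> 0" using V_approx[OF v] by blast
  note H = D.diff[OF V_H1[OF u] D1_H1[OF f(1)]] D.diff[OF V_H1[OF v] D1_H1[OF g(1)]]
  have eq: "(\<lambda>x. u x + v x - (f n x + g n x)) = (\<lambda>x. (u x - f n x) + (v x - g n x))" for n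
    by (simp add: algebra_simps)
  have "(\<lambda>n. L2_norm R (\<lambda>x. u x + v x - (f n x + g n x))) \<longlonglongrightarrow> 0"
    by (rule Lim_null_comparison[OF _ tendsto_add[OF f(2) g(2), simplified]])
       (use L2_tri[OF H1_vec_L2[OF H(1)] H1_vec_L2[OF H(2)]] in \<open>simp add: eq\<close>)
  moreover have "(\<lambda>n. V_norm a b (\<lambda>x. u x + v x - (f n x + g n x))) \<longlonglongrightarrow> 0"
    by (rule Lim_null_comparison[OF _ tendsto_add[OF f(3) g(3), simplified]])
       (use V_tri[OF H] in \<open>simp add: eq\<close>)
  ultimately show ?thesis
    unfolding V_iff using H1_vec_add[OF V_H1[OF u] V_H1[OF v]] D1_add[OF f(1) g(1)]
    by (intro conjI exI[of _ "\<lambda>n x. f n x + g n x"]) auto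
qed

lemma V_scale:
  assumes u: "u \<in> V_space a b" shows "(\<lambda>x. c *\<^sub>R u x) \<in> V_space a b"
proof -
  obtain f where f: "\<And>n. f n \<in> D1 a b" "(\<lambda>n. L2_norm R (\<lambda>x. u x - f n x)) \<longlonglongrightarrow> 0"
    "(\<lambda>n. V_norm a b (\<lambda>x. u x - f n x)) \<longlonglongrightarrow> 0" using V_approx[OF u] by blast
  note H = D.diff[OF V_H1[OF u] D1_H1[OF f(1)]]
  have eq: "(\<lambda>x. c *\<^sub>R u x - c *\<^sub>R f n x) = (\<lambda>x. c *\<^sub>R (u x - f n x))" for n
    by (simp add: algebra_simps)
  have "(\<lambda>n. L2_norm R (\<lambda>x. c *\<^sub>R u x - c *\<^sub>R f n x)) \<longlonglongrightarrow> 0"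
    unfolding eq L2_norm_scale[OF H1_vec_L2[OF H]] using tendsto_mult_right_zero[OF f(2)] by simp
  moreover have "(\<lambda>n. V_norm a b (\<lambda>x. c *\<^sub>R u x - c *\<^sub>R f n x)) \<longlonglongrightarrow> 0"
    unfolding eq V_norm_scale[OF H] using tendsto_mult_right_zero[OF f(3)] by simp
  ultimately show ?thesis
    unfolding V_iff using H1_vec_scale[OF V_H1[OF u]] D1_scale[OF f(1)]
    by (intro conjI exI[of _ "\<lambda>n x. c *\<^sub>R f n x"]) auto
qed

lemma V_diff: "u \<in> V_space a b \<Longrightarrow> v \<in> V_space a b \<Longrightarrow> (\<lambda>x. u x - v x) \<in> V_space a b"
  using V_add[OF _ V_scale[of v "-1"], of u] by simp

lemma V_approx_inner:
  assumes u: "u \<in> V_space a b" and v: "\<And>n. v n \<in> D1 a b"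
  shows "(\<lambda>n. L2_norm R (\<lambda>x. u x - v n x)) \<longlonglongrightarrow> 0 \<Longrightarrow> w \<in> L2 R \<Longrightarrow> (\<lambda>n. L2_inner R (v n) w) \<longlonglongrightarrow> L2_inner R u w"
    and "(\<lambda>n. V_norm a b (\<lambda>x. u x - v n x)) \<longlonglongrightarrow> 0 \<Longrightarrow> h \<in> H1_vec R \<Longrightarrow>
      (\<lambda>n. dirichlet_form R (v n) h) \<longlonglongrightarrow> dirichlet_form R u h"
proof -
  assume "(\<lambda>n. L2_norm R (\<lambda>x. u x - v n x)) \<longlonglongrightarrow> 0" "w \<in> L2 R"
  then show "(\<lambda>n. L2_inner R (v n) w) \<longlonglongrightarrow> L2_inner R u w"
    using V_L2[OF u] H1_vec_L2[OF D1_H1[OF v]]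
    by (intro L2_inner_tendsto) (auto simp: L2_norm_minus_commute[of _ R u])
next
  assume lim: "(\<lambda>n. V_norm a b (\<lambda>x. u x - v n x)) \<longlonglongrightarrow> 0" and h: "h \<in> H1_vec R"
  have "(\<lambda>n. V_norm a b (\<lambda>x. u x - v n x) * V_norm a b h) \<longlonglongrightarrow> 0"
    using tendsto_mult_right[OF lim] by simp
  then have "(\<lambda>n. dirichlet_form R u h - dirichlet_form R (v n) h) \<longlonglongrightarrow> 0"
    by (rule Lim_null_comparison[rotated])
       (use V_CS[OF D.diff[OF V_H1[OF u] D1_H1[OF v]] h] V_H1[OF u] D1_H1[OF v] h in \<open>simp add: D.diff_left\<close>)
  from tendsto_diff[OF tendsto_const[of "dirichlet_form R u h"] this]
  show "(\<lambda>n. dirichlet_form R (v n) h) \<longlonglongrightarrow> dirichlet_form R u h" by simp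
qed

end

section \<open>Stokes eigenfields\<close>

text \<open>The scalar sits inside the first factor so that \<open>pderiv_tensor\<close> applies to
  a multiple of a product and returns a product of the same shape.\<close>

lemma deriv_const_cosk: "deriv (\<lambda>t. c * cosk a k t) = (\<lambda>t. - (c * (of_int k * pi / a)) * sink a k t)"
proof (rule ext, rule DERIV_imp_deriv)
  show "((\<lambda>t. c * cosk a k t) has_real_derivative - (c * (of_int k * pi / a)) * sink a k t) (at t)" for t
    using DERIV_cmult[OF smooth_DERIV[OF smooth_cosk, of a k t], of c] by (simp add: deriv_cosk mult.assoc)
qed

lemma deriv_const_sink: "deriv (\<lambda>t. c * sink a k t) = (\<lambda>t. c * (of_int k * pi / a) * cosk a k t)"
proof (rule ext, rule DERIV_imp_deriv)
  show "((\<lambda>t. c * sink a k t) has_real_derivative c * (of_int k * pi / a) * cosk a k t) (at t)" for t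
    using DERIV_cmult[OF smooth_DERIV[OF smooth_sink, of a k t], of c] by (simp add: deriv_sink mult.assoc)
qed

lemma smooth_const_cosk: "smooth (\<lambda>t. c * cosk a k t)" and smooth_const_sink: "smooth (\<lambda>t. c * sink a k t)"
  by (intro smooth_mult smooth_const smooth_cosk smooth_sink)+

lemmas pderiv_sin_cos = pderiv_tensor[OF smooth_const_sink smooth_cosk, unfolded deriv_const_sink deriv_cosk]
lemmas pderiv_cos_sin = pderiv_tensor[OF smooth_const_cosk smooth_sink, unfolded deriv_const_cosk deriv_sink]
lemmas pderiv_cos_cos = pderiv_tensor[OF smooth_const_cosk smooth_cosk, unfolded deriv_const_cosk deriv_cosk]
lemmas pderiv_sin_sin = pderiv_tensor[OF smooth_const_sink smooth_sink, unfolded deriv_const_sink deriv_sink]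

lemma sink_end [simp]: "sink a k 0 = 0" and sink_end' [simp]: "a \<noteq> 0 \<Longrightarrow> sink a k a = 0"
  by (simp_all add: sink_def sin_zero_iff_int2 mult.commute)

lemma interval_integral_cosk:
  assumes "a > 0" shows "(LBINT t=0..a. cosk a k t) = (if k = 0 then a else 0)"
proof (cases "k = 0")
  case False
  have "(LBINT t=ereal 0..ereal a. cosk a k t) = sink a k a * (a / (of_int k * pi)) - sink a k 0 * (a / (of_int k * pi))"
  proof (rule interval_integral_FTC_finite)
    show "continuous_on {min 0 a..max 0 a} (cosk a k)" by (intro smooth_continuous smooth_cosk)
    show "((\<lambda>t. sink a k t * (a / (of_int k * pi))) has_vector_derivative cosk a k t) (at t within {min 0 a..max 0 a})" for t
      using DERIV_cmult_right[OF smooth_DERIV[OF smooth_sink, of a k t], of "a / (of_int k * pi)"] assms False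
      by (auto simp: deriv_sink has_real_derivative_iff_has_vector_derivative intro: has_vector_derivative_at_within)
  qed
  then show ?thesis using assms False by (simp add: zero_ereal_def)
qed (use assms in \<open>simp add: zero_ereal_def\<close>)

lemma interval_integrable_continuous:
  "a > 0 \<Longrightarrow> continuous_on UNIV f \<Longrightarrow> interval_lebesgue_integrable lborel 0 (ereal a) (f :: real \<Rightarrow> real)"
  unfolding zero_ereal_def
  by (rule interval_integrable_continuous_on) (auto intro: continuous_on_subset)

lemma sink_orthogonal:
  assumes "a > 0" "m > 0" "n > 0"
  shows "(LBINT t=0..a. sink a m t * sink a n t) = (if m = n then a / 2 else 0)"
proof -
  have i: "interval_lebesgue_integrable lborel 0 (ereal a) (\<lambda>t. cosk a k t / 2)" for k
    by (intro interval_integrable_continuous continuous_intros assms) auto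
  show ?thesis
    using assms unfolding sink_mult_sink
    by (subst interval_lebesgue_integral_diff(2)[OF i i]) (auto simp: interval_integral_cosk)
qed

lemma cosk_orthogonal:
  assumes "a > 0" "m > 0" "n > 0"
  shows "(LBINT t=0..a. cosk a m t * cosk a n t) = (if m = n then a / 2 else 0)"
proof -
  have i: "interval_lebesgue_integrable lborel 0 (ereal a) (\<lambda>t. cosk a k t / 2)" for k
    by (intro interval_integrable_continuous continuous_intros assms) auto
  show ?thesis
    using assms unfolding cosk_mult
    by (subst interval_lebesgue_integral_add(2)[OF i i]) (auto simp: interval_integral_cosk)
qed

lemma integral_Rect_tensor:
  fixes \<alpha> \<beta> :: "real \<Rightarrow> real"
  assumes "continuous_on UNIV \<alpha>" "continuous_on UNIV \<beta>" "a > 0" "b > 0"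
  shows "(\<integral>x. \<alpha> (x $ 1) * \<beta> (x $ 2) \<partial>lebesgue_on (Rect a b)) = (LBINT t=0..a. \<alpha> t) * (LBINT t=0..b. \<beta> t)"
proof -
  have "continuous_on UNIV (\<lambda>x::real^2. \<alpha> (x $ 1) * \<beta> (x $ 2))"
    by (intro continuous_on_mult continuous_on_compose2[OF assms(1), of UNIV "\<lambda>x. x $ 1"]
        continuous_on_compose2[OF assms(2), of UNIV "\<lambda>x. x $ 2"] continuous_intros subset_UNIV)
  then show ?thesis using assms(3,4) by (subst integral_Rect(1)) auto
qed

lemma smooth_vec2: "smooth f \<Longrightarrow> smooth g \<Longrightarrow> smooth (\<lambda>x. vec2 (f x) (g x))"
  unfolding vec2_axis
  by (intro smooth_add smooth_bounded_linear[OF bounded_linear_scaleR_left])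

text \<open>The index is shifted by one: k stands for the frequency k + 1, because an eigenfield
  with a zero frequency vanishes identically.\<close>

definition freq :: "real \<Rightarrow> nat \<Rightarrow> real" where
  "freq c k = real (Suc k) * pi / c"

definition sinm :: "real \<Rightarrow> nat \<Rightarrow> real \<Rightarrow> real" where
  "sinm c k = sink c (int (Suc k))"

definition cosm :: "real \<Rightarrow> nat \<Rightarrow> real \<Rightarrow> real" where
  "cosm c k = cosk c (int (Suc k))"

lemma freq_int: "of_int (int (Suc k)) * pi / c = freq c k"
  by (simp add: freq_def)

lemmas pderiv_modes =
  pderiv_sin_cos[of _ a "int (Suc k)" b "int (Suc l)" for a k b l, unfolded freq_int, folded sinm_def cosm_def]
  pderiv_cos_sin[of _ a "int (Suc k)" b "int (Suc l)" for a k b l, unfolded freq_int, folded sinm_def cosm_def]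
  pderiv_cos_cos[of _ a "int (Suc k)" b "int (Suc l)" for a k b l, unfolded freq_int, folded sinm_def cosm_def]
  pderiv_sin_sin[of _ a "int (Suc k)" b "int (Suc l)" for a k b l, unfolded freq_int, folded sinm_def cosm_def]

lemma smooth_modes: "smooth (sinm c k)" "smooth (cosm c k)"
  "smooth (\<lambda>t. d * sinm c k t)" "smooth (\<lambda>t. d * cosm c k t)"
  unfolding sinm_def cosm_def by (intro smooth_mult smooth_const smooth_sink smooth_cosk)+

lemma sinm_end [simp]: "sinm c k 0 = 0" "c \<noteq> 0 \<Longrightarrow> sinm c k c = 0"
  by (simp_all add: sinm_def del: of_nat_Suc)

lemma continuous_modes [continuous_intros]:
  "continuous_on S f \<Longrightarrow> continuous_on S (\<lambda>x. sinm c k (f x))"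
  "continuous_on S f \<Longrightarrow> continuous_on S (\<lambda>x. cosm c k (f x))"
  unfolding sinm_def cosm_def by (intro continuous_intros, assumption)+

lemma modes_orthogonal:
  assumes "a > 0"
  shows "(LBINT t=0..a. sinm a m t * sinm a n t) = (if m = n then a / 2 else 0)"
    and "(LBINT t=0..a. cosm a m t * cosm a n t) = (if m = n then a / 2 else 0)"
  using assms sink_orthogonal[of a "int (Suc m)" "int (Suc n)"] cosk_orthogonal[of a "int (Suc m)" "int (Suc n)"]
  by (simp_all add: sinm_def cosm_def del: of_nat_Suc)

lemma modes_bounds: "(sinm c k s)\<^sup>2 \<le> 1" "(cosm c k s)\<^sup>2 \<le> 1"
  by (auto simp: sinm_def cosm_def sink_def cosk_def abs_square_le_1)

section \<open>The eigenfields of the Stokes operator\<close>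

context rectangle
begin

lemma freq_pos: "freq a k > 0" "freq b k > 0"
  using a b by (auto simp: freq_def)

definition lam :: "nat \<times> nat \<Rightarrow> real" where
  "lam i = (freq a (fst i))\<^sup>2 + (freq b (snd i))\<^sup>2"

lemma lam_pos: "lam i > 0"
  unfolding lam_def by (intro add_pos_pos zero_less_power freq_pos)

text \<open>Normalises \<open>bas\<close> in L2: the squares of the trigonometric products integrate
  to a b / 4, and the squared frequencies add up to \<open>lam i\<close>.\<close>

definition amp :: "nat \<times> nat \<Rightarrow> real" where
  "amp i = 2 / sqrt (a * b * lam i)"

lemma amp_sq: "(amp i)\<^sup>2 * lam i = 4 / (a * b)"
  using a b lam_pos[of i] by (simp add: amp_def power_divide)

text \<open>The rotated gradient of the stream function \<psi> = amp sin sin, whence zero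
  divergence. Since \<psi> = 0 on the boundary, u.n = 0 there; the curl is the Laplacian of \<psi>,
  a multiple of \<psi>, and so vanishes on the boundary too.\<close>

definition bas :: "nat \<times> nat \<Rightarrow> vector_field" where
  "bas i x = vec2 ((- amp i * freq b (snd i)) * sinm a (fst i) (x $ 1) * cosm b (snd i) (x $ 2))
                  ((amp i * freq a (fst i)) * cosm a (fst i) (x $ 1) * sinm b (snd i) (x $ 2))"

lemma smooth_bas: "smooth (bas i)"
  unfolding bas_def[abs_def]
  by (intro smooth_vec2 smooth_tensor smooth_modes)

lemma pderiv_bas:
  "pderiv_at (axis 1 1) (bas i) x = vec2 ((- amp i * freq b (snd i) * freq a (fst i)) * cosm a (fst i) (x $ 1) * cosm b (snd i) (x $ 2))
      (- (amp i * freq a (fst i) * freq a (fst i)) * sinm a (fst i) (x $ 1) * sinm b (snd i) (x $ 2))"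
  "pderiv_at (axis 2 1) (bas i) x = vec2 ((amp i * freq b (snd i) * freq b (snd i)) * sinm a (fst i) (x $ 1) * sinm b (snd i) (x $ 2))
      ((amp i * freq a (fst i) * freq b (snd i)) * cosm a (fst i) (x $ 1) * cosm b (snd i) (x $ 2))"
  unfolding vec_eq_iff forall_2 pderiv_at_component[OF smooth_differentiable[OF smooth_bas], symmetric]
  unfolding bas_def vec2_nth pderiv_modes by simp_all

lemma bas_D1: "bas i \<in> D1 a b"
proof (rule D1I[OF smooth_bas])
  show "divergence (bas i) x = 0" for x
    by (simp add: divergence_def sum_2 pderiv_bas)
  show "bas i x $ j = 0" if "x \<in> face a b j" for x j
    using that a b exhaust_2[of j] by (auto simp: face_def bas_def)
  show "curl (bas i) x = 0" if "x \<in> frontier (Rect a b)" for x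
  proof -
    have "x \<in> closed_Rect a b - Rect a b"
      using that by (simp add: frontier_def closure_Rect a b interior_open[OF open_Rect])
    then have "x $ 1 = 0 \<or> x $ 1 = a \<or> x $ 2 = 0 \<or> x $ 2 = b"
      by (auto simp: closed_Rect_def Rect_def)
    then show ?thesis using a b by (auto simp: curl_def pderiv_bas)
  qed
qed

lemma pderiv_at_fun_vec2:
  assumes "smooth f" "smooth g"
  shows "pderiv_at i (\<lambda>x::real^2. vec2 (f x) (g x)) x = vec2 (pderiv_at i f x) (pderiv_at i g x)"
  unfolding vec_eq_iff forall_2 pderiv_at_component[OF smooth_differentiable[OF smooth_vec2[OF assms]], symmetric]
  by simp

lemma lap_bas: "lap (bas i) x = - lam i *\<^sub>R bas i x"
proof -
  have 1: "pderiv_at (axis 1 1) (pderiv_at (axis 1 1) (bas i)) x = - (freq a (fst i))\<^sup>2 *\<^sub>R bas i x"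
    unfolding pderiv_bas(1)[abs_def]
    by (subst pderiv_at_fun_vec2, (intro smooth_tensor smooth_modes)+, unfold pderiv_modes)
       (simp add: vec_eq_iff forall_2 bas_def power2_eq_square)
  have 2: "pderiv_at (axis 2 1) (pderiv_at (axis 2 1) (bas i)) x = - (freq b (snd i))\<^sup>2 *\<^sub>R bas i x"
    unfolding pderiv_bas(2)[abs_def]
    by (subst pderiv_at_fun_vec2, (intro smooth_tensor smooth_modes)+, unfold pderiv_modes)
       (simp add: vec_eq_iff forall_2 bas_def power2_eq_square)
  show ?thesis by (simp add: lap_def sum_2 1 2 lam_def algebra_simps)
qed

lemma bas_L2: "bas i \<in> L2 R"
  by (intro L2_smooth smooth_bas)

text \<open>The normalisation decays like the inverse square root of \<open>lam i\<close> and
  cancels the growth of the gradient of the stream function, so the bound is independent of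
  i.\<close>

lemma bas_bound: "norm (bas i x) \<le> 2 / sqrt (a * b)"
proof -
  have p: "(sinm c k s)\<^sup>2 * (cosm d m t)\<^sup>2 \<le> 1" "(cosm c k s)\<^sup>2 * (sinm d m t)\<^sup>2 \<le> 1" for c d k m s t
    using modes_bounds by (auto intro!: mult_le_one)
  have "(norm (bas i x))\<^sup>2 = (bas i x $ 1)\<^sup>2 + (bas i x $ 2)\<^sup>2"
    by (simp add: norm_vec_def L2_set_def sum_2)
  also have "\<dots> = (amp i)\<^sup>2 * (freq b (snd i))\<^sup>2 * ((sinm a (fst i) (x $ 1))\<^sup>2 * (cosm b (snd i) (x $ 2))\<^sup>2)
     + (amp i)\<^sup>2 * (freq a (fst i))\<^sup>2 * ((cosm a (fst i) (x $ 1))\<^sup>2 * (sinm b (snd i) (x $ 2))\<^sup>2)"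
    by (simp add: bas_def power_mult_distrib mult_ac)
  also have "\<dots> \<le> (amp i)\<^sup>2 * (freq b (snd i))\<^sup>2 * 1 + (amp i)\<^sup>2 * (freq a (fst i))\<^sup>2 * 1"
    by (intro add_mono mult_left_mono p) auto
  also have "\<dots> = 4 / (a * b)"
    using amp_sq[of i] by (simp add: lam_def algebra_simps)
  finally have "sqrt ((norm (bas i x))\<^sup>2) \<le> sqrt (4 / (a * b))" by (rule real_sqrt_le_mono)
  then show ?thesis by (simp add: real_sqrt_divide)
qed

lemma bas_orthonormal: "L2_inner R (bas i) (bas j) = (if i = j then 1 else 0)"
proof -
  let ?f = "\<lambda>x. ((- amp i * freq b (snd i)) * (- amp j * freq b (snd j)) * (sinm a (fst i) (x $ 1) * sinm a (fst j) (x $ 1)))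
      * (cosm b (snd i) (x $ 2) * cosm b (snd j) (x $ 2))"
  let ?g = "\<lambda>x. ((amp i * freq a (fst i)) * (amp j * freq a (fst j)) * (cosm a (fst i) (x $ 1) * cosm a (fst j) (x $ 1)))
      * (sinm b (snd i) (x $ 2) * sinm b (snd j) (x $ 2))"
  have "L2_inner R (bas i) (bas j) = (\<integral>x. ?f x + ?g x \<partial>lebesgue_on R)"
    by (simp add: L2_inner_def inner_vec_def sum_2 bas_def mult_ac)
  also have "\<dots> = (\<integral>x. ?f x \<partial>lebesgue_on R) + (\<integral>x. ?g x \<partial>lebesgue_on R)"
    by (intro Bochner_Integration.integral_add integrable_continuous_Rect continuous_intros)
  also have "(\<integral>x. ?f x \<partial>lebesgue_on R) =
      (LBINT t=0..a. (- amp i * freq b (snd i)) * (- amp j * freq b (snd j)) * (sinm a (fst i) t * sinm a (fst j) t))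
      * (LBINT t=0..b. cosm b (snd i) t * cosm b (snd j) t)"
    by (rule integral_Rect_tensor[OF _ _ a b]) (intro continuous_intros)+
  also have "\<dots> = (amp i * freq b (snd i)) * (amp j * freq b (snd j)) * (if i = j then a * b / 4 else 0)"
    by (auto simp: modes_orthogonal a b prod_eq_iff)
  also have "(\<integral>x. ?g x \<partial>lebesgue_on R) =
      (LBINT t=0..a. (amp i * freq a (fst i)) * (amp j * freq a (fst j)) * (cosm a (fst i) t * cosm a (fst j) t))
      * (LBINT t=0..b. sinm b (snd i) t * sinm b (snd j) t)"
    by (rule integral_Rect_tensor[OF _ _ a b]) (intro continuous_intros)+
  also have "\<dots> = (amp i * freq a (fst i)) * (amp j * freq a (fst j)) * (if i = j then a * b / 4 else 0)"
    by (auto simp: modes_orthogonal a b prod_eq_iff)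
  finally show ?thesis
    using amp_sq[of i] a b by (auto simp: lam_def power2_eq_square algebra_simps field_simps)
qed

lemma dirichlet_bas: "u \<in> D1 a b \<Longrightarrow> dirichlet_form R (bas i) u = lam i * L2_inner R (bas i) u"
proof -
  assume u: "u \<in> D1 a b"
  have "dirichlet_form R (bas i) u = - L2_inner R (\<lambda>x. - lam i *\<^sub>R bas i x) u"
    using dirichlet_D1[OF bas_D1 u, of i] by (simp only: ext[of "lap (bas i)", OF lap_bas])
  also have "\<dots> = lam i * L2_inner R (bas i) u"
    using L2.scale_left[OF bas_L2 L2_smooth[OF D1_smooth[OF u]], of "- lam i" i] by simp
  finally show ?thesis .
qed

lemma dirichlet_bas_bas: "dirichlet_form R (bas i) (bas j) = (if i = j then lam i else 0)"
  by (simp add: dirichlet_bas[OF bas_D1] bas_orthonormal)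

text \<open>Arbitrary index sets are allowed because differences of projections are sums over
  \<open>KK m - KK n\<close>.\<close>

definition psum :: "(nat \<times> nat) set \<Rightarrow> (nat \<times> nat \<Rightarrow> real) \<Rightarrow> vector_field" where
  "psum I c x = (\<Sum>i\<in>I. c i *\<^sub>R bas i x)"

definition KK :: "nat \<Rightarrow> (nat \<times> nat) set" where
  "KK n = {..<n} \<times> {..<n}"

lemma KK_finite [simp]: "finite (KK n)" and KK_mono: "m \<le> n \<Longrightarrow> KK m \<subseteq> KK n"
  and KK_card: "card (KK n) = n * n" and KK_0 [simp]: "KK 0 = {}"
  by (auto simp: KK_def)

lemma KK_exhaust: "\<exists>n. i \<in> KK n"
  by (rule exI[of _ "Suc (max (fst i) (snd i))"]) (auto simp: KK_def mem_Times_iff)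

lemma psum_D1: "psum I c \<in> D1 a b"
  unfolding psum_def[abs_def] by (intro D1_sum bas_D1)

lemma psum_V: "psum I c \<in> V_space a b"
  by (intro D1_V psum_D1)

lemma psum_L2: "psum I c \<in> L2 R"
  by (intro V_L2 psum_V)

lemma psum_inner: "finite I \<Longrightarrow> L2_inner R (psum I c) (psum I d) = (\<Sum>i\<in>I. c i * d i)"
  using L2.lincomb_orth[of I bas R "\<lambda>_. 1" c d] bas_L2 bas_orthonormal
  by (simp add: psum_def[abs_def])

lemma psum_dirichlet: "finite I \<Longrightarrow> dirichlet_form R (psum I c) (psum I d) = (\<Sum>i\<in>I. lam i * c i * d i)"
  using D.lincomb_orth[of I bas lam c d] D1_H1[OF bas_D1] dirichlet_bas_bas
  by (simp add: psum_def[abs_def])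

lemma psum_norm: "finite I \<Longrightarrow> (L2_norm R (psum I c))\<^sup>2 = (\<Sum>i\<in>I. (c i)\<^sup>2)"
  by (simp add: L2_norm_sq psum_inner) (simp add: power2_eq_square)

lemma psum_V_norm: "finite I \<Longrightarrow> (V_norm a b (psum I c))\<^sup>2 = (\<Sum>i\<in>I. lam i * (c i)\<^sup>2)"
  by (simp add: V_norm_sq D1_H1[OF psum_D1] psum_dirichlet) (simp add: power2_eq_square mult.assoc)

lemma psum_inner_left: "u \<in> L2 R \<Longrightarrow> L2_inner R (psum I c) u = (\<Sum>i\<in>I. c i * L2_inner R (bas i) u)"
  unfolding psum_def[abs_def] by (rule L2.lincomb_left[OF bas_L2])

lemma psum_inner_bas: "finite I \<Longrightarrow> L2_inner R (psum I c) (bas j) = (if j \<in> I then c j else 0)"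
  by (simp add: psum_inner_left bas_L2 bas_orthonormal if_distrib cong: if_cong)

lemma psum_diff:
  "finite J \<Longrightarrow> I \<subseteq> J \<Longrightarrow> (\<lambda>x. psum J c x - psum I c x) = psum (J - I) c"
  by (auto simp: psum_def fun_eq_iff sum_diff)

text \<open>All modes share one sup bound, and Cauchy-Schwarz over the n^2 modes costs the square
  root of their number.\<close>

lemma psum_bound: "norm (psum (KK n) c x) \<le> 2 / sqrt (a * b) * n * L2_norm R (psum (KK n) c)"
proof -
  have "norm (psum (KK n) c x) \<le> (\<Sum>i\<in>KK n. norm (c i *\<^sub>R bas i x))"
    unfolding psum_def by (rule norm_sum)
  also have "\<dots> \<le> (\<Sum>i\<in>KK n. \<bar>c i\<bar> * (2 / sqrt (a * b)))"
    unfolding norm_scaleR by (intro sum_mono mult_left_mono bas_bound) auto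
  also have "\<dots> = 2 / sqrt (a * b) * (\<Sum>i\<in>KK n. \<bar>c i\<bar>)" by (simp add: sum_distrib_left sum_divide_distrib mult.commute)
  also have "(\<Sum>i\<in>KK n. \<bar>c i\<bar>) \<le> n * L2_norm R (psum (KK n) c)"
  proof (rule power2_le_imp_le)
    have "(\<Sum>i\<in>KK n. \<bar>c i\<bar>)\<^sup>2 \<le> (\<Sum>i\<in>KK n. \<bar>c i\<bar>\<^sup>2) * card (KK n)"
      using sum_squared_le_sum_of_squares[of "\<lambda>i. \<bar>c i\<bar>" "KK n"] by simp
    also have "\<dots> = (n * L2_norm R (psum (KK n) c))\<^sup>2"
      by (simp add: KK_card power_mult_distrib psum_norm power2_eq_square[of "real n"])
    finally show "(\<Sum>i\<in>KK n. \<bar>c i\<bar>)\<^sup>2 \<le> (n * L2_norm R (psum (KK n) c))\<^sup>2" .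
  qed simp
  finally show ?thesis using a b by (simp add: mult.assoc mult_left_mono divide_right_mono)
qed

section \<open>Coefficients, Bessel's inequality and square-summable sequences\<close>

definition coef :: "vector_field \<Rightarrow> nat \<times> nat \<Rightarrow> real" where
  "coef u i = L2_inner R u (bas i)"

lemma coef_diff: "u \<in> L2 R \<Longrightarrow> v \<in> L2 R \<Longrightarrow> coef (\<lambda>x. u x - v x) i = coef u i - coef v i"
  by (simp add: coef_def L2.diff_left bas_L2)

lemma coef_psum: "finite I \<Longrightarrow> coef (psum I c) i = (if i \<in> I then c i else 0)"
  by (simp add: coef_def psum_inner_bas)

abbreviation PP :: "nat \<Rightarrow> vector_field \<Rightarrow> vector_field" where
  "PP n u \<equiv> psum (KK n) (coef u)"

lemma bessel: "u \<in> L2 R \<Longrightarrow> finite I \<Longrightarrow> (\<Sum>i\<in>I. (coef u i)\<^sup>2) \<le> L2_inner R u u"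
proof -
  assume u: "u \<in> L2 R" and I: "finite I"
  have "L2_inner R u (psum I (coef u)) = (\<Sum>i\<in>I. (coef u i)\<^sup>2)"
    using psum_inner_left[OF u, of I "coef u"]
    by (simp add: L2_inner_commute[of _ u] coef_def power2_eq_square)
  then show ?thesis
    using L2.nonneg[OF L2.diff[OF u psum_L2[of I "coef u"]]] L2.quadratic(2)[OF u psum_L2, of I "coef u"] psum_inner[OF I, of "coef u" "coef u"]
    by (simp add: power2_eq_square)
qed

text \<open>By orthonormality the squared distance of two partial sums is the difference of two
  terms of a bounded increasing sequence, so the partial sums are Cauchy.\<close>

lemma riesz_fischer:
  assumes bdd: "\<And>n. (\<Sum>i\<in>KK n. (c i)\<^sup>2) \<le> M"
  obtains w where "w \<in> L2 R" "coef w = c" "(\<lambda>n. L2_norm R (\<lambda>x. psum (KK n) c x - w x)) \<longlonglongrightarrow> 0"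
proof -
  define s where "s n = (\<Sum>i\<in>KK n. (c i)\<^sup>2)" for n
  have "incseq s" unfolding s_def incseq_def by (auto intro!: sum_mono2 dest: KK_mono)
  then have "convergent s"
    using incseq_convergent[of s M] bdd unfolding s_def convergent_def by metis
  then have cau: "Cauchy s" by (simp add: Cauchy_convergent_iff)
  have d: "(L2_norm R (\<lambda>x. psum (KK m) c x - psum (KK n) c x))\<^sup>2 = \<bar>s m - s n\<bar>" for m n
  proof -
    have *: "(L2_norm R (\<lambda>x. psum (KK m) c x - psum (KK n) c x))\<^sup>2 = \<bar>s m - s n\<bar>" if "n \<le> m" for m n
    proof -
      have "(L2_norm R (\<lambda>x. psum (KK m) c x - psum (KK n) c x))\<^sup>2 = s m - s n"
        using KK_mono[OF that] by (simp add: psum_diff psum_norm s_def sum_diff)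
      then show ?thesis by (metis abs_of_nonneg zero_le_power2)
    qed
    show ?thesis
      using *[of n m] *[of m n] L2_norm_minus_commute[OF psum_L2 psum_L2, of "KK m" c "KK n" c]
      by (cases "n \<le> m") (auto simp: abs_minus_commute)
  qed
  have "\<exists>N. \<forall>m\<ge>N. \<forall>n\<ge>N. L2_norm R (\<lambda>x. psum (KK m) c x - psum (KK n) c x) < e" if e: "e > 0" for e
  proof -
    obtain N where N: "\<And>m n. m \<ge> N \<Longrightarrow> n \<ge> N \<Longrightarrow> \<bar>s m - s n\<bar> < e\<^sup>2"
      using CauchyD[OF cau, of "e\<^sup>2"] e by auto
    have "L2_norm R (\<lambda>x. psum (KK m) c x - psum (KK n) c x) < e" if "m \<ge> N" "n \<ge> N" for m n
      using N[OF that] e power2_less_imp_less[of _ e] unfolding d[symmetric] by simp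
    then show ?thesis by blast
  qed
  from L2_complete[OF finite_measure_Rect psum_L2 this]
  obtain w where w: "w \<in> L2 R" "(\<lambda>n. L2_norm R (\<lambda>x. psum (KK n) c x - w x)) \<longlonglongrightarrow> 0" by blast
  have "coef w i = c i" for i
  proof -
    obtain n0 where n0: "i \<in> KK n0" using KK_exhaust by blast
    have "(\<lambda>n. L2_inner R (psum (KK n) c) (bas i)) \<longlonglongrightarrow> L2_inner R w (bas i)"
      by (rule L2_inner_tendsto[OF psum_L2 w(1) bas_L2 w(2)])
    moreover have "(\<lambda>n. L2_inner R (psum (KK n) c) (bas i)) \<longlonglongrightarrow> c i"
    proof (rule tendsto_eventually)
      show "\<forall>\<^sub>F n in sequentially. L2_inner R (psum (KK n) c) (bas i) = c i"
        unfolding eventually_sequentially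
        using n0 KK_mono by (intro exI[of _ n0]) (auto simp: psum_inner_bas)
    qed
    ultimately show ?thesis unfolding coef_def by (rule LIMSEQ_unique)
  qed
  then show ?thesis using that w by blast
qed

section \<open>Completeness of the eigenfields\<close>

definition grad_cos :: "nat \<Rightarrow> nat \<Rightarrow> vector_field" where
  "grad_cos j k x = vec2 (- (real j * pi / a) * (sink a j (x $ 1) * cosk b k (x $ 2)))
     (- (real k * pi / b) * (cosk a j (x $ 1) * sink b k (x $ 2)))"

text \<open>A working version of H: orthogonality to the gradients of products of cosines encodes
  zero divergence and zero normal trace by countably many conditions that survive L2 limits. Both V
  and \<open>H_space\<close> are shown to lie in it.\<close>

definition HH :: "vector_field set" where
  "HH = {u \<in> L2 R. \<forall>j k. L2_inner R u (grad_cos j k) = 0}"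

lemma grad_cos_L2: "grad_cos j k \<in> L2 R"
  unfolding grad_cos_def[abs_def] by (intro L2_continuous continuous_intros)

lemma HH_L2: "u \<in> HH \<Longrightarrow> u \<in> L2 R"
  by (simp add: HH_def)

lemma HH_diff: "u \<in> HH \<Longrightarrow> v \<in> HH \<Longrightarrow> (\<lambda>x. u x - v x) \<in> HH"
  by (simp add: HH_def L2.diff L2.diff_left grad_cos_L2)

lemma HH_limit:
  assumes "\<And>n. f n \<in> HH" "g \<in> L2 R" "(\<lambda>n. L2_norm R (\<lambda>x. f n x - g x)) \<longlonglongrightarrow> 0"
  shows "g \<in> HH"
proof -
  have "L2_inner R g (grad_cos j k) = 0" for j k
  proof -
    have "(\<lambda>n. L2_inner R (f n) (grad_cos j k)) \<longlonglongrightarrow> L2_inner R g (grad_cos j k)"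
      by (rule L2_inner_tendsto[OF HH_L2[OF assms(1)] assms(2) grad_cos_L2 assms(3)])
    then show ?thesis using assms(1) by (simp add: HH_def LIMSEQ_const_iff)
  qed
  then show ?thesis using assms(2) by (simp add: HH_def)
qed

lemma D1_grad_orthogonal:
  assumes u: "u \<in> D1 a b" and \<phi>: "smooth \<phi>"
  shows "L2_inner R u (\<lambda>x. \<chi> i. pderiv_at (axis i 1) \<phi> x) = 0"
proof -
  note su = smooth_component[OF D1_smooth[OF u]]
  note sd = smooth_pderiv[OF \<phi> axis_in_Basis]
  have 1: "(\<integral>x. u x $ i * pderiv_at (axis i 1) \<phi> x \<partial>lebesgue_on R) = - (\<integral>x. pderiv_at (axis i 1) u x $ i * \<phi> x \<partial>lebesgue_on R)" for i
    using integral_by_parts_Rect[where i = i, OF su[of i] \<phi> _ a b] D1_face[OF u]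
    by (simp add: pderiv_component_smooth[OF D1_smooth[OF u]])
  have i1: "integrable (lebesgue_on R) (\<lambda>x. u x $ i * pderiv_at (axis i 1) \<phi> x)" for i
    by (intro integrable_continuous_Rect continuous_intros smooth_continuous su sd)
  have i2: "integrable (lebesgue_on R) (\<lambda>x. pderiv_at (axis i 1) u x $ i * \<phi> x)" for i
    by (intro integrable_continuous_Rect continuous_on_mult smooth_continuous \<phi> smooth_pderiv_component D1_smooth[OF u])
  have "L2_inner R u (\<lambda>x. \<chi> i. pderiv_at (axis i 1) \<phi> x) = (\<Sum>i\<in>UNIV. \<integral>x. u x $ i * pderiv_at (axis i 1) \<phi> x \<partial>lebesgue_on R)"
    using i1 by (simp add: L2_inner_def inner_vec_def Bochner_Integration.integral_sum)
  also have "\<dots> = - (\<integral>x. divergence u x * \<phi> x \<partial>lebesgue_on R)"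
    using i2 unfolding 1 divergence_def sum_distrib_right
    by (simp add: Bochner_Integration.integral_sum sum_negf)
  also have "(\<integral>x. divergence u x * \<phi> x \<partial>lebesgue_on R) = (\<integral>x. 0 \<partial>lebesgue_on R)"
    by (rule Bochner_Integration.integral_cong) (use D1_div[OF u] in auto)
  finally show ?thesis by simp
qed

lemma grad_cos_eq: "grad_cos j k x = (\<chi> i. pderiv_at (axis i 1) (\<lambda>x. (1 * cosk a j (x $ 1)) * cosk b k (x $ 2)) x)"
  unfolding vec_eq_iff forall_2 vec_lambda_beta pderiv_cos_cos by (simp add: grad_cos_def)

lemma D1_HH: "u \<in> D1 a b \<Longrightarrow> u \<in> HH"
proof -
  assume u: "u \<in> D1 a b"
  have "L2_inner R u (grad_cos j k) = 0" for j k
    using D1_grad_orthogonal[OF u, OF smooth_tensor[OF smooth_const_cosk[of 1] smooth_cosk]]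
    by (simp add: grad_cos_eq[abs_def])
  then show ?thesis using L2_smooth[OF D1_smooth[OF u]] by (simp add: HH_def)
qed

lemma V_HH: assumes u: "u \<in> V_space a b" shows "u \<in> HH"
proof -
  obtain v where v: "\<And>n. v n \<in> D1 a b" "(\<lambda>n. L2_norm R (\<lambda>x. u x - v n x)) \<longlonglongrightarrow> 0"
    using V_approx[OF u] by blast
  show ?thesis
    by (rule HH_limit[OF D1_HH[OF v(1)] V_L2[OF u]])
       (use v(2) L2_norm_minus_commute[OF V_L2[OF u] V_L2[OF D1_V[OF v(1)]]] in simp)
qed

text \<open>The orthogonality relations to \<open>grad_cos\<close> (divergence-free) and to the basis determine both
  the sine-cosine coefficients of the two components; multiplying by \<open>sin\<close> turns these into
  cosine-cosine coefficients.\<close>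

lemma HH_complete:
  assumes u: "u \<in> HH" and c: "\<And>i. coef u i = 0"
  shows "AE x in lebesgue_on R. u x = 0"
proof -
  have uL: "(\<lambda>x. u x $ i) \<in> L2 R" for i using HH_L2[OF u] by (simp add: L2_vec)
  define S1 where "S1 j k = (\<integral>x. u x $ 1 * (sink a j (x $ 1) * cosk b k (x $ 2)) \<partial>lebesgue_on R)" for j k :: int
  define S2 where "S2 j k = (\<integral>x. u x $ 2 * (cosk a j (x $ 1) * sink b k (x $ 2)) \<partial>lebesgue_on R)" for j k :: int
  have int: "integrable (lebesgue_on R) (\<lambda>x. u x $ i * g x)" if "continuous_on UNIV g" for g i
    using L2_inner_integrable[OF uL L2_continuous[OF that]] by simp
  have int1: "integrable (lebesgue_on R) (\<lambda>x. u x $ 1 * (sink a j (x $ 1) * cosk b k (x $ 2)))" for j k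
    by (intro int continuous_intros)
  have int2: "integrable (lebesgue_on R) (\<lambda>x. u x $ 2 * (cosk a j (x $ 1) * sink b k (x $ 2)))" for j k
    by (intro int continuous_intros)
  have g: "real j * pi / a * S1 j k + real k * pi / b * S2 j k = 0" for j k :: nat
  proof -
    have "L2_inner R u (grad_cos j k) = (\<integral>x. - (real j * pi / a) * (u x $ 1 * (sink a j (x $ 1) * cosk b k (x $ 2))) +
       - (real k * pi / b) * (u x $ 2 * (cosk a j (x $ 1) * sink b k (x $ 2))) \<partial>lebesgue_on R)"
      unfolding L2_inner_def inner_vec_def sum_2 grad_cos_def by (simp add: mult_ac)
    also have "\<dots> = - (real j * pi / a) * S1 j k + - (real k * pi / b) * S2 j k"
      unfolding S1_def S2_def using int1[of j k] int2[of j k]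
      by (subst Bochner_Integration.integral_add) auto
    finally show ?thesis using u by (simp add: HH_def)
  qed
  have o: "freq b l * S1 (int (Suc k)) (int (Suc l)) = freq a k * S2 (int (Suc k)) (int (Suc l))" for k l :: nat
  proof -
    let ?A = "amp (k, l)"
    have "coef u (k, l) = (\<integral>x. (- ?A * freq b l) * (u x $ 1 * (sinm a k (x $ 1) * cosm b l (x $ 2))) +
       (?A * freq a k) * (u x $ 2 * (cosm a k (x $ 1) * sinm b l (x $ 2))) \<partial>lebesgue_on R)"
      unfolding coef_def L2_inner_def inner_vec_def sum_2 bas_def by (simp add: mult_ac del: of_nat_Suc)
    also have "\<dots> = (- ?A * freq b l) * S1 (int (Suc k)) (int (Suc l)) + (?A * freq a k) * S2 (int (Suc k)) (int (Suc l))"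
      unfolding S1_def S2_def sinm_def cosm_def
      by (subst Bochner_Integration.integral_add[OF integrable_mult_right[OF int1] integrable_mult_right[OF int2]])
         (simp only: integral_mult_right_zero)
    finally have "?A * (freq a k * S2 (int (Suc k)) (int (Suc l)) - freq b l * S1 (int (Suc k)) (int (Suc l))) = 0"
      using c by (simp add: right_diff_distrib mult.assoc del: of_nat_Suc)
    moreover have "?A \<noteq> 0" using amp_sq[of "(k,l)"] a b by auto
    ultimately show ?thesis by simp
  qed
  have S1: "S1 j k = 0" if pos: "j > 0" for j k :: nat
  proof (cases "k = 0")
    case True
    then show ?thesis using g[of j 0] pos a by simp
  next
    case False
    obtain j' k' where jk: "j = Suc j'" "k = Suc k'" using pos False by (cases j; cases k) auto
    let ?S1 = "S1 (int (Suc j')) (int (Suc k'))" and ?S2 = "S2 (int (Suc j')) (int (Suc k'))"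
    have 1: "freq a j' * ?S1 + freq b k' * ?S2 = 0" using g[of j k] by (simp add: jk freq_def)
    \<comment> \<open>Orthogonality to a gradient and the vanishing coefficient are two linear
      equations for \<open>S1\<close> and \<open>S2\<close>, whose determinant is the eigenvalue up
      to sign.\<close>
    have "((freq a j')\<^sup>2 + (freq b k')\<^sup>2) * ?S1 = freq a j' * (freq a j' * ?S1 + freq b k' * ?S2) + freq b k' * (freq b k' * ?S1 - freq a j' * ?S2)"
      by (simp add: power2_eq_square algebra_simps)
    also have "\<dots> = 0" using 1 o[of k' j'] by simp
    finally show ?thesis using lam_pos[of "(j',k')"] by (auto simp: lam_def jk)
  qed
  have S2: "S2 j k = 0" if pos: "k > 0" for j k :: nat
  proof (cases "j = 0")
    case True
    then show ?thesis using g[of 0 k] pos b by simp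
  next
    case False
    obtain j' k' where jk: "j = Suc j'" "k = Suc k'" using pos False by (cases j; cases k) auto
    have "freq b k' * S2 j k = 0" using g[of j k] S1[of j k] by (simp add: jk freq_def)
    then show ?thesis using freq_pos(2)[of k'] by simp
  qed
  \<comment> \<open>The product formulas produce the frequency 1 - j, so the relations are extended
    to zero and negative frequencies by oddness of the sine.\<close>
  have z: "S1 0 k = 0" "S2 k 0 = 0" "S1 (- j) k = - S1 j k" "S2 j (- k) = - S2 j k" for j k :: int
    by (simp_all add: S1_def S2_def sink_def)
  have S1': "S1 j k = 0" for j :: int and k :: nat
    using S1[of "nat \<bar>j\<bar>" k] z(1)[of k] z(3)[of j k] by (cases "j = 0"; cases "j < 0") auto
  have S2': "S2 j k = 0" for k :: int and j :: nat
    using S2[of "nat \<bar>k\<bar>" j] z(2)[of j] z(4)[of j k] by (cases "k = 0"; cases "k < 0") auto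
  have 1: "AE x in lebesgue_on R. u x $ 1 * sink a 1 (x $ 1) = 0"
  proof (rule cosine_orthogonal_imp_zero[OF a b])
    show "integrable (lebesgue_on R) (\<lambda>x. u x $ 1 * sink a 1 (x $ 1))" by (intro int continuous_intros)
    fix j k :: nat
    have "u x $ 1 * sink a 1 (x $ 1) * (cosk a j (x $ 1) * cosk b k (x $ 2)) =
       (u x $ 1 * (sink a (1 + int j) (x $ 1) * cosk b k (x $ 2))) / 2 + (u x $ 1 * (sink a (1 - int j) (x $ 1) * cosk b k (x $ 2))) / 2" for x
    proof -
      have "u x $ 1 * sink a 1 (x $ 1) * (cosk a j (x $ 1) * cosk b k (x $ 2))
        = u x $ 1 * (sink a 1 (x $ 1) * cosk a j (x $ 1)) * cosk b k (x $ 2)" by (simp only: mult.assoc)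
      then show ?thesis unfolding sink_mult_cosk by (simp add: algebra_simps)
    qed
    then have "(\<integral>x. u x $ 1 * sink a 1 (x $ 1) * (cosk a j (x $ 1) * cosk b k (x $ 2)) \<partial>lebesgue_on R) = S1 (1 + int j) k / 2 + S1 (1 - int j) k / 2"
      unfolding S1_def using int1 by simp
    then show "(\<integral>x. u x $ 1 * sink a 1 (x $ 1) * (cosk a j (x $ 1) * cosk b k (x $ 2)) \<partial>lebesgue_on R) = 0"
      by (simp add: S1')
  qed
  have 2: "AE x in lebesgue_on R. u x $ 2 * sink b 1 (x $ 2) = 0"
  proof (rule cosine_orthogonal_imp_zero[OF a b])
    show "integrable (lebesgue_on R) (\<lambda>x. u x $ 2 * sink b 1 (x $ 2))" by (intro int continuous_intros)
    fix j k :: nat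
    have "u x $ 2 * sink b 1 (x $ 2) * (cosk a j (x $ 1) * cosk b k (x $ 2)) =
       (u x $ 2 * (cosk a j (x $ 1) * sink b (1 + int k) (x $ 2))) / 2 + (u x $ 2 * (cosk a j (x $ 1) * sink b (1 - int k) (x $ 2))) / 2" for x
    proof -
      have "u x $ 2 * sink b 1 (x $ 2) * (cosk a j (x $ 1) * cosk b k (x $ 2))
        = u x $ 2 * (sink b 1 (x $ 2) * cosk b k (x $ 2)) * cosk a j (x $ 1)" by (simp only: mult_ac)
      then show ?thesis unfolding sink_mult_cosk by (simp add: algebra_simps)
    qed
    then have "(\<integral>x. u x $ 2 * sink b 1 (x $ 2) * (cosk a j (x $ 1) * cosk b k (x $ 2)) \<partial>lebesgue_on R) = S2 j (1 + int k) / 2 + S2 j (1 - int k) / 2"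
      unfolding S2_def using int2 by simp
    then show "(\<integral>x. u x $ 2 * sink b 1 (x $ 2) * (cosk a j (x $ 1) * cosk b k (x $ 2)) \<partial>lebesgue_on R) = 0"
      by (simp add: S2')
  qed
  show ?thesis
    using 1 2 AE_space
  proof eventually_elim
    case (elim x)
    \<comment> \<open>The lowest sine is positive on the open interval and can be divided
      out.\<close>
    have pos: "sink c 1 t \<noteq> 0" if "0 < t" "t < c" for c t
    proof -
      have "0 < pi / c * t" "pi / c * t < pi" using that by (auto simp: field_simps)
      then show ?thesis unfolding sink_def using sin_gt_zero[of "pi / c * t"] by simp
    qed
    show ?case using elim pos[of "x $ 1" a] pos[of "x $ 2" b] by (auto simp: Rect_def vec_eq_iff forall_2)
  qed
qed

text \<open>The partial sums have an L2 limit w in \<open>HH\<close> with the coefficients of u, and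
  \<open>HH_complete\<close> identifies it with u.\<close>

lemma PP_tendsto:
  assumes u: "u \<in> HH"
  shows "(\<lambda>n. L2_norm R (\<lambda>x. u x - PP n u x)) \<longlonglongrightarrow> 0"
proof -
  note uL = HH_L2[OF u]
  obtain w where w: "w \<in> L2 R" "coef w = coef u" "(\<lambda>n. L2_norm R (\<lambda>x. PP n u x - w x)) \<longlonglongrightarrow> 0"
    using riesz_fischer[of "coef u", OF bessel[OF uL KK_finite]] by blast
  have wH: "w \<in> HH" by (rule HH_limit[OF D1_HH[OF psum_D1] w(1,3)])
  have "AE x in lebesgue_on R. u x - w x = 0"
    by (rule HH_complete[OF HH_diff[OF u wH]]) (simp add: coef_diff uL w)
  then have "L2_norm R (\<lambda>x. u x - w x) = 0"
    by (subst L2_norm_AE_zero) (auto intro: L2.diff uL w)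
  then have "L2_norm R (\<lambda>x. u x - PP n u x) \<le> L2_norm R (\<lambda>x. PP n u x - w x)" for n
    using L2_tri_diff[OF uL w(1) psum_L2, of "KK n" "coef u"] L2_norm_minus_commute[OF w(1) psum_L2, of "KK n" "coef u"]
    by simp
  then show ?thesis by (intro Lim_null_comparison[OF _ w(3)]) simp
qed

end

text \<open>The second bound follows from the first by reflecting t to c - t, which changes a sine
  mode at most by its sign.\<close>

lemma abs_sinm_le: 
  assumes "c > 0" shows "\<bar>sinm c k t\<bar> \<le> freq c k * \<bar>t\<bar>" and "\<bar>sinm c k t\<bar> \<le> freq c k * \<bar>c - t\<bar>"
proof -
  have e: "sinm c k t = sin (freq c k * t)" for t
    using freq_int[of k c] by (simp add: sinm_def sink_def del: of_nat_Suc)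
  have f: "freq c k \<ge> 0" using assms by (simp add: freq_def)
  show 1: "\<bar>sinm c k t\<bar> \<le> freq c k * \<bar>t\<bar>" for t
    using abs_sin_x_le_abs_x[of "freq c k * t"] f by (simp add: e abs_mult)
  have "freq c k * (c - t) = real (Suc k) * pi - freq c k * t"
    using assms by (simp add: freq_def field_simps)
  then have "sinm c k (c - t) = - (sinm c k t * cos (real (Suc k) * pi))"
    unfolding e by (simp only: sin_diff sin_npi mult_zero_left) (simp add: mult.commute)
  moreover have "\<bar>cos (real (Suc k) * pi)\<bar> = 1" unfolding cos_npi by simp
  ultimately have "\<bar>sinm c k t\<bar> = \<bar>sinm c k (c - t)\<bar>" by (simp only: abs_minus_cancel abs_mult mult_1_right)
  then show "\<bar>sinm c k t\<bar> \<le> freq c k * \<bar>c - t\<bar>" using 1[of "c - t"] by simp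
qed

section \<open>Convergence of eigenfunction expansions in V\<close>

text \<open>The stream functions of the eigenfields vanish on the boundary but are not compactly
  supported in the open rectangle; with these modified modes they become test functions.\<close>

definition cutoff_mode :: "real \<Rightarrow> nat \<Rightarrow> real \<Rightarrow> real \<Rightarrow> real" where
  "cutoff_mode c k e t = cutoff e e (c - e) t * sinm c k t"

lemma cutoff_mode_test: "e > 0 \<Longrightarrow> cutoff_mode c k e \<in> test_functions {0<..<c}"
  unfolding cutoff_mode_def[abs_def] by (intro test_functions_mult cutoff_test smooth_modes) auto

lemma deriv_sinm: "deriv (sinm c k) t = freq c k * cosm c k t"
  by (simp add: sinm_def cosm_def deriv_sink freq_int del: of_nat_Suc of_int_of_nat_eq)

lemma deriv_cutoff_mode:
  "deriv (cutoff_mode c k e) t = deriv (cutoff e e (c - e)) t * sinm c k t + cutoff e e (c - e) t * (freq c k * cosm c k t)"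
proof (rule DERIV_imp_deriv)
  show "(cutoff_mode c k e has_real_derivative deriv (cutoff e e (c - e)) t * sinm c k t + cutoff e e (c - e) t * (freq c k * cosm c k t)) (at t)"
    unfolding cutoff_mode_def[abs_def]
    using DERIV_mult[OF smooth_DERIV[OF smooth_cutoff, of e e "c - e" t] smooth_DERIV[OF smooth_modes(1), of c k t]]
    by (simp add: deriv_sinm algebra_simps)
qed

lemma cutoff_mode_limits:
  assumes "0 < t" "t < c"
  shows "(\<lambda>n. cutoff_mode c k (1 / real (Suc n)) t) \<longlonglongrightarrow> sinm c k t"
    and "(\<lambda>n. deriv (cutoff_mode c k (1 / real (Suc n))) t) \<longlonglongrightarrow> freq c k * cosm c k t"
proof -
  \<comment> \<open>The cutoff starts at distance e from an end point and is full at distance 2 e; a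
    distance above 3 e puts t strictly inside the plateau.\<close>
  have "eventually (\<lambda>n. 1 / real (Suc n) < min t (c - t) / 3) sequentially"
    using order_tendstoD(2)[OF LIMSEQ_inverse_real_of_nat, of "min t (c - t) / 3"] assms
    by (simp add: inverse_eq_divide)
  then have ev: "eventually (\<lambda>n. cutoff (1 / real (Suc n)) (1 / real (Suc n)) (c - 1 / real (Suc n)) t = 1 \<and>
      deriv (cutoff (1 / real (Suc n)) (1 / real (Suc n)) (c - 1 / real (Suc n))) t = 0) sequentially"
  proof eventually_elim
    case (elim n)
    define e where "e = 1 / real (Suc n)"
    have "e < min t (c - t) / 3" using elim unfolding e_def .
    moreover have "e > 0" by (simp add: e_def)
    ultimately have e: "e > 0" "t > 3 * e" "c - t > 3 * e" by auto
    have "(t - e) / e > 1" "(c - e - t) / e > 1" using e by (auto simp: field_simps)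
    then have "cutoff e e (c - e) t = 1" "deriv (cutoff e e (c - e)) t = 0"
      by (auto simp: cutoff_def deriv_cutoff smooth_step_1 deriv_smooth_step_0)
    then show ?case by (simp add: e_def)
  qed
  show "(\<lambda>n. cutoff_mode c k (1 / real (Suc n)) t) \<longlonglongrightarrow> sinm c k t"
    by (rule tendsto_eventually, rule eventually_mono[OF ev]) (simp add: cutoff_mode_def)
  show "(\<lambda>n. deriv (cutoff_mode c k (1 / real (Suc n))) t) \<longlonglongrightarrow> freq c k * cosm c k t"
    by (rule tendsto_eventually, rule eventually_mono[OF ev]) (simp add: deriv_cutoff_mode)
qed

lemma abs_modes_le: "\<bar>sinm c k t\<bar> \<le> 1" "\<bar>cosm c k t\<bar> \<le> 1"
  by (simp_all add: sinm_def cosm_def sink_def cosk_def)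

lemma cutoff_mode_bound: "\<bar>cutoff_mode c k e t\<bar> \<le> 1"
  unfolding cutoff_mode_def abs_mult using cutoff_bounds[of e e "c - e" t] abs_modes_le[of c k t]
  by (intro mult_le_one) auto

text \<open>The derivative of the cutoff is of size \<open>1 / e\<close>, but lives within distance \<open>2 * e\<close> of the
  end points, where the sine mode is of size \<open>e\<close>.\<close>

lemma deriv_cutoff_mode_bound:
  assumes c: "c > 0" obtains C where "\<And>e t. e > 0 \<Longrightarrow> 0 < t \<Longrightarrow> t < c \<Longrightarrow> \<bar>deriv (cutoff_mode c k e) t\<bar> \<le> C"
proof -
  obtain C where C: "C \<ge> 0" "\<And>x. \<bar>deriv smooth_step x\<bar> \<le> C" using deriv_smooth_step_bounded by blast
  have f: "freq c k \<ge> 0" using c by (simp add: freq_def)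
  have "\<bar>deriv (cutoff_mode c k e) t\<bar> \<le> 2 * C * freq c k + 2 * C * freq c k + freq c k"
    if e: "e > 0" and t: "0 < t" "t < c" for e t
  proof -
    \<comment> \<open>Treats both ends at once: r + e is the distance to an end point, with r = t -
      e on the left and r = c - e - t on the right.\<close>
    have p: "\<bar>deriv smooth_step (r / e) / e\<bar> * \<bar>sinm c k t\<bar> \<le> 2 * C * freq c k"
      if r: "\<bar>sinm c k t\<bar> \<le> freq c k * (r + e)" for r
    proof (cases "r / e \<in> {0..1}")
      case True
      then have "r \<le> e" "0 \<le> r" using e by (auto simp: field_simps)
      then have "freq c k * (r + e) \<le> freq c k * (2 * e)" using f by (intro mult_left_mono) auto
      then have "\<bar>sinm c k t\<bar> \<le> freq c k * (2 * e)" using r by linarith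
      then have "\<bar>deriv smooth_step (r / e) / e\<bar> * \<bar>sinm c k t\<bar> \<le> (C / e) * (freq c k * (2 * e))"
        using C e f by (intro mult_mono) (auto simp: divide_right_mono)
      then show ?thesis using e by (simp add: field_simps)
    next
      case False
      then show ?thesis using C f by (simp add: deriv_smooth_step_0)
    qed
    have ss: "\<bar>smooth_step x\<bar> \<le> 1" for x using smooth_step_bounds[of x] by simp
    have t1: "\<bar>deriv smooth_step ((t - e) / e) / e\<bar> * \<bar>sinm c k t\<bar> \<le> 2 * C * freq c k"
      by (rule p) (use abs_sinm_le(1)[OF c, of k t] t in simp)
    have t2: "\<bar>deriv smooth_step ((c - e - t) / e) / e\<bar> * \<bar>sinm c k t\<bar> \<le> 2 * C * freq c k"
      by (rule p) (use abs_sinm_le(2)[OF c, of k t] t in simp)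
    have "\<bar>deriv (cutoff e e (c - e)) t * sinm c k t\<bar> \<le>
      \<bar>deriv smooth_step ((t - e) / e) / e\<bar> * \<bar>sinm c k t\<bar> + \<bar>deriv smooth_step ((c - e - t) / e) / e\<bar> * \<bar>sinm c k t\<bar>"
    proof -
      have "\<bar>deriv (cutoff e e (c - e)) t\<bar> \<le> \<bar>deriv smooth_step ((t - e) / e) / e\<bar> * 1 + 1 * \<bar>deriv smooth_step ((c - e - t) / e) / e\<bar>"
        unfolding deriv_cutoff
        by (rule order_trans[OF abs_triangle_ineq4], unfold abs_mult) (intro add_mono mult_left_mono mult_right_mono ss; simp)
      then have "\<bar>deriv (cutoff e e (c - e)) t\<bar> * \<bar>sinm c k t\<bar> \<le>
         (\<bar>deriv smooth_step ((t - e) / e) / e\<bar> + \<bar>deriv smooth_step ((c - e - t) / e) / e\<bar>) * \<bar>sinm c k t\<bar>"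
        by (intro mult_right_mono) auto
      then show ?thesis by (simp add: abs_mult distrib_right)
    qed
    moreover have "\<bar>cutoff e e (c - e) t * (freq c k * cosm c k t)\<bar> \<le> 1 * (freq c k * 1)"
      unfolding abs_mult using f cutoff_bounds[of e e "c - e" t] abs_modes_le(2)[of c k t]
      by (intro mult_mono) auto
    ultimately show ?thesis
      unfolding deriv_cutoff_mode using t1 t2 by linarith
  qed
  then show ?thesis using that by blast
qed

section \<open>Projections in V, lower bounds for the eigenvalues and the link with H\<close>

context rectangle
begin

lemma dirichlet_V_bas:
  assumes u: "u \<in> V_space a b" shows "dirichlet_form R u (bas i) = lam i * coef u i"
proof -
  obtain v where v: "\<And>n. v n \<in> D1 a b" "(\<lambda>n. L2_norm R (\<lambda>x. u x - v n x)) \<longlonglongrightarrow> 0"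
    "(\<lambda>n. V_norm a b (\<lambda>x. u x - v n x)) \<longlonglongrightarrow> 0"
    using V_approx[OF u] by blast
  have "(\<lambda>n. dirichlet_form R (v n) (bas i)) \<longlonglongrightarrow> dirichlet_form R u (bas i)"
    by (rule V_approx_inner(2)[OF u v(1,3) D1_H1[OF bas_D1]])
  moreover have "dirichlet_form R (v n) (bas i) = lam i * L2_inner R (v n) (bas i)" for n
    using dirichlet_bas[OF v(1)] D.sym[OF D1_H1[OF v(1)] D1_H1[OF bas_D1]] by (simp add: L2_inner_commute)
  moreover have "(\<lambda>n. lam i * L2_inner R (v n) (bas i)) \<longlonglongrightarrow> lam i * coef u i"
    unfolding coef_def by (intro tendsto_mult_left V_approx_inner(1)[OF u v(1,2) bas_L2])
  ultimately show ?thesis using LIMSEQ_unique by force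
qed

lemma dirichlet_V_psum:
  assumes u: "u \<in> V_space a b" shows "dirichlet_form R u (psum I c) = (\<Sum>i\<in>I. lam i * c i * coef u i)"
  unfolding psum_def[abs_def]
  by (subst D.lincomb_right) (auto simp: V_H1[OF u] D1_H1[OF bas_D1] dirichlet_V_bas[OF u] mult_ac)

text \<open>The eigenfields are orthogonal for the Dirichlet form too, so the squared norm of the
  projection equals its product with u, and Cauchy-Schwarz applies.\<close>

lemma PP_V_norm_le:
  assumes u: "u \<in> V_space a b" shows "V_norm a b (PP n u) \<le> V_norm a b u"
proof -
  have "(V_norm a b (PP n u))\<^sup>2 = dirichlet_form R u (PP n u)"
    by (simp add: psum_V_norm dirichlet_V_psum[OF u]) (simp add: power2_eq_square mult.assoc)
  also have "\<dots> \<le> V_norm a b u * V_norm a b (PP n u)"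
    using V_CS[OF V_H1[OF u] D1_H1[OF psum_D1], of "KK n" "coef u"] by simp
  finally have "V_norm a b (PP n u) * V_norm a b (PP n u) \<le> V_norm a b u * V_norm a b (PP n u)"
    by (simp only: power2_eq_square)
  then show ?thesis
    by (cases "V_norm a b (PP n u) = 0") (auto simp: order.strict_iff_order)
qed

lemma psum_diff_coef: "(\<lambda>x. psum I c x - psum I d x) = psum I (\<lambda>i. c i - d i)"
  by (simp add: psum_def fun_eq_iff sum_subtractf scaleR_diff_left)

text \<open>The remainder q is orthogonal to the projection in V, so Green's formula bounds its
  squared V norm by |lap u| |q|. Convergence in L2 is thus upgraded to V for smooth fields.\<close>

lemma PP_V_tendsto_D1:
  assumes u: "u \<in> D1 a b"
  shows "(\<lambda>n. V_norm a b (\<lambda>x. u x - PP n u x)) \<longlonglongrightarrow> 0"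
proof -
  note uV = D1_V[OF u]
  define q where "q n x = u x - PP n u x" for n x
  have q: "q n \<in> D1 a b" for n unfolding q_def by (intro D1_diff u psum_D1)
  have qL: "q n \<in> L2 R" for n by (rule V_L2[OF D1_V[OF q]])
  have "(V_norm a b (q n))\<^sup>2 \<le> L2_norm R (lap u) * L2_norm R (q n)" for n
  proof -
    have "dirichlet_form R (psum (KK n) (coef u)) (q n) = 0"
      using D.sym[OF D1_H1[OF q] D1_H1[OF psum_D1], of n "KK n" "coef u"]
        coef_diff[OF V_L2[OF uV] psum_L2, of "KK n" "coef u"]
      by (simp add: dirichlet_V_psum[OF D1_V[OF q]]) (simp add: q_def[abs_def] coef_psum)
    then have "(V_norm a b (q n))\<^sup>2 = dirichlet_form R u (q n)"
      unfolding V_norm_sq[OF D1_H1[OF q]]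
      using D.diff_left[OF D1_H1[OF u] D1_H1[OF psum_D1] D1_H1[OF q], of "KK n" "coef u" n]
      by (simp add: q_def[abs_def])
    also have "\<dots> = - L2_inner R (lap u) (q n)" by (rule dirichlet_D1[OF u q])
    also have "\<dots> \<le> L2_norm R (lap u) * L2_norm R (q n)"
      using L2_CS[OF L2_smooth[OF smooth_lap[OF D1_smooth[OF u]]] qL, of n] by simp
    finally show ?thesis .
  qed
  moreover have "(\<lambda>n. L2_norm R (lap u) * L2_norm R (q n)) \<longlonglongrightarrow> 0"
    using tendsto_mult_right_zero[OF PP_tendsto[OF D1_HH[OF u]]] unfolding q_def .
  ultimately have "(\<lambda>n. (V_norm a b (q n))\<^sup>2) \<longlonglongrightarrow> 0"
    by (intro Lim_null_comparison[of "\<lambda>n. (V_norm a b (q n))\<^sup>2"]) auto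
  then have "(\<lambda>n. sqrt ((V_norm a b (q n))\<^sup>2)) \<longlonglongrightarrow> sqrt 0" by (rule tendsto_real_sqrt)
  then show ?thesis by (simp add: q_def[abs_def])
qed

text \<open>Three thirds of e: the approximation of u by w in D1, the convergence for w, and the
  projection of u - w, controlled uniformly in n by \<open>PP_V_norm_le\<close>.\<close>

lemma PP_V_tendsto:
  assumes u: "u \<in> V_space a b"
  shows "(\<lambda>n. V_norm a b (\<lambda>x. u x - PP n u x)) \<longlonglongrightarrow> 0"
proof (rule LIMSEQ_I)
  fix e :: real assume e: "e > 0"
  obtain v where v: "\<And>n. v n \<in> D1 a b" "(\<lambda>n. V_norm a b (\<lambda>x. u x - v n x)) \<longlonglongrightarrow> 0"
    using V_approx[OF u] by blast
  obtain m where m: "V_norm a b (\<lambda>x. u x - v m x) < e / 3"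
    using order_tendstoD(2)[OF v(2), of "e / 3"] e eventually_sequentially by fastforce
  define w where "w = v m"
  have w: "w \<in> D1 a b" "V_norm a b (\<lambda>x. u x - w x) < e / 3" using v m by (auto simp: w_def)
  note wV = D1_V[OF w(1)]
  obtain N where N: "\<And>n. n \<ge> N \<Longrightarrow> V_norm a b (\<lambda>x. w x - PP n w x) < e / 3"
    using order_tendstoD(2)[OF PP_V_tendsto_D1[OF w(1)], of "e / 3"] e eventually_sequentially by fastforce
  have "V_norm a b (\<lambda>x. u x - PP n u x) < e" if n: "n \<ge> N" for n
  proof -
    note H = V_H1[OF V_diff[OF u wV]] V_H1[OF V_diff[OF wV psum_V]] D1_H1[OF psum_D1]
    have "PP n (\<lambda>x. u x - w x) = (\<lambda>x. PP n u x - PP n w x)"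
      unfolding psum_diff_coef using coef_diff[OF V_L2[OF u] V_L2[OF wV]] by (simp add: psum_def[abs_def])
    then have "(\<lambda>x. u x - PP n u x) = (\<lambda>x. ((u x - w x) + (w x - PP n w x)) - PP n (\<lambda>x. u x - w x) x)"
      by (simp add: fun_eq_iff)
    then have "V_norm a b (\<lambda>x. u x - PP n u x) \<le> V_norm a b (\<lambda>x. (u x - w x) + (w x - PP n w x)) + V_norm a b (PP n (\<lambda>x. u x - w x))"
      using V_tri_sub[OF D.add[OF H(1,2)] H(3), of "KK n" "coef w" "KK n" "coef (\<lambda>x. u x - w x)"] by simp
    also have "\<dots> \<le> V_norm a b (\<lambda>x. u x - w x) + V_norm a b (\<lambda>x. w x - PP n w x) + V_norm a b (\<lambda>x. u x - w x)"
      by (intro add_mono V_tri[OF H(1,2)] PP_V_norm_le V_diff[OF u wV])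
    also have "\<dots> < e" using w(2) N[OF n] by simp
    finally show ?thesis .
  qed
  then show "\<exists>N. \<forall>n\<ge>N. norm (V_norm a b (\<lambda>x. u x - PP n u x) - 0) < e" by auto
qed

definition kap :: real where
  "kap = min ((pi / a)\<^sup>2) ((pi / b)\<^sup>2)"

lemma kap_pos: "kap > 0"
  using a b by (simp add: kap_def)

text \<open>Outside \<open>KK n\<close> one of the indices is at least n, and index k stands for
  frequency k + 1. The shift keeps the bound positive for n = 0, where it yields Poincare's
  inequality.\<close>

lemma lam_ge: "i \<notin> KK n \<Longrightarrow> kap * (real n + 1)\<^sup>2 \<le> lam i"
proof -
  assume i: "i \<notin> KK n"
  have sq: "(real n + 1)\<^sup>2 \<le> (real (Suc k))\<^sup>2" if "n \<le> k" for k
    using that by (intro power_mono) auto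
  have f: "(freq c k)\<^sup>2 = (pi / c)\<^sup>2 * (real (Suc k))\<^sup>2" for c k
    by (simp add: freq_def power_mult_distrib power_divide mult.commute del: of_nat_Suc)
  consider "n \<le> fst i" | "n \<le> snd i" using i by (auto simp: KK_def mem_Times_iff)
  then show ?thesis
  proof cases
    case 1
    have "kap * (real n + 1)\<^sup>2 \<le> (freq a (fst i))\<^sup>2"
      unfolding f by (intro mult_mono sq 1) (auto simp: kap_def)
    then show ?thesis by (simp add: lam_def add_increasing2)
  next
    case 2
    have "kap * (real n + 1)\<^sup>2 \<le> (freq b (snd i))\<^sup>2"
      unfolding f by (intro mult_mono sq 2) (auto simp: kap_def)
    then show ?thesis by (simp add: lam_def add_increasing)
  qed
qed

text \<open>For finite sums over \<open>KK m - KK n\<close> this is a termwise comparison of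
  eigenvalues; the limit in m uses the convergence of the projections in L2 and in V.\<close>

lemma tail_poincare:
  assumes u: "u \<in> V_space a b"
  shows "sqrt kap * (real n + 1) * L2_norm R (\<lambda>x. u x - PP n u x) \<le> V_norm a b (\<lambda>x. u x - PP n u x)"
proof -
  define d where "d m = (\<lambda>x. PP m u x - PP n u x)" for m
  have dV: "d m \<in> V_space a b" for m unfolding d_def by (intro V_diff psum_V)
  have le: "sqrt kap * (real n + 1) * L2_norm R (d m) \<le> V_norm a b (d m)" if m: "m \<ge> n" for m
  proof (rule power2_le_imp_le)
    have d: "d m = psum (KK m - KK n) (coef u)"
      unfolding d_def using KK_mono[OF m] by (simp add: psum_diff)
    have "(sqrt kap * (real n + 1) * L2_norm R (d m))\<^sup>2 = (\<Sum>i\<in>KK m - KK n. kap * (real n + 1)\<^sup>2 * (coef u i)\<^sup>2)"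
      using kap_pos by (simp add: power_mult_distrib d psum_norm sum_distrib_left)
    also have "\<dots> \<le> (\<Sum>i\<in>KK m - KK n. lam i * (coef u i)\<^sup>2)"
      by (intro sum_mono mult_right_mono lam_ge) auto
    also have "\<dots> = (V_norm a b (d m))\<^sup>2" by (simp add: d psum_V_norm)
    finally show "(sqrt kap * (real n + 1) * L2_norm R (d m))\<^sup>2 \<le> (V_norm a b (d m))\<^sup>2" .
  qed simp
  define q where "q = (\<lambda>x. u x - PP n u x)"
  have qV: "q \<in> V_space a b" unfolding q_def by (intro V_diff u psum_V)
  have dq: "(\<lambda>x. q x - d m x) = (\<lambda>x. u x - PP m u x)" for m by (simp add: q_def d_def fun_eq_iff)
  have l1: "(\<lambda>m. L2_norm R (d m)) \<longlonglongrightarrow> L2_norm R q"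
    by (rule L2_norm_tendsto[OF V_L2[OF dV] V_L2[OF qV]])
       (use PP_tendsto[OF V_HH[OF u]] L2_norm_minus_commute[OF V_L2[OF dV] V_L2[OF qV]] in \<open>simp add: dq\<close>)
  have l2: "(\<lambda>m. V_norm a b (d m)) \<longlonglongrightarrow> V_norm a b q"
  proof -
    have "(\<lambda>m. V_norm a b q - V_norm a b (d m)) \<longlonglongrightarrow> 0"
      by (rule Lim_null_comparison[OF _ PP_V_tendsto[OF u]])
         (use D.tri_rev[OF V_H1[OF qV] V_H1[OF dV], folded V_norm_def] in \<open>simp add: dq\<close>)
    from tendsto_diff[OF tendsto_const[of "V_norm a b q"] this] show ?thesis by simp
  qed
  have "sqrt kap * (real n + 1) * L2_norm R q \<le> V_norm a b q"
    by (rule LIMSEQ_le[OF tendsto_mult_left[OF l1] l2]) (use le in blast)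
  then show ?thesis by (simp add: q_def)
qed

lemma poincare:
  assumes u: "u \<in> V_space a b"
  shows "sqrt kap * L2_norm R u \<le> V_norm a b u"
  using tail_poincare[OF u, of 0] by (simp add: psum_def)

text \<open>A rotated gradient is orthogonal to a gradient because mixed derivatives commute. The
  cutoff stream function is an admissible test function for the weak derivatives of \<phi>, and the
  uniform bound on the derivatives of the cutoff modes permits the limit, whatever the boundary
  values of \<phi>.\<close>

lemma bas_weak_grad:
  assumes \<phi>: "\<phi> \<in> H1 R" shows "L2_inner R (bas i) (weak_grad R \<phi>) = 0"
proof -
  define g where "g j = weak_pderiv R j \<phi>" for j
  have g: "g j \<in> L2 R" "has_weak_pderiv R j \<phi> (g j)" for j
    unfolding g_def by (intro weak_pderiv_L2 weak_pderiv_has \<phi>)+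
  define A where "A n = cutoff_mode a (fst i) (1 / real (Suc n))" for n
  define B where "B n = cutoff_mode b (snd i) (1 / real (Suc n))" for n
  have A: "A n \<in> test_functions {0<..<a}" and B: "B n \<in> test_functions {0<..<b}" for n
    unfolding A_def B_def by (intro cutoff_mode_test, simp)+
  note sm = test_functions_smooth[OF A] test_functions_smooth[OF B]
  \<comment> \<open>The two test functions are the partial derivatives of A(x1) B(x2); both
    integrals equal minus the integral of \<phi> against its mixed second derivative.\<close>
  have eq: "(\<integral>x. g 2 x * (deriv (A n) (x $ 1) * B n (x $ 2)) \<partial>lebesgue_on R)
      = (\<integral>x. g 1 x * (A n (x $ 1) * deriv (B n) (x $ 2)) \<partial>lebesgue_on R)" for n
  proof -
    have t1: "(\<lambda>x::real^2. deriv (A n) (x $ 1) * B n (x $ 2)) \<in> test_functions R"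
      by (intro test_functions_tensor test_functions_deriv A B)
    have t2: "(\<lambda>x::real^2. A n (x $ 1) * deriv (B n) (x $ 2)) \<in> test_functions R"
      by (intro test_functions_tensor test_functions_deriv A B)
    have "pderiv_at (axis 2 1) (\<lambda>x::real^2. deriv (A n) (x $ 1) * B n (x $ 2)) =
        pderiv_at (axis 1 1) (\<lambda>x::real^2. A n (x $ 1) * deriv (B n) (x $ 2))"
      by (simp add: pderiv_tensor smooth_deriv sm)
    then show ?thesis
      using g(2)[of 2, unfolded has_weak_pderiv_def, rule_format, OF t1]
        g(2)[of 1, unfolded has_weak_pderiv_def, rule_format, OF t2]
      by (simp add: L2_inner_def)
  qed
  obtain CA where CA: "\<And>e t. e > 0 \<Longrightarrow> 0 < t \<Longrightarrow> t < a \<Longrightarrow> \<bar>deriv (cutoff_mode a (fst i) e) t\<bar> \<le> CA"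
    using deriv_cutoff_mode_bound[OF a] by blast
  obtain CB where CB: "\<And>e t. e > 0 \<Longrightarrow> 0 < t \<Longrightarrow> t < b \<Longrightarrow> \<bar>deriv (cutoff_mode b (snd i) e) t\<bar> \<le> CB"
    using deriv_cutoff_mode_bound[OF b] by blast
  have gi: "integrable (lebesgue_on R) (g j)" for j
    by (rule L2_imp_integrable(1)[OF finite_measure_Rect g(1)])
  have int: "integrable (lebesgue_on R) (\<lambda>x. g j x * f x)" if "continuous_on UNIV f" for f j
    using L2_inner_integrable[OF g(1) L2_continuous[OF that], of j] by simp
  have lim: "(\<lambda>n. \<integral>x. g j x * F n x \<partial>lebesgue_on R) \<longlonglongrightarrow> (\<integral>x. g j x * f x \<partial>lebesgue_on R)"
    if F: "\<And>n. continuous_on UNIV (F n)" and f: "continuous_on UNIV f"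
      and bd: "\<And>n x. x \<in> R \<Longrightarrow> \<bar>F n x\<bar> \<le> C" and pt: "\<And>x. x \<in> R \<Longrightarrow> (\<lambda>n. F n x) \<longlonglongrightarrow> f x" for F f C j
  proof (rule integral_dominated_convergence[where w = "\<lambda>x. C * \<bar>g j x\<bar>"])
    show "AE x in lebesgue_on R. (\<lambda>n. g j x * F n x) \<longlonglongrightarrow> g j x * f x"
      by (intro AE_I2 tendsto_mult_left pt) simp
    show "AE x in lebesgue_on R. norm (g j x * F n x) \<le> C * \<bar>g j x\<bar>" for n
      by (intro AE_I2) (use bd[of _ n] in \<open>simp add: abs_mult mult.commute[of "\<bar>g j _\<bar>"] mult_right_mono\<close>)
    show "integrable (lebesgue_on R) (\<lambda>x. C * \<bar>g j x\<bar>)" using gi[of j] by simp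
    show "(\<lambda>x. g j x * F n x) \<in> borel_measurable (lebesgue_on R)" for n using int[OF F] by blast
    show "(\<lambda>x. g j x * f x) \<in> borel_measurable (lebesgue_on R)" using int[OF f] by blast
  qed
  have cont: "continuous_on UNIV (\<lambda>x::real^2. \<alpha> (x $ 1) * \<beta> (x $ 2))" if "smooth \<alpha>" "smooth \<beta>" for \<alpha> \<beta> :: "real \<Rightarrow> real"
    by (rule smooth_continuous[OF smooth_tensor[OF that]])
  let ?f2 = "\<lambda>x::real^2. (freq a (fst i) * cosm a (fst i) (x $ 1)) * sinm b (snd i) (x $ 2)"
  let ?f1 = "\<lambda>x::real^2. sinm a (fst i) (x $ 1) * (freq b (snd i) * cosm b (snd i) (x $ 2))"
  have l2: "(\<lambda>n. \<integral>x. g 2 x * (deriv (A n) (x $ 1) * B n (x $ 2)) \<partial>lebesgue_on R) \<longlonglongrightarrow> (\<integral>x. g 2 x * ?f2 x \<partial>lebesgue_on R)"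
  proof (rule lim[where C = "\<bar>CA\<bar>"])
    show "\<bar>deriv (A n) (x $ 1) * B n (x $ 2)\<bar> \<le> \<bar>CA\<bar>" if "x \<in> R" for n x
    proof -
      have "\<bar>deriv (A n) (x $ 1)\<bar> * \<bar>B n (x $ 2)\<bar> \<le> \<bar>CA\<bar> * 1"
        using CA[of "1 / real (Suc n)" "x $ 1"] cutoff_mode_bound[of b "snd i" _ "x $ 2"] that
        unfolding A_def B_def by (intro mult_mono) (auto simp: Rect_def)
      then show ?thesis by (simp add: abs_mult)
    qed
    show "(\<lambda>n. deriv (A n) (x $ 1) * B n (x $ 2)) \<longlonglongrightarrow> ?f2 x" if "x \<in> R" for x
      unfolding A_def B_def using that by (intro tendsto_mult cutoff_mode_limits) (auto simp: Rect_def)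
  qed (intro cont smooth_deriv sm smooth_modes)+
  have l1: "(\<lambda>n. \<integral>x. g 1 x * (A n (x $ 1) * deriv (B n) (x $ 2)) \<partial>lebesgue_on R) \<longlonglongrightarrow> (\<integral>x. g 1 x * ?f1 x \<partial>lebesgue_on R)"
  proof (rule lim[where C = "\<bar>CB\<bar>"])
    show "\<bar>A n (x $ 1) * deriv (B n) (x $ 2)\<bar> \<le> \<bar>CB\<bar>" if "x \<in> R" for n x
    proof -
      have "\<bar>A n (x $ 1)\<bar> * \<bar>deriv (B n) (x $ 2)\<bar> \<le> 1 * \<bar>CB\<bar>"
        using CB[of "1 / real (Suc n)" "x $ 2"] cutoff_mode_bound[of a "fst i" _ "x $ 1"] that
        unfolding A_def B_def by (intro mult_mono) (auto simp: Rect_def)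
      then show ?thesis by (simp add: abs_mult)
    qed
    show "(\<lambda>n. A n (x $ 1) * deriv (B n) (x $ 2)) \<longlonglongrightarrow> ?f1 x" if "x \<in> R" for x
      unfolding A_def B_def using that by (intro tendsto_mult cutoff_mode_limits) (auto simp: Rect_def)
  qed (intro cont smooth_deriv sm smooth_modes)+
  have eq': "(\<integral>x. g 2 x * ?f2 x \<partial>lebesgue_on R) = (\<integral>x. g 1 x * ?f1 x \<partial>lebesgue_on R)"
    using l2 l1 unfolding eq by (rule LIMSEQ_unique)
  have "L2_inner R (bas i) (weak_grad R \<phi>) = (\<integral>x. amp i * (g 2 x * ?f2 x) - amp i * (g 1 x * ?f1 x) \<partial>lebesgue_on R)"
    unfolding L2_inner_def inner_vec_def sum_2 weak_grad_def bas_def g_def by (simp add: mult_ac)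
  also have "\<dots> = amp i * (\<integral>x. g 2 x * ?f2 x \<partial>lebesgue_on R) - amp i * (\<integral>x. g 1 x * ?f1 x \<partial>lebesgue_on R)"
    by (subst Bochner_Integration.integral_diff[OF integrable_mult_right[OF int] integrable_mult_right[OF int]])
       (auto intro!: cont smooth_modes simp only: integral_mult_right_zero)
  also have "\<dots> = 0" using eq' by simp
  finally show ?thesis .
qed

text \<open>Orthogonality to all weak gradients holds for the eigenfields and is stable under L2
  limits. Tested with compactly supported functions it is zero divergence, with all of H1 it is zero
  normal trace.\<close>

lemma limit_H_space:
  assumes w: "w \<in> L2 R" and lim: "(\<lambda>n. L2_norm R (\<lambda>x. psum (KK n) c x - w x)) \<longlonglongrightarrow> 0"
  shows "w \<in> H_space a b"
proof -
  have orth: "L2_inner R w (weak_grad R \<phi>) = 0" if \<phi>: "\<phi> \<in> H1 R" for \<phi>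
  proof -
    have "(\<lambda>n. L2_inner R (psum (KK n) c) (weak_grad R \<phi>)) \<longlonglongrightarrow> L2_inner R w (weak_grad R \<phi>)"
      by (rule L2_inner_tendsto[OF psum_L2 w weak_grad_L2[OF \<phi>] lim])
    then show ?thesis
      by (simp add: psum_inner_left weak_grad_L2[OF \<phi>] bas_weak_grad[OF \<phi>] LIMSEQ_const_iff)
  qed
  have div: "has_weak_div R w (\<lambda>x. 0)"
    unfolding has_weak_div_def
  proof
    fix \<phi> assume \<phi>: "\<phi> \<in> test_functions R"
    note s = test_functions_smooth[OF \<phi>]
    have H: "\<phi> \<in> H1 R" by (rule H1_smooth[OF a b s])
    have "AE x in lebesgue_on R. \<forall>i. weak_pderiv R i \<phi> x = pderiv_at (axis i 1) \<phi> x"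
      using weak_pderiv_smooth[OF a b s] by (simp add: AE_all_countable)
    then have AE: "AE x in lebesgue_on R. weak_grad R \<phi> x = (\<chi> i. pderiv_at (axis i 1) \<phi> x)"
      by eventually_elim (simp add: weak_grad_def)
    have "(\<lambda>x. \<chi> i. pderiv_at (axis i 1) \<phi> x) \<in> L2 R"
      by (simp add: L2_vec test_L2(2)[OF \<phi>])
    from L2_inner_cong_AE[OF w w weak_grad_L2[OF H] this _ AE]
    have "L2_inner R w (\<lambda>x. \<chi> i. pderiv_at (axis i 1) \<phi> x) = 0" using orth[OF H] by simp
    then show "L2_inner R w (\<lambda>x. \<chi> i. pderiv_at (axis i 1) \<phi> x) = - L2_inner R (\<lambda>x. 0) \<phi>"
      by (simp add: L2_inner_def)
  qed
  have "normal_trace_zero R w"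
    unfolding normal_trace_zero_def
    by (intro bexI[of _ "\<lambda>x. 0"] conjI ballI div L2.zero) (simp add: orth, simp add: L2_inner_def)
  then show ?thesis using w div by (simp add: H_space_def)
qed

text \<open>The divergence d occurring in the normal trace agrees almost everywhere with the weak
  divergence 0, so Green's formula with a product of cosines leaves orthogonality to its
  gradient.\<close>

lemma H_space_HH:
  assumes u: "u \<in> H_space a b" shows "u \<in> HH"
proof -
  have uL: "u \<in> L2 R" and div: "has_weak_div R u (\<lambda>x. 0)" and "normal_trace_zero R u"
    using u by (auto simp: H_space_def)
  then obtain d where d: "d \<in> L2 R" "has_weak_div R u d"
    and tr: "\<And>\<phi>. \<phi> \<in> H1 R \<Longrightarrow> L2_inner R u (weak_grad R \<phi>) + L2_inner R d \<phi> = 0"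
    by (auto simp: normal_trace_zero_def)
  have "AE x in lebesgue_on R. d x = 0"
    by (rule test_orthogonal_imp_zero[OF a b d(1)])
       (use div d(2) in \<open>auto simp: has_weak_div_def L2_inner_def\<close>)
  then have d0: "L2_inner R d \<phi> = 0" if "\<phi> \<in> L2 R" for \<phi>
    using L2_inner_cong_AE[OF d(1) L2.zero that that] L2.zero_left[OF that] by simp
  have "L2_inner R u (grad_cos j k) = 0" for j k
  proof -
    let ?\<phi> = "\<lambda>x::real^2. (1 * cosk a j (x $ 1)) * cosk b k (x $ 2)"
    have s: "smooth ?\<phi>" by (intro smooth_tensor smooth_const_cosk smooth_cosk)
    have H: "?\<phi> \<in> H1 R" by (rule H1_smooth[OF a b s])
    have "AE x in lebesgue_on R. \<forall>i. weak_pderiv R i ?\<phi> x = pderiv_at (axis i 1) ?\<phi> x"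
      using weak_pderiv_smooth[OF a b s] by (simp add: AE_all_countable)
    then have AE: "AE x in lebesgue_on R. grad_cos j k x = weak_grad R ?\<phi> x"
      by eventually_elim (simp add: weak_grad_def grad_cos_eq)
    have "L2_inner R u (grad_cos j k) = L2_inner R u (weak_grad R ?\<phi>)"
      by (rule L2_inner_cong_AE[OF uL uL grad_cos_L2 weak_grad_L2[OF H] _ AE]) simp
    also have "\<dots> = 0" using tr[OF H] d0[OF L2_smooth[OF s]] by simp
    finally show ?thesis .
  qed
  then show ?thesis using uL by (simp add: HH_def)
qed

end

section \<open>The trilinear form\<close>

text \<open>The value of f^2 at t exceeds that at s by at most the integral of |(f^2)'|; averaging
  over s gives the bound. The term f^2 / c takes the place of a zero boundary value, since
  tangential components need not vanish on the boundary.\<close>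

lemma sq_le_average:
  fixes f f' :: "real \<Rightarrow> real"
  assumes c: "c > 0" and d: "\<And>x. (f has_real_derivative f' x) (at x)" and f': "continuous_on UNIV f'"
    and t: "0 \<le> t" "t \<le> c"
  shows "ennreal ((f t)\<^sup>2) \<le> (\<integral>\<^sup>+s. ennreal ((f s)\<^sup>2 / c + 2 * (\<bar>f s\<bar> * \<bar>f' s\<bar>)) * indicator {0<..<c} s \<partial>lborel)"
proof -
  have fc: "continuous_on S f" for S
    using d by (meson DERIV_isCont continuous_at_imp_continuous_on)
  have fc': "continuous_on S f'" for S using f' continuous_on_subset by blast
  let ?k = "\<lambda>x. 2 * (f x * f' x)"
  have kint: "?k integrable_on {u..v}" for u v
    by (intro integrable_continuous_interval continuous_intros fc fc')
  have kabs: "(\<lambda>x. 2 * (\<bar>f x\<bar> * \<bar>f' x\<bar>)) integrable_on {u..v}" for u v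
    by (intro integrable_continuous_interval continuous_intros fc fc')
  have fint: "(\<lambda>x. (f x)\<^sup>2) integrable_on {u..v}" for u v
    by (intro integrable_continuous_interval continuous_intros fc)
  define I where "I = integral {0..c} (\<lambda>x. 2 * (\<bar>f x\<bar> * \<bar>f' x\<bar>))"
  have dd: "((\<lambda>x. (f x)\<^sup>2) has_vector_derivative ?k x) (at x within S)" for x S
  proof -
    have "((\<lambda>x. (f x)\<^sup>2) has_real_derivative ?k x) (at x)"
      using d by (auto intro!: derivative_eq_intros)
    then show ?thesis
      unfolding has_real_derivative_iff_has_vector_derivative by (rule has_vector_derivative_at_within)
  qed
  have diff: "\<bar>(f v)\<^sup>2 - (f u)\<^sup>2\<bar> \<le> I" if "0 \<le> u" "u \<le> v" "v \<le> c" for u v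
  proof -
    have "(?k has_integral ((f v)\<^sup>2 - (f u)\<^sup>2)) {u..v}"
      by (rule fundamental_theorem_of_calculus[OF that(2) dd])
    then have "(f v)\<^sup>2 - (f u)\<^sup>2 = integral {u..v} ?k" by (rule integral_unique[symmetric])
    also have "\<bar>\<dots>\<bar> \<le> integral {u..v} (\<lambda>x. 2 * (\<bar>f x\<bar> * \<bar>f' x\<bar>))"
      using integral_norm_bound_integral[OF kint kabs, of u v] by (simp add: abs_mult)
    also have "\<dots> \<le> I" unfolding I_def
      by (rule integral_subset_le) (use that kabs in auto)
    finally show ?thesis .
  qed
  have le: "(f t)\<^sup>2 \<le> (f s)\<^sup>2 + I" if s: "s \<in> {0..c}" for s
    using diff[of s t] diff[of t s] s t by (cases "s \<le> t") (auto simp: abs_le_iff)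
  have "c * (f t)\<^sup>2 = integral {0..c} (\<lambda>s. (f t)\<^sup>2)" using c by simp
  also have "\<dots> \<le> integral {0..c} (\<lambda>s. (f s)\<^sup>2 + I)"
    by (rule integral_le) (use le fint in \<open>auto intro!: integrable_add\<close>)
  also have "\<dots> = integral {0..c} (\<lambda>s. (f s)\<^sup>2) + c * I"
    using c by (subst integral_add[OF fint]) auto
  finally have "(f t)\<^sup>2 \<le> integral {0..c} (\<lambda>s. (f s)\<^sup>2) / c + I"
    using c by (simp add: field_simps)
  also have "\<dots> = integral {0..c} (\<lambda>s. (f s)\<^sup>2 / c + 2 * (\<bar>f s\<bar> * \<bar>f' s\<bar>))"
    unfolding I_def using fint kabs
    by (subst integral_add) (auto simp: integral_divide intro: integrable_on_divide)
  finally have le2: "(f t)\<^sup>2 \<le> integral {0..c} (\<lambda>s. (f s)\<^sup>2 / c + 2 * (\<bar>f s\<bar> * \<bar>f' s\<bar>))" .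
  have hi: "((\<lambda>s. (f s)\<^sup>2 / c + 2 * (\<bar>f s\<bar> * \<bar>f' s\<bar>)) has_integral
      integral {0..c} (\<lambda>s. (f s)\<^sup>2 / c + 2 * (\<bar>f s\<bar> * \<bar>f' s\<bar>))) {0<..<c}"
    unfolding has_integral_Icc_iff_Ioo[symmetric]
    by (intro integrable_integral integrable_add kabs) (use fint in \<open>simp add: integrable_on_divide\<close>)
  have "(\<integral>\<^sup>+s. ennreal ((f s)\<^sup>2 / c + 2 * (\<bar>f s\<bar> * \<bar>f' s\<bar>)) * indicator {0<..<c} s \<partial>lborel) =
      (\<integral>\<^sup>+s. ennreal (indicator {0<..<c} s * ((f s)\<^sup>2 / c + 2 * (\<bar>f s\<bar> * \<bar>f' s\<bar>))) \<partial>lborel)"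
    by (intro nn_integral_cong) (auto simp: indicator_def)
  also have "\<dots> = ennreal (integral {0..c} (\<lambda>s. (f s)\<^sup>2 / c + 2 * (\<bar>f s\<bar> * \<bar>f' s\<bar>)))"
  proof (rule nn_integral_has_integral_lebesgue[OF _ hi])
    show "0 \<le> (f s)\<^sup>2 / c + 2 * (\<bar>f s\<bar> * \<bar>f' s\<bar>)" for s using c by simp
  qed
  finally show ?thesis using le2 by (simp add: ennreal_leI)
qed

text \<open>f^2 is bounded by a function of the second variable alone and g^2 by a function of the
  first alone, so the integral of the product of the bounds factors.\<close>

lemma ladyzhenskaya_product:
  fixes f g :: "real^2 \<Rightarrow> real"
  assumes ab: "a > 0" "b > 0" and f: "smooth f" and g: "smooth g"
  defines "F \<equiv> \<lambda>x. (f x)\<^sup>2 / a + 2 * (\<bar>f x\<bar> * \<bar>pderiv_at (axis 1 1) f x\<bar>)"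
    and "G \<equiv> \<lambda>x. (g x)\<^sup>2 / b + 2 * (\<bar>g x\<bar> * \<bar>pderiv_at (axis 2 1) g x\<bar>)"
  shows "(\<integral>x. (f x)\<^sup>2 * (g x)\<^sup>2 \<partial>lebesgue_on (Rect a b)) \<le>
    (\<integral>x. F x \<partial>lebesgue_on (Rect a b)) * (\<integral>x. G x \<partial>lebesgue_on (Rect a b))"
proof -
  let ?M = "lebesgue_on (Rect a b)"
  note c = smooth_continuous[OF f, of UNIV] smooth_continuous[OF g, of UNIV]
    smooth_continuous[OF smooth_pderiv[OF f axis_in_Basis], of UNIV] smooth_continuous[OF smooth_pderiv[OF g axis_in_Basis], of UNIV]
  have Fc: "continuous_on UNIV F" unfolding F_def using ab by (intro continuous_intros c) auto
  have Gc: "continuous_on UNIV G" unfolding G_def using ab by (intro continuous_intros c) auto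
  have Fn: "F x \<ge> 0" and Gn: "G x \<ge> 0" for x using ab by (simp_all add: F_def G_def)
  have fgc: "continuous_on UNIV (\<lambda>x. (f x)\<^sup>2 * (g x)\<^sup>2)" by (intro continuous_intros c)
  note meas = borel_measurable_continuous_onI[OF Fc] borel_measurable_continuous_onI[OF Gc]
    borel_measurable_continuous_onI[OF fgc]
  have [measurable]: "F \<in> borel_measurable borel" "G \<in> borel_measurable borel" by (fact meas)+
  define HF where "HF y = (\<integral>\<^sup>+s. ennreal (F (vec2 s y)) * indicator {0<..<a} s \<partial>lborel)" for y
  define HG where "HG x = (\<integral>\<^sup>+s. ennreal (G (vec2 x s)) * indicator {0<..<b} s \<partial>lborel)" for x
  have v [measurable]: "(\<lambda>p. vec2 (fst p) (snd p)) \<in> borel_measurable (borel \<Otimes>\<^sub>M borel)"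
    "(\<lambda>p. vec2 (snd p) (fst p)) \<in> borel_measurable (borel \<Otimes>\<^sub>M borel)"
    unfolding borel_prod by (intro borel_measurable_continuous_onI continuous_intros)+
  have [measurable]: "HF \<in> borel_measurable lborel"
    unfolding HF_def[abs_def]
    by (rule lborel.borel_measurable_nn_integral)
       (use measurable_compose[OF v(2), of "\<lambda>x. ennreal (F x)"] in \<open>simp add: split_beta'\<close>)
  have [measurable]: "HG \<in> borel_measurable lborel"
    unfolding HG_def[abs_def]
    by (rule lborel.borel_measurable_nn_integral)
       (use measurable_compose[OF v(1), of "\<lambda>x. ennreal (G x)"] in \<open>simp add: split_beta'\<close>)
  have line: "((\<lambda>t. h (vec2 t y)) has_real_derivative pderiv_at (axis 1 1) h (vec2 t y)) (at t)"
      "((\<lambda>t. h (vec2 y t)) has_real_derivative pderiv_at (axis 2 1) h (vec2 y t)) (at t)" if "smooth h" for h :: "real^2 \<Rightarrow> real" and t y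
    using pderiv_line[OF smooth_differentiable[OF that], where x = "vec2 0 y" and t = t and i = "axis 1 1"]
      pderiv_line[OF smooth_differentiable[OF that], where x = "vec2 y 0" and t = t and i = "axis 2 1"]
    by (simp_all add: vec2_axis add.commute)
  have fb: "ennreal ((f (vec2 x y))\<^sup>2) \<le> HF y" if "x \<in> {0<..<a}" for x y
    unfolding HF_def F_def
    by (rule sq_le_average[OF ab(1) line(1)[OF f]])
       (use that in \<open>auto intro!: continuous_on_compose2[OF c(3)] continuous_intros\<close>)
  have gb: "ennreal ((g (vec2 x y))\<^sup>2) \<le> HG x" if "y \<in> {0<..<b}" for x y
    unfolding HG_def G_def
    by (rule sq_le_average[OF ab(2) line(2)[OF g]])
       (use that in \<open>auto intro!: continuous_on_compose2[OF c(4)] continuous_intros\<close>)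
  have "ennreal (\<integral>x. (f x)\<^sup>2 * (g x)\<^sup>2 \<partial>?M) = (\<integral>\<^sup>+x. ennreal ((f x)\<^sup>2 * (g x)\<^sup>2) \<partial>?M)"
    by (rule nn_integral_eq_integral[symmetric, OF integrable_continuous_Rect[OF fgc]]) auto
  also have "\<dots> = (\<integral>\<^sup>+x. (\<integral>\<^sup>+y. ennreal ((f (vec2 x y))\<^sup>2 * (g (vec2 x y))\<^sup>2) * indicator {0<..<b} y \<partial>lborel) * indicator {0<..<a} x \<partial>lborel)"
    by (rule nn_integral_Rect(1)) (use meas in measurable)
  also have "\<dots> \<le> (\<integral>\<^sup>+x. (\<integral>\<^sup>+y. (HF y * indicator {0<..<b} y) * HG x \<partial>lborel) * indicator {0<..<a} x \<partial>lborel)"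
  proof (rule nn_integral_mono)
    fix x :: real
    show "(\<integral>\<^sup>+y. ennreal ((f (vec2 x y))\<^sup>2 * (g (vec2 x y))\<^sup>2) * indicator {0<..<b} y \<partial>lborel) * indicator {0<..<a} x
       \<le> (\<integral>\<^sup>+y. (HF y * indicator {0<..<b} y) * HG x \<partial>lborel) * indicator {0<..<a} x"
    proof (cases "x \<in> {0<..<a}")
      case True
      have "ennreal ((f (vec2 x y))\<^sup>2 * (g (vec2 x y))\<^sup>2) * indicator {0<..<b} y \<le> (HF y * indicator {0<..<b} y) * HG x" for y
        using fb[OF True, of y] gb[of y x]
        by (cases "y \<in> {0<..<b}") (auto simp: ennreal_mult intro!: mult_mono)
      then show ?thesis using True by (auto intro!: nn_integral_mono)
    qed simp
  qed
  also have "\<dots> = (\<integral>\<^sup>+y. HF y * indicator {0<..<b} y \<partial>lborel) * (\<integral>\<^sup>+x. HG x * indicator {0<..<a} x \<partial>lborel)"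
  proof -
    have "(\<integral>\<^sup>+y. (HF y * indicator {0<..<b} y) * HG x \<partial>lborel) * indicator {0<..<a} x =
      (\<integral>\<^sup>+y. HF y * indicator {0<..<b} y \<partial>lborel) * (HG x * indicator {0<..<a} x)" for x
      by (subst nn_integral_multc) (simp_all only: mult.assoc, measurable)
    then show ?thesis by (simp only:) (rule nn_integral_cmult, measurable)
  qed
  also have "(\<integral>\<^sup>+y. HF y * indicator {0<..<b} y \<partial>lborel) = (\<integral>\<^sup>+x. ennreal (F x) \<partial>?M)"
    unfolding HF_def by (rule nn_integral_Rect(2)[symmetric]) measurable
  also have "(\<integral>\<^sup>+x. HG x * indicator {0<..<a} x \<partial>lborel) = (\<integral>\<^sup>+x. ennreal (G x) \<partial>?M)"
    unfolding HG_def by (rule nn_integral_Rect(1)[symmetric]) measurable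
  also have "(\<integral>\<^sup>+x. ennreal (F x) \<partial>?M) = ennreal (\<integral>x. F x \<partial>?M)"
    by (rule nn_integral_eq_integral[OF integrable_continuous_Rect[OF Fc]]) (simp add: Fn)
  also have "(\<integral>\<^sup>+x. ennreal (G x) \<partial>?M) = ennreal (\<integral>x. G x \<partial>?M)"
    by (rule nn_integral_eq_integral[OF integrable_continuous_Rect[OF Gc]]) (simp add: Gn)
  finally have "ennreal (\<integral>x. (f x)\<^sup>2 * (g x)\<^sup>2 \<partial>?M) \<le> ennreal ((\<integral>x. F x \<partial>?M) * (\<integral>x. G x \<partial>?M))"
    by (simp add: ennreal_mult Fn Gn)
  then show ?thesis
    by (subst (asm) ennreal_le_iff) (auto simp: Fn Gn)
qed

lemma L2_triple:
  fixes f g h :: "real^2 \<Rightarrow> real"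
  assumes f: "f \<in> L2 S" and g: "g \<in> L2 S" and h: "h \<in> borel_measurable (lebesgue_on S)"
    "\<And>x. x \<in> S \<Longrightarrow> \<bar>h x\<bar> \<le> W" "W \<ge> 0"
  shows "integrable (lebesgue_on S) (\<lambda>x. f x * g x * h x)"
    and "\<bar>\<integral>x. f x * g x * h x \<partial>lebesgue_on S\<bar> \<le> W * L2_norm S f * L2_norm S g"
proof -
  note hf = L2_mult_bounded[OF f h]
  have eq: "(\<lambda>x. f x * g x * h x) = (\<lambda>x. (h x *\<^sub>R f x) \<bullet> g x)" by (simp add: fun_eq_iff)
  show "integrable (lebesgue_on S) (\<lambda>x. f x * g x * h x)"
    unfolding eq by (rule L2_inner_integrable[OF hf(1) g])
  have "\<bar>L2_inner S (\<lambda>x. h x *\<^sub>R f x) g\<bar> \<le> L2_norm S (\<lambda>x. h x *\<^sub>R f x) * L2_norm S g"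
    by (rule L2_CS[OF hf(1) g])
  also have "\<dots> \<le> W * L2_norm S f * L2_norm S g" by (rule mult_right_mono[OF hf(2) L2_norm_nonneg])
  finally show "\<bar>\<integral>x. f x * g x * h x \<partial>lebesgue_on S\<bar> \<le> W * L2_norm S f * L2_norm S g"
    unfolding eq L2_inner_def .
qed

section \<open>Integrability, bounds and antisymmetry of the trilinear form\<close>

context rectangle
begin

text \<open>The integral of a nonintegrable function is 0 by convention, so additivity of
  \<open>b_form\<close> in an argument presupposes integrability; this predicate carries it
  along.\<close>

definition b_integrable :: "vector_field \<Rightarrow> vector_field \<Rightarrow> vector_field \<Rightarrow> bool" where
  "b_integrable u v w \<longleftrightarrow> (\<forall>i j. integrable (lebesgue_on R) (\<lambda>x. u x $ i * wd i j v x * w x $ j))"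

lemma component_bound: "norm (w x :: real^2) \<le> W \<Longrightarrow> \<bar>w x $ j\<bar> \<le> W"
  using component_le_norm_cart[of "w x" j] by simp

text \<open>The factor 4 counts the index pairs (i, j) in dimension two.\<close>

lemma b_sum_bound:
  assumes "\<And>i j. \<bar>\<integral>x. u x $ i * wd i j v x * w x $ j \<partial>lebesgue_on R\<bar> \<le> C"
  shows "\<bar>b_form a b u v w\<bar> \<le> 4 * C"
  using assms[of 1 1] assms[of 1 2] assms[of 2 1] assms[of 2 2]
  unfolding b_form_def sum_2 by linarith

lemma b_bound_right:
  assumes u: "u \<in> L2 R" and v: "v \<in> H1_vec R" and w: "w \<in> L2 R" and W: "\<And>x. x \<in> R \<Longrightarrow> norm (w x) \<le> W" "W \<ge> 0"
  shows "b_integrable u v w" and "\<bar>b_form a b u v w\<bar> \<le> 4 * (W * L2_norm R u * V_norm a b v)"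
proof -
  have t: "integrable (lebesgue_on R) (\<lambda>x. u x $ i * wd i j v x * w x $ j)"
     "\<bar>\<integral>x. u x $ i * wd i j v x * w x $ j \<partial>lebesgue_on R\<bar> \<le> W * L2_norm R (\<lambda>x. u x $ i) * L2_norm R (wd i j v)" for i j
    by (rule L2_triple; use u v w W in \<open>auto simp: L2_vec wd_L2 L2D(1) intro!: component_bound\<close>)+
  show "b_integrable u v w" using t(1) by (simp add: b_integrable_def)
  have "W * L2_norm R (\<lambda>x. u x $ i) * L2_norm R (wd i j v) \<le> W * L2_norm R u * V_norm a b v" for i j
    by (intro mult_mono mult_left_mono L2_norm_component u wd_norm_le v W) (simp_all add: W)
  then show "\<bar>b_form a b u v w\<bar> \<le> 4 * (W * L2_norm R u * V_norm a b v)"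
    by (intro b_sum_bound order_trans[OF t(2)])
qed

lemma b_bound_left:
  assumes u: "u \<in> L2 R" and v: "v \<in> H1_vec R" and w: "w \<in> L2 R" and W: "\<And>x. x \<in> R \<Longrightarrow> norm (u x) \<le> W" "W \<ge> 0"
  shows "b_integrable u v w" and "\<bar>b_form a b u v w\<bar> \<le> 4 * (W * L2_norm R w * V_norm a b v)"
proof -
  have eq: "(\<lambda>x. u x $ i * wd i j v x * w x $ j) = (\<lambda>x. w x $ j * wd i j v x * u x $ i)" for i j
    by (simp add: fun_eq_iff)
  have t: "integrable (lebesgue_on R) (\<lambda>x. u x $ i * wd i j v x * w x $ j)"
     "\<bar>\<integral>x. u x $ i * wd i j v x * w x $ j \<partial>lebesgue_on R\<bar> \<le> W * L2_norm R (\<lambda>x. w x $ j) * L2_norm R (wd i j v)" for i j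
    unfolding eq
    by (rule L2_triple; use u v w W in \<open>auto simp: L2_vec wd_L2 L2D(1) intro!: component_bound\<close>)+
  show "b_integrable u v w" using t(1) by (simp add: b_integrable_def)
  have "W * L2_norm R (\<lambda>x. w x $ j) * L2_norm R (wd i j v) \<le> W * L2_norm R w * V_norm a b v" for i j
    by (intro mult_mono mult_left_mono L2_norm_component w wd_norm_le v W) (simp_all add: W)
  then show "\<bar>b_form a b u v w\<bar> \<le> 4 * (W * L2_norm R w * V_norm a b v)"
    by (intro b_sum_bound order_trans[OF t(2)])
qed

lemma b_diff_left:
  assumes "b_integrable u v w" "b_integrable u' v w"
  shows "b_form a b (\<lambda>x. u x - u' x) v w = b_form a b u v w - b_form a b u' v w"
  using assms unfolding b_form_def b_integrable_def
  by (simp add: left_diff_distrib sum_subtractf)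

lemma b_diff_mid:
  assumes v: "v \<in> H1_vec R" "v' \<in> H1_vec R" and i: "b_integrable u v w" "b_integrable u v' w"
    and m: "u \<in> L2 R" "w \<in> L2 R"
  shows "b_form a b u (\<lambda>x. v x - v' x) w = b_form a b u v w - b_form a b u v' w"
proof -
  have "(\<integral>x. u x $ i * wd i j (\<lambda>x. v x - v' x) x * w x $ j \<partial>lebesgue_on R) =
     (\<integral>x. u x $ i * wd i j v x * w x $ j - u x $ i * wd i j v' x * w x $ j \<partial>lebesgue_on R)" for i j
  proof (rule integral_cong_AE)
    have [measurable]: "(\<lambda>x. u x $ i) \<in> borel_measurable (lebesgue_on R)" "(\<lambda>x. w x $ j) \<in> borel_measurable (lebesgue_on R)"
      "wd i j (\<lambda>x. v x - v' x) \<in> borel_measurable (lebesgue_on R)"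
      using m wd_L2[OF D.diff[OF v], of i j] by (auto simp: L2_vec L2D(1))
    show "(\<lambda>x. u x $ i * wd i j (\<lambda>x. v x - v' x) x * w x $ j) \<in> borel_measurable (lebesgue_on R)"
      by (intro borel_measurable_times) fact+
    show "(\<lambda>x. u x $ i * wd i j v x * w x $ j - u x $ i * wd i j v' x * w x $ j) \<in> borel_measurable (lebesgue_on R)"
      using i unfolding b_integrable_def by (intro borel_measurable_diff borel_measurable_integrable) auto
    show "AE x in lebesgue_on R. u x $ i * wd i j (\<lambda>x. v x - v' x) x * w x $ j = u x $ i * wd i j v x * w x $ j - u x $ i * wd i j v' x * w x $ j"
      using wd_diff[OF v, of i j] by eventually_elim (simp only: right_diff_distrib left_diff_distrib)
  qed
  then show ?thesis
    using i unfolding b_form_def b_integrable_def by (simp add: sum_subtractf)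
qed

lemma b_sum_right:
  assumes "\<And>i. i \<in> I \<Longrightarrow> b_integrable u v (f i)"
  shows "b_form a b u v (\<lambda>x. \<Sum>i\<in>I. c i *\<^sub>R f i x) = (\<Sum>i\<in>I. c i * b_form a b u v (f i))"
proof -
  have t: "(\<integral>x. u x $ k * wd k j v x * (\<Sum>i\<in>I. c i *\<^sub>R f i x) $ j \<partial>lebesgue_on R) =
     (\<Sum>i\<in>I. c i * (\<integral>x. u x $ k * wd k j v x * f i x $ j \<partial>lebesgue_on R))" for k j
  proof -
    have "(\<integral>x. u x $ k * wd k j v x * (\<Sum>i\<in>I. c i *\<^sub>R f i x) $ j \<partial>lebesgue_on R) =
      (\<integral>x. (\<Sum>i\<in>I. c i * (u x $ k * wd k j v x * f i x $ j)) \<partial>lebesgue_on R)"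
      by (simp add: sum_distrib_left mult_ac)
    also have "\<dots> = (\<Sum>i\<in>I. \<integral>x. c i * (u x $ k * wd k j v x * f i x $ j) \<partial>lebesgue_on R)"
      by (rule Bochner_Integration.integral_sum) (use assms in \<open>auto simp: b_integrable_def\<close>)
    finally show ?thesis by simp
  qed
  show ?thesis unfolding b_form_def t sum_2 by (simp add: sum.distrib distrib_left)
qed

lemma D1_bounded:
  assumes "w \<in> D1 a b" obtains W where "W \<ge> 0" "\<And>x. x \<in> R \<Longrightarrow> norm (w x) \<le> W"
proof -
  obtain B where "B > 0" "\<And>x. x \<in> closed_Rect a b \<Longrightarrow> norm (w x) \<le> B"
    using continuous_bounded_Rect[OF smooth_continuous[OF D1_smooth[OF assms]]] by blast
  then show ?thesis using that[of B] Rect_subset_closed[of a b] by auto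
qed

lemma b_integrable_D1_right: "u \<in> L2 R \<Longrightarrow> v \<in> H1_vec R \<Longrightarrow> w \<in> D1 a b \<Longrightarrow> b_integrable u v w"
  by (metis D1_bounded b_bound_right(1) D1_V V_L2)

lemma b_integrable_D1_left: "u \<in> D1 a b \<Longrightarrow> v \<in> H1_vec R \<Longrightarrow> w \<in> L2 R \<Longrightarrow> b_integrable u v w"
  by (metis D1_bounded b_bound_left(1) D1_V V_L2)

text \<open>Integration by parts moves the derivative off v: u_i = 0 on the faces orthogonal to
  direction i removes the boundary term, and the derivatives falling on u add up to the divergence,
  which is zero.\<close>

lemma b_antisym_D1:
  assumes u: "u \<in> D1 a b" and v: "v \<in> D1 a b" and w: "w \<in> D1 a b"
  shows "b_form a b u v w = - b_form a b u w v"
proof -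
  note s = D1_smooth[OF u] D1_smooth[OF v] D1_smooth[OF w]
  have sc: "smooth (\<lambda>x. u x $ i)" "smooth (\<lambda>x. v x $ i)" "smooth (\<lambda>x. w x $ i)" for i
    by (intro smooth_component s)+
  have bb: "b_form a b u v w = (\<Sum>i\<in>UNIV. \<Sum>j\<in>UNIV. \<integral>x. pderiv_at (axis i 1) v x $ j * (u x $ i * w x $ j) \<partial>lebesgue_on R)"
    if v: "v \<in> D1 a b" and w: "w \<in> D1 a b" for v w
    unfolding b_form_def
  proof (intro sum.cong refl integral_cong_AE)
    fix i j
    show "(\<lambda>x. u x $ i * wd i j v x * w x $ j) \<in> borel_measurable (lebesgue_on R)"
      using b_integrable_D1_right[OF V_L2[OF D1_V[OF u]] D1_H1[OF v] w] by (auto simp: b_integrable_def)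
    show "(\<lambda>x. pderiv_at (axis i 1) v x $ j * (u x $ i * w x $ j)) \<in> borel_measurable (lebesgue_on R)"
      by (intro borel_measurable_continuous_Rect continuous_on_mult smooth_continuous smooth_component smooth_pderiv axis_in_Basis D1_smooth[OF u] D1_smooth[OF v] D1_smooth[OF w])
    show "AE x in lebesgue_on R. u x $ i * wd i j v x * w x $ j = pderiv_at (axis i 1) v x $ j * (u x $ i * w x $ j)"
      using wd_smooth[OF D1_smooth[OF v], of i j] by eventually_elim simp
  qed
  have t: "(\<integral>x. pderiv_at (axis i 1) v x $ j * (u x $ i * w x $ j) \<partial>lebesgue_on R) =
     - (\<integral>x. pderiv_at (axis i 1) u x $ i * (v x $ j * w x $ j) \<partial>lebesgue_on R)
     - (\<integral>x. pderiv_at (axis i 1) w x $ j * (u x $ i * v x $ j) \<partial>lebesgue_on R)" for i j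
  proof -
    have "(\<integral>x. pderiv_at (axis i 1) (\<lambda>x. v x $ j) x * (u x $ i * w x $ j) \<partial>lebesgue_on R) =
      - (\<integral>x. v x $ j * pderiv_at (axis i 1) (\<lambda>x. u x $ i * w x $ j) x \<partial>lebesgue_on R)"
      by (rule integral_by_parts_Rect) (use D1_face[OF u] a b sc in \<open>auto intro!: smooth_mult\<close>)
    also have "pderiv_at (axis i 1) (\<lambda>x. u x $ i * w x $ j) = (\<lambda>x. u x $ i * pderiv_at (axis i 1) w x $ j + pderiv_at (axis i 1) u x $ i * w x $ j)"
      by (rule ext, subst pderiv_at_mult) (simp_all add: smooth_differentiable sc pderiv_component_smooth s)
    also have "(\<integral>x. v x $ j * (u x $ i * pderiv_at (axis i 1) w x $ j + pderiv_at (axis i 1) u x $ i * w x $ j) \<partial>lebesgue_on R)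
      = (\<integral>x. pderiv_at (axis i 1) w x $ j * (u x $ i * v x $ j) + pderiv_at (axis i 1) u x $ i * (v x $ j * w x $ j) \<partial>lebesgue_on R)"
      by (simp add: algebra_simps)
    also have "\<dots> = (\<integral>x. pderiv_at (axis i 1) w x $ j * (u x $ i * v x $ j) \<partial>lebesgue_on R) + (\<integral>x. pderiv_at (axis i 1) u x $ i * (v x $ j * w x $ j) \<partial>lebesgue_on R)"
      by (intro Bochner_Integration.integral_add integrable_continuous_Rect continuous_on_mult smooth_continuous smooth_component smooth_pderiv axis_in_Basis s)
    finally show ?thesis by (simp add: pderiv_component_smooth s)
  qed
  have d: "(\<Sum>i\<in>UNIV. \<integral>x. pderiv_at (axis i 1) u x $ i * (v x $ j * w x $ j) \<partial>lebesgue_on R) = 0" for j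
  proof -
    have "(\<Sum>i\<in>UNIV. \<integral>x. pderiv_at (axis i 1) u x $ i * (v x $ j * w x $ j) \<partial>lebesgue_on R)
      = (\<integral>x. (\<Sum>i\<in>UNIV. pderiv_at (axis i 1) u x $ i * (v x $ j * w x $ j)) \<partial>lebesgue_on R)"
      by (intro Bochner_Integration.integral_sum[symmetric] integrable_continuous_Rect continuous_on_mult smooth_continuous smooth_component smooth_pderiv axis_in_Basis s)
    also have "\<dots> = (\<integral>x. divergence u x * (v x $ j * w x $ j) \<partial>lebesgue_on R)"
      by (simp add: divergence_def sum_distrib_right)
    also have "\<dots> = (\<integral>x. 0 \<partial>lebesgue_on R)"
      by (rule Bochner_Integration.integral_cong) (use D1_div[OF u] in auto)
    finally show ?thesis by simp
  qed
  have "b_form a b u v w = - (\<Sum>j\<in>UNIV. \<Sum>i\<in>UNIV. \<integral>x. pderiv_at (axis i 1) u x $ i * (v x $ j * w x $ j) \<partial>lebesgue_on R) - b_form a b u w v"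
    unfolding bb[OF v w] bb[OF w v] t sum_2 by simp
  then show ?thesis by (simp add: d)
qed

lemma tendsto_zero_eq:
  fixes X :: real
  assumes "\<And>n. \<bar>X\<bar> \<le> f n" "f \<longlonglongrightarrow> 0" shows "X = 0"
  using LIMSEQ_le[OF tendsto_const[of "\<bar>X\<bar>"] assms(2)] assms(1) by auto

text \<open>For bounded p with square-integrable gradient the form is continuous in its first
  argument for the L2 norm, so the identity, known on D1 by antisymmetry, extends to u in V.\<close>

lemma b_self_zero:
  assumes u: "u \<in> V_space a b" and p: "p \<in> D1 a b"
  shows "b_form a b u p p = 0"
proof -
  obtain v where v: "\<And>n. v n \<in> D1 a b" "(\<lambda>n. L2_norm R (\<lambda>x. u x - v n x)) \<longlonglongrightarrow> 0"
    using V_approx[OF u] by blast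
  obtain W where W: "W \<ge> 0" "\<And>x. x \<in> R \<Longrightarrow> norm (p x) \<le> W" using D1_bounded[OF p] by blast
  note pL = V_L2[OF D1_V[OF p]] and vL = V_L2[OF D1_V[OF v(1)]]
  have "\<bar>b_form a b u p p\<bar> \<le> 4 * (W * L2_norm R (\<lambda>x. u x - v n x) * V_norm a b p)" for n
  proof -
    have "b_form a b (v n) p p = 0" using b_antisym_D1[OF v(1)[of n] p p] by simp
    then have "b_form a b u p p = b_form a b (\<lambda>x. u x - v n x) p p"
      using b_diff_left[OF b_integrable_D1_right[OF V_L2[OF u] D1_H1[OF p] p] b_integrable_D1_right[OF vL D1_H1[OF p] p], of n] by simp
    then show ?thesis
      using b_bound_right(2)[OF L2.diff[OF V_L2[OF u] vL] D1_H1[OF p] pL W(2,1), of n] by simp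
  qed
  moreover have "(\<lambda>n. 4 * (W * L2_norm R (\<lambda>x. u x - v n x) * V_norm a b p)) \<longlonglongrightarrow> 0"
    by (intro tendsto_mult_right_zero tendsto_mult_left_zero v(2))
  ultimately show ?thesis by (rule tendsto_zero_eq)
qed

lemma b_antisym:
  assumes p: "p \<in> D1 a b" and q: "q \<in> V_space a b" and w: "w \<in> D1 a b"
  shows "b_form a b p q w = - b_form a b p w q"
proof -
  obtain v where v: "\<And>n. v n \<in> D1 a b" "(\<lambda>n. L2_norm R (\<lambda>x. q x - v n x)) \<longlonglongrightarrow> 0"
      "(\<lambda>n. V_norm a b (\<lambda>x. q x - v n x)) \<longlonglongrightarrow> 0"
    using V_approx[OF q] by blast
  obtain P where P: "P \<ge> 0" "\<And>x. x \<in> R \<Longrightarrow> norm (p x) \<le> P" using D1_bounded[OF p] by blast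
  note pL = V_L2[OF D1_V[OF p]] and wL = V_L2[OF D1_V[OF w]] and vL = V_L2[OF D1_V[OF v(1)]] and qL = V_L2[OF q]
  have "\<bar>b_form a b p q w + b_form a b p w q\<bar> \<le>
    4 * (P * L2_norm R w * V_norm a b (\<lambda>x. q x - v n x)) + 4 * (P * L2_norm R (\<lambda>x. q x - v n x) * V_norm a b w)" for n
  proof -
    have 1: "b_form a b p (\<lambda>x. q x - v n x) w = b_form a b p q w - b_form a b p (v n) w"
      by (rule b_diff_mid[OF V_H1[OF q] D1_H1[OF v(1)] b_integrable_D1_left[OF p V_H1[OF q] wL] b_integrable_D1_left[OF p D1_H1[OF v(1)] wL] pL wL])
    \<comment> \<open>The difference is written as a linear combination over two booleans with
      coefficients 1 and -1.\<close>
    have 2: "b_form a b p w (\<lambda>x. q x - v n x) = b_form a b p w q - b_form a b p w (v n)"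
      using b_sum_right[of "{True, False}" p w "\<lambda>c. if c then q else v n" "\<lambda>c. if c then 1 else -1"]
        b_integrable_D1_left[OF p D1_H1[OF w] qL] b_integrable_D1_left[OF p D1_H1[OF w] vL] by simp
    have "b_form a b p q w + b_form a b p w q = b_form a b p (\<lambda>x. q x - v n x) w + b_form a b p w (\<lambda>x. q x - v n x)"
      using b_antisym_D1[OF p v(1)[of n] w] 1 2 by simp
    then show ?thesis
      using b_bound_left(2)[OF pL V_H1[OF V_diff[OF q D1_V[OF v(1)]]] wL P(2,1), of n]
        b_bound_left(2)[OF pL D1_H1[OF w] L2.diff[OF qL vL] P(2,1), of n] by linarith
  qed
  moreover have "(\<lambda>n. 4 * (P * L2_norm R w * V_norm a b (\<lambda>x. q x - v n x)) + 4 * (P * L2_norm R (\<lambda>x. q x - v n x) * V_norm a b w)) \<longlonglongrightarrow> 0"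
    by (intro tendsto_add_zero tendsto_mult_right_zero tendsto_mult_left_zero v)
  ultimately have "b_form a b p q w + b_form a b p w q = 0" by (rule tendsto_zero_eq)
  then show ?thesis by simp
qed

section \<open>Estimates with projections, uniform in the truncation\<close>

definition bern :: real where "bern = 2 / sqrt (a * b)"

lemma bern_pos: "bern > 0" using a b by (simp add: bern_def)

lemma PP_bound: "norm (PP n u x) \<le> bern * n * L2_norm R (PP n u)"
  unfolding bern_def by (rule psum_bound)

text \<open>The form of the tail bound that absorbs a factor n coming from \<open>PP_bound\<close>;
  the bound with n + 1 gives it at once, n = 0 included.\<close>

lemma scaled_tail:
  assumes u: "u \<in> V_space a b"
  shows "n * L2_norm R (\<lambda>x. u x - PP n u x) \<le> V_norm a b (\<lambda>x. u x - PP n u x) / sqrt kap"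
proof -
  have "sqrt kap * (n * L2_norm R (\<lambda>x. u x - PP n u x)) \<le> sqrt kap * (real n + 1) * L2_norm R (\<lambda>x. u x - PP n u x)"
    using kap_pos by (simp add: algebra_simps)
  also have "\<dots> \<le> V_norm a b (\<lambda>x. u x - PP n u x)" by (rule tail_poincare[OF u])
  finally show ?thesis using kap_pos by (simp add: field_simps)
qed

text \<open>With \<open>p = PP n z\<close> and \<open>q = z - p\<close> one has
  \<open>b(u,z,p) = b(u,q,p) = b(u - PP n u, q, p) - b(PP n u, p, q)\<close>. The factor \<open>n\<close> lost in bounding a
  projection in the supremum norm is regained from the tails \<open>u - PP n u\<close> and \<open>q\<close>.\<close>

lemma b_projection:
  assumes u: "u \<in> V_space a b" and z: "z \<in> V_space a b"
  shows "\<bar>b_form a b u z (PP n z)\<bar> \<le> 8 * bern / sqrt kap * V_norm a b (\<lambda>x. z x - PP n z x) *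
    (V_norm a b u * L2_norm R (PP n z) + L2_norm R (PP n u) * V_norm a b (PP n z))"
proof -
  let ?p = "PP n z" and ?Pu = "PP n u"
  let ?q = "\<lambda>x. z x - PP n z x" and ?Qu = "\<lambda>x. u x - PP n u x"
  have p: "?p \<in> D1 a b" and Pu: "?Pu \<in> D1 a b" by (rule psum_D1)+
  have q: "?q \<in> V_space a b" and Qu: "?Qu \<in> V_space a b" by (intro V_diff u z psum_V)+
  note uL = V_L2[OF u] and pL = V_L2[OF D1_V[OF p]] and PuL = V_L2[OF D1_V[OF Pu]]
  have "b_form a b u ?q ?p = b_form a b u z ?p - b_form a b u ?p ?p"
    by (rule b_diff_mid[OF V_H1[OF z] D1_H1[OF p] b_integrable_D1_right[OF uL V_H1[OF z] p]
        b_integrable_D1_right[OF uL D1_H1[OF p] p] uL pL])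
  then have 1: "b_form a b u z ?p = b_form a b u ?q ?p" by (simp add: b_self_zero[OF u p])
  have 2: "b_form a b ?Qu ?q ?p = b_form a b u ?q ?p - b_form a b ?Pu ?q ?p"
    by (rule b_diff_left[OF b_integrable_D1_right[OF uL V_H1[OF q] p] b_integrable_D1_right[OF PuL V_H1[OF q] p]])
  have 3: "b_form a b ?Pu ?q ?p = - b_form a b ?Pu ?p ?q" by (rule b_antisym[OF Pu q p])
  have nn: "0 \<le> bern * n * L2_norm R w" for w :: vector_field using bern_pos by simp
  have e1: "\<bar>b_form a b ?Qu ?q ?p\<bar> \<le> 4 * (bern * n * L2_norm R ?p * L2_norm R ?Qu * V_norm a b ?q)"
    by (rule b_bound_right(2)[OF V_L2[OF Qu] V_H1[OF q] pL PP_bound nn])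
  have e2: "\<bar>b_form a b ?Pu ?p ?q\<bar> \<le> 4 * (bern * n * L2_norm R ?Pu * L2_norm R ?q * V_norm a b ?p)"
    by (rule b_bound_left(2)[OF PuL D1_H1[OF p] V_L2[OF q] PP_bound nn])
  \<comment> \<open>The factor 2 here turns the 4 of the index pairs into the 8 of the
    statement.\<close>
  have Qle: "V_norm a b ?Qu \<le> 2 * V_norm a b u"
    using V_tri_sub[OF V_H1[OF u] D1_H1[OF Pu]] PP_V_norm_le[OF u, of n] by simp
  have k: "sqrt kap > 0" using kap_pos by simp
  have f1: "4 * (bern * n * L2_norm R ?p * L2_norm R ?Qu * V_norm a b ?q)
     \<le> 8 * bern / sqrt kap * V_norm a b ?q * (V_norm a b u * L2_norm R ?p)"
  proof -
    have "n * L2_norm R ?Qu \<le> 2 * V_norm a b u / sqrt kap"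
      using scaled_tail[OF u, of n] divide_right_mono[OF Qle, of "sqrt kap"] k by linarith
    then have "(4 * bern * L2_norm R ?p * V_norm a b ?q) * (n * L2_norm R ?Qu)
       \<le> (4 * bern * L2_norm R ?p * V_norm a b ?q) * (2 * V_norm a b u / sqrt kap)"
      using bern_pos by (intro mult_left_mono) auto
    then show ?thesis by (simp add: mult_ac)
  qed
  have f2: "4 * (bern * n * L2_norm R ?Pu * L2_norm R ?q * V_norm a b ?p)
     \<le> 8 * bern / sqrt kap * V_norm a b ?q * (L2_norm R ?Pu * V_norm a b ?p)"
  proof -
    have "n * L2_norm R ?q \<le> 2 * V_norm a b ?q / sqrt kap"
      using scaled_tail[OF z, of n] k divide_right_mono[of "V_norm a b ?q" "2 * V_norm a b ?q" "sqrt kap"] by simp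
    then have "(4 * bern * L2_norm R ?Pu * V_norm a b ?p) * (n * L2_norm R ?q)
       \<le> (4 * bern * L2_norm R ?Pu * V_norm a b ?p) * (2 * V_norm a b ?q / sqrt kap)"
      using bern_pos by (intro mult_left_mono) auto
    then show ?thesis by (simp add: mult_ac)
  qed
  have "\<bar>b_form a b u z ?p\<bar> \<le> \<bar>b_form a b ?Qu ?q ?p\<bar> + \<bar>b_form a b ?Pu ?p ?q\<bar>"
    using 1 2 3 by linarith
  also have "\<dots> \<le> 8 * bern / sqrt kap * V_norm a b ?q * (V_norm a b u * L2_norm R ?p)
     + 8 * bern / sqrt kap * V_norm a b ?q * (L2_norm R ?Pu * V_norm a b ?p)"
    using e1 e2 f1 f2 by linarith
  finally show ?thesis by (simp only: distrib_left)
qed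

text \<open>Each bracket is the constant of one line average: 1 / (c sqrt kap) from Poincare's
  inequality applied to the term f^2 / c, and 2 from the derivative of f^2. The sum bounds each
  bracket, so its square bounds their product.\<close>

definition lad :: real where
  "lad = (1 / (a * sqrt kap) + 2) + (1 / (b * sqrt kap) + 2)"

lemma lad_pos: "lad > 0" using a b kap_pos by (simp add: lad_def add_pos_pos)

text \<open>\<open>ladyzhenskaya_product\<close> is applied to two components, one averaged in each
  direction. Poincare's inequality trades one factor |p| of the zero order term for
  \<parallel>p\<parallel>, so both averages are bounded by multiples of |p|
  \<parallel>p\<parallel>.\<close>

lemma ladyzhenskaya_component:
  assumes p: "p \<in> D1 a b"
  shows "L2_norm R (\<lambda>x. p x $ i * p x $ j) \<le> lad * (L2_norm R p * V_norm a b p)"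
proof -
  note sc = smooth_component[OF D1_smooth[OF p]]
  note pV = D1_V[OF p] and pL = V_L2[OF D1_V[OF p]]
  have k: "sqrt kap > 0" using kap_pos by simp
  have P: "L2_norm R p \<le> V_norm a b p / sqrt kap"
    using poincare[OF pV] k by (simp add: field_simps)
  have est: "(\<integral>x. (p x $ i)\<^sup>2 / c + 2 * (\<bar>p x $ i\<bar> * \<bar>pderiv_at (axis k 1) (\<lambda>x. p x $ i) x\<bar>) \<partial>lebesgue_on R)
      \<le> (1 / (c * sqrt kap) + 2) * (L2_norm R p * V_norm a b p)" if c: "c > 0" for c i k
  proof -
    note L = L2_smooth[OF sc[of i], of a b] L2_smooth[OF smooth_pderiv[OF sc[of i] axis_in_Basis[of k]], of a b]
    have dn: "L2_norm R (pderiv_at (axis k 1) (\<lambda>x. p x $ i)) \<le> V_norm a b p"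
    proof -
      have "L2_norm R (pderiv_at (axis k 1) (\<lambda>x. p x $ i)) = L2_norm R (wd k i p)"
        unfolding L2_norm_def pderiv_component_smooth[OF D1_smooth[OF p]]
        by (intro arg_cong[of _ _ sqrt] L2_inner_cong_AE)
           (use wd_smooth[OF D1_smooth[OF p], of k i] wd_L2[OF D1_H1[OF p]] L2_smooth[OF smooth_pderiv_component[OF D1_smooth[OF p]]] in \<open>auto elim!: eventually_mono\<close>)
      then show ?thesis using wd_norm_le[OF D1_H1[OF p], of k i] by simp
    qed
    have i1: "integrable (lebesgue_on R) (\<lambda>x. (p x $ i)\<^sup>2 / c)" using L2D(2)[OF L(1)] by simp
    have i2: "integrable (lebesgue_on R) (\<lambda>x. 2 * (\<bar>p x $ i\<bar> * \<bar>pderiv_at (axis k 1) (\<lambda>x. p x $ i) x\<bar>))"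
      using L2_CS_norm(1)[OF L] by simp
    have "(\<integral>x. (p x $ i)\<^sup>2 / c + 2 * (\<bar>p x $ i\<bar> * \<bar>pderiv_at (axis k 1) (\<lambda>x. p x $ i) x\<bar>) \<partial>lebesgue_on R)
       = (\<integral>x. (p x $ i)\<^sup>2 \<partial>lebesgue_on R) / c + 2 * (\<integral>x. \<bar>p x $ i\<bar> * \<bar>pderiv_at (axis k 1) (\<lambda>x. p x $ i) x\<bar> \<partial>lebesgue_on R)"
      by (subst Bochner_Integration.integral_add[OF i1 i2]) simp
    also have "(\<integral>x. (p x $ i)\<^sup>2 \<partial>lebesgue_on R) = (L2_norm R (\<lambda>x. p x $ i))\<^sup>2"
      by (simp add: L2_norm_sq L2_inner_self)
    also have "(L2_norm R (\<lambda>x. p x $ i))\<^sup>2 / c + 2 * (\<integral>x. \<bar>p x $ i\<bar> * \<bar>pderiv_at (axis k 1) (\<lambda>x. p x $ i) x\<bar> \<partial>lebesgue_on R)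
       \<le> (L2_norm R p * (V_norm a b p / sqrt kap)) / c + 2 * (L2_norm R p * V_norm a b p)"
    proof (intro add_mono divide_right_mono mult_left_mono)
      show "(L2_norm R (\<lambda>x. p x $ i))\<^sup>2 \<le> L2_norm R p * (V_norm a b p / sqrt kap)"
        unfolding power2_eq_square using L2_norm_component[OF pL, of i] P by (intro mult_mono) auto
      have "(\<integral>x. \<bar>p x $ i\<bar> * \<bar>pderiv_at (axis k 1) (\<lambda>x. p x $ i) x\<bar> \<partial>lebesgue_on R) \<le> L2_norm R (\<lambda>x. p x $ i) * L2_norm R (pderiv_at (axis k 1) (\<lambda>x. p x $ i))"
        using L2_CS_norm(2)[OF L] by simp
      also have "\<dots> \<le> L2_norm R p * V_norm a b p" by (intro mult_mono L2_norm_component pL dn) auto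
      finally show "(\<integral>x. \<bar>p x $ i\<bar> * \<bar>pderiv_at (axis k 1) (\<lambda>x. p x $ i) x\<bar> \<partial>lebesgue_on R) \<le> L2_norm R p * V_norm a b p" .
    qed (use c in auto)
    also have "\<dots> = (1 / (c * sqrt kap) + 2) * (L2_norm R p * V_norm a b p)"
      by (simp add: algebra_simps)
    finally show ?thesis .
  qed
  let ?X = "L2_norm R p * V_norm a b p"
  have X: "?X \<ge> 0" by simp
  have l: "0 \<le> 1 / (a * sqrt kap) + 2" "0 \<le> 1 / (b * sqrt kap) + 2" using a b k by auto
  have "(L2_norm R (\<lambda>x. p x $ i * p x $ j))\<^sup>2 = (\<integral>x. (p x $ i)\<^sup>2 * (p x $ j)\<^sup>2 \<partial>lebesgue_on R)"
    by (simp add: L2_norm_sq L2_inner_self power_mult_distrib)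
  also have "\<dots> \<le> (\<integral>x. (p x $ i)\<^sup>2 / a + 2 * (\<bar>p x $ i\<bar> * \<bar>pderiv_at (axis 1 1) (\<lambda>x. p x $ i) x\<bar>) \<partial>lebesgue_on R)
     * (\<integral>x. (p x $ j)\<^sup>2 / b + 2 * (\<bar>p x $ j\<bar> * \<bar>pderiv_at (axis 2 1) (\<lambda>x. p x $ j) x\<bar>) \<partial>lebesgue_on R)"
    by (rule ladyzhenskaya_product[OF a b sc sc])
  also have "\<dots> \<le> ((1 / (a * sqrt kap) + 2) * ?X) * ((1 / (b * sqrt kap) + 2) * ?X)"
    using l b by (intro mult_mono est a b mult_nonneg_nonneg integral_nonneg_AE) auto
  also have "\<dots> \<le> (lad * ?X) * (lad * ?X)"
    using l X unfolding lad_def by (intro mult_mono mult_right_mono) auto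
  finally have "(L2_norm R (\<lambda>x. p x $ i * p x $ j))\<^sup>2 \<le> (lad * ?X)\<^sup>2" by (simp only: power2_eq_square)
  then show ?thesis by (rule power2_le_imp_le) (use lad_pos X in auto)
qed

lemma b_ladyzhenskaya:
  assumes p: "p \<in> D1 a b" and v: "v \<in> H1_vec R"
  shows "\<bar>b_form a b p v p\<bar> \<le> 4 * (lad * (L2_norm R p * V_norm a b p) * V_norm a b v)"
proof (rule b_sum_bound)
  fix i j
  note sc = smooth_component[OF D1_smooth[OF p]]
  have L: "(\<lambda>x. p x $ i * p x $ j) \<in> L2 R" by (intro L2_smooth smooth_mult sc)
  have "(\<integral>x. p x $ i * wd i j v x * p x $ j \<partial>lebesgue_on R) = L2_inner R (\<lambda>x. p x $ i * p x $ j) (wd i j v)"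
    unfolding L2_inner_def by (simp add: mult_ac)
  also have "\<bar>\<dots>\<bar> \<le> L2_norm R (\<lambda>x. p x $ i * p x $ j) * L2_norm R (wd i j v)"
    by (rule L2_CS[OF L wd_L2[OF v]])
  also have "\<dots> \<le> lad * (L2_norm R p * V_norm a b p) * V_norm a b v"
    using lad_pos by (intro mult_mono ladyzhenskaya_component p wd_norm_le v) auto
  finally show "\<bar>\<integral>x. p x $ i * wd i j v x * p x $ j \<partial>lebesgue_on R\<bar> \<le> lad * (L2_norm R p * V_norm a b p) * V_norm a b v" .
qed

text \<open>The first argument splits into p = PP n z, treated by Ladyzhenskaya, and the tail,
  treated by the sup bound of p and \<open>scaled_tail\<close>. The second term carries the V norm
  of the tail and serves as a remainder.\<close>

lemma b_convected:
  assumes z: "z \<in> V_space a b" and v: "v \<in> V_space a b"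
  shows "\<bar>b_form a b z v (PP n z)\<bar> \<le> 4 * lad * (L2_norm R (PP n z) * V_norm a b (PP n z) * V_norm a b v)
     + 4 * bern / sqrt kap * (L2_norm R (PP n z) * V_norm a b (\<lambda>x. z x - PP n z x) * V_norm a b v)"
proof -
  let ?p = "PP n z" let ?q = "\<lambda>x. z x - PP n z x"
  have p: "?p \<in> D1 a b" by (rule psum_D1)
  have q: "?q \<in> V_space a b" by (intro V_diff z psum_V)
  note zL = V_L2[OF z] and pL = V_L2[OF D1_V[OF p]]
  have 1: "b_form a b ?q v ?p = b_form a b z v ?p - b_form a b ?p v ?p"
    by (rule b_diff_left[OF b_integrable_D1_right[OF zL V_H1[OF v] p] b_integrable_D1_right[OF pL V_H1[OF v] p]])
  have nn: "0 \<le> bern * n * L2_norm R w" for w :: vector_field using bern_pos by simp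
  have "\<bar>b_form a b ?q v ?p\<bar> \<le> 4 * (bern * n * L2_norm R ?p * L2_norm R ?q * V_norm a b v)"
    by (rule b_bound_right(2)[OF V_L2[OF q] V_H1[OF v] pL PP_bound nn])
  also have "\<dots> = (4 * bern * L2_norm R ?p * V_norm a b v) * (n * L2_norm R ?q)" by (simp add: mult_ac)
  also have "\<dots> \<le> (4 * bern * L2_norm R ?p * V_norm a b v) * (V_norm a b ?q / sqrt kap)"
    using bern_pos by (intro mult_left_mono scaled_tail z) auto
  also have "\<dots> = 4 * bern / sqrt kap * (L2_norm R ?p * V_norm a b ?q * V_norm a b v)" by (simp add: mult_ac)
  finally show ?thesis
    using 1 b_ladyzhenskaya[OF p V_H1[OF v]] by (simp add: mult.assoc)
qed

end

section \<open>Weak time derivatives and Gronwall's lemma\<close>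

text \<open>Rests on the completeness of Lebesgue measure; the limits of step functions are known
  only almost everywhere.\<close>

lemma borel_measurable_lebesgue_on_AE:
  fixes f g :: "'a::euclidean_space \<Rightarrow> 'b::euclidean_space"
  assumes S: "S \<in> sets lebesgue" and f: "f \<in> borel_measurable (lebesgue_on S)" and eq: "AE x in lebesgue_on S. f x = g x"
  shows "g \<in> borel_measurable (lebesgue_on S)"
proof -
  have "(\<lambda>x. if x \<in> S then f x else 0) \<in> borel_measurable lebesgue"
    using f S by (simp add: borel_measurable_if)
  moreover have "AE x in lebesgue. (if x \<in> S then f x else 0) = (if x \<in> S then g x else 0)"
    using eq S by (subst (asm) AE_restrict_space_iff) (auto elim!: eventually_mono)
  ultimately have "(\<lambda>x. if x \<in> S then g x else 0) \<in> borel_measurable lebesgue"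
    by (rule borel_measurable_AE)
  then show ?thesis using S by (simp add: borel_measurable_if)
qed

lemma measurable_interval: "f \<in> borel_measurable borel \<Longrightarrow> f \<in> borel_measurable (lebesgue_on {0<..<T::real})"
  for f :: "real \<Rightarrow> real"
  by (intro measurable_restrict_space1) (simp add: measurable_completion)

lemma finite_measure_interval: "finite_measure (lebesgue_on {0<..<T::real})"
proof (rule finite_measureI)
  have "emeasure lebesgue {0<..<T} < \<infinity>"
    using emeasure_bounded_finite[of "{0<..<T}"] by simp
  then show "emeasure (lebesgue_on {0<..<T}) (space (lebesgue_on {0<..<T})) \<noteq> \<infinity>"
    by (simp add: emeasure_restrict_space space_restrict_space)
qed

lemma continuous_on_measurable_interval:
  fixes f :: "real \<Rightarrow> real"
  assumes "continuous_on {0..T} f"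
  shows "f \<in> borel_measurable (lebesgue_on {0<..<T})"
  by (rule continuous_imp_measurable_on_sets_lebesgue) (auto intro: continuous_on_subset[OF assms])

lemma integrable_ind_mult:
  fixes g :: "real \<Rightarrow> real"
  assumes "integrable (lebesgue_on {0<..<T}) g"
  shows "integrable (lebesgue_on {0<..<T}) (\<lambda>x. indicat_real {s<..<t} x * g x)"
proof -
  have "(\<lambda>x. indicat_real {s<..<t} x) \<in> borel_measurable (lebesgue_on {0<..<T})"
    by (rule measurable_interval) measurable
  from integrable_mult_bounded[OF assms this, of 1] show ?thesis
    by (simp add: mult.commute indicator_def)
qed

lemma ind_limit:
  fixes g :: "real \<Rightarrow> real"
  assumes g: "integrable (lebesgue_on {0<..<T}) g"
    and F: "\<And>n. F n \<in> borel_measurable (lebesgue_on {0<..<T})" "\<And>n x. \<bar>F n x\<bar> \<le> 1"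
    and lim: "\<And>x. (\<lambda>n. F n x) \<longlonglongrightarrow> indicat_real {s<..<t} x"
  shows "(\<lambda>n. \<integral>x. F n x * g x \<partial>lebesgue_on {0<..<T}) \<longlonglongrightarrow> (\<integral>x. indicat_real {s<..<t} x * g x \<partial>lebesgue_on {0<..<T})"
proof (rule integral_dominated_convergence[where w = "\<lambda>x. \<bar>g x\<bar>"])
  have gm: "g \<in> borel_measurable (lebesgue_on {0<..<T})" using g by blast
  show "(\<lambda>x. indicat_real {s<..<t} x * g x) \<in> borel_measurable (lebesgue_on {0<..<T})"
    using integrable_ind_mult[OF g] by blast
  show "(\<lambda>x. F n x * g x) \<in> borel_measurable (lebesgue_on {0<..<T})" for n
    by (rule borel_measurable_times[OF F(1) gm])
  show "AE x in lebesgue_on {0<..<T}. (\<lambda>n. F n x * g x) \<longlonglongrightarrow> indicat_real {s<..<t} x * g x"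
    by (intro AE_I2 tendsto_mult_right lim)
  show "AE x in lebesgue_on {0<..<T}. norm (F n x * g x) \<le> \<bar>g x\<bar>" for n
    by (intro AE_I2) (use F(2)[of n] in \<open>simp add: abs_mult mult_left_le_one_le\<close>)
qed (use g in simp)

section \<open>From distributional derivatives to increments\<close>

lemma smooth_step_integral: "(\<integral>x. deriv smooth_step x \<partial>lborel) = 1" "integrable lborel (deriv smooth_step)"
proof -
  have eq: "(\<lambda>x. indicator {0..1} x *\<^sub>R deriv smooth_step x) = deriv smooth_step"
    using deriv_smooth_step_0 by (auto simp: fun_eq_iff indicator_def)
  have c: "continuous_on {0..1} (deriv smooth_step)"
    by (intro smooth_continuous smooth_deriv smooth_smooth_step)
  have "(\<integral>x. indicator {0..1} x *\<^sub>R deriv smooth_step x \<partial>lborel) = smooth_step 1 - smooth_step 0"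
    by (rule integral_FTC_atLeastAtMost[OF _ _ c])
       (use smooth_DERIV[OF smooth_smooth_step] in \<open>auto simp: has_real_derivative_iff_has_vector_derivative[symmetric] intro: has_field_derivative_at_within\<close>)
  then show "(\<integral>x. deriv smooth_step x \<partial>lborel) = 1"
    unfolding eq by (simp add: smooth_step_0 smooth_step_1)
  show "integrable lborel (deriv smooth_step)"
    using borel_integrable_atLeastAtMost'[OF c] by (simp only: set_integrable_def eq)
qed

lemma cutoff_tendsto_indicator:
  assumes "s < t"
  shows "(\<lambda>n. cutoff (1 / real (Suc n)) s t x) \<longlonglongrightarrow> indicat_real {s<..<t} x"
proof (cases "s < x \<and> x < t")
  case True
  have "eventually (\<lambda>n. 1 / real (Suc n) < min (x - s) (t - x)) sequentially"
    using order_tendstoD(2)[OF LIMSEQ_inverse_real_of_nat, of "min (x - s) (t - x)"] True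
    by (simp add: inverse_eq_divide)
  then have "eventually (\<lambda>n. cutoff (1 / real (Suc n)) s t x = 1) sequentially"
  proof eventually_elim
    case (elim n)
    define e where "e = 1 / real (Suc n)"
    have e: "e > 0" "e < x - s" "e < t - x" using elim unfolding e_def by auto
    then have "(x - s) / e \<ge> 1" "(t - x) / e \<ge> 1" by (auto simp: field_simps)
    then show ?case unfolding e_def[symmetric] by (simp add: cutoff_def smooth_step_1)
  qed
  then show ?thesis using True by (simp add: tendsto_eventually)
next
  case False
  have "cutoff (1 / real (Suc n)) s t x = 0" for n
  proof -
    consider "x \<le> s" | "t \<le> x" using False by linarith
    then show ?thesis by cases (simp_all add: cutoff_def smooth_step_0 mult_nonpos_nonneg)
  qed
  moreover have "indicat_real {s<..<t} x = 0" using False by simp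
  ultimately show ?thesis by simp
qed

text \<open>The derivative of \<open>smooth_step\<close> has integral 1 and serves as mollifier. The
  scale e n may be negative, which covers the falling ramp of a cutoff as well as the rising
  one.\<close>

lemma mollified_limit:
  fixes W :: "real \<Rightarrow> real"
  assumes W: "continuous_on UNIV W" "\<And>x. \<bar>W x\<bar> \<le> B" and e: "\<And>n. e n \<noteq> 0" "e \<longlonglongrightarrow> 0"
  shows "(\<lambda>n. \<integral>x. deriv smooth_step x * W (s + e n * x) \<partial>lborel) \<longlonglongrightarrow> W s"
proof -
  have "(\<lambda>n. \<integral>x. deriv smooth_step x * W (s + e n * x) \<partial>lborel) \<longlonglongrightarrow> (\<integral>x. deriv smooth_step x * W s \<partial>lborel)"
  proof (rule integral_dominated_convergence[where w = "\<lambda>x. \<bar>deriv smooth_step x\<bar> * B"])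
    have dm: "deriv smooth_step \<in> borel_measurable lborel" using smooth_step_integral(2) by blast
    show "(\<lambda>x. deriv smooth_step x * W s) \<in> borel_measurable lborel" using dm by measurable
    show "(\<lambda>x. deriv smooth_step x * W (s + e n * x)) \<in> borel_measurable lborel" for n
    proof -
      have "continuous_on UNIV (\<lambda>x. W (s + e n * x))"
        by (rule continuous_on_compose2[OF W(1)]) (auto intro!: continuous_intros)
      then have "(\<lambda>x. W (s + e n * x)) \<in> borel_measurable lborel" by (simp add: borel_measurable_continuous_onI)
      then show ?thesis using dm by measurable
    qed
    show "integrable lborel (\<lambda>x. \<bar>deriv smooth_step x\<bar> * B)" using smooth_step_integral(2) by simp
    show "AE x in lborel. norm (deriv smooth_step x * W (s + e n * x)) \<le> \<bar>deriv smooth_step x\<bar> * B" for n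
      by (intro AE_I2) (simp add: abs_mult mult_left_mono W(2))
    show "AE x in lborel. (\<lambda>n. deriv smooth_step x * W (s + e n * x)) \<longlonglongrightarrow> deriv smooth_step x * W s"
    proof (intro AE_I2 tendsto_mult_left)
      fix x
      have "(\<lambda>n. s + e n * x) \<longlonglongrightarrow> s + 0 * x" by (intro tendsto_intros e)
      moreover have "isCont W s" using W(1) by (simp add: continuous_on_eq_continuous_at)
      ultimately show "(\<lambda>n. W (s + e n * x)) \<longlonglongrightarrow> W s"
        using isCont_tendsto_compose[of s W "\<lambda>n. s + e n * x" sequentially] by simp
    qed
  qed
  then show ?thesis using smooth_step_integral(1) by simp
qed

text \<open>Tested with cutoffs of shrinking ramps, the derivative of the cutoff concentrates at s
  and, with the opposite sign, at t. The integrability in the premise supplies the measurability of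
  the tested product.\<close>

lemma weak_derivative_interior:
  fixes W y g :: "real \<Rightarrow> real"
  assumes W: "continuous_on {0..T} W" and st: "0 < s" "s < t" "t < T"
    and AE: "AE x in lebesgue_on {0<..<T}. y x = W x"
    and g: "integrable (lebesgue_on {0<..<T}) g"
    and weak: "\<And>\<phi>. \<phi> \<in> test_functions {0<..<T} \<Longrightarrow>
      integrable (lebesgue_on {0<..<T}) (\<lambda>x. deriv \<phi> x * y x) \<and>
      (\<integral>x. deriv \<phi> x * y x \<partial>lebesgue_on {0<..<T}) = - (\<integral>x. \<phi> x * g x \<partial>lebesgue_on {0<..<T})"
  shows "W t - W s = (\<integral>x. indicat_real {s<..<t} x * g x \<partial>lebesgue_on {0<..<T})"
proof -
  let ?M = "lebesgue_on {0<..<T}"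
  have T: "T > 0" using st by simp
  \<comment> \<open>Clamping the argument extends W to a bounded continuous function on the line, as
    the rescaled integrals require.\<close>
  define V where "V x = W (max 0 (min T x))" for x
  have Vc: "continuous_on UNIV V"
    unfolding V_def[abs_def] by (rule continuous_on_compose2[OF W]) (use T in \<open>auto intro!: continuous_intros\<close>)
  have "bounded (W ` {0..T})" by (intro compact_imp_bounded compact_continuous_image W compact_Icc)
  then obtain B where B: "\<forall>x\<in>{0..T}. \<bar>W x\<bar> \<le> B" unfolding bounded_iff by auto
  then have VB: "\<bar>V x\<bar> \<le> B" for x unfolding V_def using T by auto
  have VW: "V x = W x" if "x \<in> {0..T}" for x using that by (simp add: V_def)
  define e where "e n = 1 / real (Suc n)" for n
  have e: "e n > 0" "e n \<noteq> 0" "- e n \<noteq> 0" for n by (simp_all add: e_def)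
  have elim: "e \<longlonglongrightarrow> 0"
    using LIMSEQ_inverse_real_of_nat by (simp add: e_def[abs_def] inverse_eq_divide)
  have elim': "(\<lambda>n. - e n) \<longlonglongrightarrow> 0" using tendsto_minus[OF elim] by simp
  have test: "cutoff (e n) s t \<in> test_functions {0<..<T}" for n
    using st by (intro cutoff_test e) auto
  have l1: "(\<lambda>n. \<integral>x. cutoff (e n) s t x * g x \<partial>?M) \<longlonglongrightarrow> (\<integral>x. indicat_real {s<..<t} x * g x \<partial>?M)"
  proof (rule ind_limit[OF g])
    show "cutoff (e n) s t \<in> borel_measurable ?M" for n
      by (intro measurable_interval borel_measurable_continuous_onI smooth_continuous smooth_cutoff)
    show "\<bar>cutoff (e n) s t x\<bar> \<le> 1" for n x using cutoff_bounds[of "e n" s t x] by simp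
    show "(\<lambda>n. cutoff (e n) s t x) \<longlonglongrightarrow> indicat_real {s<..<t} x" for x
      unfolding e_def by (rule cutoff_tendsto_indicator[OF st(2)])
  qed
  have ev: "eventually (\<lambda>n. (\<integral>x. deriv (cutoff (e n) s t) x * y x \<partial>?M) =
     (\<integral>x. deriv smooth_step x * V (s + e n * x) \<partial>lborel) - (\<integral>x. deriv smooth_step x * V (t + (- e n) * x) \<partial>lborel)) sequentially"
  proof -
    \<comment> \<open>Below this threshold the two ramps are disjoint: where one factor of the
      cutoff varies the other is 1, and the derivative is a difference of two bumps.\<close>
    have "eventually (\<lambda>n. e n < (t - s) / 2) sequentially"
      using order_tendstoD(2)[OF elim, of "(t - s) / 2"] st by simp
    then show ?thesis
    proof eventually_elim
      case (elim n)
      let ?d = "deriv (cutoff (e n) s t)"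
      have dc: "continuous_on UNIV ?d" by (intro smooth_continuous smooth_deriv smooth_cutoff)
      have d: "?d x = deriv smooth_step ((x - s) / e n) / e n - deriv smooth_step ((t - x) / e n) / e n" for x
      proof -
        have 1: "smooth_step ((t - x) / e n) = 1 \<or> deriv smooth_step ((x - s) / e n) = 0"
        proof (cases "(x - s) / e n \<le> 1")
          case True
          then have "x - s \<le> e n" using e(1)[of n] by (simp add: field_simps)
          then have "(t - x) / e n \<ge> 1" using elim e(1)[of n] by (simp add: field_simps)
          then show ?thesis by (simp add: smooth_step_1)
        qed (simp add: deriv_smooth_step_0)
        have 2: "smooth_step ((x - s) / e n) = 1 \<or> deriv smooth_step ((t - x) / e n) = 0"
        proof (cases "(t - x) / e n \<le> 1")
          case True
          then have "t - x \<le> e n" using e(1)[of n] by (simp add: field_simps)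
          then have "(x - s) / e n \<ge> 1" using elim e(1)[of n] by (simp add: field_simps)
          then show ?thesis by (simp add: smooth_step_1)
        qed (simp add: deriv_smooth_step_0)
        show ?thesis unfolding deriv_cutoff using 1 2 by auto
      qed
      have d0: "?d x = 0" if "x \<notin> {0<..<T}" for x
        using test_functions_zero[OF test_functions_deriv[OF test] that] .
      have "(\<integral>x. ?d x * y x \<partial>?M) = (\<integral>x. ?d x * V x \<partial>?M)"
      proof (rule integral_cong_AE)
        show "(\<lambda>x. ?d x * y x) \<in> borel_measurable ?M" using weak[OF test[of n]] by blast
        show "(\<lambda>x. ?d x * V x) \<in> borel_measurable ?M"
          by (intro measurable_interval borel_measurable_continuous_onI continuous_intros dc Vc)
        show "AE x in ?M. ?d x * y x = ?d x * V x"
          using AE AE_space by eventually_elim (auto simp: VW space_restrict_space)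
      qed
      also have "\<dots> = (\<integral>x. indicator {0<..<T} x *\<^sub>R (?d x * V x) \<partial>lebesgue)"
        by (rule integral_restrict_space) simp
      also have "(\<lambda>x. indicator {0<..<T} x *\<^sub>R (?d x * V x)) = (\<lambda>x. ?d x * V x)"
        using d0 by (auto simp: fun_eq_iff indicator_def)
      also have "(\<integral>x. ?d x * V x \<partial>lebesgue) = (\<integral>x. ?d x * V x \<partial>lborel)"
        using borel_measurable_continuous_onI[OF continuous_on_mult[OF dc Vc]] by (intro integral_completion) simp
      also have "\<dots> = (\<integral>x. deriv smooth_step ((x - s) / e n) / e n * V x - deriv smooth_step ((t - x) / e n) / e n * V x \<partial>lborel)"
        unfolding d by (simp add: left_diff_distrib)
      also have "\<dots> = (\<integral>x. deriv smooth_step ((x - s) / e n) / e n * V x \<partial>lborel) - (\<integral>x. deriv smooth_step ((t - x) / e n) / e n * V x \<partial>lborel)"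
      proof (rule Bochner_Integration.integral_diff)
        have int: "integrable lborel (\<lambda>x. deriv smooth_step (p + q * x) / e n * V x)" if q: "q \<noteq> 0" for p q
        proof (rule integrable_mult_bounded)
          show "integrable lborel (\<lambda>x. deriv smooth_step (p + q * x) / e n)"
            using lborel_integrable_real_affine[OF smooth_step_integral(2) q, of p] by simp
          show "V \<in> borel_measurable lborel" using Vc by (simp add: borel_measurable_continuous_onI)
          show "AE x in lborel. \<bar>V x\<bar> \<le> B" using VB by simp
        qed
        show "integrable lborel (\<lambda>x. deriv smooth_step ((x - s) / e n) / e n * V x)"
          using int[of "1 / e n" "- s / e n"] e(2)[of n] by (simp add: diff_divide_distrib)
        show "integrable lborel (\<lambda>x. deriv smooth_step ((t - x) / e n) / e n * V x)"
          using int[of "- 1 / e n" "t / e n"] e(2)[of n] by (simp add: diff_divide_distrib)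
      qed
      also have "(\<integral>x. deriv smooth_step ((x - s) / e n) / e n * V x \<partial>lborel) = (\<integral>x. deriv smooth_step x * V (s + e n * x) \<partial>lborel)"
        using e(1)[of n] by (subst lborel_integral_real_affine[of "e n" _ s]) auto
      also have "(\<integral>x. deriv smooth_step ((t - x) / e n) / e n * V x \<partial>lborel) = (\<integral>x. deriv smooth_step x * V (t + (- e n) * x) \<partial>lborel)"
        using e(1)[of n] by (subst lborel_integral_real_affine[of "- e n" _ t]) auto
      finally show ?case .
    qed
  qed
  have "(\<lambda>n. \<integral>x. deriv (cutoff (e n) s t) x * y x \<partial>?M) \<longlonglongrightarrow> V s - V t"
    by (rule Lim_transform_eventually[OF tendsto_diff[OF mollified_limit[OF Vc VB e(2) elim] mollified_limit[OF Vc VB e(3) elim']]])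
       (use ev in \<open>auto elim!: eventually_mono\<close>)
  moreover have "(\<lambda>n. \<integral>x. deriv (cutoff (e n) s t) x * y x \<partial>?M) \<longlonglongrightarrow> - (\<integral>x. indicat_real {s<..<t} x * g x \<partial>?M)"
    using weak[OF test] tendsto_minus[OF l1] by simp
  ultimately have "V s - V t = - (\<integral>x. indicat_real {s<..<t} x * g x \<partial>?M)" by (rule LIMSEQ_unique)
  then show ?thesis using VW[of s] VW[of t] st by simp
qed

text \<open>Cutoffs supported in the open interval cannot reach 0 and T; the interval is shrunk by r
  n, and the continuity of W gives the end points.\<close>

lemma weak_derivative_primitive:
  fixes W y g :: "real \<Rightarrow> real"
  assumes W: "continuous_on {0..T} W" and st: "0 \<le> s" "s \<le> t" "t \<le> T"
    and AE: "AE x in lebesgue_on {0<..<T}. y x = W x"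
    and g: "integrable (lebesgue_on {0<..<T}) g"
    and weak: "\<And>\<phi>. \<phi> \<in> test_functions {0<..<T} \<Longrightarrow>
      integrable (lebesgue_on {0<..<T}) (\<lambda>x. deriv \<phi> x * y x) \<and>
      (\<integral>x. deriv \<phi> x * y x \<partial>lebesgue_on {0<..<T}) = - (\<integral>x. \<phi> x * g x \<partial>lebesgue_on {0<..<T})"
  shows "W t - W s = (\<integral>x. indicat_real {s<..<t} x * g x \<partial>lebesgue_on {0<..<T})"
proof (cases "s = t")
  case False
  then have lt: "s < t" using st by simp
  \<comment> \<open>The offset 3 keeps r n at most a third of the length, so the shrunk interval is
    nonempty for every n.\<close>
  define r where "r n = (t - s) / real (n + 3)" for n
  have rlim: "r \<longlonglongrightarrow> 0"
    unfolding r_def[abs_def]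
    by (intro real_tendsto_divide_at_top[OF tendsto_const] filterlim_compose[OF filterlim_real_sequentially] filterlim_add_const_nat_at_top)
  have r: "r n > 0" "r n \<le> (t - s) / 3" for n
  proof -
    show "r n > 0" using lt by (simp add: r_def)
    show "r n \<le> (t - s) / 3" unfolding r_def by (rule divide_left_mono) (use lt in auto)
  qed
  have l: "(\<lambda>n. s + r n) \<longlonglongrightarrow> s" "(\<lambda>n. t - r n) \<longlonglongrightarrow> t"
    using tendsto_add[OF tendsto_const rlim, of s] tendsto_diff[OF tendsto_const rlim, of t] by auto
  have in_I: "s + r n \<in> {0..T}" "t - r n \<in> {0..T}" and lt': "s + r n < t - r n" "0 < s + r n" "t - r n < T" for n
    using r[of n] st lt by (auto simp: field_simps)
  have eq: "W (t - r n) - W (s + r n) = (\<integral>x. indicat_real {s + r n<..<t - r n} x * g x \<partial>lebesgue_on {0<..<T})" for n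
    by (rule weak_derivative_interior[OF W lt'(2,1,3) AE g weak])
  have "(\<lambda>n. W (t - r n) - W (s + r n)) \<longlonglongrightarrow> W t - W s"
    by (intro tendsto_diff continuous_on_tendsto_compose[OF W] l) (use in_I st in auto)
  moreover have "(\<lambda>n. W (t - r n) - W (s + r n)) \<longlonglongrightarrow> (\<integral>x. indicat_real {s<..<t} x * g x \<partial>lebesgue_on {0<..<T})"
    unfolding eq
  proof (rule ind_limit[OF g])
    show "indicat_real {s + r n<..<t - r n} \<in> borel_measurable (lebesgue_on {0<..<T})" for n
      by (rule measurable_interval) measurable
    show "\<bar>indicat_real {s + r n<..<t - r n} x\<bar> \<le> 1" for n x by (simp add: indicator_def)
    show "(\<lambda>n. indicat_real {s + r n<..<t - r n} x) \<longlonglongrightarrow> indicat_real {s<..<t} x" for x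
    proof (cases "x \<in> {s<..<t}")
      case True
      have "eventually (\<lambda>n. r n < min (x - s) (t - x)) sequentially"
        using order_tendstoD(2)[OF rlim, of "min (x - s) (t - x)"] True by simp
      then have "eventually (\<lambda>n. indicat_real {s + r n<..<t - r n} x = 1) sequentially"
        by eventually_elim auto
      then show ?thesis using True by (simp add: tendsto_eventually)
    next
      case False
      have 1: "(\<lambda>n. indicat_real {s + r n<..<t - r n} x) = (\<lambda>n. 0)"
      proof
        show "indicat_real {s + r n<..<t - r n} x = 0" for n
          using r(1)[of n] False by auto
      qed
      have 2: "indicat_real {s<..<t} x = 0" using False by simp
      show ?thesis unfolding 1 2 by simp
    qed
  qed
  ultimately show ?thesis by (rule LIMSEQ_unique)
qed simp

text \<open>Absolute continuity with derivative g, stated through increments instead of pointwise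
  derivatives; the indicator keeps all integrals over one fixed measure space.\<close>

definition primitive_on :: "real \<Rightarrow> (real \<Rightarrow> real) \<Rightarrow> (real \<Rightarrow> real) \<Rightarrow> bool" where
  "primitive_on T C g \<longleftrightarrow> continuous_on {0..T} C \<and> integrable (lebesgue_on {0<..<T}) g \<and>
     (\<forall>s t. 0 \<le> s \<longrightarrow> s \<le> t \<longrightarrow> t \<le> T \<longrightarrow> C t - C s = (\<integral>x. indicat_real {s<..<t} x * g x \<partial>lebesgue_on {0<..<T}))"

lemma integrable_continuous_mult:
  fixes C g :: "real \<Rightarrow> real"
  assumes C: "continuous_on {0..T} C" and g: "integrable (lebesgue_on {0<..<T}) g"
  shows "integrable (lebesgue_on {0<..<T}) (\<lambda>x. g x * C x)"
proof -
  have "bounded (C ` {0..T})" by (intro compact_imp_bounded compact_continuous_image C compact_Icc)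
  then obtain B where B: "\<forall>x\<in>{0..T}. \<bar>C x\<bar> \<le> B" unfolding bounded_iff by auto
  show ?thesis
    by (rule integrable_mult_bounded[OF g continuous_on_measurable_interval[OF C], of B])
       (use B in \<open>auto intro!: AE_I2\<close>)
qed

text \<open>The product rule for absolutely continuous functions: g(x) g(y) is integrated over the
  triangle s < y < x < t in both orders.\<close>

lemma primitive_on_square:
  assumes p: "primitive_on T C g"
  shows "primitive_on T (\<lambda>t. (C t)\<^sup>2) (\<lambda>t. 2 * (g t * C t))"
proof -
  let ?M = "lebesgue_on {0<..<T}"
  have C: "continuous_on {0..T} C" and g: "integrable ?M g"
    and eq: "\<And>s t. 0 \<le> s \<Longrightarrow> s \<le> t \<Longrightarrow> t \<le> T \<Longrightarrow> C t - C s = (\<integral>x. indicat_real {s<..<t} x * g x \<partial>?M)"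
    using p by (auto simp: primitive_on_def)
  have gC: "integrable ?M (\<lambda>x. g x * C x)" by (rule integrable_continuous_mult[OF C g])
  have gm [measurable]: "g \<in> borel_measurable ?M" using g by blast
  have id [measurable]: "(\<lambda>x. x) \<in> borel_measurable ?M" by (rule measurable_interval) simp
  interpret finite_measure ?M by (rule finite_measure_interval)
  interpret P: pair_sigma_finite ?M ?M by standard
  have "(C t)\<^sup>2 - (C s)\<^sup>2 = (\<integral>x. indicat_real {s<..<t} x * (2 * (g x * C x)) \<partial>?M)" if st: "0 \<le> s" "s \<le> t" "t \<le> T" for s t
  proof -
    define k where "k x y = (if s < y \<and> y < x \<and> x < t then g x * g y else 0)" for x y
    have km [measurable]: "(\<lambda>(x, y). k x y) \<in> borel_measurable (?M \<Otimes>\<^sub>M ?M)"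
    proof -
      have [measurable]: "(\<lambda>p. fst p) \<in> borel_measurable (?M \<Otimes>\<^sub>M ?M)" "(\<lambda>p. snd p) \<in> borel_measurable (?M \<Otimes>\<^sub>M ?M)"
        using measurable_compose[OF measurable_fst id] measurable_compose[OF measurable_snd id] by auto
      have [measurable]: "(\<lambda>p. g (fst p)) \<in> borel_measurable (?M \<Otimes>\<^sub>M ?M)" "(\<lambda>p. g (snd p)) \<in> borel_measurable (?M \<Otimes>\<^sub>M ?M)"
        using measurable_compose[OF measurable_fst gm] measurable_compose[OF measurable_snd gm] by auto
      show ?thesis unfolding k_def split_beta' by measurable
    qed
    have gg: "integrable (?M \<Otimes>\<^sub>M ?M) (\<lambda>p. g (fst p) * g (snd p))"
    proof (rule P.Fubini_integrable)
      show "(\<lambda>p. g (fst p) * g (snd p)) \<in> borel_measurable (?M \<Otimes>\<^sub>M ?M)"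
        using measurable_compose[OF measurable_fst gm] measurable_compose[OF measurable_snd gm] by measurable
      show "integrable ?M (\<lambda>x. \<integral>y. norm (g (fst (x, y)) * g (snd (x, y))) \<partial>?M)"
        using g by (simp add: abs_mult)
      show "AE x in ?M. integrable ?M (\<lambda>y. g (fst (x, y)) * g (snd (x, y)))"
        using g by simp
    qed
    have kint: "integrable (?M \<Otimes>\<^sub>M ?M) (\<lambda>(x, y). k x y)"
      by (rule Bochner_Integration.integrable_bound[OF gg km]) (auto simp: k_def)
    have F: "(\<integral>y. (\<integral>x. k x y \<partial>?M) \<partial>?M) = (\<integral>x. (\<integral>y. k x y \<partial>?M) \<partial>?M)"
      by (rule P.Fubini_integral[OF kint])
    define I where "I = (\<integral>x. indicat_real {s<..<t} x * (g x * C x) \<partial>?M)"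
    have gi: "integrable ?M (\<lambda>x. indicat_real {s<..<t} x * g x)" "integrable ?M (\<lambda>x. indicat_real {s<..<t} x * (g x * C x))"
      by (intro integrable_ind_mult g gC)+
    have "(\<integral>x. (\<integral>y. k x y \<partial>?M) \<partial>?M) = (\<integral>x. indicat_real {s<..<t} x * (g x * C x) - indicat_real {s<..<t} x * g x * C s \<partial>?M)"
    proof (rule Bochner_Integration.integral_cong)
      fix x assume x: "x \<in> space ?M"
      show "(\<integral>y. k x y \<partial>?M) = indicat_real {s<..<t} x * (g x * C x) - indicat_real {s<..<t} x * g x * C s"
      proof (cases "x \<in> {s<..<t}")
        case True
        have "(\<integral>y. k x y \<partial>?M) = (\<integral>y. g x * (indicat_real {s<..<x} y * g y) \<partial>?M)"
          using True by (intro Bochner_Integration.integral_cong) (auto simp: k_def indicator_def)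
        also have "\<dots> = g x * (C x - C s)" using eq[of s x] True st by simp
        finally show ?thesis using True by (simp add: algebra_simps)
      next
        case False
        then have "k x y = 0" for y by (auto simp: k_def)
        then show ?thesis using False by simp
      qed
    qed simp
    also have "\<dots> = I - (C t - C s) * C s"
      unfolding I_def using gi eq[OF st] by (subst Bochner_Integration.integral_diff) auto
    finally have 1: "(\<integral>x. (\<integral>y. k x y \<partial>?M) \<partial>?M) = I - (C t - C s) * C s" .
    have "(\<integral>y. (\<integral>x. k x y \<partial>?M) \<partial>?M) = (\<integral>y. indicat_real {s<..<t} y * g y * C t - indicat_real {s<..<t} y * (g y * C y) \<partial>?M)"
    proof (rule Bochner_Integration.integral_cong)
      fix y assume y: "y \<in> space ?M"
      show "(\<integral>x. k x y \<partial>?M) = indicat_real {s<..<t} y * g y * C t - indicat_real {s<..<t} y * (g y * C y)"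
      proof (cases "y \<in> {s<..<t}")
        case True
        have "(\<integral>x. k x y \<partial>?M) = (\<integral>x. g y * (indicat_real {y<..<t} x * g x) \<partial>?M)"
          using True by (intro Bochner_Integration.integral_cong) (auto simp: k_def indicator_def)
        also have "\<dots> = g y * (C t - C y)" using eq[of y t] True st by simp
        finally show ?thesis using True by (simp add: algebra_simps)
      next
        case False
        then have "k x y = 0" for x by (auto simp: k_def)
        then show ?thesis using False by simp
      qed
    qed simp
    also have "\<dots> = (C t - C s) * C t - I"
      unfolding I_def using gi eq[OF st] by (subst Bochner_Integration.integral_diff) auto
    finally have 2: "(\<integral>y. (\<integral>x. k x y \<partial>?M) \<partial>?M) = (C t - C s) * C t - I" .
    \<comment> \<open>Equating the two values gives 2 I = (C t - C s) (C t + C s).\<close>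
    have "2 * I = (C t)\<^sup>2 - (C s)\<^sup>2"
      using F 1 2 by (simp add: power2_eq_square algebra_simps)
    moreover have "(\<integral>x. indicat_real {s<..<t} x * (2 * (g x * C x)) \<partial>?M) = 2 * I"
      unfolding I_def by (simp add: mult.left_commute[of _ 2])
    ultimately show ?thesis by simp
  qed
  moreover have "continuous_on {0..T} (\<lambda>t. (C t)\<^sup>2)" by (intro continuous_intros C)
  ultimately show ?thesis using gC by (simp add: primitive_on_def)
qed

lemma primitive_on_sum:
  assumes "\<And>i. i \<in> I \<Longrightarrow> primitive_on T (C i) (g i)"
  shows "primitive_on T (\<lambda>t. \<Sum>i\<in>I. C i t) (\<lambda>t. \<Sum>i\<in>I. g i t)"
proof -
  have "(\<Sum>i\<in>I. C i t) - (\<Sum>i\<in>I. C i s) = (\<integral>x. indicat_real {s<..<t} x * (\<Sum>i\<in>I. g i x) \<partial>lebesgue_on {0<..<T})"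
    if "0 \<le> s" "s \<le> t" "t \<le> T" for s t
  proof -
    have "(\<integral>x. indicat_real {s<..<t} x * (\<Sum>i\<in>I. g i x) \<partial>lebesgue_on {0<..<T}) =
      (\<integral>x. (\<Sum>i\<in>I. indicat_real {s<..<t} x * g i x) \<partial>lebesgue_on {0<..<T})"
      by (simp add: sum_distrib_left)
    also have "\<dots> = (\<Sum>i\<in>I. \<integral>x. indicat_real {s<..<t} x * g i x \<partial>lebesgue_on {0<..<T})"
      using assms by (intro Bochner_Integration.integral_sum integrable_ind_mult) (auto simp: primitive_on_def)
    also have "\<dots> = (\<Sum>i\<in>I. C i t - C i s)"
      using assms that by (intro sum.cong) (auto simp: primitive_on_def)
    finally show ?thesis by (simp add: sum_subtractf)
  qed
  then show ?thesis
    using assms unfolding primitive_on_def by (auto intro!: continuous_on_sum Bochner_Integration.integrable_sum)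
qed

lemma primitive_on_diff:
  assumes "primitive_on T C g" "primitive_on T D h"
  shows "primitive_on T (\<lambda>t. C t - D t) (\<lambda>t. g t - h t)"
proof -
  have "(C t - D t) - (C s - D s) = (\<integral>x. indicat_real {s<..<t} x * (g x - h x) \<partial>lebesgue_on {0<..<T})"
    if "0 \<le> s" "s \<le> t" "t \<le> T" for s t
  proof -
    have "(\<integral>x. indicat_real {s<..<t} x * (g x - h x) \<partial>lebesgue_on {0<..<T}) =
       (\<integral>x. indicat_real {s<..<t} x * g x - indicat_real {s<..<t} x * h x \<partial>lebesgue_on {0<..<T})"
      by (simp add: right_diff_distrib)
    also have "\<dots> = (C t - C s) - (D t - D s)"
      using assms that integrable_ind_mult[of T g] integrable_ind_mult[of T h]
      by (subst Bochner_Integration.integral_diff) (auto simp: primitive_on_def)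
    finally show ?thesis by simp
  qed
  then show ?thesis using assms unfolding primitive_on_def by (auto intro!: continuous_intros)
qed

section \<open>Indefinite integrals and Gronwall's lemma\<close>

lemma indefinite_integral_continuous:
  fixes g :: "real \<Rightarrow> real"
  assumes g: "integrable (lebesgue_on {0<..<T}) g"
  shows "continuous_on {0..T} (\<lambda>t. \<integral>x. indicat_real {0<..<t} x * g x \<partial>lebesgue_on {0<..<T})"
  unfolding continuous_on_sequentially
proof (intro allI ballI impI)
  fix f t assume t: "t \<in> {0..T}" and f: "(\<forall>n. f n \<in> {0..T}) \<and> f \<longlonglongrightarrow> t"
  have gm: "g \<in> borel_measurable (lebesgue_on {0<..<T})" using g by blast
  show "((\<lambda>t. \<integral>x. indicat_real {0<..<t} x * g x \<partial>lebesgue_on {0<..<T}) \<circ> f) \<longlonglongrightarrow> (\<integral>x. indicat_real {0<..<t} x * g x \<partial>lebesgue_on {0<..<T})"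
    unfolding comp_def
  proof (rule integral_dominated_convergence[where w = "\<lambda>x. \<bar>g x\<bar>"])
    show "AE x in lebesgue_on {0<..<T}. (\<lambda>n. indicat_real {0<..<f n} x * g x) \<longlonglongrightarrow> indicat_real {0<..<t} x * g x"
      using AE_lebesgue_on_negligible[OF negligible_sing[of t], of "{0<..<T}"]
    proof (rule eventually_mono)
      fix x assume "x \<notin> {t}"
      then consider "x < t" | "t < x" by force
      then have "eventually (\<lambda>n. indicat_real {0<..<f n} x = indicat_real {0<..<t} x) sequentially"
      proof cases
        case 1
        then have "eventually (\<lambda>n. x < f n) sequentially" using f order_tendstoD(1) by blast
        then show ?thesis by eventually_elim (use 1 in \<open>auto simp: indicator_def\<close>)
      next
        case 2
        then have "eventually (\<lambda>n. f n < x) sequentially" using f order_tendstoD(2) by blast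
        then show ?thesis by eventually_elim (use 2 in \<open>auto simp: indicator_def\<close>)
      qed
      then show "(\<lambda>n. indicat_real {0<..<f n} x * g x) \<longlonglongrightarrow> indicat_real {0<..<t} x * g x"
        by (intro tendsto_mult_right tendsto_eventually)
    qed simp
  qed (use g gm integrable_ind_mult[OF g] in \<open>auto simp: indicator_def\<close>)
qed

lemma ind_split:
  fixes g :: "real \<Rightarrow> real"
  assumes g: "integrable (lebesgue_on {0<..<T}) g" and st: "r \<le> s" "s \<le> t"
  shows "(\<integral>x. indicat_real {r<..<t} x * g x \<partial>lebesgue_on {0<..<T}) =
    (\<integral>x. indicat_real {r<..<s} x * g x \<partial>lebesgue_on {0<..<T}) + (\<integral>x. indicat_real {s<..<t} x * g x \<partial>lebesgue_on {0<..<T})"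
proof -
  have "(\<integral>x. indicat_real {r<..<t} x * g x \<partial>lebesgue_on {0<..<T}) =
    (\<integral>x. indicat_real {r<..<s} x * g x + indicat_real {s<..<t} x * g x \<partial>lebesgue_on {0<..<T})"
  proof (rule integral_cong_AE)
    show "AE x in lebesgue_on {0<..<T}. indicat_real {r<..<t} x * g x = indicat_real {r<..<s} x * g x + indicat_real {s<..<t} x * g x"
      using AE_lebesgue_on_negligible[OF negligible_sing[of s], of "{0<..<T}"]
      by (rule eventually_mono) (use st in \<open>auto simp: indicator_def\<close>)
  qed (use integrable_ind_mult[OF g] in \<open>auto intro!: borel_measurable_add\<close>)
  then show ?thesis by (simp add: integrable_ind_mult[OF g])
qed

text \<open>On an interval over which k has integral at most 1/2, the maximum of m is at most half
  of itself and so vanishes, once m is zero before. Uniform continuity of the indefinite integral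
  gives steps of one common length, and finitely many of them reach T.\<close>

lemma integral_gronwall_zero:
  fixes m k :: "real \<Rightarrow> real"
  assumes T: "T > 0" and m: "continuous_on {0..T} m" and m0: "\<And>t. t \<in> {0..T} \<Longrightarrow> m t \<ge> 0"
    and k: "integrable (lebesgue_on {0<..<T}) k" and k0: "\<And>t. k t \<ge> 0"
    and le: "\<And>t. t \<in> {0..T} \<Longrightarrow> m t \<le> (\<integral>x. indicat_real {0<..<t} x * (k x * m x) \<partial>lebesgue_on {0<..<T})"
    and t: "t \<in> {0..T}"
  shows "m t = 0"
proof -
  let ?M = "lebesgue_on {0<..<T}"
  define K where "K t = (\<integral>x. indicat_real {0<..<t} x * k x \<partial>?M)" for t
  have "uniformly_continuous_on {0..T} K"
    unfolding K_def[abs_def] by (intro compact_uniformly_continuous indefinite_integral_continuous k compact_Icc)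
  then obtain d where d: "d > 0" "\<And>s t. s \<in> {0..T} \<Longrightarrow> t \<in> {0..T} \<Longrightarrow> dist t s < d \<Longrightarrow> dist (K t) (K s) < 1 / 2"
    unfolding uniformly_continuous_on_def by (metis half_gt_zero_iff zero_less_one)
  have km: "integrable ?M (\<lambda>x. k x * m x)" by (rule integrable_continuous_mult[OF m k])
  have step: "\<forall>t\<in>{0..T}. t \<le> s + d / 2 \<longrightarrow> m t = 0"
    if s: "s \<in> {0..T}" and z: "\<And>t. t \<in> {0..T} \<Longrightarrow> t \<le> s \<Longrightarrow> m t = 0" for s
  proof -
    define r where "r = min T (s + d / 2)"
    have r: "s \<le> r" "r \<in> {0..T}" using s d(1) by (auto simp: r_def)
    have "continuous_on {s..r} m" by (rule continuous_on_subset[OF m]) (use s r in auto)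
    then obtain x0 where x0: "x0 \<in> {s..r}" "\<And>x. x \<in> {s..r} \<Longrightarrow> m x \<le> m x0"
      using continuous_attains_sup[OF compact_Icc, of s r m] r by auto
    have x0T: "x0 \<in> {0..T}" using x0 s r by auto
    have "m x0 \<le> (\<integral>x. indicat_real {0<..<s} x * (k x * m x) \<partial>?M) + (\<integral>x. indicat_real {s<..<x0} x * (k x * m x) \<partial>?M)"
      using le[OF x0T] ind_split[OF km, of 0 s x0] s x0 by simp
    also have "(\<integral>x. indicat_real {0<..<s} x * (k x * m x) \<partial>?M) = (\<integral>x. 0 \<partial>?M)"
      by (rule Bochner_Integration.integral_cong) (use z s in \<open>auto simp: indicator_def space_restrict_space\<close>)
    also have "(\<integral>x. indicat_real {s<..<x0} x * (k x * m x) \<partial>?M) \<le> (\<integral>x. indicat_real {s<..<x0} x * k x * m x0 \<partial>?M)"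
    proof (rule integral_mono)
      show "integrable ?M (\<lambda>x. indicat_real {s<..<x0} x * (k x * m x))" by (rule integrable_ind_mult[OF km])
      show "integrable ?M (\<lambda>x. indicat_real {s<..<x0} x * k x * m x0)" using integrable_ind_mult[OF k] by simp
      show "indicat_real {s<..<x0} x * (k x * m x) \<le> indicat_real {s<..<x0} x * k x * m x0" for x
        using x0 k0[of x] by (auto simp: indicator_def intro!: mult_left_mono)
    qed
    also have "\<dots> = (K x0 - K s) * m x0"
      using ind_split[OF k, of 0 s x0] s x0 by (simp add: K_def)
    also have "\<dots> \<le> 1 / 2 * m x0"
    proof (rule mult_right_mono)
      have "dist x0 s < d" using x0 d(1) by (auto simp: dist_real_def r_def)
      then have "\<bar>K x0 - K s\<bar> < 1 / 2" using d(2)[OF s x0T] by (simp only: dist_real_def)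
      then show "K x0 - K s \<le> 1 / 2" by linarith
    qed (rule m0[OF x0T])
    finally have "m x0 = 0" using m0[OF x0T] by simp
    then have "m t = 0" if "t \<in> {s..r}" for t
      using x0(2)[OF that] m0[of t] that s r by auto
    then show ?thesis using z unfolding r_def by force
  qed
  have "\<forall>t\<in>{0..T}. t \<le> real n * (d / 2) \<longrightarrow> m t = 0" for n
  proof (induction n)
    case 0
    have "m 0 \<le> (\<integral>x. indicat_real {0<..<0} x * (k x * m x) \<partial>?M)" using le[of 0] T by simp
    then have "m 0 = 0" using m0[of 0] T by simp
    then show ?case by auto
  next
    case (Suc n)
    show ?case
    proof (cases "real n * (d / 2) \<le> T")
      case True
      have "\<forall>t\<in>{0..T}. t \<le> real n * (d / 2) + d / 2 \<longrightarrow> m t = 0"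
        by (rule step) (use True Suc d(1) in auto)
      then show ?thesis by (simp add: algebra_simps)
    next
      case False
      then show ?thesis using Suc by auto
    qed
  qed
  moreover obtain n :: nat where "T / (d / 2) < real n" using reals_Archimedean2 by blast
  then have "T \<le> real n * (d / 2)" using d(1) by (simp add: field_simps)
  then have "t \<le> real n * (d / 2)" using t by auto
  ultimately show ?thesis using t by blast
qed

section \<open>Pairing with the dual space\<close>

context rectangle
begin

lemma V_dual_linear:
  assumes "l \<in> V_dual a b" "u \<in> V_space a b" "v \<in> V_space a b"
  shows "l (\<lambda>x. c *\<^sub>R u x + d *\<^sub>R v x) = c * l u + d * l v"
  using assms by (simp add: V_dual_def)

lemma V_dual_scale: "l \<in> V_dual a b \<Longrightarrow> u \<in> V_space a b \<Longrightarrow> l (\<lambda>x. c *\<^sub>R u x) = c * l u"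
  using V_dual_linear[of l u u c 0] by simp

lemma V_dual_psum:
  assumes l: "l \<in> V_dual a b" and I: "finite I"
  shows "l (psum I c) = (\<Sum>i\<in>I. c i * l (bas i))"
  using I
proof (induction I rule: finite_induct)
  case empty
  have "l (\<lambda>x. 0) = 0" using V_dual_scale[OF l V_zero, of 0] by simp
  then show ?case by (simp add: psum_def[abs_def])
next
  case (insert i I)
  have "psum (insert i I) c = (\<lambda>x. c i *\<^sub>R bas i x + 1 *\<^sub>R psum I c x)"
    using insert by (simp add: psum_def fun_eq_iff)
  then have "l (psum (insert i I) c) = c i * l (bas i) + 1 * l (psum I c)"
    using V_dual_linear[OF l D1_V[OF bas_D1] psum_V, of "c i" i 1 I c] by simp
  then show ?case using insert by simp
qed

lemma V_dual_ex_bound: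
  assumes "l \<in> V_dual a b" obtains C where "C \<ge> 0" "\<And>v. v \<in> V_space a b \<Longrightarrow> \<bar>l v\<bar> \<le> C * V_norm a b v"
proof -
  obtain C where C: "\<And>v. v \<in> V_space a b \<Longrightarrow> \<bar>l v\<bar> \<le> C * V_norm a b v"
    using assms unfolding V_dual_def by blast
  have "\<bar>l v\<bar> \<le> max C 0 * V_norm a b v" if "v \<in> V_space a b" for v
    using C[OF that] mult_right_mono[of C "max C 0" "V_norm a b v"] by simp
  then show ?thesis using that[of "max C 0"] by simp
qed

text \<open>A supremum of reals is meaningful only for a bounded set, and membership in
  \<open>V_dual\<close> provides the bound. A field of V norm zero cannot be normalised; there the
  same bound forces l v = 0.\<close>

lemma V_dual_bound:
  assumes l: "l \<in> V_dual a b" and v: "v \<in> V_space a b"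
  shows "\<bar>l v\<bar> \<le> V_dual_norm a b l * V_norm a b v"
proof -
  obtain C where C: "C \<ge> 0" "\<And>v. v \<in> V_space a b \<Longrightarrow> \<bar>l v\<bar> \<le> C * V_norm a b v"
    using V_dual_ex_bound[OF l] by blast
  show ?thesis
  proof (cases "V_norm a b v = 0")
    case True
    then show ?thesis using C(2)[OF v] by simp
  next
    case False
    then have pos: "V_norm a b v > 0" using V_norm_nonneg[of v] by linarith
    let ?w = "\<lambda>x. (1 / V_norm a b v) *\<^sub>R v x"
    have w: "?w \<in> V_space a b" by (rule V_scale[OF v])
    have nw: "V_norm a b ?w = 1" using V_norm_scale[OF V_H1[OF v], of "1 / V_norm a b v"] pos by simp
    have "\<bar>l ?w\<bar> \<le> V_dual_norm a b l"
      unfolding V_dual_norm_def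
    proof (rule cSUP_upper)
      show "?w \<in> {v \<in> V_space a b. V_norm a b v \<le> 1}" using w nw by simp
      have "\<bar>l v\<bar> \<le> C" if "v \<in> V_space a b" "V_norm a b v \<le> 1" for v
        using C(2)[OF that(1)] mult_left_mono[OF that(2) C(1)] by simp
      then show "bdd_above ((\<lambda>v. \<bar>l v\<bar>) ` {v \<in> V_space a b. V_norm a b v \<le> 1})"
        by (intro bdd_aboveI2[of _ _ C]) auto
    qed
    then show ?thesis
      using V_dual_scale[OF l v, of "1 / V_norm a b v"] pos by (simp add: abs_mult field_simps)
  qed
qed

lemma V_dual_norm_nonneg:
  assumes l: "l \<in> V_dual a b" shows "V_dual_norm a b l \<ge> 0"
proof -
  have "0 \<le> \<bar>l (bas (0,0))\<bar>" by simp
  also have "\<dots> \<le> V_dual_norm a b l * V_norm a b (bas (0,0))" by (rule V_dual_bound[OF l D1_V[OF bas_D1]])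
  finally have "0 \<le> V_dual_norm a b l * V_norm a b (bas (0,0))" .
  moreover have "V_norm a b (bas (0,0)) > 0" using lam_pos[of "(0,0)"] by (simp add: V_norm_def dirichlet_bas_bas)
  ultimately show ?thesis by (simp add: zero_le_mult_iff)
qed

lemma V_dual_combine:
  assumes "l \<in> V_dual a b" "m \<in> V_dual a b"
  shows "(\<lambda>v. c * l v + d * m v) \<in> V_dual a b"
proof -
  obtain C where C: "C \<ge> 0" "\<And>v. v \<in> V_space a b \<Longrightarrow> \<bar>l v\<bar> \<le> C * V_norm a b v"
    using V_dual_ex_bound[OF assms(1)] by blast
  obtain D where D: "D \<ge> 0" "\<And>v. v \<in> V_space a b \<Longrightarrow> \<bar>m v\<bar> \<le> D * V_norm a b v"
    using V_dual_ex_bound[OF assms(2)] by blast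
  have "\<bar>c * l v + d * m v\<bar> \<le> (\<bar>c\<bar> * C + \<bar>d\<bar> * D) * V_norm a b v" if "v \<in> V_space a b" for v
  proof -
    have "\<bar>c * l v + d * m v\<bar> \<le> \<bar>c\<bar> * \<bar>l v\<bar> + \<bar>d\<bar> * \<bar>m v\<bar>" by (metis abs_mult abs_triangle_ineq)
    also have "\<dots> \<le> \<bar>c\<bar> * (C * V_norm a b v) + \<bar>d\<bar> * (D * V_norm a b v)"
      by (intro add_mono mult_left_mono C(2) D(2) that) auto
    finally show ?thesis by (simp add: algebra_simps)
  qed
  then have "\<exists>C. \<forall>v\<in>V_space a b. \<bar>c * l v + d * m v\<bar> \<le> C * V_norm a b v" by blast
  then show ?thesis using V_dual_linear[OF assms(1)] V_dual_linear[OF assms(2)]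
    by (simp add: V_dual_def algebra_simps)
qed

lemma V_dual_diff: "l \<in> V_dual a b \<Longrightarrow> m \<in> V_dual a b \<Longrightarrow> (\<lambda>v. l v - m v) \<in> V_dual a b"
  using V_dual_combine[of l m 1 "-1"] by simp

lemma V_dual_lincomb:
  "(\<And>k. k < (n::nat) \<Longrightarrow> z k \<in> V_dual a b) \<Longrightarrow> (\<lambda>v. \<Sum>k<n. c k *\<^sub>R z k v) \<in> V_dual a b"
proof (induction n)
  case 0
  show ?case by (auto simp: V_dual_def intro!: exI[of _ 0])
next
  case (Suc n)
  have "(\<lambda>v. 1 * (\<Sum>k<n. c k *\<^sub>R z k v) + c n * z n v) \<in> V_dual a b"
    using Suc by (intro V_dual_combine) auto
  then show ?case by simp
qed

section \<open>Evaluating step functions and Bochner integrals at an element of V\<close>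

lemma step_pairing:
  assumes "has_step_integral (V_dual a b) S s J"
  shows "integrable (lebesgue_on S) (\<lambda>t. s t v)" "(\<integral>t. s t v \<partial>lebesgue_on S) = J v"
    and "\<And>t. t \<in> S \<Longrightarrow> s t \<in> V_dual a b" "J \<in> V_dual a b"
proof -
  obtain n :: nat and E z where E: "\<And>k. k < n \<Longrightarrow> E k \<in> sets (lebesgue_on S) \<and> emeasure (lebesgue_on S) (E k) < \<infinity> \<and> z k \<in> V_dual a b"
    and s: "\<And>t. t \<in> S \<Longrightarrow> s t = (\<lambda>x. \<Sum>k<n. indicat_real (E k) t *\<^sub>R z k x)"
    and J: "J = (\<lambda>x. \<Sum>k<n. measure (lebesgue_on S) (E k) *\<^sub>R z k x)"
    using assms unfolding has_step_integral_def by blast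
  show "s t \<in> V_dual a b" if "t \<in> S" for t
    unfolding s[OF that] by (rule V_dual_lincomb) (use E in auto)
  show "J \<in> V_dual a b" unfolding J by (rule V_dual_lincomb) (use E in auto)
  have st: "s t v = (\<Sum>k<n. indicat_real (E k) t * z k v)" if "t \<in> space (lebesgue_on S)" for t
    using s[of t] that by (auto simp: space_restrict_space)
  have i: "integrable (lebesgue_on S) (\<lambda>t. indicat_real (E k) t * z k v)" if "k < n" for k
    using E[OF that] by (intro integrable_mult_left integrable_real_indicator) auto
  show "integrable (lebesgue_on S) (\<lambda>t. s t v)"
  proof -
    have "integrable (lebesgue_on S) (\<lambda>t. \<Sum>k<n. indicat_real (E k) t * z k v)"
      by (rule Bochner_Integration.integrable_sum) (use i in simp)
    then show ?thesis by (simp only: Bochner_Integration.integrable_cong[OF refl st])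
  qed
  have "(\<integral>t. s t v \<partial>lebesgue_on S) = (\<integral>t. (\<Sum>k<n. indicat_real (E k) t * z k v) \<partial>lebesgue_on S)"
    by (rule Bochner_Integration.integral_cong[OF refl st])
  also have "\<dots> = (\<Sum>k<n. \<integral>t. indicat_real (E k) t * z k v \<partial>lebesgue_on S)"
    by (rule Bochner_Integration.integral_sum) (use i in auto)
  also have "\<dots> = J v" unfolding J
  proof (intro sum.cong refl)
    fix k assume "k \<in> {..<n}"
    then have k: "E k \<in> sets (lebesgue_on S)" using E by simp
    then have "E k \<inter> S = E k" using sets.sets_into_space[OF k] by (auto simp: space_restrict_space)
    then show "(\<integral>t. indicat_real (E k) t * z k v \<partial>lebesgue_on S) = measure (lebesgue_on S) (E k) *\<^sub>R z k v"
      by (simp add: space_restrict_space)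
  qed
  finally show "(\<integral>t. s t v \<partial>lebesgue_on S) = J v" .
qed

lemma pairing_tendsto:
  assumes "AE t in lebesgue_on S. f t \<in> V_dual a b" and s: "\<And>m. has_step_integral (V_dual a b) S (s m) (J m)"
    and lim: "AE t in lebesgue_on S. (\<lambda>m. V_dual_norm a b (\<lambda>x. f t x - s m t x)) \<longlonglongrightarrow> 0"
    and v: "v \<in> V_space a b"
  shows "AE t in lebesgue_on S. (\<lambda>m. s m t v) \<longlonglongrightarrow> f t v"
  using assms(1) lim AE_space
proof eventually_elim
  case (elim t)
  then have t: "t \<in> S" by (simp add: space_restrict_space)
  have "(\<lambda>m. f t v - s m t v) \<longlonglongrightarrow> 0"
  proof (rule Lim_null_comparison)
    show "(\<lambda>m. V_dual_norm a b (\<lambda>x. f t x - s m t x) * V_norm a b v) \<longlonglongrightarrow> 0"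
      using tendsto_mult_right[OF elim(2), of "V_norm a b v"] by simp
    show "\<forall>\<^sub>F m in sequentially. norm (f t v - s m t v) \<le> V_dual_norm a b (\<lambda>x. f t x - s m t x) * V_norm a b v"
      using V_dual_bound[OF V_dual_diff[OF elim(1) step_pairing(3)[OF s t]] v] by (intro always_eventually allI) simp
  qed
  from tendsto_diff[OF tendsto_const[of "f t v"] this] show ?case by simp
qed

lemma pairing_measurable:
  fixes S :: "real set"
  assumes f: "AE t in lebesgue_on S. f t \<in> V_dual a b" and s: "\<And>m. has_step_integral (V_dual a b) S (s m) (J m)"
    and lim: "AE t in lebesgue_on S. (\<lambda>m. V_dual_norm a b (\<lambda>x. f t x - s m t x)) \<longlonglongrightarrow> 0"
    and v: "v \<in> V_space a b" and S: "S \<in> sets lebesgue"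
  shows "(\<lambda>t. f t v) \<in> borel_measurable (lebesgue_on S)"
proof (rule borel_measurable_lebesgue_on_AE[OF S])
  have sm: "(\<lambda>t. s m t v) \<in> borel_measurable (lebesgue_on S)" for m
    using step_pairing(1)[OF s, of m v] by blast
  show "(\<lambda>t. lim (\<lambda>m. s m t v)) \<in> borel_measurable (lebesgue_on S)"
    using sm by (rule borel_measurable_lim_metric)
  show "AE t in lebesgue_on S. lim (\<lambda>m. s m t v) = f t v"
    using pairing_tendsto[OF f s lim v] by eventually_elim (rule limI)
qed

lemma strongly_measurable_pairing:
  fixes S :: "real set"
  assumes "strongly_measurable (V_dual a b) (V_dual_norm a b) S f" and v: "v \<in> V_space a b" and S: "S \<in> sets lebesgue"
  shows "(\<lambda>t. f t v) \<in> borel_measurable (lebesgue_on S)"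
  using assms pairing_measurable unfolding strongly_measurable_def by blast

text \<open>Evaluation at v is a bounded functional on V', so it commutes with the Bochner integral:
  the step functions converge in L1 after evaluation, and their integrals J m v converge to I
  v.\<close>

lemma bochner_pairing:
  fixes S :: "real set"
  assumes B: "has_bochner_integral_in (V_dual a b) (V_dual_norm a b) S f I" and v: "v \<in> V_space a b"
    and S: "S \<in> sets lebesgue"
  shows "integrable (lebesgue_on S) (\<lambda>t. f t v)" "(\<integral>t. f t v \<partial>lebesgue_on S) = I v"
proof -
  let ?M = "lebesgue_on S"
  obtain s J where f: "AE t in ?M. f t \<in> V_dual a b" and I: "I \<in> V_dual a b"
    and s: "\<And>m. has_step_integral (V_dual a b) S (s m) (J m)"
    and lim: "AE t in ?M. (\<lambda>m. V_dual_norm a b (\<lambda>x. f t x - s m t x)) \<longlonglongrightarrow> 0"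
    and L1: "(\<lambda>m. \<integral>\<^sup>+ t. ennreal (V_dual_norm a b (\<lambda>x. f t x - s m t x)) \<partial>?M) \<longlonglongrightarrow> 0"
    and J: "(\<lambda>m. V_dual_norm a b (\<lambda>x. J m x - I x)) \<longlonglongrightarrow> 0"
    using B unfolding has_bochner_integral_in_def by blast
  have fm [measurable]: "(\<lambda>t. f t v) \<in> borel_measurable ?M" by (rule pairing_measurable[OF f s lim v S])
  have sm [measurable]: "(\<lambda>t. s m t v) \<in> borel_measurable ?M" for m
    using step_pairing(1)[OF s, of m v] by blast
  have le: "(\<integral>\<^sup>+t. ennreal (norm (f t v - s m t v)) \<partial>?M) \<le>
      ennreal (V_norm a b v + 1) * (\<integral>\<^sup>+ t. ennreal (V_dual_norm a b (\<lambda>x. f t x - s m t x)) \<partial>?M)" for m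
  proof -
    \<comment> \<open>The summand 1 makes c positive, so that it can be divided by.\<close>
    define c where "c = V_norm a b v + 1"
    have c: "c > 0" "V_norm a b v \<le> c" using V_norm_nonneg[of v] by (auto simp: c_def add_nonneg_pos)
    have "(\<integral>\<^sup>+t. ennreal (norm (f t v - s m t v) / c) \<partial>?M) \<le> (\<integral>\<^sup>+ t. ennreal (V_dual_norm a b (\<lambda>x. f t x - s m t x)) \<partial>?M)"
    proof (rule nn_integral_mono_AE)
      show "AE t in ?M. ennreal (norm (f t v - s m t v) / c) \<le> ennreal (V_dual_norm a b (\<lambda>x. f t x - s m t x))"
        using f AE_space
      proof eventually_elim
        case (elim t)
        then have t: "t \<in> S" by (simp add: space_restrict_space)
        note d = V_dual_diff[OF elim(1) step_pairing(3)[OF s t]]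
        have "\<bar>f t v - s m t v\<bar> \<le> V_dual_norm a b (\<lambda>x. f t x - s m t x) * V_norm a b v"
          by (rule V_dual_bound[OF d v])
        also have "\<dots> \<le> V_dual_norm a b (\<lambda>x. f t x - s m t x) * c"
          by (rule mult_left_mono[OF c(2) V_dual_norm_nonneg[OF d]])
        finally show ?case using c by (intro ennreal_leI) (simp add: field_simps)
      qed
    qed
    then have "ennreal c * (\<integral>\<^sup>+t. ennreal (norm (f t v - s m t v) / c) \<partial>?M) \<le> ennreal c * (\<integral>\<^sup>+ t. ennreal (V_dual_norm a b (\<lambda>x. f t x - s m t x)) \<partial>?M)"
      by (rule mult_left_mono) simp
    also have "ennreal c * (\<integral>\<^sup>+t. ennreal (norm (f t v - s m t v) / c) \<partial>?M) = (\<integral>\<^sup>+t. ennreal c * ennreal (norm (f t v - s m t v) / c) \<partial>?M)"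
      by (rule nn_integral_cmult[symmetric]) measurable
    also have "\<dots> = (\<integral>\<^sup>+t. ennreal (norm (f t v - s m t v)) \<partial>?M)"
      using c by (intro nn_integral_cong) (simp add: ennreal_mult[symmetric])
    finally show ?thesis unfolding c_def .
  qed
  have "(\<lambda>m. ennreal (V_norm a b v + 1) * (\<integral>\<^sup>+ t. ennreal (V_dual_norm a b (\<lambda>x. f t x - s m t x)) \<partial>?M)) \<longlonglongrightarrow> ennreal (V_norm a b v + 1) * 0"
    by (rule ennreal_tendsto_cmult[OF _ L1]) simp
  note ub = this
  have L1v: "(\<lambda>m. \<integral>\<^sup>+t. ennreal (norm (f t v - s m t v)) \<partial>?M) \<longlonglongrightarrow> 0"
    by (rule tendsto_sandwich[OF always_eventually[OF allI[OF zero_le]] always_eventually[OF allI[OF le]]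
          tendsto_const ub[unfolded mult_zero_right]])
  \<comment> \<open>A single step function at finite L1 distance already makes the evaluated
    function integrable.\<close>
  obtain m0 where m0: "(\<integral>\<^sup>+t. ennreal (norm (f t v - s m0 t v)) \<partial>?M) < 1"
    using order_tendstoD(2)[OF L1v, of 1] eventually_sequentially by fastforce
  have "integrable ?M (\<lambda>t. f t v - s m0 t v)"
    by (rule integrableI_bounded) (use m0 less_trans[OF m0, of \<infinity>] in auto)
  from Bochner_Integration.integrable_add[OF this step_pairing(1)[OF s, of m0 v]]
  show int: "integrable ?M (\<lambda>t. f t v)" by simp
  have "(\<lambda>m. \<integral>t. s m t v \<partial>?M) \<longlonglongrightarrow> (\<integral>t. f t v \<partial>?M)"
    by (rule tendsto_L1_int[OF step_pairing(1)[OF s] int])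
       (use L1v in \<open>simp only: norm_minus_commute[of "s _ _ v"]\<close>)
  then have 1: "(\<lambda>m. J m v) \<longlonglongrightarrow> (\<integral>t. f t v \<partial>?M)" by (simp add: step_pairing(2)[OF s])
  have "(\<lambda>m. J m v - I v) \<longlonglongrightarrow> 0"
  proof (rule Lim_null_comparison)
    show "(\<lambda>m. V_dual_norm a b (\<lambda>x. J m x - I x) * V_norm a b v) \<longlonglongrightarrow> 0"
      using tendsto_mult_right[OF J, of "V_norm a b v"] by simp
    show "\<forall>\<^sub>F m in sequentially. norm (J m v - I v) \<le> V_dual_norm a b (\<lambda>x. J m x - I x) * V_norm a b v"
      using V_dual_bound[OF V_dual_diff[OF step_pairing(4)[OF s] I] v] by (intro always_eventually allI) simp
  qed
  then have "(\<lambda>m. J m v) \<longlonglongrightarrow> I v" using LIM_zero_iff by blast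
  with 1 show "(\<integral>t. f t v \<partial>?M) = I v" by (rule LIMSEQ_unique)
qed

text \<open>Reduces the V'-valued problem to scalar equations for the coefficients; all later
  arguments use the solution through these data.\<close>

lemma solution_data:
  assumes F: "F \<in> bochner_Lp 2 (V_dual a b) (V_dual_norm a b) {0<..<T}" and T: "T > 0"
    and sol: "is_solution a b T \<nu> F u0 u"
  obtains c g where "\<And>i. primitive_on T (c i) (g i)" "\<And>i. c i 0 = coef u0 i"
    and "AE t in lebesgue_on {0<..<T}. u t \<in> V_space a b \<and> F t \<in> V_dual a b \<and>
      (\<forall>i. c i t = coef (u t) i \<and>
        g i t = F t (bas i) - \<nu> * (lam i * coef (u t) i) - b_form a b (u t) (u t) (bas i))"
    and "integrable (lebesgue_on {0<..<T}) (\<lambda>t. (V_norm a b (u t))\<^sup>2)"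
proof -
  let ?S = "{0<..<T}"
  let ?M = "lebesgue_on ?S"
  have S: "?S \<in> sets lebesgue" by simp
  obtain u' w where uL: "u \<in> bochner_Lp 2 (V_space a b) (V_norm a b) ?S"
    and u': "u' \<in> bochner_Lp 1 (V_dual a b) (V_dual_norm a b) ?S"
    and der: "has_distributional_derivative (V_dual a b) (V_dual_norm a b) ?S (\<lambda>t. embed_H a b (u t)) u'"
    and eq: "AE t in ?M. V_dual_equal a b (\<lambda>v. u' t v + \<nu> * stokes_op a b (u t) v + B_op a b (u t) v) (F t)"
    and w: "continuous_into (V_dual a b) (V_dual_norm a b) {0..T} w"
    and uw: "AE t in ?M. V_dual_equal a b (embed_H a b (u t)) (w t)"
    and w0: "V_dual_equal a b (w 0) (embed_H a b u0)"
    using sol unfolding is_solution_def by blast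
  note basV = D1_V[OF bas_D1]
  \<comment> \<open>Taken from the continuous representative w and not from u, so that c i t has a
    meaning for every t, in particular at 0.\<close>
  define c where "c i t = w t (bas i)" for i t
  define g where "g i t = u' t (bas i)" for i t
  have g: "integrable ?M (g i)" for i
  proof -
    have m: "g i \<in> borel_measurable ?M"
      unfolding g_def[abs_def] using u' by (intro strongly_measurable_pairing basV S) (simp add: bochner_Lp_def)
    have "integrable ?M (\<lambda>t. V_dual_norm a b (u' t) * V_norm a b (bas i))"
      using u' by (simp add: bochner_Lp_def)
    then show ?thesis
    proof (rule Bochner_Integration.integrable_bound[OF _ m])
      have "AE t in ?M. u' t \<in> V_dual a b" using u' by (simp add: bochner_Lp_def strongly_measurable_def)
      then show "AE t in ?M. norm (g i t) \<le> norm (V_dual_norm a b (u' t) * V_norm a b (bas i))"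
      proof eventually_elim
        case (elim t)
        then show ?case using V_dual_bound[OF elim basV, of i] by (simp add: g_def)
      qed
    qed
  qed
  have cc: "continuous_on {0..T} (c i)" for i
    unfolding continuous_on_def
  proof
    fix t1 assume t1: "t1 \<in> {0..T}"
    have lim: "((\<lambda>t. V_dual_norm a b (\<lambda>x. w t x - w t1 x)) \<longlongrightarrow> 0) (at t1 within {0..T})"
      using w t1 by (simp add: continuous_into_def)
    have "((\<lambda>t. c i t - c i t1) \<longlongrightarrow> 0) (at t1 within {0..T})"
    proof (rule Lim_null_comparison)
      show "((\<lambda>t. V_dual_norm a b (\<lambda>x. w t x - w t1 x) * V_norm a b (bas i)) \<longlongrightarrow> 0) (at t1 within {0..T})"
        using tendsto_mult_right[OF lim, of "V_norm a b (bas i)"] by simp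
      show "\<forall>\<^sub>F t in at t1 within {0..T}. norm (c i t - c i t1) \<le> V_dual_norm a b (\<lambda>x. w t x - w t1 x) * V_norm a b (bas i)"
        unfolding eventually_at_filter
      proof (intro always_eventually allI impI)
        fix t assume "t \<in> {0..T}"
        then have "w t \<in> V_dual a b" "w t1 \<in> V_dual a b" using w t1 by (auto simp: continuous_into_def)
        from V_dual_bound[OF V_dual_diff[OF this] basV]
        show "norm (c i t - c i t1) \<le> V_dual_norm a b (\<lambda>x. w t x - w t1 x) * V_norm a b (bas i)"
          by (simp add: c_def)
      qed
    qed
    then show "(c i \<longlongrightarrow> c i t1) (at t1 within {0..T})" using LIM_zero_iff by blast
  qed
  have emb: "embed_H a b v (bas i) = coef v i" for v i by (simp add: embed_H_def coef_def)
  have uc: "AE t in ?M. coef (u t) i = c i t" for i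
    using uw
  proof eventually_elim
    case (elim t)
    then have "embed_H a b (u t) (bas i) = w t (bas i)" using basV by (simp only: V_dual_equal_def)
    then show ?case by (simp add: emb c_def)
  qed
  have prim: "primitive_on T (c i) (g i)" for i
    unfolding primitive_on_def
  proof (intro conjI allI impI cc g)
    fix s t assume st: "0 \<le> s" "s \<le> t" "t \<le> T"
    show "c i t - c i s = (\<integral>x. indicat_real {s<..<t} x * g i x \<partial>?M)"
    proof (rule weak_derivative_primitive[OF cc st uc g])
      fix \<phi> assume "\<phi> \<in> test_functions ?S"
      then obtain I where I: "has_bochner_integral_in (V_dual a b) (V_dual_norm a b) ?S (\<lambda>t x. deriv \<phi> t *\<^sub>R embed_H a b (u t) x) I"
        "has_bochner_integral_in (V_dual a b) (V_dual_norm a b) ?S (\<lambda>t x. \<phi> t *\<^sub>R u' t x) (\<lambda>x. - I x)"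
        using der unfolding has_distributional_derivative_def by blast
      show "integrable ?M (\<lambda>x. deriv \<phi> x * coef (u x) i) \<and>
         (\<integral>x. deriv \<phi> x * coef (u x) i \<partial>?M) = - (\<integral>x. \<phi> x * g i x \<partial>?M)"
        using bochner_pairing[OF I(1) basV[of i] S] bochner_pairing[OF I(2) basV[of i] S]
        by (simp add: emb g_def)
    qed
  qed
  have c0: "c i 0 = coef u0 i" for i
    using w0 basV by (simp add: c_def V_dual_equal_def emb)
  have FV: "AE t in ?M. F t \<in> V_dual a b" using F by (simp add: bochner_Lp_def strongly_measurable_def)
  have uV: "AE t in ?M. u t \<in> V_space a b" using uL by (simp add: bochner_Lp_def strongly_measurable_def)
  have all: "AE t in ?M. u t \<in> V_space a b \<and> F t \<in> V_dual a b \<and>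
      (\<forall>i. c i t = coef (u t) i \<and>
        g i t = F t (bas i) - \<nu> * (lam i * coef (u t) i) - b_form a b (u t) (u t) (bas i))"
    using FV uV uw eq
  proof eventually_elim
    case (elim t)
    have "c i t = coef (u t) i" for i using elim(3) basV[of i] by (auto simp: V_dual_equal_def c_def emb)
    moreover have "g i t = F t (bas i) - \<nu> * (lam i * coef (u t) i) - b_form a b (u t) (u t) (bas i)" for i
    proof -
      have "u' t (bas i) + \<nu> * stokes_op a b (u t) (bas i) + B_op a b (u t) (bas i) = F t (bas i)"
        using elim(4) basV[of i] by (auto simp: V_dual_equal_def)
      then show ?thesis by (simp add: g_def stokes_op_def B_op_def dirichlet_V_bas[OF elim(2)])
    qed
    ultimately show ?case using elim by blast
  qed
  have "integrable ?M (\<lambda>t. (V_norm a b (u t))\<^sup>2)" using uL by (simp add: bochner_Lp_def)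
  with prim c0 all show ?thesis using that by blast
qed

end

section \<open>Energy estimates, continuity and uniqueness\<close>

lemma quadratic_bound:
  fixes S A B :: real
  assumes "S\<^sup>2 \<le> A + B * S" "A \<ge> 0" "B \<ge> 0"
  shows "S \<le> A + B + 1"
proof (rule ccontr)
  assume "\<not> S \<le> A + B + 1"
  then have S: "S > A + B + 1" by simp
  have "A + B * S \<le> (A + B) * S"
    using S assms mult_left_mono[of 1 S A] by (simp add: algebra_simps)
  also have "\<dots> < S * S" using S assms by (intro mult_strict_right_mono) auto
  finally show False using assms(1) by (simp add: power2_eq_square)
qed

context rectangle
begin

lemma b_psum:
  assumes "u \<in> L2 R" "v \<in> H1_vec R"
  shows "b_form a b u v (psum I c) = (\<Sum>i\<in>I. c i * b_form a b u v (bas i))"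
  unfolding psum_def[abs_def] by (rule b_sum_right) (intro b_integrable_D1_right assms bas_D1)

text \<open>On the left stands the time derivative of |PP n u|^2, assembled coefficient by
  coefficient; on the right the equation tested with PP n u.\<close>

lemma galerkin_identity:
  assumes l: "l \<in> V_dual a b" and u: "u \<in> V_space a b"
  shows "(\<Sum>i\<in>KK n. 2 * ((l (bas i) - \<nu> * (lam i * coef u i) - b_form a b u u (bas i)) * coef u i)) =
    2 * (l (PP n u) - \<nu> * (V_norm a b (PP n u))\<^sup>2 - b_form a b u u (PP n u))"
proof -
  have "(\<Sum>i\<in>KK n. 2 * ((l (bas i) - \<nu> * (lam i * coef u i) - b_form a b u u (bas i)) * coef u i)) =
     2 * ((\<Sum>i\<in>KK n. coef u i * l (bas i)) - \<nu> * (\<Sum>i\<in>KK n. lam i * (coef u i)\<^sup>2) - (\<Sum>i\<in>KK n. coef u i * b_form a b u u (bas i)))"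
    by (simp add: sum_distrib_left sum_subtractf[symmetric] power2_eq_square algebra_simps)
  then show ?thesis
    by (simp add: V_dual_psum[OF l] psum_V_norm b_psum[OF V_L2[OF u] V_H1[OF u]])
qed

definition cb :: real where "cb = 8 * bern / sqrt kap"

lemma cb_nonneg: "cb \<ge> 0"
  using bern_pos kap_pos by (simp add: cb_def)

lemma PP_V_diff_le: "u \<in> V_space a b \<Longrightarrow> V_norm a b (\<lambda>x. u x - PP n u x) \<le> 2 * V_norm a b u"
  using V_tri_sub[OF V_H1 D1_H1[OF psum_D1], of u "KK n" "coef u"] PP_V_norm_le[of u n] by simp

text \<open>The right side is affine in |PP n u|, with coefficients that are integrable in time and
  free of n. The dissipative term is bounded in absolute value instead of being dropped, since the
  estimate also has to serve as a modulus of continuity in t.\<close>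

lemma energy_rate_bound:
  assumes l: "l \<in> V_dual a b" and u: "u \<in> V_space a b" and \<nu>: "\<nu> > 0"
  shows "\<bar>2 * (l (PP n u) - \<nu> * (V_norm a b (PP n u))\<^sup>2 - b_form a b u u (PP n u))\<bar> \<le>
    ((V_dual_norm a b l)\<^sup>2 + (1 + 2 * \<nu>) * (V_norm a b u)\<^sup>2) + 8 * cb * (V_norm a b u)\<^sup>2 * L2_norm R (PP n u)"
proof -
  define U where "U = V_norm a b u"
  define P where "P = V_norm a b (PP n u)"
  define p where "p = L2_norm R (PP n u)"
  define N where "N = V_dual_norm a b l"
  define Q where "Q = V_norm a b (\<lambda>x. u x - PP n u x)"
  have P: "0 \<le> P" "P \<le> U" unfolding P_def U_def using PP_V_norm_le[OF u] by auto
  have Q: "0 \<le> Q" "Q \<le> 2 * U" unfolding Q_def U_def using PP_V_diff_le[OF u] by auto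
  have N: "0 \<le> N" unfolding N_def by (rule V_dual_norm_nonneg[OF l])
  have p: "0 \<le> p" by (simp add: p_def)
  have "\<bar>l (PP n u)\<bar> \<le> N * P" unfolding N_def P_def by (rule V_dual_bound[OF l psum_V])
  also have "\<dots> \<le> N * U" using P N by (intro mult_left_mono)
  finally have 1: "2 * \<bar>l (PP n u)\<bar> \<le> N\<^sup>2 + U\<^sup>2" using sum_squares_bound[of N U] by simp
  have 2: "P\<^sup>2 \<le> U\<^sup>2" using P by (intro power_mono) auto
  have "\<bar>b_form a b u u (PP n u)\<bar> \<le> cb * Q * (U * p + p * P)"
    using b_projection[OF u u, of n] unfolding cb_def Q_def U_def p_def P_def .
  also have "\<dots> \<le> cb * (2 * U) * (U * p + p * U)"
    using P Q p cb_nonneg by (intro mult_mono add_mono mult_left_mono) auto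
  also have "\<dots> = 4 * cb * U\<^sup>2 * p" by (simp add: power2_eq_square algebra_simps)
  finally have 3: "\<bar>b_form a b u u (PP n u)\<bar> \<le> 4 * cb * U\<^sup>2 * p" .
  have "\<bar>2 * (l (PP n u) - \<nu> * P\<^sup>2 - b_form a b u u (PP n u))\<bar> \<le> 2 * \<bar>l (PP n u)\<bar> + 2 * (\<nu> * P\<^sup>2) + 2 * \<bar>b_form a b u u (PP n u)\<bar>"
  proof -
    have "\<bar>2 * (x - y - r)\<bar> \<le> 2 * \<bar>x\<bar> + 2 * y + 2 * \<bar>r\<bar>" if "y \<ge> 0" for x y r :: real
      using that abs_ge_self[of x] abs_ge_minus_self[of x] abs_ge_self[of r] abs_ge_minus_self[of r]
      unfolding abs_le_iff[of "2 * (x - y - r)"] by simp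
    then show ?thesis using \<nu> by simp
  qed
  also have "\<dots> \<le> (N\<^sup>2 + U\<^sup>2) + 2 * (\<nu> * U\<^sup>2) + 2 * (4 * cb * U\<^sup>2 * p)"
    using 1 2 3 \<nu> by (intro add_mono mult_left_mono) auto
  finally show ?thesis unfolding U_def P_def p_def N_def by (simp add: algebra_simps)
qed

lemma primitive_on_modulus:
  assumes p: "primitive_on T Y G" and D: "integrable (lebesgue_on {0<..<T}) D"
    and le: "AE x in lebesgue_on {0<..<T}. \<bar>G x\<bar> \<le> D x" and st: "0 \<le> s" "s \<le> t" "t \<le> T"
  shows "\<bar>Y t - Y s\<bar> \<le> (\<integral>x. indicat_real {s<..<t} x * D x \<partial>lebesgue_on {0<..<T})"
proof -
  have G: "integrable (lebesgue_on {0<..<T}) G" using p by (simp add: primitive_on_def)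
  have "\<bar>Y t - Y s\<bar> = \<bar>\<integral>x. indicat_real {s<..<t} x * G x \<partial>lebesgue_on {0<..<T}\<bar>"
    using p st by (simp add: primitive_on_def)
  also have "\<dots> \<le> (\<integral>x. \<bar>indicat_real {s<..<t} x * G x\<bar> \<partial>lebesgue_on {0<..<T})" by (rule integral_abs_bound)
  also have "\<dots> \<le> (\<integral>x. indicat_real {s<..<t} x * D x \<partial>lebesgue_on {0<..<T})"
  proof (rule integral_mono_AE)
    show "AE x in lebesgue_on {0<..<T}. \<bar>indicat_real {s<..<t} x * G x\<bar> \<le> indicat_real {s<..<t} x * D x"
      using le by eventually_elim (simp add: abs_mult mult_left_mono)
  qed (use integrable_ind_mult G D in auto)
  finally show ?thesis .
qed

lemma ind_integral_le:
  fixes D :: "real \<Rightarrow> real"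
  assumes D: "integrable (lebesgue_on {0<..<T}) D" and nn: "\<And>x. D x \<ge> 0"
  shows "(\<integral>x. indicat_real {s<..<t} x * D x \<partial>lebesgue_on {0<..<T}) \<le> (\<integral>x. D x \<partial>lebesgue_on {0<..<T})"
  by (rule integral_mono[OF integrable_ind_mult[OF D] D]) (use nn in \<open>simp add: indicator_def\<close>)

text \<open>Testing with \<open>PP n u\<close> bounds \<open>y n = \<bar>PP n u\<bar>\<^sup>2\<close> through
  \<open>M\<^sup>2 \<le> A + B * M\<close> for \<open>M = sup (sqrt (y n))\<close>, with \<open>A\<close> and \<open>B\<close> independent of \<open>n\<close>.\<close>

lemma solution_bounds:
  assumes F: "F \<in> bochner_Lp 2 (V_dual a b) (V_dual_norm a b) {0<..<T}" and T: "T > 0" and \<nu>: "\<nu> > 0"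
    and u0: "u0 \<in> L2 R" and sol: "is_solution a b T \<nu> F u0 u"
  obtains c g M D where "\<And>i. primitive_on T (c i) (g i)" "\<And>i. c i 0 = coef u0 i"
    and "AE t in lebesgue_on {0<..<T}. u t \<in> V_space a b \<and> F t \<in> V_dual a b \<and>
      (\<forall>i. c i t = coef (u t) i \<and>
        g i t = F t (bas i) - \<nu> * (lam i * coef (u t) i) - b_form a b (u t) (u t) (bas i))"
    and "integrable (lebesgue_on {0<..<T}) (\<lambda>t. (V_norm a b (u t))\<^sup>2)"
    and "M \<ge> 0" "\<And>n t. t \<in> {0..T} \<Longrightarrow> (\<Sum>i\<in>KK n. (c i t)\<^sup>2) \<le> M\<^sup>2"
    and "integrable (lebesgue_on {0<..<T}) D"
    and "\<And>n s t. 0 \<le> s \<Longrightarrow> s \<le> t \<Longrightarrow> t \<le> T \<Longrightarrow>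
      \<bar>(\<Sum>i\<in>KK n. (c i t)\<^sup>2) - (\<Sum>i\<in>KK n. (c i s)\<^sup>2)\<bar> \<le> (\<integral>x. indicat_real {s<..<t} x * D x \<partial>lebesgue_on {0<..<T})"
proof -
  let ?M = "lebesgue_on {0<..<T}"
  obtain c g where pr: "\<And>i. primitive_on T (c i) (g i)" and c0: "\<And>i. c i 0 = coef u0 i"
    and ae: "AE t in ?M. u t \<in> V_space a b \<and> F t \<in> V_dual a b \<and>
      (\<forall>i. c i t = coef (u t) i \<and>
        g i t = F t (bas i) - \<nu> * (lam i * coef (u t) i) - b_form a b (u t) (u t) (bas i))"
    and uint: "integrable ?M (\<lambda>t. (V_norm a b (u t))\<^sup>2)"
    using solution_data[OF F T sol] by blast
  have Fint: "integrable ?M (\<lambda>t. (V_dual_norm a b (F t))\<^sup>2)" using F by (simp add: bochner_Lp_def)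
  define y where "y n t = (\<Sum>i\<in>KK n. (c i t)\<^sup>2)" for n t
  define G where "G n t = (\<Sum>i\<in>KK n. 2 * (g i t * c i t))" for n t
  have py: "primitive_on T (y n) (G n)" for n
    unfolding y_def[abs_def] G_def[abs_def] by (intro primitive_on_sum primitive_on_square pr)
  have y0: "0 \<le> y n t" for n t by (simp add: y_def sum_nonneg)
  define D1 where "D1 t = (V_dual_norm a b (F t))\<^sup>2 + (1 + 2 * \<nu>) * (V_norm a b (u t))\<^sup>2" for t
  define D2 where "D2 t = 8 * cb * (V_norm a b (u t))\<^sup>2" for t
  have Dint: "integrable ?M D1" "integrable ?M D2"
    unfolding D1_def[abs_def] D2_def[abs_def] using uint Fint by auto
  have Dnn: "D1 t \<ge> 0" "D2 t \<ge> 0" for t using \<nu> cb_nonneg by (auto simp: D1_def D2_def)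
  have Gle: "AE t in ?M. \<bar>G n t\<bar> \<le> D1 t + D2 t * sqrt (y n t)" for n
    using ae
  proof eventually_elim
    case (elim t)
    then have u: "u t \<in> V_space a b" and Ft: "F t \<in> V_dual a b" and ci: "\<And>i. c i t = coef (u t) i"
      and gi: "\<And>i. g i t = F t (bas i) - \<nu> * (lam i * coef (u t) i) - b_form a b (u t) (u t) (bas i)" by auto
    have "sqrt (y n t) = L2_norm R (PP n (u t))"
      using psum_norm[of "KK n" "coef (u t)"] by (simp add: y_def ci flip: psum_norm)
    then show ?case
      using energy_rate_bound[OF Ft u \<nu>, of n] galerkin_identity[OF Ft u, of \<nu> n]
      by (simp add: G_def ci gi D1_def D2_def)
  qed
  \<comment> \<open>A collects the initial energy and the part of the rate that is free of the
    unknown, B the factor in front of its square root.\<close>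
  define A where "A = L2_inner R u0 u0 + (\<integral>x. D1 x \<partial>?M)"
  define B where "B = (\<integral>x. D2 x \<partial>?M)"
  have A: "A \<ge> 0" unfolding A_def using Dnn by (intro add_nonneg_nonneg L2_inner_nonneg integral_nonneg_AE) auto
  have B: "B \<ge> 0" unfolding B_def using Dnn by (intro integral_nonneg_AE) auto
  define M where "M = A + B + 1"
  have M: "M \<ge> 0" using A B by (simp add: M_def)
  have bound: "sqrt (y n t) \<le> M" if t: "t \<in> {0..T}" for n t
  proof -
    have yc: "continuous_on {0..T} (y n)" using py by (simp add: primitive_on_def)
    \<comment> \<open>The maximum of y n is attained because y n is continuous on a compact
      interval, so S is finite before any bound is known.\<close>
    obtain s where s: "s \<in> {0..T}" "\<And>t. t \<in> {0..T} \<Longrightarrow> y n t \<le> y n s"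
      using continuous_attains_sup[OF compact_Icc _ yc] T by auto
    define S where "S = sqrt (y n s)"
    have S: "S \<ge> 0" "S\<^sup>2 = y n s" using y0 by (simp_all add: S_def)
    have DS: "integrable ?M (\<lambda>x. D1 x + D2 x * S)" using Dint by auto
    have Gs: "AE x in ?M. \<bar>G n x\<bar> \<le> D1 x + D2 x * S"
      using Gle[of n] AE_space
    proof eventually_elim
      case (elim x)
      have "sqrt (y n x) \<le> S" unfolding S_def using s(2)[of x] elim(2) by (simp add: space_restrict_space)
      then have "D2 x * sqrt (y n x) \<le> D2 x * S" using Dnn by (intro mult_left_mono)
      then show ?case using elim(1) by simp
    qed
    have "y n s \<le> y n 0 + \<bar>y n s - y n 0\<bar>" by simp
    also have "\<bar>y n s - y n 0\<bar> \<le> (\<integral>x. indicat_real {0<..<s} x * (D1 x + D2 x * S) \<partial>?M)"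
      by (rule primitive_on_modulus[OF py DS Gs]) (use s in auto)
    also have "\<dots> \<le> (\<integral>x. D1 x + D2 x * S \<partial>?M)"
      by (rule ind_integral_le[OF DS]) (use Dnn S in simp)
    also have "\<dots> = (\<integral>x. D1 x \<partial>?M) + B * S"
      unfolding B_def using Dint by simp
    also have "y n 0 \<le> L2_inner R u0 u0"
      unfolding y_def c0 by (rule bessel[OF u0 KK_finite])
    finally have "S\<^sup>2 \<le> A + B * S" unfolding S(2) A_def by simp
    then have "S \<le> M" unfolding M_def using A B by (rule quadratic_bound)
    moreover have "sqrt (y n t) \<le> S" unfolding S_def using s(2)[OF t] by simp
    ultimately show ?thesis by simp
  qed
  have yM: "y n t \<le> M\<^sup>2" if "t \<in> {0..T}" for n t
    using power_mono[OF bound[OF that, of n], of 2] y0 by simp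
  have DM: "integrable ?M (\<lambda>x. D1 x + D2 x * M)" using Dint by auto
  have GM: "AE x in ?M. \<bar>G n x\<bar> \<le> D1 x + D2 x * M" for n
    using Gle[of n] AE_space
  proof eventually_elim
    case (elim x)
    have "D2 x * sqrt (y n x) \<le> D2 x * M"
      using Dnn bound[of x n] elim(2) by (intro mult_left_mono) (auto simp: space_restrict_space)
    then show ?case using elim(1) by simp
  qed
  show ?thesis
    using that[OF pr c0 ae uint M _ DM] yM primitive_on_modulus[OF py DM GM] unfolding y_def by blast
qed

section \<open>Continuity into H\<close>

lemma L2_norm_PP_diff:
  assumes w: "w \<in> L2 R"
  shows "(L2_norm R (\<lambda>x. w x - PP n w x))\<^sup>2 = (L2_norm R w)\<^sup>2 - (\<Sum>i\<in>KK n. (coef w i)\<^sup>2)"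
proof -
  have "L2_inner R w (PP n w) = (\<Sum>i\<in>KK n. (coef w i)\<^sup>2)"
    using psum_inner_left[OF w, of "KK n" "coef w"]
    by (simp add: L2_inner_commute[of _ w] coef_def power2_eq_square)
  then show ?thesis
    using L2.quadratic(2)[OF w psum_L2, of "KK n" "coef w"]
    by (simp add: L2_norm_sq psum_inner) (simp add: power2_eq_square)
qed

text \<open>For each t the square-summable coefficients define a field w t. Its squared norm
  inherits the modulus of continuity of the partial sums; a tail small at t1 therefore stays small
  nearby, and the finitely many remaining coefficients are continuous.\<close>

lemma solution_H_valued:
  assumes F: "F \<in> bochner_Lp 2 (V_dual a b) (V_dual_norm a b) {0<..<T}" and T: "T > 0" and \<nu>: "\<nu> > 0"
    and u0: "u0 \<in> L2 R" and sol: "is_solution a b T \<nu> F u0 u"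
  obtains c g M w where "\<And>i. primitive_on T (c i) (g i)" "\<And>i. c i 0 = coef u0 i"
    and "AE t in lebesgue_on {0<..<T}. u t \<in> V_space a b \<and> F t \<in> V_dual a b \<and>
      (\<forall>i. c i t = coef (u t) i \<and>
        g i t = F t (bas i) - \<nu> * (lam i * coef (u t) i) - b_form a b (u t) (u t) (bas i))"
    and "integrable (lebesgue_on {0<..<T}) (\<lambda>t. (V_norm a b (u t))\<^sup>2)"
    and "M \<ge> 0" "\<And>n t. t \<in> {0..T} \<Longrightarrow> (\<Sum>i\<in>KK n. (c i t)\<^sup>2) \<le> M\<^sup>2"
    and "\<And>t. t \<in> {0..T} \<Longrightarrow> w t \<in> H_space a b" "\<And>t i. t \<in> {0..T} \<Longrightarrow> coef (w t) i = c i t"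
    and "\<And>t1. t1 \<in> {0..T} \<Longrightarrow> ((\<lambda>t. L2_norm R (\<lambda>x. w t x - w t1 x)) \<longlongrightarrow> 0) (at t1 within {0..T})"
proof -
  let ?M = "lebesgue_on {0<..<T}"
  obtain c g D M where pr: "\<And>i. primitive_on T (c i) (g i)" and c0: "\<And>i. c i 0 = coef u0 i"
    and ae: "AE t in lebesgue_on {0<..<T}. u t \<in> V_space a b \<and> F t \<in> V_dual a b \<and>
      (\<forall>i. c i t = coef (u t) i \<and>
        g i t = F t (bas i) - \<nu> * (lam i * coef (u t) i) - b_form a b (u t) (u t) (bas i))"
    and uint: "integrable (lebesgue_on {0<..<T}) (\<lambda>t. (V_norm a b (u t))\<^sup>2)"
    and M: "M \<ge> 0" and yM: "\<And>n t. t \<in> {0..T} \<Longrightarrow> (\<Sum>i\<in>KK n. (c i t)\<^sup>2) \<le> M\<^sup>2"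
    and D: "integrable (lebesgue_on {0<..<T}) D"
    and mod: "\<And>n s t. 0 \<le> s \<Longrightarrow> s \<le> t \<Longrightarrow> t \<le> T \<Longrightarrow>
      \<bar>(\<Sum>i\<in>KK n. (c i t)\<^sup>2) - (\<Sum>i\<in>KK n. (c i s)\<^sup>2)\<bar> \<le> (\<integral>x. indicat_real {s<..<t} x * D x \<partial>lebesgue_on {0<..<T})"
    by (fact solution_bounds[OF F T \<nu> u0 sol])
  have cc: "continuous_on {0..T} (c i)" for i using pr by (simp add: primitive_on_def)
  have "\<exists>w. w \<in> L2 R \<and> coef w = (\<lambda>i. c i t) \<and> (\<lambda>n. L2_norm R (\<lambda>x. psum (KK n) (\<lambda>i. c i t) x - w x)) \<longlonglongrightarrow> 0"
    if t: "t \<in> {0..T}" for t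
  proof -
    obtain w where "w \<in> L2 R" "coef w = (\<lambda>i. c i t)" "(\<lambda>n. L2_norm R (\<lambda>x. psum (KK n) (\<lambda>i. c i t) x - w x)) \<longlonglongrightarrow> 0"
      by (fact riesz_fischer[OF yM[OF t]])
    then show ?thesis by (intro exI conjI)
  qed
  then have "\<forall>t\<in>{0..T}. \<exists>w. w \<in> L2 R \<and> coef w = (\<lambda>i. c i t) \<and> (\<lambda>n. L2_norm R (\<lambda>x. psum (KK n) (\<lambda>i. c i t) x - w x)) \<longlonglongrightarrow> 0"
    by (rule ballI)
  \<comment> \<open>The coefficients exist at every t, so w is defined at each point of the closed
    interval and not merely almost everywhere.\<close>
  from bchoice[OF this] obtain w where "\<forall>t\<in>{0..T}. w t \<in> L2 R \<and> coef (w t) = (\<lambda>i. c i t) \<and>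
      (\<lambda>n. L2_norm R (\<lambda>x. psum (KK n) (\<lambda>i. c i t) x - w t x)) \<longlonglongrightarrow> 0" ..
  then have w: "\<And>t. t \<in> {0..T} \<Longrightarrow> w t \<in> L2 R" "\<And>t. t \<in> {0..T} \<Longrightarrow> coef (w t) = (\<lambda>i. c i t)"
      "\<And>t. t \<in> {0..T} \<Longrightarrow> (\<lambda>n. L2_norm R (\<lambda>x. psum (KK n) (\<lambda>i. c i t) x - w t x)) \<longlonglongrightarrow> 0"
    by simp_all
  have wH: "w t \<in> H_space a b" if t: "t \<in> {0..T}" for t
    by (rule limit_H_space[OF w(1)[OF t] w(3)[OF t]])
  define m where "m t = (L2_norm R (w t))\<^sup>2" for t
  define y where "y n t = (\<Sum>i\<in>KK n. (c i t)\<^sup>2)" for n t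
  have ym: "(\<lambda>n. y n t) \<longlonglongrightarrow> m t" if t: "t \<in> {0..T}" for t
  proof -
    have "(\<lambda>n. (L2_norm R (psum (KK n) (\<lambda>i. c i t)))\<^sup>2) \<longlonglongrightarrow> (L2_norm R (w t))\<^sup>2"
      by (intro tendsto_power L2_norm_tendsto[OF psum_L2 w(1)[OF t] w(3)[OF t]])
    then show ?thesis by (simp add: psum_norm y_def m_def)
  qed
  define K where "K t = (\<integral>x. indicat_real {0<..<t} x * D x \<partial>?M)" for t
  have Kc: "continuous_on {0..T} K"
    unfolding K_def[abs_def] by (rule indefinite_integral_continuous[OF D])
  have mK: "\<bar>m t - m s\<bar> \<le> \<bar>K t - K s\<bar>" if "s \<in> {0..T}" "t \<in> {0..T}" for s t
  proof -
    have *: "\<bar>m t - m s\<bar> \<le> \<bar>K t - K s\<bar>" if st: "s \<in> {0..T}" "t \<in> {0..T}" "s \<le> t" for s t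
    proof -
      have "(\<lambda>n. \<bar>y n t - y n s\<bar>) \<longlonglongrightarrow> \<bar>m t - m s\<bar>" by (intro tendsto_intros ym st)
      moreover have "\<bar>y n t - y n s\<bar> \<le> K t - K s" for n
        using mod[of s t n] ind_split[OF D, of 0 s t] st by (simp add: y_def K_def)
      ultimately have "\<bar>m t - m s\<bar> \<le> K t - K s" by (intro LIMSEQ_le_const2) auto
      then show ?thesis by simp
    qed
    show ?thesis using *[OF that] *[OF that(2,1)] by (cases "s \<le> t") (auto simp: abs_minus_commute)
  qed
  have cont: "((\<lambda>t. L2_norm R (\<lambda>x. w t x - w t1 x)) \<longlongrightarrow> 0) (at t1 within {0..T})" if t1: "t1 \<in> {0..T}" for t1
  proof (rule tendstoI)
    let ?A = "at t1 within {0..T}"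
    fix e :: real assume e: "e > 0"
    define d where "d = e / 3"
    have d: "d > 0" using e by (simp add: d_def)
    have inT: "\<forall>\<^sub>F t in ?A. t \<in> {0..T}" by (simp add: eventually_at_filter)
    have yc: "((\<lambda>t. y n t) \<longlongrightarrow> y n t1) ?A" for n
      unfolding y_def using cc t1 by (intro tendsto_intros) (auto simp: continuous_on_def)
    have mc: "(m \<longlongrightarrow> m t1) ?A"
    proof -
      have "((\<lambda>t. \<bar>K t - K t1\<bar>) \<longlongrightarrow> \<bar>K t1 - K t1\<bar>) ?A"
        using Kc t1 by (intro tendsto_intros) (auto simp: continuous_on_def)
      then have "((\<lambda>t. m t - m t1) \<longlongrightarrow> 0) ?A"
        by (intro Lim_null_comparison[of "\<lambda>t. m t - m t1" "\<lambda>t. \<bar>K t - K t1\<bar>"])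
           (use inT mK[OF t1] in \<open>auto elim!: eventually_mono\<close>)
      then show ?thesis using LIM_zero_iff by blast
    qed
    \<comment> \<open>n is chosen at t1 alone; the continuity of m and y n then carries the tail
      bound to neighbouring t.\<close>
    obtain n where n: "m t1 - y n t1 < d\<^sup>2"
    proof -
      have "(\<lambda>n. m t1 - y n t1) \<longlonglongrightarrow> m t1 - m t1" by (intro tendsto_intros ym t1)
      then have "\<forall>\<^sub>F n in sequentially. m t1 - y n t1 < d\<^sup>2" using d by (intro order_tendstoD(2)) auto
      then show ?thesis using that eventually_sequentially by auto
    qed
    have tail: "(L2_norm R (\<lambda>x. w t x - psum (KK n) (\<lambda>i. c i t) x))\<^sup>2 = m t - y n t" if "t \<in> {0..T}" for t
      using L2_norm_PP_diff[OF w(1)[OF that], of n] by (simp add: w(2)[OF that] m_def y_def)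
    have e1: "\<forall>\<^sub>F t in ?A. m t - y n t < d\<^sup>2"
      using order_tendstoD(2)[OF tendsto_diff[OF mc yc[of n]] n] .
    have e2: "\<forall>\<^sub>F t in ?A. (\<Sum>i\<in>KK n. (c i t - c i t1)\<^sup>2) < d\<^sup>2"
    proof -
      have "((\<lambda>t. \<Sum>i\<in>KK n. (c i t - c i t1)\<^sup>2) \<longlongrightarrow> (\<Sum>i\<in>KK n. (c i t1 - c i t1)\<^sup>2)) ?A"
        using cc t1 by (intro tendsto_intros) (auto simp: continuous_on_def)
      then show ?thesis using d by (intro order_tendstoD(2)) auto
    qed
    show "\<forall>\<^sub>F t in ?A. dist (L2_norm R (\<lambda>x. w t x - w t1 x)) 0 < e"
      using e1 e2 inT
    proof eventually_elim
      case (elim t)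
      note t = elim(3)
      let ?S = "psum (KK n) (\<lambda>i. c i t)" and ?S1 = "psum (KK n) (\<lambda>i. c i t1)"
      have 1: "L2_norm R (\<lambda>x. w t x - ?S x) < d"
        by (rule power2_less_imp_less) (use tail[OF t] elim(1) d in auto)
      have 2: "L2_norm R (\<lambda>x. ?S x - ?S1 x) < d"
        by (rule power2_less_imp_less) (use elim(2) d in \<open>auto simp: psum_diff_coef psum_norm\<close>)
      have "L2_norm R (\<lambda>x. w t1 x - ?S1 x) < d"
        by (rule power2_less_imp_less) (use tail[OF t1] n d in auto)
      then have 3: "L2_norm R (\<lambda>x. ?S1 x - w t1 x) < d"
        using L2_norm_minus_commute[OF w(1)[OF t1] psum_L2] by simp
      have "L2_norm R (\<lambda>x. w t x - w t1 x) \<le> L2_norm R (\<lambda>x. w t x - ?S x) + L2_norm R (\<lambda>x. ?S x - w t1 x)"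
        by (rule L2_tri_diff[OF w(1)[OF t] psum_L2 w(1)[OF t1]])
      also have "L2_norm R (\<lambda>x. ?S x - w t1 x) \<le> L2_norm R (\<lambda>x. ?S x - ?S1 x) + L2_norm R (\<lambda>x. ?S1 x - w t1 x)"
        by (rule L2_tri_diff[OF psum_L2 psum_L2 w(1)[OF t1]])
      finally show ?case using 1 2 3 by (simp add: d_def dist_real_def)
    qed
  qed
  show ?thesis
    using that[of c g M w] pr c0 ae uint M yM wH w(2) cont by simp
qed

section \<open>Uniqueness\<close>

lemma coef_eq_imp_AE_eq:
  assumes "u \<in> HH" "v \<in> HH" "\<And>i. coef u i = coef v i"
  shows "AE x in lebesgue_on R. u x = v x"
proof -
  have "AE x in lebesgue_on R. u x - v x = 0"
    by (rule HH_complete[OF HH_diff[OF assms(1,2)]]) (simp add: coef_diff HH_L2 assms)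
  then show ?thesis by eventually_elim simp
qed

text \<open>The difference of the nonlinear terms is b(u,z,p) + b(z,v,p) with p = PP n z. The first
  is handled by \<open>b_projection\<close>; in the second, the part from Ladyzhenskaya is absorbed
  into the dissipation and leaves a Gronwall term. The other contributions carry the V norm of z -
  p.\<close>

lemma difference_rate_bound:
  assumes u: "u \<in> V_space a b" and v: "v \<in> V_space a b" and \<nu>: "\<nu> > 0" and M: "M \<ge> 0"
  defines "z \<equiv> \<lambda>x. u x - v x"
  assumes PM: "L2_norm R (PP n u) \<le> M" "L2_norm R (PP n z) \<le> M"
  shows "2 * (- \<nu> * (V_norm a b (PP n z))\<^sup>2 - (b_form a b u u (PP n z) - b_form a b v v (PP n z))) \<le>
    8 * lad\<^sup>2 / \<nu> * (V_norm a b v)\<^sup>2 * (L2_norm R (PP n z))\<^sup>2 +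
    5 * cb * M * V_norm a b (\<lambda>x. z x - PP n z x) * (V_norm a b u + V_norm a b v)"
proof -
  define p where "p = PP n z"
  have z: "z \<in> V_space a b" unfolding z_def by (rule V_diff[OF u v])
  have p: "p \<in> D1 a b" unfolding p_def by (rule psum_D1)
  note uL = V_L2[OF u] and vL = V_L2[OF v] and pL = V_L2[OF D1_V[OF p]] and uH = V_H1[OF u] and vH = V_H1[OF v]
  have 1: "b_form a b u z p = b_form a b u u p - b_form a b u v p"
    unfolding z_def
    by (rule b_diff_mid[OF uH vH b_integrable_D1_right[OF uL uH p] b_integrable_D1_right[OF uL vH p] uL pL])
  have 2: "b_form a b z v p = b_form a b u v p - b_form a b v v p"
    unfolding z_def
    by (rule b_diff_left[OF b_integrable_D1_right[OF uL vH p] b_integrable_D1_right[OF vL vH p]])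
  define U where "U = V_norm a b u"
  define V where "V = V_norm a b v"
  define P where "P = V_norm a b p"
  define Q where "Q = V_norm a b (\<lambda>x. z x - p x)"
  define q where "q = L2_norm R p"
  have nn: "U \<ge> 0" "V \<ge> 0" "P \<ge> 0" "Q \<ge> 0" "q \<ge> 0" by (simp_all add: U_def V_def P_def Q_def q_def)
  have PZ: "P \<le> U + V"
    using PP_V_norm_le[OF z, of n] V_tri_sub[OF uH vH] unfolding P_def p_def U_def V_def z_def by simp
  have qM: "q \<le> M" using PM by (simp add: q_def p_def)
  have "\<bar>b_form a b u z p\<bar> \<le> cb * Q * (U * q + L2_norm R (PP n u) * P)"
    using b_projection[OF u z, of n] unfolding cb_def Q_def U_def q_def P_def p_def .
  also have "\<dots> \<le> cb * Q * ((U + V) * M + M * (U + V))"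
    using nn cb_nonneg PM PZ qM M by (intro mult_left_mono add_mono mult_mono) auto
  finally have 3: "\<bar>b_form a b u z p\<bar> \<le> 2 * (cb * M * Q * (U + V))" by (simp add: algebra_simps)
  have "\<bar>b_form a b z v p\<bar> \<le> 4 * lad * (q * P * V) + 4 * bern / sqrt kap * (q * Q * V)"
    using b_convected[OF z v, of n] unfolding q_def P_def Q_def V_def p_def .
  also have "4 * bern / sqrt kap * (q * Q * V) \<le> 4 * bern / sqrt kap * (M * Q * (U + V))"
    using nn qM M bern_pos kap_pos by (intro mult_left_mono mult_mono) auto
  also have "4 * bern / sqrt kap = cb / 2" by (simp add: cb_def)
  finally have 4: "\<bar>b_form a b z v p\<bar> \<le> 4 * lad * (q * P * V) + cb / 2 * (M * Q * (U + V))" by simp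
  \<comment> \<open>Young's inequality, weighted so that exactly the available dissipation is
    spent.\<close>
  have 5: "4 * lad * (q * P * V) \<le> \<nu> * P\<^sup>2 + 4 * lad\<^sup>2 / \<nu> * V\<^sup>2 * q\<^sup>2"
  proof -
    have "0 \<le> (\<nu> * P - 2 * lad * (q * V))\<^sup>2" by simp
    then have "\<nu> * (4 * lad * (q * P * V)) \<le> \<nu> * (\<nu> * P\<^sup>2 + 4 * lad\<^sup>2 / \<nu> * V\<^sup>2 * q\<^sup>2)"
      using \<nu> by (simp add: power2_eq_square algebra_simps)
    then show ?thesis using \<nu> by simp
  qed
  define X1 where "X1 = 4 * lad * (q * P * V)"
  define X2 where "X2 = 4 * lad\<^sup>2 / \<nu> * V\<^sup>2 * q\<^sup>2"
  define X3 where "X3 = cb * M * Q * (U + V)"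
  define X4 where "X4 = \<nu> * P\<^sup>2"
  have 4: "\<bar>b_form a b z v p\<bar> \<le> X1 + X3 / 2" using 4 by (simp add: X1_def X3_def mult.assoc)
  have "2 * (- \<nu> * P\<^sup>2 - (b_form a b u u p - b_form a b v v p)) = 2 * (- X4 - b_form a b u z p - b_form a b z v p)"
    using 1 2 by (simp add: X4_def)
  \<comment> \<open>The 5 is twice 2 + 1/2, the multiples of X3 left by the two trilinear
    terms.\<close>
  also have "\<dots> \<le> 2 * X2 + 5 * X3"
  proof -
    have "- b_form a b u z p \<le> 2 * X3" "- b_form a b z v p \<le> X1 + X3 / 2" "X1 \<le> X4 + X2"
      using 3 4 5 unfolding X1_def X2_def X3_def X4_def abs_le_iff by simp_all
    then show ?thesis by simp
  qed
  also have "\<dots> = 8 * lad\<^sup>2 / \<nu> * V\<^sup>2 * q\<^sup>2 + 5 * cb * M * Q * (U + V)"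
    by (simp add: X2_def X3_def)
  finally show ?thesis unfolding U_def V_def P_def Q_def q_def p_def .
qed

text \<open>The forcing is common to both solutions and cancels; \<open>l\<close> stands for its
  values on the eigenfields.\<close>

lemma difference_identity:
  assumes u: "u \<in> V_space a b" and v: "v \<in> V_space a b"
  defines "z \<equiv> \<lambda>x. u x - v x"
  shows "(\<Sum>i\<in>KK n. 2 * (((l i - \<nu> * (lam i * coef u i) - b_form a b u u (bas i)) -
      (l i - \<nu> * (lam i * coef v i) - b_form a b v v (bas i))) * (coef u i - coef v i))) =
    2 * (- \<nu> * (V_norm a b (PP n z))\<^sup>2 - (b_form a b u u (PP n z) - b_form a b v v (PP n z)))"
proof -
  have cz: "coef u i - coef v i = coef z i" for i
    unfolding z_def by (simp add: coef_diff V_L2 u v)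
  have "((l i - \<nu> * (lam i * coef u i) - b_form a b u u (bas i)) - (l i - \<nu> * (lam i * coef v i) - b_form a b v v (bas i))) * (coef u i - coef v i)
    = - \<nu> * (lam i * (coef z i)\<^sup>2) - (coef z i * b_form a b u u (bas i) - coef z i * b_form a b v v (bas i))" for i
    unfolding cz[symmetric] by (simp add: power2_eq_square algebra_simps)
  then have "(\<Sum>i\<in>KK n. 2 * (((l i - \<nu> * (lam i * coef u i) - b_form a b u u (bas i)) -
      (l i - \<nu> * (lam i * coef v i) - b_form a b v v (bas i))) * (coef u i - coef v i))) =
    2 * (- \<nu> * (\<Sum>i\<in>KK n. lam i * (coef z i)\<^sup>2) - ((\<Sum>i\<in>KK n. coef z i * b_form a b u u (bas i)) - (\<Sum>i\<in>KK n. coef z i * b_form a b v v (bas i))))"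
    by (simp only: sum_distrib_left[symmetric] sum_subtractf)
  then show ?thesis
    by (simp add: psum_V_norm b_psum[OF V_L2[OF u] V_H1[OF u]] b_psum[OF V_L2[OF v] V_H1[OF v]])
qed

text \<open>For fixed n the inequality for y n contains an error E n, so Gronwall's lemma is applied
  only to the limit m = |z|^2, for which the error has disappeared.\<close>

lemma uniqueness:
  assumes F: "F \<in> bochner_Lp 2 (V_dual a b) (V_dual_norm a b) {0<..<T}" and T: "T > 0" and \<nu>: "\<nu> > 0"
    and u0: "u0 \<in> L2 R" and sol1: "is_solution a b T \<nu> F u0 u1" and sol2: "is_solution a b T \<nu> F u0 u2"
  shows "AE t in lebesgue_on {0<..<T}. ae_equal R (u1 t) (u2 t)"
proof -
  let ?M = "lebesgue_on {0<..<T}"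
  obtain c1 g1 w1 M1 where pr1: "\<And>i. primitive_on T (c1 i) (g1 i)" and c10: "\<And>i. c1 i 0 = coef u0 i"
    and ae1: "AE t in ?M. u1 t \<in> V_space a b \<and> F t \<in> V_dual a b \<and>
      (\<forall>i. c1 i t = coef (u1 t) i \<and>
        g1 i t = F t (bas i) - \<nu> * (lam i * coef (u1 t) i) - b_form a b (u1 t) (u1 t) (bas i))"
    and int1: "integrable ?M (\<lambda>t. (V_norm a b (u1 t))\<^sup>2)"
    and M1: "M1 \<ge> 0" "\<And>n t. t \<in> {0..T} \<Longrightarrow> (\<Sum>i\<in>KK n. (c1 i t)\<^sup>2) \<le> M1\<^sup>2"
    and w1: "\<And>t. t \<in> {0..T} \<Longrightarrow> w1 t \<in> H_space a b" "\<And>t i. t \<in> {0..T} \<Longrightarrow> coef (w1 t) i = c1 i t"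
    and cont1: "\<And>t1. t1 \<in> {0..T} \<Longrightarrow> ((\<lambda>t. L2_norm R (\<lambda>x. w1 t x - w1 t1 x)) \<longlongrightarrow> 0) (at t1 within {0..T})"
    by (fact solution_H_valued[OF F T \<nu> u0 sol1])
  obtain c2 g2 w2 M2 where pr2: "\<And>i. primitive_on T (c2 i) (g2 i)" and c20: "\<And>i. c2 i 0 = coef u0 i"
    and ae2: "AE t in ?M. u2 t \<in> V_space a b \<and> F t \<in> V_dual a b \<and>
      (\<forall>i. c2 i t = coef (u2 t) i \<and>
        g2 i t = F t (bas i) - \<nu> * (lam i * coef (u2 t) i) - b_form a b (u2 t) (u2 t) (bas i))"
    and int2: "integrable ?M (\<lambda>t. (V_norm a b (u2 t))\<^sup>2)"
    and M2: "M2 \<ge> 0" "\<And>n t. t \<in> {0..T} \<Longrightarrow> (\<Sum>i\<in>KK n. (c2 i t)\<^sup>2) \<le> M2\<^sup>2"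
    and w2: "\<And>t. t \<in> {0..T} \<Longrightarrow> w2 t \<in> H_space a b" "\<And>t i. t \<in> {0..T} \<Longrightarrow> coef (w2 t) i = c2 i t"
    and cont2: "\<And>t1. t1 \<in> {0..T} \<Longrightarrow> ((\<lambda>t. L2_norm R (\<lambda>x. w2 t x - w2 t1 x)) \<longlongrightarrow> 0) (at t1 within {0..T})"
    by (fact solution_H_valued[OF F T \<nu> u0 sol2])
  define d where "d i t = c1 i t - c2 i t" for i t
  define y where "y n t = (\<Sum>i\<in>KK n. (d i t)\<^sup>2)" for n t
  define G where "G n t = (\<Sum>i\<in>KK n. 2 * ((g1 i t - g2 i t) * d i t))" for n t
  have py: "primitive_on T (y n) (G n)" for n
    unfolding y_def[abs_def] G_def[abs_def] d_def[abs_def]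
    by (intro primitive_on_sum primitive_on_square primitive_on_diff pr1 pr2)
  have y0: "0 \<le> y n t" for n t by (simp add: y_def sum_nonneg)
  \<comment> \<open>Built from the continuous representatives, so that m is defined and continuous
    at every t.\<close>
  define z where "z t = (\<lambda>x. w1 t x - w2 t x)" for t
  have zH: "z t \<in> HH" if "t \<in> {0..T}" for t
    unfolding z_def by (intro HH_diff H_space_HH w1 w2 that)
  have zc: "coef (z t) i = d i t" if "t \<in> {0..T}" for t i
    unfolding z_def d_def using w1(2)[OF that] w2(2)[OF that]
    by (simp add: coef_diff HH_L2[OF H_space_HH[OF w1(1)[OF that]]] HH_L2[OF H_space_HH[OF w2(1)[OF that]]])
  define m where "m t = (L2_norm R (z t))\<^sup>2" for t
  have ym: "(\<lambda>n. y n t) \<longlonglongrightarrow> m t" if t: "t \<in> {0..T}" for t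
  proof -
    have "(\<lambda>n. (L2_norm R (\<lambda>x. z t x - PP n (z t) x))\<^sup>2) \<longlonglongrightarrow> 0\<^sup>2"
      by (intro tendsto_power PP_tendsto zH t)
    then have "(\<lambda>n. m t - y n t) \<longlonglongrightarrow> 0"
      unfolding L2_norm_PP_diff[OF HH_L2[OF zH[OF t]]] by (simp add: zc[OF t] m_def y_def)
    from tendsto_diff[OF tendsto_const[of "m t"] this] show ?thesis by simp
  qed
  have mc: "continuous_on {0..T} m"
    unfolding continuous_on_def
  proof
    fix t1 assume t1: "t1 \<in> {0..T}"
    have wL: "w1 t \<in> L2 R" "w2 t \<in> L2 R" if "t \<in> {0..T}" for t
      using H_space_HH[OF w1(1)[OF that]] H_space_HH[OF w2(1)[OF that]] HH_L2 by auto
    have "((\<lambda>t. L2_norm R (z t) - L2_norm R (z t1)) \<longlongrightarrow> 0) (at t1 within {0..T})"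
    proof (rule Lim_null_comparison)
      show "((\<lambda>t. L2_norm R (\<lambda>x. w1 t x - w1 t1 x) + L2_norm R (\<lambda>x. w2 t x - w2 t1 x)) \<longlongrightarrow> 0) (at t1 within {0..T})"
        using tendsto_add[OF cont1[OF t1] cont2[OF t1]] by simp
      show "\<forall>\<^sub>F t in at t1 within {0..T}. norm (L2_norm R (z t) - L2_norm R (z t1)) \<le>
         L2_norm R (\<lambda>x. w1 t x - w1 t1 x) + L2_norm R (\<lambda>x. w2 t x - w2 t1 x)"
        unfolding eventually_at_filter
      proof (intro always_eventually allI impI)
        fix t assume t: "t \<in> {0..T}"
        have "\<bar>L2_norm R (z t) - L2_norm R (z t1)\<bar> \<le> L2_norm R (\<lambda>x. z t x - z t1 x)"
          by (rule L2_tri_rev[OF HH_L2[OF zH[OF t]] HH_L2[OF zH[OF t1]]])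
        also have "(\<lambda>x. z t x - z t1 x) = (\<lambda>x. (w1 t x - w1 t1 x) - (w2 t x - w2 t1 x))"
          by (simp add: z_def fun_eq_iff)
        also have "L2_norm R \<dots> \<le> L2_norm R (\<lambda>x. w1 t x - w1 t1 x) + L2_norm R (\<lambda>x. w2 t x - w2 t1 x)"
          by (intro L2_tri_sub L2.diff wL t t1)
        finally show "norm (L2_norm R (z t) - L2_norm R (z t1)) \<le>
          L2_norm R (\<lambda>x. w1 t x - w1 t1 x) + L2_norm R (\<lambda>x. w2 t x - w2 t1 x)" by simp
      qed
    qed
    then have "((\<lambda>t. L2_norm R (z t)) \<longlongrightarrow> L2_norm R (z t1)) (at t1 within {0..T})" using LIM_zero_iff by blast
    then show "(m \<longlongrightarrow> m t1) (at t1 within {0..T})" unfolding m_def[abs_def] by (rule tendsto_power)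
  qed
  define M where "M = M1 + M2"
  have M: "M \<ge> 0" "M1 \<le> M" using M1 M2 by (simp_all add: M_def)
  have sqd: "sqrt (y n t) \<le> M" if t: "t \<in> {0..T}" for n t
  proof -
    have l: "L2_norm R (psum (KK n) (\<lambda>i. c1 i t)) \<le> M1" "L2_norm R (psum (KK n) (\<lambda>i. c2 i t)) \<le> M2"
      by (rule power2_le_imp_le; use M1 M2 t in \<open>simp add: psum_norm\<close>)+
    have "(L2_norm R (psum (KK n) (\<lambda>i. d i t)))\<^sup>2 = y n t" by (simp add: psum_norm y_def)
    then have "sqrt (y n t) = L2_norm R (psum (KK n) (\<lambda>i. d i t))" by (metis L2_norm_nonneg real_sqrt_abs abs_of_nonneg)
    also have "\<dots> = L2_norm R (\<lambda>x. psum (KK n) (\<lambda>i. c1 i t) x - psum (KK n) (\<lambda>i. c2 i t) x)"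
      unfolding psum_diff_coef d_def ..
    also have "\<dots> \<le> M" using L2_tri_sub[OF psum_L2 psum_L2, of "KK n" "\<lambda>i. c1 i t" "KK n" "\<lambda>i. c2 i t"] l by (simp add: M_def)
    finally show ?thesis .
  qed
  have yM: "y n t \<le> M\<^sup>2" if "t \<in> {0..T}" for n t
    using power_mono[OF sqd[OF that, of n], of 2] y0 by simp
  define k where "k t = 8 * lad\<^sup>2 / \<nu> * (V_norm a b (u2 t))\<^sup>2" for t
  have kint: "integrable ?M k" unfolding k_def[abs_def] using int2 by simp
  have k0: "k t \<ge> 0" for t using \<nu> by (simp add: k_def)
  have yc: "continuous_on {0..T} (y n)" and Gint: "integrable ?M (G n)" for n
    using py by (auto simp: primitive_on_def)
  have ky: "integrable ?M (\<lambda>t. k t * y n t)" for n by (rule integrable_continuous_mult[OF yc kint])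
  have km: "integrable ?M (\<lambda>t. k t * m t)" by (rule integrable_continuous_mult[OF mc kint])
  \<comment> \<open>The positive part is taken so that the error may be integrated over the whole
    interval instead of up to t.\<close>
  define E where "E n t = max 0 (G n t - k t * y n t)" for n t
  define q where "q n t = V_norm a b (\<lambda>x. (u1 t x - u2 t x) - PP n (\<lambda>x. u1 t x - u2 t x) x)" for n t
  define \<epsilon> where "\<epsilon> n t = 5 * cb * M * q n t * (V_norm a b (u1 t) + V_norm a b (u2 t))" for n t
  have eps0: "\<epsilon> n t \<ge> 0" for n t using cb_nonneg M by (simp add: \<epsilon>_def q_def)
  have EAE: "AE t in ?M. (\<forall>n. E n t \<le> \<epsilon> n t) \<and> (\<lambda>n. \<epsilon> n t) \<longlonglongrightarrow> 0 \<and>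
      (\<forall>n. \<epsilon> n t \<le> 5 * cb * M * (4 * ((V_norm a b (u1 t))\<^sup>2 + (V_norm a b (u2 t))\<^sup>2)))"
    using ae1 ae2 AE_space
  proof eventually_elim
    case (elim t)
    then have V: "u1 t \<in> V_space a b" "u2 t \<in> V_space a b" and t: "t \<in> {0..T}"
      and ci: "\<And>i. c1 i t = coef (u1 t) i" "\<And>i. c2 i t = coef (u2 t) i"
      and gi: "\<And>i. g1 i t = F t (bas i) - \<nu> * (lam i * coef (u1 t) i) - b_form a b (u1 t) (u1 t) (bas i)"
        "\<And>i. g2 i t = F t (bas i) - \<nu> * (lam i * coef (u2 t) i) - b_form a b (u2 t) (u2 t) (bas i)"
      by (auto simp: space_restrict_space)
    let ?z = "\<lambda>x. u1 t x - u2 t x"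
    have zV: "?z \<in> V_space a b" by (rule V_diff[OF V])
    have cz: "coef ?z i = d i t" for i by (simp add: coef_diff V_L2 V d_def ci)
    have Py: "(L2_norm R (PP n ?z))\<^sup>2 = y n t" for n by (simp add: psum_norm y_def cz)
    have le: "E n t \<le> \<epsilon> n t" for n
    proof -
      have a1: "L2_norm R (PP n (u1 t)) \<le> M"
      proof -
        have "L2_norm R (PP n (u1 t)) \<le> M1"
          by (rule power2_le_imp_le) (use M1(2)[OF t, of n] M1(1) in \<open>simp_all add: psum_norm ci\<close>)
        then show ?thesis using M(2) by simp
      qed
      have a2: "L2_norm R (PP n ?z) \<le> M"
        by (rule power2_le_imp_le) (use yM[OF t, of n] M(1) in \<open>simp_all only: Py\<close>)
      have "G n t \<le> 8 * lad\<^sup>2 / \<nu> * (V_norm a b (u2 t))\<^sup>2 * (L2_norm R (PP n ?z))\<^sup>2 +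
          5 * cb * M * V_norm a b (\<lambda>x. ?z x - PP n ?z x) * (V_norm a b (u1 t) + V_norm a b (u2 t))"
        using difference_rate_bound[OF V \<nu> M(1) a1 a2] difference_identity[OF V, of "\<lambda>i. F t (bas i)" \<nu> n]
        unfolding G_def d_def ci gi by simp
      then have "G n t - k t * y n t \<le> \<epsilon> n t" unfolding Py \<epsilon>_def q_def k_def by simp
      then show ?thesis using eps0[of n t] by (simp add: E_def)
    qed
    have lim: "(\<lambda>n. \<epsilon> n t) \<longlonglongrightarrow> 0"
      unfolding \<epsilon>_def q_def by (intro tendsto_mult_left_zero tendsto_mult_right_zero PP_V_tendsto zV)
    have bd: "\<epsilon> n t \<le> 5 * cb * M * (4 * ((V_norm a b (u1 t))\<^sup>2 + (V_norm a b (u2 t))\<^sup>2))" for n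
    proof -
      let ?U = "V_norm a b (u1 t)" and ?V = "V_norm a b (u2 t)"
      have "q n t \<le> 2 * (?U + ?V)"
        using PP_V_diff_le[OF zV, of n] V_tri_sub[OF V_H1[OF V(1)] V_H1[OF V(2)]] unfolding q_def by simp
      then have "q n t * (?U + ?V) \<le> (2 * (?U + ?V)) * (?U + ?V)" by (intro mult_right_mono) auto
      also have "\<dots> \<le> 4 * (?U\<^sup>2 + ?V\<^sup>2)"
        using sum_squares_bound[of ?U ?V] by (simp add: power2_eq_square algebra_simps)
      finally have "5 * cb * M * (q n t * (?U + ?V)) \<le> 5 * cb * M * (4 * (?U\<^sup>2 + ?V\<^sup>2))"
        using cb_nonneg M by (intro mult_left_mono) auto
      then show ?thesis by (simp add: \<epsilon>_def mult.assoc)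
    qed
    show ?case using le lim bd by blast
  qed
  have Em: "E n \<in> borel_measurable ?M" for n
    unfolding E_def[abs_def] using Gint[of n] ky[of n] by (intro borel_measurable_max borel_measurable_diff) auto
  have wint: "integrable ?M (\<lambda>t. 5 * cb * M * (4 * ((V_norm a b (u1 t))\<^sup>2 + (V_norm a b (u2 t))\<^sup>2)))"
    using int1 int2 by simp
  have Ebd: "AE t in ?M. norm (E n t) \<le> 5 * cb * M * (4 * ((V_norm a b (u1 t))\<^sup>2 + (V_norm a b (u2 t))\<^sup>2))" for n
    using EAE
  proof eventually_elim
    case (elim t)
    have "0 \<le> E n t" by (simp add: E_def)
    then show ?case using elim order_trans[of "E n t" "\<epsilon> n t"] by auto
  qed
  have Eint: "integrable ?M (E n)" for n
    by (rule Bochner_Integration.integrable_bound[OF wint Em]) (use Ebd[of n] in \<open>auto elim!: eventually_mono\<close>)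
  have Elim: "(\<lambda>n. \<integral>t. E n t \<partial>?M) \<longlonglongrightarrow> (\<integral>t. 0 \<partial>?M)"
  proof (rule integral_dominated_convergence[OF _ Em wint _ Ebd])
    show "AE t in ?M. (\<lambda>n. E n t) \<longlonglongrightarrow> 0"
      using EAE
    proof eventually_elim
      case (elim t)
      show ?case
        by (rule tendsto_sandwich[OF _ _ tendsto_const, of _ _ _ "\<lambda>n. \<epsilon> n t"]) (use elim in \<open>auto simp: E_def\<close>)
    qed
  qed simp
  have y00: "y n 0 = 0" for n by (simp add: y_def d_def c10 c20)
  have step: "y n t \<le> (\<integral>x. indicat_real {0<..<t} x * (k x * y n x) \<partial>?M) + (\<integral>x. E n x \<partial>?M)"
    if t: "t \<in> {0..T}" for n t
  proof -
    have "y n t = (\<integral>x. indicat_real {0<..<t} x * G n x \<partial>?M)"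
      using py[of n] t y00[of n] unfolding primitive_on_def by force
    also have "\<dots> \<le> (\<integral>x. indicat_real {0<..<t} x * (k x * y n x) + E n x \<partial>?M)"
    proof (rule integral_mono[OF integrable_ind_mult[OF Gint] Bochner_Integration.integrable_add[OF integrable_ind_mult[OF ky] Eint]])
      show "indicat_real {0<..<t} x * G n x \<le> indicat_real {0<..<t} x * (k x * y n x) + E n x" for x
        by (auto simp: indicator_def E_def)
    qed
    also have "\<dots> = (\<integral>x. indicat_real {0<..<t} x * (k x * y n x) \<partial>?M) + (\<integral>x. E n x \<partial>?M)"
      by (rule Bochner_Integration.integral_add[OF integrable_ind_mult[OF ky] Eint])
    finally show ?thesis .
  qed
  have mle: "m t \<le> (\<integral>x. indicat_real {0<..<t} x * (k x * m x) \<partial>?M)" if t: "t \<in> {0..T}" for t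
  proof -
    have "(\<lambda>n. \<integral>x. indicat_real {0<..<t} x * (k x * y n x) \<partial>?M) \<longlonglongrightarrow> (\<integral>x. indicat_real {0<..<t} x * (k x * m x) \<partial>?M)"
    proof (rule integral_dominated_convergence[where w = "\<lambda>x. k x * M\<^sup>2"])
      show "(\<lambda>x. indicat_real {0<..<t} x * (k x * m x)) \<in> borel_measurable ?M" using integrable_ind_mult[OF km] by blast
      show "(\<lambda>x. indicat_real {0<..<t} x * (k x * y n x)) \<in> borel_measurable ?M" for n using integrable_ind_mult[OF ky] by blast
      show "integrable ?M (\<lambda>x. k x * M\<^sup>2)" using kint by simp
      show "AE x in ?M. (\<lambda>n. indicat_real {0<..<t} x * (k x * y n x)) \<longlonglongrightarrow> indicat_real {0<..<t} x * (k x * m x)"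
        by (intro AE_I2 tendsto_mult_left ym) (auto simp: space_restrict_space)
      show "AE x in ?M. norm (indicat_real {0<..<t} x * (k x * y n x)) \<le> k x * M\<^sup>2" for n
      proof (intro AE_I2)
        fix x assume "x \<in> space ?M"
        then have "k x * y n x \<le> k x * M\<^sup>2"
          using yM[of x n] k0[of x] by (intro mult_left_mono) (auto simp: space_restrict_space)
        then show "norm (indicat_real {0<..<t} x * (k x * y n x)) \<le> k x * M\<^sup>2"
          using k0[of x] y0[of n x] by (auto simp: indicator_def)
      qed
    qed
    from tendsto_add[OF this Elim]
    have "(\<lambda>n. (\<integral>x. indicat_real {0<..<t} x * (k x * y n x) \<partial>?M) + (\<integral>x. E n x \<partial>?M)) \<longlonglongrightarrow> (\<integral>x. indicat_real {0<..<t} x * (k x * m x) \<partial>?M)"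
      by simp
    from LIMSEQ_le[OF ym[OF t] this] step[OF t] show ?thesis by blast
  qed
  have m0: "m t = 0" if "t \<in> {0..T}" for t
    by (rule integral_gronwall_zero[OF T mc _ kint k0 mle that]) (simp add: m_def)
  \<comment> \<open>Bessel's inequality for a single index bounds each coefficient by the
    norm.\<close>
  have d0: "d i t = 0" if t: "t \<in> {0..T}" for i t
  proof -
    have "(\<Sum>i\<in>{i}. (coef (z t) i)\<^sup>2) \<le> L2_inner R (z t) (z t)" by (rule bessel[OF HH_L2[OF zH[OF t]]]) simp
    then show ?thesis using m0[OF t] by (simp add: m_def L2_norm_sq zc[OF t])
  qed
  show ?thesis
    using ae1 ae2 AE_space
  proof eventually_elim
    case (elim t)
    have t: "t \<in> {0..T}" using elim(3) by (simp add: space_restrict_space)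
    have V1: "u1 t \<in> V_space a b" using elim(1) by blast
    have V2: "u2 t \<in> V_space a b" using elim(2) by blast
    have "\<forall>i. c1 i t = coef (u1 t) i" using elim(1) by simp
    moreover have "\<forall>i. c2 i t = coef (u2 t) i" using elim(2) by simp
    ultimately have "coef (u1 t) i = coef (u2 t) i" for i
      using d0[OF t, of i] unfolding d_def by (metis eq_iff_diff_eq_0)
    then show ?case unfolding ae_equal_def by (rule coef_eq_imp_AE_eq[OF V_HH[OF V1] V_HH[OF V2]])
  qed
qed

text \<open>For almost every t the fields w t and u t have the same coefficients and lie in
  \<open>HH\<close>, so they agree; at t = 0 the same argument identifies w 0 with u0.\<close>

lemma H_continuity:
  assumes F: "F \<in> bochner_Lp 2 (V_dual a b) (V_dual_norm a b) {0<..<T}" and T: "T > 0" and \<nu>: "\<nu> > 0"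
    and u0: "u0 \<in> H_space a b" and sol: "is_solution a b T \<nu> F u0 u"
  obtains w where "continuous_into (H_space a b) (L2_norm R) {0..T} w"
    and "AE t in lebesgue_on {0<..<T}. ae_equal R (u t) (w t)"
    and "((\<lambda>t. L2_norm R (\<lambda>x. w t x - u0 x)) \<longlongrightarrow> 0) (at 0 within {0..T})"
proof -
  note u0L = HH_L2[OF H_space_HH[OF u0]]
  obtain c g w M where "\<And>i. primitive_on T (c i) (g i)" and c0: "\<And>i. c i 0 = coef u0 i"
    and ae: "AE t in lebesgue_on {0<..<T}. u t \<in> V_space a b \<and> F t \<in> V_dual a b \<and>
      (\<forall>i. c i t = coef (u t) i \<and>
        g i t = F t (bas i) - \<nu> * (lam i * coef (u t) i) - b_form a b (u t) (u t) (bas i))"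
    and "integrable (lebesgue_on {0<..<T}) (\<lambda>t. (V_norm a b (u t))\<^sup>2)"
    and "M \<ge> 0" "\<And>n t. t \<in> {0..T} \<Longrightarrow> (\<Sum>i\<in>KK n. (c i t)\<^sup>2) \<le> M\<^sup>2"
    and w: "\<And>t. t \<in> {0..T} \<Longrightarrow> w t \<in> H_space a b" "\<And>t i. t \<in> {0..T} \<Longrightarrow> coef (w t) i = c i t"
    and cont: "\<And>t1. t1 \<in> {0..T} \<Longrightarrow> ((\<lambda>t. L2_norm R (\<lambda>x. w t x - w t1 x)) \<longlongrightarrow> 0) (at t1 within {0..T})"
    by (fact solution_H_valued[OF F T \<nu> u0L sol])
  have 1: "continuous_into (H_space a b) (L2_norm R) {0..T} w"
    using w cont by (simp add: continuous_into_def)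
  have 2: "AE t in lebesgue_on {0<..<T}. ae_equal R (u t) (w t)"
    using ae AE_space
  proof eventually_elim
    case (elim t)
    then have t: "t \<in> {0..T}" by (simp add: space_restrict_space)
    show ?case unfolding ae_equal_def
      by (intro coef_eq_imp_AE_eq V_HH H_space_HH w(1)[OF t]) (use elim w(2)[OF t] in auto)
  qed
  have T0: "0 \<in> {0..T}" using T by simp
  have wL: "w t \<in> L2 R" if "t \<in> {0..T}" for t by (rule HH_L2[OF H_space_HH[OF w(1)[OF that]]])
  have "AE x in lebesgue_on R. w 0 x = u0 x"
    by (intro coef_eq_imp_AE_eq H_space_HH w(1)[OF T0] u0) (simp add: w(2)[OF T0] c0)
  then have "AE x in lebesgue_on R. w 0 x - u0 x = 0" by eventually_elim simp
  then have z: "L2_norm R (\<lambda>x. w 0 x - u0 x) = 0"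
    by (subst L2_norm_AE_zero[OF L2.diff[OF wL[OF T0] u0L]])
  have 3: "((\<lambda>t. L2_norm R (\<lambda>x. w t x - u0 x)) \<longlongrightarrow> 0) (at 0 within {0..T})"
  proof (rule Lim_null_comparison[OF _ cont[OF T0]])
    show "\<forall>\<^sub>F t in at 0 within {0..T}. norm (L2_norm R (\<lambda>x. w t x - u0 x)) \<le> L2_norm R (\<lambda>x. w t x - w 0 x)"
      unfolding eventually_at_filter
    proof (intro always_eventually allI impI)
      fix t assume "t \<in> {0..T}"
      from L2_tri_diff[OF wL[OF this] wL[OF T0] u0L] z
      show "norm (L2_norm R (\<lambda>x. w t x - u0 x)) \<le> L2_norm R (\<lambda>x. w t x - w 0 x)" by simp
    qed
  qed
  show ?thesis by (rule that[OF 1 2 3])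
qed

end

theorem theorem2p7p2:
  fixes a b T \<nu> :: real
    and F :: "real \<Rightarrow> functional"
    and u0 :: vector_field
  assumes "a > 0" and "b > 0" and "T > 0" and "\<nu> > 0"
    and "F \<in> bochner_Lp 2 (V_dual a b) (V_dual_norm a b) {0<..<T}"
    and "u0 \<in> H_space a b"
  shows
    "(\<forall>u1 u2. is_solution a b T \<nu> F u0 u1 \<longrightarrow> is_solution a b T \<nu> F u0 u2 \<longrightarrow>
        (AE t in lebesgue_on {0<..<T}. ae_equal (Rect a b) (u1 t) (u2 t))) \<and>
     (\<forall>u. is_solution a b T \<nu> F u0 u \<longrightarrow>
        (\<exists>w. continuous_into (H_space a b) (L2_norm (Rect a b)) {0..T} w \<and>
             (AE t in lebesgue_on {0<..<T}. ae_equal (Rect a b) (u t) (w t)) \<and>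
             (\<forall>t1\<in>{0..T}.
                ((\<lambda>t. L2_norm (Rect a b) (\<lambda>x. w t x - w t1 x)) \<longlongrightarrow> 0) (at t1 within {0..T})) \<and>
             ((\<lambda>t. L2_norm (Rect a b) (\<lambda>x. w t x - u0 x)) \<longlongrightarrow> 0) (at 0 within {0..T}) \<and>
             ((\<lambda>t. L2_norm (Rect a b) (\<lambda>x. w t x - w T x)) \<longlongrightarrow> 0) (at T within {0..T})))"
proof (intro conjI allI impI)
  interpret rectangle a b using assms by unfold_locales
  note u0L = HH_L2[OF H_space_HH[OF assms(6)]]
  show "AE t in lebesgue_on {0<..<T}. ae_equal (Rect a b) (u1 t) (u2 t)"
    if "is_solution a b T \<nu> F u0 u1" "is_solution a b T \<nu> F u0 u2" for u1 u2
    by (rule uniqueness[OF assms(5,3,4) u0L that])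
  fix u assume sol: "is_solution a b T \<nu> F u0 u"
  obtain w where w: "continuous_into (H_space a b) (L2_norm R) {0..T} w"
    "AE t in lebesgue_on {0<..<T}. ae_equal R (u t) (w t)"
    "((\<lambda>t. L2_norm R (\<lambda>x. w t x - u0 x)) \<longlongrightarrow> 0) (at 0 within {0..T})"
    using H_continuity[OF assms(5,3,4,6) sol] by blast
  have c: "((\<lambda>t. L2_norm R (\<lambda>x. w t x - w t1 x)) \<longlongrightarrow> 0) (at t1 within {0..T})" if "t1 \<in> {0..T}" for t1
    using w(1) that by (simp add: continuous_into_def)
  show "\<exists>w. continuous_into (H_space a b) (L2_norm (Rect a b)) {0..T} w \<and>
             (AE t in lebesgue_on {0<..<T}. ae_equal (Rect a b) (u t) (w t)) \<and>
             (\<forall>t1\<in>{0..T}.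
                ((\<lambda>t. L2_norm (Rect a b) (\<lambda>x. w t x - w t1 x)) \<longlongrightarrow> 0) (at t1 within {0..T})) \<and>
             ((\<lambda>t. L2_norm (Rect a b) (\<lambda>x. w t x - u0 x)) \<longlongrightarrow> 0) (at 0 within {0..T}) \<and>
             ((\<lambda>t. L2_norm (Rect a b) (\<lambda>x. w t x - w T x)) \<longlongrightarrow> 0) (at T within {0..T})"
    using w c assms(3) by (intro exI[of _ w]) auto
qed

end
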